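(* Let $p$ be an odd prime and let $L/K$ be a separable field extension of degree $p^3$. Then the following implications hold. 1) If $L/K$ has a Hopf Galois structure of type $H_p$, then $L/K$ has a Hopf Galois structure of type $C_p^3=C_p\times C_p\times C_p$. 2) If $L/K$ has a Hopf Galois structure of type $G_p$, then $L/K$ has a Hopf Galois structure of type $C_{p^2}\times C_p$.
   Context: $C_m$ denotes the cyclic group of order $m$. For an odd prime $p$, the two nonabelian groups of order $p^3$ are the Heisenberg group $$H_p=\left\{\begin{pmatrix}1&a&b\\0&1&c\\0&0&1\end{pmatrix}: a,b,c\in\mathbb{F}_p\right\}\subset \mathrm{GL}(3,\mathbb{F}_p)$$ (of exponent $p$) and the group $$G_p=\left\{\begin{pmatrix}1+pb&a\\0&1\end{pmatrix}: a,b\in\mathbb{Z}/p^2\mathbb{Z}\right\}\subset \mathrm{GL}(2,\mathbb{Z}/p^2\mathbb{Z})$$ (of exponent $p^2$; only $b$ modulo $p$ matters). A Hopf Galois structure on a finite field extension $L/K$ is a pair $(\mathcal{H},\mu)$, where $\mathcal{H}$ is a finite cocommutative $K$-Hopf algebra and $\mu:\mathcal{H}\to \operatorname{End}_K(L)$ is a $K$-linear map giving $L$ a left $\mathcal{H}$-module algebra structure and inducing a $K$-vector space isomorphism $L\otimes_K \mathcal{H}\to \operatorname{End}_K(L)$. Let $L/K$ be finite separable of degree $g$ with normal closure $\widetilde{L}$, $G=\operatorname{Gal}(\widetilde{L}/K)$, $G'=\operatorname{Gal}(\widetilde{L}/L)$, and let $\lambda:G\hookrightarrow \operatorname{Sym}(G/G')\cong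 S_g$ be the action of $G$ on the left cosets $G/G'$. By the theorem of Greither and Pareigis, isomorphism classes of Hopf Galois structures on $L/K$ are in bijection with regular subgroups $N$ of $\operatorname{Sym}(G/G')$ normalized by $\lambda(G)$ (the Hopf algebra corresponding to $N$ is $\widetilde{L}[N]^G$, with $G$ acting on $\widetilde{L}$ by automorphisms and on $N$ by conjugation through $\lambda$). The type of a Hopf Galois structure is the isomorphism class of the corresponding group $N$. *)

theory Defs
  imports
    "HOL-Algebra.Algebra"
    "Jordan_Normal_Form.Missing_VectorSpace"
    "Jordan_Normal_Form.Matrix"
begin

section \<open>Field extensions inside an ambient field\<close>

text \<open>
  Extensions are pairs of subfields of an ambient field \<open>M\<close>, as in
  \<^theory>\<open>HOL-Algebra.Finite_Extensions\<close>; the subfield \<open>K\<close> regarded as a ring is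
  \<open>M\<lparr>carrier := K\<rparr>\<close>.
\<close>

definition normal_extension :: "('a, 'b) ring_scheme \<Rightarrow> 'a set \<Rightarrow> 'a set \<Rightarrow> bool" where
  "normal_extension M K F \<longleftrightarrow>
     (\<forall>x\<in>F. \<not> ring.transcendental M K x) \<and>
     (\<forall>q\<in>carrier (K[X]\<^bsub>M\<^esub>). pirreducible\<^bsub>M\<^esub> K q \<and> (\<exists>x\<in>F. ring.eval M q x = \<zero>\<^bsub>M\<^esub>)
        \<longrightarrow> ring.splitted (M\<lparr>carrier := F\<rparr>) q)"

definition normal_closure :: "('a, 'b) ring_scheme \<Rightarrow> 'a set \<Rightarrow> 'a set \<Rightarrow> bool" where
  "normal_closure M K L \<longleftrightarrow>
     normal_extension M K (carrier M) \<and>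
     (\<forall>F. subfield F M \<and> L \<subseteq> F \<and> normal_extension M K F \<longrightarrow> F = carrier M)"

text \<open>
  Minimal polynomials have no repeated roots. The roots are counted in \<open>M\<close>, which therefore
  has to be large enough to split them, as a normal closure of \<open>L\<close> over \<open>K\<close> is.
\<close>

definition separable_extension :: "('a, 'b) ring_scheme \<Rightarrow> 'a set \<Rightarrow> 'a set \<Rightarrow> bool" where
  "separable_extension M K L \<longleftrightarrow>
     (\<forall>x\<in>L. \<not> ring.transcendental M K x \<and>
        card {a \<in> carrier M. ring.eval M (ring.Irr M K x) a = \<zero>\<^bsub>M\<^esub>}
          = Polynomials.degree (ring.Irr M K x))"

definition galois_group :: "('a, 'b) ring_scheme \<Rightarrow> 'a set \<Rightarrow> ('a \<Rightarrow> 'a) monoid" where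
  "galois_group M K =
     BijGroup (carrier M)
       \<lparr>carrier := {\<sigma> \<in> Bij (carrier M). \<sigma> \<in> Ring.ring_hom M M \<and> (\<forall>k\<in>K. \<sigma> k = k)}\<rparr>"


section \<open>Tensor products\<close>

text \<open>
  The type \<^type>\<open>module\<close> of records also has the fields \<^const>\<open>monoid.mult\<close> and
  \<^const>\<open>one\<close>, so it serves for algebras as well. Where there is no product, these two fields
  get dummy values.
\<close>

definition free_module :: "('k, 'm) ring_scheme \<Rightarrow> 's set \<Rightarrow> ('k, 's \<Rightarrow> 'k) module" where
  "free_module R S =
     \<lparr>carrier = {f. (\<forall>s. f s \<in> carrier R) \<and> finite {s. f s \<noteq> \<zero>\<^bsub>R\<^esub>} \<and>
                    (\<forall>s. s \<notin> S \<longrightarrow> f s = \<zero>\<^bsub>R\<^esub>)},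
      monoid.mult = \<lambda>f g s. \<zero>\<^bsub>R\<^esub>,
      monoid.one = \<lambda>s. \<zero>\<^bsub>R\<^esub>,
      ring.zero = \<lambda>s. \<zero>\<^bsub>R\<^esub>,
      ring.add = \<lambda>f g s. f s \<oplus>\<^bsub>R\<^esub> g s,
      module.smult = \<lambda>a f s. a \<otimes>\<^bsub>R\<^esub> f s\<rparr>"

definition free_gen :: "('k, 'm) ring_scheme \<Rightarrow> 's \<Rightarrow> 's \<Rightarrow> 'k" where
  "free_gen R s = (\<lambda>t. if t = s then \<one>\<^bsub>R\<^esub> else \<zero>\<^bsub>R\<^esub>)"

definition tensor_relators ::
    "('k, 'm) ring_scheme \<Rightarrow> ('k, 'v, 'x) module_scheme \<Rightarrow> ('k, 'w, 'y) module_scheme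
      \<Rightarrow> ('v \<times> 'w \<Rightarrow> 'k) set" where
  "tensor_relators R V W =
     (let F = free_module R (carrier V \<times> carrier W); e = free_gen R in
       {e (v \<oplus>\<^bsub>V\<^esub> v', w) \<ominus>\<^bsub>F\<^esub> (e (v, w) \<oplus>\<^bsub>F\<^esub> e (v', w)) | v v' w.
          v \<in> carrier V \<and> v' \<in> carrier V \<and> w \<in> carrier W}
     \<union> {e (v, w \<oplus>\<^bsub>W\<^esub> w') \<ominus>\<^bsub>F\<^esub> (e (v, w) \<oplus>\<^bsub>F\<^esub> e (v, w')) | v w w'.
          v \<in> carrier V \<and> w \<in> carrier W \<and> w' \<in> carrier W}
     \<union> {e (a \<odot>\<^bsub>V\<^esub> v, w) \<ominus>\<^bsub>F\<^esub> (a \<odot>\<^bsub>F\<^esub> e (v, w)) | a v w.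
          a \<in> carrier R \<and> v \<in> carrier V \<and> w \<in> carrier W}
     \<union> {e (v, a \<odot>\<^bsub>W\<^esub> w) \<ominus>\<^bsub>F\<^esub> (a \<odot>\<^bsub>F\<^esub> e (v, w)) | a v w.
          a \<in> carrier R \<and> v \<in> carrier V \<and> w \<in> carrier W})"

definition tensor_null ::
    "('k, 'm) ring_scheme \<Rightarrow> ('k, 'v, 'x) module_scheme \<Rightarrow> ('k, 'w, 'y) module_scheme
      \<Rightarrow> ('v \<times> 'w \<Rightarrow> 'k) set" where
  "tensor_null R V W =
     LinearCombinations.module.span R (free_module R (carrier V \<times> carrier W))
       (tensor_relators R V W)"

definition pure_tensor ::
    "('k, 'm) ring_scheme \<Rightarrow> ('k, 'v, 'x) module_scheme \<Rightarrow> ('k, 'w, 'y) module_scheme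
      \<Rightarrow> 'v \<Rightarrow> 'w \<Rightarrow> ('v \<times> 'w \<Rightarrow> 'k) set" where
  "pure_tensor R V W v w =
     tensor_null R V W +>\<^bsub>free_module R (carrier V \<times> carrier W)\<^esub> free_gen R (v, w)"

definition tensor_module ::
    "('k, 'm) ring_scheme \<Rightarrow> ('k, 'v, 'x) module_scheme \<Rightarrow> ('k, 'w, 'y) module_scheme
      \<Rightarrow> ('k, ('v \<times> 'w \<Rightarrow> 'k) set) module" where
  "tensor_module R V W =
     (let F = free_module R (carrier V \<times> carrier W); N = tensor_null R V W in
      \<lparr>carrier = a_rcosets\<^bsub>F\<^esub> N,
       monoid.mult = \<lambda>s t. N,
       monoid.one = N,
       ring.zero = N,
       ring.add = set_add F,
       module.smult = \<lambda>a t. \<Union>f\<in>t. N +>\<^bsub>F\<^esub> (a \<odot>\<^bsub>F\<^esub> f)\<rparr>)"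

text \<open>
  The map on a tensor product induced by a bilinear map \<open>b\<close> into \<open>P\<close>. The image taken here is a
  singleton when \<open>b\<close> is bilinear. The scalars of \<open>P\<close> may be larger than \<open>R\<close>.
\<close>

definition tensor_lift ::
    "('k, 'm) ring_scheme \<Rightarrow> ('k, 'p, 'z) module_scheme \<Rightarrow> ('v \<Rightarrow> 'w \<Rightarrow> 'p)
      \<Rightarrow> ('v \<times> 'w \<Rightarrow> 'k) set \<Rightarrow> 'p" where
  "tensor_lift R P b t =
     the_elem ((\<lambda>f. \<Oplus>\<^bsub>P\<^esub>s\<in>{s. f s \<noteq> \<zero>\<^bsub>R\<^esub>}. f s \<odot>\<^bsub>P\<^esub> b (fst s) (snd s)) ` t)"

definition tensor ::
    "('k, 'm) ring_scheme \<Rightarrow> ('k, 'v, 'x) module_scheme \<Rightarrow> ('k, 'w, 'y) module_scheme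
      \<Rightarrow> ('k, ('v \<times> 'w \<Rightarrow> 'k) set) module" where
  "tensor R V W =
     (let T = tensor_module R V W in
      T\<lparr>monoid.mult := \<lambda>s t.
          tensor_lift R T
            (\<lambda>v w. tensor_lift R T
               (\<lambda>v' w'. pure_tensor R V W (v \<otimes>\<^bsub>V\<^esub> v') (w \<otimes>\<^bsub>W\<^esub> w')) t) s,
        monoid.one := pure_tensor R V W \<one>\<^bsub>V\<^esub> \<one>\<^bsub>W\<^esub>\<rparr>)"


section \<open>Hopf algebras\<close>

record ('k, 'h) hopf = "('k, 'h) module" +
  comult :: "'h \<Rightarrow> ('h \<times> 'h \<Rightarrow> 'k) set"
  counit :: "'h \<Rightarrow> 'k"
  antipode :: "'h \<Rightarrow> 'h"

text \<open>Unlike \<^locale>\<open>algebra\<close>, this does not require commutativity.\<close>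

locale assoc_algebra = A_mod?: Module.module R A + A_ring?: ring A for R and A +
  assumes smult_mult_left: "\<lbrakk>a \<in> carrier R; x \<in> carrier A; y \<in> carrier A\<rbrakk>
      \<Longrightarrow> (a \<odot>\<^bsub>A\<^esub> x) \<otimes>\<^bsub>A\<^esub> y = a \<odot>\<^bsub>A\<^esub> (x \<otimes>\<^bsub>A\<^esub> y)"
    and smult_mult_right: "\<lbrakk>a \<in> carrier R; x \<in> carrier A; y \<in> carrier A\<rbrakk>
      \<Longrightarrow> x \<otimes>\<^bsub>A\<^esub> (a \<odot>\<^bsub>A\<^esub> y) = a \<odot>\<^bsub>A\<^esub> (x \<otimes>\<^bsub>A\<^esub> y)"

locale hopf_algebra = assoc_algebra R H
  for R :: "('k, 'm) ring_scheme" and H :: "('k, 'h, 'x) hopf_scheme" +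
  assumes comult_hom: "comult H \<in> Ring.ring_hom H (tensor R H H)"
    and comult_linear: "comult H \<in> module_hom R H (tensor R H H)"
    and counit_hom: "counit H \<in> Ring.ring_hom H R"
    and counit_linear: "\<lbrakk>a \<in> carrier R; h \<in> carrier H\<rbrakk>
      \<Longrightarrow> counit H (a \<odot>\<^bsub>H\<^esub> h) = a \<otimes>\<^bsub>R\<^esub> counit H h"
    and antipode_linear: "antipode H \<in> module_hom R H H"
    \<comment> \<open>both sides lie in \<open>H \<otimes> (H \<otimes> H)\<close>; on the left, \<open>\<Delta> \<otimes> id\<close> is followed by the associator\<close>
    and coassoc: "h \<in> carrier H \<Longrightarrow>
      tensor_lift R (tensor R H (tensor R H H))
        (\<lambda>h1 h2. tensor_lift R (tensor R H (tensor R H H))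
           (\<lambda>h11 h12. pure_tensor R H (tensor R H H) h11 (pure_tensor R H H h12 h2))
           (comult H h1)) (comult H h)
      = tensor_lift R (tensor R H (tensor R H H))
          (\<lambda>h1 h2. pure_tensor R H (tensor R H H) h1 (comult H h2)) (comult H h)"
    and counit_left: "h \<in> carrier H \<Longrightarrow>
      tensor_lift R H (\<lambda>h1 h2. counit H h1 \<odot>\<^bsub>H\<^esub> h2) (comult H h) = h"
    and counit_right: "h \<in> carrier H \<Longrightarrow>
      tensor_lift R H (\<lambda>h1 h2. counit H h2 \<odot>\<^bsub>H\<^esub> h1) (comult H h) = h"
    and antipode_left: "h \<in> carrier H \<Longrightarrow>
      tensor_lift R H (\<lambda>h1 h2. antipode H h1 \<otimes>\<^bsub>H\<^esub> h2) (comult H h) = counit H h \<odot>\<^bsub>H\<^esub> \<one>\<^bsub>H\<^esub>"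
    and antipode_right: "h \<in> carrier H \<Longrightarrow>
      tensor_lift R H (\<lambda>h1 h2. h1 \<otimes>\<^bsub>H\<^esub> antipode H h2) (comult H h) = counit H h \<odot>\<^bsub>H\<^esub> \<one>\<^bsub>H\<^esub>"

locale cocommutative_hopf_algebra = hopf_algebra +
  assumes cocomm: "h \<in> carrier H \<Longrightarrow>
      tensor_lift R (tensor R H H) (\<lambda>h1 h2. pure_tensor R H H h2 h1) (comult H h) = comult H h"

definition group_algebra ::
    "('a, 'm) ring_scheme \<Rightarrow> ('g, 'n) monoid_scheme \<Rightarrow> ('a, 'g \<Rightarrow> 'a) module" where
  "group_algebra R N =
     \<lparr>carrier = carrier N \<rightarrow>\<^sub>E carrier R,
      monoid.mult = \<lambda>x y. \<lambda>n\<in>carrier N. \<Oplus>\<^bsub>R\<^esub>m\<in>carrier N. x m \<otimes>\<^bsub>R\<^esub> y (inv\<^bsub>N\<^esub> m \<otimes>\<^bsub>N\<^esub> n),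
      monoid.one = \<lambda>n\<in>carrier N. if n = \<one>\<^bsub>N\<^esub> then \<one>\<^bsub>R\<^esub> else \<zero>\<^bsub>R\<^esub>,
      ring.zero = \<lambda>n\<in>carrier N. \<zero>\<^bsub>R\<^esub>,
      ring.add = \<lambda>x y. \<lambda>n\<in>carrier N. x n \<oplus>\<^bsub>R\<^esub> y n,
      module.smult = \<lambda>a x. \<lambda>n\<in>carrier N. a \<otimes>\<^bsub>R\<^esub> x n\<rparr>"

text \<open>
  The Hopf algebra \<open>R[N]\<close> of a finite group \<open>N\<close>; for infinite \<open>N\<close> the underlying set above would
  be wrong.
\<close>

definition group_hopf_algebra ::
    "('a, 'm) ring_scheme \<Rightarrow> ('g, 'n) monoid_scheme \<Rightarrow> ('a, 'g \<Rightarrow> 'a) hopf" where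
  "group_hopf_algebra R N =
     (let A = group_algebra R N;
          e = (\<lambda>n. \<lambda>m\<in>carrier N. if m = n then \<one>\<^bsub>R\<^esub> else \<zero>\<^bsub>R\<^esub>) in
      module.extend A
        (hopf.fields
          (\<lambda>x. \<Oplus>\<^bsub>tensor R A A\<^esub>n\<in>carrier N. x n \<odot>\<^bsub>tensor R A A\<^esub> pure_tensor R A A (e n) (e n))
          (\<lambda>x. \<Oplus>\<^bsub>R\<^esub>n\<in>carrier N. x n)
          (\<lambda>x. \<lambda>n\<in>carrier N. x (inv\<^bsub>N\<^esub> n))))"


section \<open>Hopf Galois structures\<close>

definition self_algebra :: "('a, 'b) ring_scheme \<Rightarrow> ('a, 'a) module" where
  "self_algebra E =
     \<lparr>carrier = carrier E, monoid.mult = monoid.mult E, monoid.one = \<one>\<^bsub>E\<^esub>, ring.zero = \<zero>\<^bsub>E\<^esub>, ring.add = ring.add E,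
      module.smult = monoid.mult E\<rparr>"

definition end_algebra ::
    "('k, 'm) ring_scheme \<Rightarrow> ('k, 'v, 'x) module_scheme \<Rightarrow> ('k, 'v \<Rightarrow> 'v) module" where
  "end_algebra R V =
     \<lparr>carrier = module_hom R V V \<inter> extensional (carrier V),
      monoid.mult = compose (carrier V),
      monoid.one = \<lambda>v\<in>carrier V. v,
      ring.zero = \<lambda>v\<in>carrier V. \<zero>\<^bsub>V\<^esub>,
      ring.add = \<lambda>f g. \<lambda>v\<in>carrier V. f v \<oplus>\<^bsub>V\<^esub> g v,
      module.smult = \<lambda>a f. \<lambda>v\<in>carrier V. a \<odot>\<^bsub>V\<^esub> f v\<rparr>"

locale hopf_galois_structure =
  fixes E :: "('a, 'b) ring_scheme" and K :: "'a set"
    and H :: "('a, 'h) hopf" and \<mu> :: "'h \<Rightarrow> 'a \<Rightarrow> 'a"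
    and R :: "('a, 'b) ring_scheme" and A :: "('a, 'a) module"
    and End :: "('a, 'a \<Rightarrow> 'a) module" and \<theta>
  defines "R \<equiv> E\<lparr>carrier := K\<rparr>"
    and "A \<equiv> self_algebra E"
    and "End \<equiv> end_algebra R A"
    and "\<theta> \<equiv> tensor_lift R End (\<lambda>x h. \<lambda>y\<in>carrier E. x \<otimes>\<^bsub>E\<^esub> \<mu> h y)"
  assumes field: "field E" and subfield: "subfield K E"
    and hopf: "cocommutative_hopf_algebra R H"
    and fin_dim: "vectorspace.fin_dim R H"
    and action_linear: "\<mu> \<in> module_hom R H End"
    and action_hom: "\<mu> \<in> Ring.ring_hom H End"
    and action_mult: "\<lbrakk>h \<in> carrier H; x \<in> carrier E; y \<in> carrier E\<rbrakk> \<Longrightarrow>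
        \<mu> h (x \<otimes>\<^bsub>E\<^esub> y) = tensor_lift R A (\<lambda>h1 h2. \<mu> h1 x \<otimes>\<^bsub>E\<^esub> \<mu> h2 y) (comult H h)"
    and action_one: "h \<in> carrier H \<Longrightarrow> \<mu> h \<one>\<^bsub>E\<^esub> = counit H h"
    and galois_linear: "\<theta> \<in> module_hom R (tensor R A H) End"
    and galois_bij: "bij_betw \<theta> (carrier (tensor R A H)) (carrier End)"


section \<open>The type of a Hopf Galois structure\<close>

text \<open>
  Throughout, \<open>K \<subseteq> L\<close> are subfields of \<open>M\<close>, and \<open>M\<close> is a normal closure of \<open>L\<close> over \<open>K\<close>.
\<close>

definition galois_cosets :: "('a, 'b) ring_scheme \<Rightarrow> 'a set \<Rightarrow> 'a set \<Rightarrow> ('a \<Rightarrow> 'a) set set" where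
  "galois_cosets M K L = lcosets\<^bsub>galois_group M K\<^esub> (carrier (galois_group M L))"

definition left_translation ::
    "('a, 'b) ring_scheme \<Rightarrow> 'a set \<Rightarrow> 'a set \<Rightarrow> ('a \<Rightarrow> 'a) \<Rightarrow> ('a \<Rightarrow> 'a) set \<Rightarrow> ('a \<Rightarrow> 'a) set" where
  "left_translation M K L \<sigma> = (\<lambda>C\<in>galois_cosets M K L. \<sigma> <#\<^bsub>galois_group M K\<^esub> C)"

abbreviation galois_sym :: "('a, 'b) ring_scheme \<Rightarrow> 'a set \<Rightarrow> 'a set
    \<Rightarrow> (('a \<Rightarrow> 'a) set \<Rightarrow> ('a \<Rightarrow> 'a) set) monoid" where
  "galois_sym M K L \<equiv> BijGroup (galois_cosets M K L)"

definition regular_perms :: "'x set \<Rightarrow> ('x \<Rightarrow> 'x) set \<Rightarrow> bool" where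
  "regular_perms S N \<longleftrightarrow> (\<forall>x\<in>S. \<forall>y\<in>S. \<exists>!n. n \<in> N \<and> n x = y)"

definition galois_conj ::
    "('a, 'b) ring_scheme \<Rightarrow> 'a set \<Rightarrow> 'a set \<Rightarrow> ('a \<Rightarrow> 'a)
      \<Rightarrow> (('a \<Rightarrow> 'a) set \<Rightarrow> ('a \<Rightarrow> 'a) set) \<Rightarrow> (('a \<Rightarrow> 'a) set \<Rightarrow> ('a \<Rightarrow> 'a) set)" where
  "galois_conj M K L \<sigma> n =
     left_translation M K L \<sigma> \<otimes>\<^bsub>galois_sym M K L\<^esub> n
       \<otimes>\<^bsub>galois_sym M K L\<^esub> inv\<^bsub>galois_sym M K L\<^esub> left_translation M K L \<sigma>"

definition greither_pareigis_subgroup ::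
    "('a, 'b) ring_scheme \<Rightarrow> 'a set \<Rightarrow> 'a set \<Rightarrow> (('a \<Rightarrow> 'a) set \<Rightarrow> ('a \<Rightarrow> 'a) set) set \<Rightarrow> bool" where
  "greither_pareigis_subgroup M K L N \<longleftrightarrow>
     subgroup N (galois_sym M K L) \<and>
     regular_perms (galois_cosets M K L) N \<and>
     (\<forall>\<sigma>\<in>carrier (galois_group M K). \<forall>n\<in>N. galois_conj M K L \<sigma> n \<in> N)"

abbreviation perm_group ::
    "('a, 'b) ring_scheme \<Rightarrow> 'a set \<Rightarrow> 'a set \<Rightarrow> (('a \<Rightarrow> 'a) set \<Rightarrow> ('a \<Rightarrow> 'a) set) set
      \<Rightarrow> (('a \<Rightarrow> 'a) set \<Rightarrow> ('a \<Rightarrow> 'a) set) monoid" where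
  "perm_group M K L N \<equiv> (galois_sym M K L)\<lparr>carrier := N\<rparr>"

text \<open>
  \<open>M[N]\<^sup>G\<close> for the action of \<open>\<sigma> \<in> G\<close> that sends \<open>\<Sum> x\<^sub>n n\<close> to
  \<open>\<Sum> \<sigma>(x\<^sub>n) \<lambda>(\<sigma>) n \<lambda>(\<sigma>)\<inverse>\<close>.
\<close>

definition descended_algebra ::
    "('a, 'b) ring_scheme \<Rightarrow> 'a set \<Rightarrow> 'a set \<Rightarrow> (('a \<Rightarrow> 'a) set \<Rightarrow> ('a \<Rightarrow> 'a) set) set
      \<Rightarrow> ((('a \<Rightarrow> 'a) set \<Rightarrow> ('a \<Rightarrow> 'a) set) \<Rightarrow> 'a) set" where
  "descended_algebra M K L N =
     {x \<in> carrier (group_hopf_algebra M (perm_group M K L N)).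
        \<forall>\<sigma>\<in>carrier (galois_group M K). \<forall>n\<in>N. x (galois_conj M K L \<sigma> n) = \<sigma> (x n)}"

text \<open>
  \<open>(H, \<mu>)\<close> is, up to isomorphism, the structure attached to \<open>N\<close> by Greither and Pareigis: \<open>f\<close>
  identifies \<open>H\<close> with the \<open>K\<close>-Hopf algebra \<open>M[N]\<^sup>G\<close>, whose operations are those of the
  \<open>M\<close>-Hopf algebra \<open>M[N]\<close>, and \<open>\<Sum> x\<^sub>n n\<close> acts on \<open>y \<in> L\<close> as
  \<open>\<Sum> x\<^sub>n (n\<inverse>(1 G'))(y)\<close>. The elements of a coset \<open>\<tau> G'\<close> agree on \<open>L\<close>, so that
  \<open>(\<tau> G')(y) = \<tau>(y)\<close> makes sense. Comultiplications are compared in \<open>M[N] \<otimes>\<^sub>M M[N]\<close>, to which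
  \<open>H \<otimes>\<^sub>K H\<close> is mapped by \<open>f \<otimes> f\<close>.
\<close>

definition greither_pareigis_structure ::
    "('a, 'b) ring_scheme \<Rightarrow> 'a set \<Rightarrow> 'a set \<Rightarrow> (('a \<Rightarrow> 'a) set \<Rightarrow> ('a \<Rightarrow> 'a) set) set
      \<Rightarrow> ('a, 'h) hopf \<Rightarrow> ('h \<Rightarrow> 'a \<Rightarrow> 'a) \<Rightarrow> bool" where
  "greither_pareigis_structure M K L N H \<mu> \<longleftrightarrow>
     (\<exists>f. let A = group_hopf_algebra M (perm_group M K L N) in
        f \<in> Ring.ring_hom H A \<and>
        bij_betw f (carrier H) (descended_algebra M K L N) \<and>
        (\<forall>k\<in>K. \<forall>h\<in>carrier H. f (k \<odot>\<^bsub>H\<^esub> h) = k \<odot>\<^bsub>A\<^esub> f h) \<and>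
        (\<forall>h\<in>carrier H.
           comult A (f h) =
             tensor_lift (M\<lparr>carrier := K\<rparr>) (tensor M A A)
               (\<lambda>h1 h2. pure_tensor M A A (f h1) (f h2)) (comult H h)) \<and>
        (\<forall>h\<in>carrier H. counit A (f h) = counit H h) \<and>
        (\<forall>h\<in>carrier H. antipode A (f h) = f (antipode H h)) \<and>
        (\<forall>h\<in>carrier H. \<forall>y\<in>L.
           \<mu> h y =
             (\<Oplus>\<^bsub>M\<^esub>n\<in>N. f h n \<otimes>\<^bsub>M\<^esub>
                the_elem ((\<lambda>\<tau>. \<tau> y) `
                  ((inv\<^bsub>galois_sym M K L\<^esub> n) (carrier (galois_group M L)))))))"

text \<open>
  The type token says where the elements of the Hopf algebra live. Every finite-dimensional
  vector space over a subfield of \<open>'a\<close> has an isomorphic copy on a subset of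
  \<open>nat \<Rightarrow> 'a\<close>, so every Hopf Galois structure has one for the token
  \<open>TYPE(nat \<Rightarrow> 'a)\<close>.
\<close>

definition has_hopf_galois_structure_of_type ::
    "'h itself \<Rightarrow> ('a, 'b) ring_scheme \<Rightarrow> 'a set \<Rightarrow> 'a set \<Rightarrow> ('g, 'c) monoid_scheme \<Rightarrow> bool" where
  "has_hopf_galois_structure_of_type (_ :: 'h itself) M K L T \<longleftrightarrow>
     (\<exists>(H :: ('a, 'h) hopf) \<mu> N.
        hopf_galois_structure (M\<lparr>carrier := L\<rparr>) K H \<mu> \<and>
        greither_pareigis_subgroup M K L N \<and>
        greither_pareigis_structure M K L N H \<mu> \<and>
        perm_group M K L N \<cong> T)"


section \<open>The groups of order \<open>p\<^sup>3\<close>\<close>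

text \<open>
  Matrices over \<open>\<int>/m\<close> are integer matrices with entries in \<open>{0..<m}\<close>, multiplied modulo \<open>m\<close>.
\<close>

definition mat_mult_mod :: "nat \<Rightarrow> int mat \<Rightarrow> int mat \<Rightarrow> int mat" where
  "mat_mult_mod m A B = map_mat (\<lambda>x. x mod int m) (A * B)"

definition heisenberg_group :: "nat \<Rightarrow> int mat monoid" where
  "heisenberg_group p =
     \<lparr>carrier = {mat_of_rows_list 3 [[1, a, b], [0, 1, c], [0, 0, 1]] | a b c.
                   a \<in> {0..<int p} \<and> b \<in> {0..<int p} \<and> c \<in> {0..<int p}},
      monoid.mult = mat_mult_mod p,
      monoid.one = 1\<^sub>m 3\<rparr>"

definition G_group :: "nat \<Rightarrow> int mat monoid" where
  "G_group p =
     \<lparr>carrier = {mat_of_rows_list 2 [[(1 + int p * b) mod int (p^2), a], [0, 1]] | a b.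
                   a \<in> {0..<int (p^2)} \<and> b \<in> {0..<int (p^2)}},
      monoid.mult = mat_mult_mod (p^2),
      monoid.one = 1\<^sub>m 2\<rparr>"

end

theory Submission
  imports Defs "HOL-Library.Product_Plus" "HOL-Library.Countable_Set"
begin

text \<open>
  Let \<open>N\<close> be the given regular subgroup, isomorphic to \<open>H\<^sub>p\<close> or \<open>G\<^sub>p\<close>. Since \<open>N\<close> has class two and
  odd order, every \<open>x \<in> N\<close> has a square root \<open>x\<^sup>h\<close>, and Baer's operation \<open>x \<circ> y = x\<^sup>h y x\<^sup>h\<close> turns \<open>N\<close>
  into an abelian group, isomorphic to \<open>C\<^sub>p\<^sup>3\<close> or \<open>C\<^bsub>p\<^sup>2\<^esub> \<times> C\<^sub>p\<close>. Identify the cosets with \<open>N\<close>. An element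
  of \<open>\<lambda>(G)\<close> acts as \<open>y \<mapsto> \<alpha>(y) a\<close> with \<open>\<alpha> \<in> Aut N\<close> and conjugates the translation \<open>y \<mapsto> x \<circ> y\<close> into
  \<open>y \<mapsto> z\<^sup>h y (a\<^sup>-\<^sup>1 z\<^sup>h a)\<close> with \<open>z = \<alpha>(x)\<close>. As commutators are central, this is again a translation
  of \<open>\<circ>\<close>, so these translations form a regular abelian subgroup normalised by \<open>\<lambda>(G)\<close>.

  That a regular subgroup \<open>N\<close> normalised by \<open>\<lambda>(G)\<close> gives a Hopf Galois structure rests on one remark:
  \<open>M[N]\<^sup>G\<close> and \<open>L\<close> are spaces of equivariant functions from a finite \<open>G\<close>-set to \<open>M\<close>, and a \<open>K\<close>-basis
  of such a space is an \<open>M\<close>-basis of all functions. Hence tensor products over \<open>K\<close> embed into functions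
  on products of \<open>G\<close>-sets, and every Hopf algebra identity becomes an identity between functions.
\<close>

section \<open>Tensor products of modules\<close>

text \<open>Tensors are cosets in a free module and have no normal form, so an identity between them
  is decided by evaluating them as functions. Two facts make this work. An algebra of functions on a
  finite set that contains the constants and separates the points contains every function; this is
  why equivariant functions span over M. And if an equivariant function is expanded in an M-basis of
  equivariant functions, applying \<tau> in G moves only the coefficients; these are unique, hence
  fixed by G, hence in K. The same facts produce elements: the comultiplication has no formula
  inside H \<otimes> H, and the sum that defines the action lies a priori in M only, but both are
  recovered from equivariant functions. On the group side, x^h y x^h is built from powers and
  products, so every automorphism respects it. In exponential coordinates it is the addition of
  integer vectors, and the group law is x + y + [x, y] / 2. The number h inverts 2 modulo the
  exponent: (p + 1) / 2 for H_p and (p^2 + 1) / 2 for G_p.\<close>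

lemma free_module_simps [simp]:
  "carrier (free_module R S) = {f. (\<forall>s. f s \<in> carrier R) \<and> finite {s. f s \<noteq> \<zero>\<^bsub>R\<^esub>} \<and>
     (\<forall>s. s \<notin> S \<longrightarrow> f s = \<zero>\<^bsub>R\<^esub>)}"
  "\<zero>\<^bsub>free_module R S\<^esub> = (\<lambda>s. \<zero>\<^bsub>R\<^esub>)"
  "f \<oplus>\<^bsub>free_module R S\<^esub> g = (\<lambda>s. f s \<oplus>\<^bsub>R\<^esub> g s)"
  "a \<odot>\<^bsub>free_module R S\<^esub> f = (\<lambda>s. a \<otimes>\<^bsub>R\<^esub> f s)"
  by (simp_all add: free_module_def)

lemma module_free_module:
  fixes R (structure)
  assumes "cring R"
  shows "Module.module R (free_module R S)"
proof -
  interpret cring R by fact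
  have fin: "finite {s. f s \<oplus> g s \<noteq> \<zero>}"
    if "finite {s. f s \<noteq> \<zero>}" "finite {s. g s \<noteq> \<zero>}" for f g
    by (rule finite_subset[OF _ finite_UnI[OF that]]) auto
  have fin': "finite {s. a \<otimes> f s \<noteq> \<zero>}"
    if "finite {s. f s \<noteq> \<zero>}" "a \<in> carrier R" for a f
    by (rule finite_subset[OF _ that(1)]) (use that in auto)
  have neg: "\<exists>g\<in>carrier (free_module R S). f \<oplus>\<^bsub>free_module R S\<^esub> g = \<zero>\<^bsub>free_module R S\<^esub>"
    if "f \<in> carrier (free_module R S)" for f
    by (rule bexI[of _ "\<lambda>s. \<ominus> f s"]) (use that in \<open>auto simp: r_neg\<close>)
  show ?thesis
    by (rule module_criteria)
      (use neg in \<open>auto simp: fin fin' assms fun_eq_iff a_ac m_assoc l_distr r_distr\<close>)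
qed

definition bilinear_map ::
    "('k, 'm) ring_scheme \<Rightarrow> ('k, 'v, 'x) module_scheme \<Rightarrow> ('k, 'w, 'y) module_scheme
      \<Rightarrow> ('k, 'p, 'z) module_scheme \<Rightarrow> ('v \<Rightarrow> 'w \<Rightarrow> 'p) \<Rightarrow> bool" where
  "bilinear_map R V W P b \<longleftrightarrow>
     (\<forall>v\<in>carrier V. \<forall>w\<in>carrier W. b v w \<in> carrier P) \<and>
     (\<forall>v\<in>carrier V. \<forall>v'\<in>carrier V. \<forall>w\<in>carrier W. b (v \<oplus>\<^bsub>V\<^esub> v') w = b v w \<oplus>\<^bsub>P\<^esub> b v' w) \<and>
     (\<forall>v\<in>carrier V. \<forall>w\<in>carrier W. \<forall>w'\<in>carrier W. b v (w \<oplus>\<^bsub>W\<^esub> w') = b v w \<oplus>\<^bsub>P\<^esub> b v w') \<and>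
     (\<forall>a\<in>carrier R. \<forall>v\<in>carrier V. \<forall>w\<in>carrier W. b (a \<odot>\<^bsub>V\<^esub> v) w = a \<odot>\<^bsub>P\<^esub> b v w) \<and>
     (\<forall>a\<in>carrier R. \<forall>v\<in>carrier V. \<forall>w\<in>carrier W. b v (a \<odot>\<^bsub>W\<^esub> w) = a \<odot>\<^bsub>P\<^esub> b v w)"

lemma bilinear_mapI:
  assumes "\<And>v w. \<lbrakk>v \<in> carrier V; w \<in> carrier W\<rbrakk> \<Longrightarrow> b v w \<in> carrier P"
    and "\<And>v v' w. \<lbrakk>v \<in> carrier V; v' \<in> carrier V; w \<in> carrier W\<rbrakk> \<Longrightarrow>
      b (v \<oplus>\<^bsub>V\<^esub> v') w = b v w \<oplus>\<^bsub>P\<^esub> b v' w"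
    and "\<And>v w w'. \<lbrakk>v \<in> carrier V; w \<in> carrier W; w' \<in> carrier W\<rbrakk> \<Longrightarrow>
      b v (w \<oplus>\<^bsub>W\<^esub> w') = b v w \<oplus>\<^bsub>P\<^esub> b v w'"
    and "\<And>a v w. \<lbrakk>a \<in> carrier R; v \<in> carrier V; w \<in> carrier W\<rbrakk> \<Longrightarrow>
      b (a \<odot>\<^bsub>V\<^esub> v) w = a \<odot>\<^bsub>P\<^esub> b v w"
    and "\<And>a v w. \<lbrakk>a \<in> carrier R; v \<in> carrier V; w \<in> carrier W\<rbrakk> \<Longrightarrow>
      b v (a \<odot>\<^bsub>W\<^esub> w) = a \<odot>\<^bsub>P\<^esub> b v w"
  shows "bilinear_map R V W P b"
  using assms by (simp add: bilinear_map_def)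

text \<open>This treats one representative at a time. \<open>tensor_lift\<close> takes the image of
  a whole coset under this sum and is meaningful because the sum is constant on cosets of
  \<open>tensor_null\<close>.\<close>

definition free_lift ::
    "('k, 'm) ring_scheme \<Rightarrow> ('k, 'p, 'z) module_scheme \<Rightarrow> ('v \<Rightarrow> 'w \<Rightarrow> 'p)
      \<Rightarrow> ('v \<times> 'w \<Rightarrow> 'k) \<Rightarrow> 'p" where
  "free_lift R P b f = (\<Oplus>\<^bsub>P\<^esub>s\<in>{s. f s \<noteq> \<zero>\<^bsub>R\<^esub>}. f s \<odot>\<^bsub>P\<^esub> b (fst s) (snd s))"

locale tensor_modules = V: Module.module R V + W: Module.module R W
  for R :: "('k, 'm) ring_scheme" (structure)
    and V :: "('k, 'v, 'x) module_scheme" and W :: "('k, 'w, 'y) module_scheme"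
begin

abbreviation "F \<equiv> free_module R (carrier V \<times> carrier W)"
abbreviation "null \<equiv> tensor_null R V W"
abbreviation "T \<equiv> tensor R V W"
abbreviation "pure \<equiv> pure_tensor R V W"

sublocale F: Module.module R F
  by (rule module_free_module) unfold_locales

lemma free_gen_closed: "\<lbrakk>v \<in> carrier V; w \<in> carrier W\<rbrakk> \<Longrightarrow> free_gen R (v, w) \<in> carrier F"
  by (auto simp: free_gen_def)

lemma relators_subset: "tensor_relators R V W \<subseteq> carrier F"
  unfolding tensor_relators_def Let_def
  by (auto simp del: free_module_simps
      intro!: F.minus_closed F.add.m_closed F.smult_closed free_gen_closed)

lemma submodule_null: "LinearCombinations.submodule R null F"
  unfolding tensor_null_def by (rule F.span_is_submodule[OF relators_subset])

lemma null_subset: "null \<subseteq> carrier F"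
  using submodule_null by (simp only: LinearCombinations.submodule_def)

sublocale N: abelian_subgroup null F
proof (rule abelian_subgroupI3)
  interpret S: LinearCombinations.submodule R null F by (rule submodule_null)
  show "additive_subgroup null F"
  proof (rule additive_subgroupI, unfold_locales)
    show "null \<subseteq> carrier (add_monoid F)" using null_subset by simp
    fix x y assume xy: "x \<in> null" "y \<in> null"
    show "x \<otimes>\<^bsub>add_monoid F\<^esub> y \<in> null" using S.m_closed[OF xy] by simp
    \<comment> \<open>Closure under negation comes from the scalar -1.\<close>
    have "\<ominus>\<^bsub>F\<^esub> x = (\<ominus> \<one>) \<odot>\<^bsub>F\<^esub> x"
      using xy null_subset F.smult_l_minus[of \<one> x] F.smult_one[of x] V.R.one_closed by (simp only: subset_iff)
    then have "\<ominus>\<^bsub>F\<^esub> x \<in> null"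
      using S.smult_closed[of "\<ominus> \<one>" x] xy by simp
    then show "inv\<^bsub>add_monoid F\<^esub> x \<in> null"
      by (simp only: a_inv_def)
  next
    show "\<one>\<^bsub>add_monoid F\<^esub> \<in> null" using S.zero_closed by simp
  qed
  show "abelian_group F" by (rule F.abelian_group_axioms)
qed

lemma smult_null: "\<lbrakk>a \<in> carrier R; x \<in> null\<rbrakk> \<Longrightarrow> a \<odot>\<^bsub>F\<^esub> x \<in> null"
  using submodule_null LinearCombinations.submodule.smult_closed by metis

lemma tensor_simps:
  "carrier T = a_rcosets\<^bsub>F\<^esub> null"
  "\<zero>\<^bsub>T\<^esub> = null"
  "s \<oplus>\<^bsub>T\<^esub> t = s <+>\<^bsub>F\<^esub> t"
  "a \<odot>\<^bsub>T\<^esub> t = (\<Union>f\<in>t. null +>\<^bsub>F\<^esub> (a \<odot>\<^bsub>F\<^esub> f))"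
  by (simp_all add: tensor_def tensor_module_def Let_def)

lemma tensor_carrierE:
  assumes "t \<in> carrier T"
  obtains f where "f \<in> carrier F" "t = null +>\<^bsub>F\<^esub> f"
  using assms by (auto simp: tensor_simps A_RCOSETS_def' simp del: free_module_simps)

lemma coset_closed: "f \<in> carrier F \<Longrightarrow> null +>\<^bsub>F\<^esub> f \<in> carrier T"
  by (auto simp: tensor_simps A_RCOSETS_def' simp del: free_module_simps)

lemma coset_add:
  "\<lbrakk>f \<in> carrier F; g \<in> carrier F\<rbrakk> \<Longrightarrow>
    (null +>\<^bsub>F\<^esub> f) \<oplus>\<^bsub>T\<^esub> (null +>\<^bsub>F\<^esub> g) = null +>\<^bsub>F\<^esub> (f \<oplus>\<^bsub>F\<^esub> g)"
  unfolding tensor_simps by (rule N.a_rcos_sum)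

lemma coset_eq:
  assumes "f \<in> carrier F" "g \<in> carrier F" "f \<ominus>\<^bsub>F\<^esub> g \<in> null"
  shows "null +>\<^bsub>F\<^esub> f = null +>\<^bsub>F\<^esub> g"
proof -
  have "f \<in> null +>\<^bsub>F\<^esub> g"
    using N.a_rcos_module_rev[of g f] assms by (simp only: a_minus_def)
  then show ?thesis using N.a_repr_independence'[of f g] assms(2) by simp
qed

text \<open>By definition the left side is the union of the cosets of a g over all representatives
  g. They coincide because g - f in \<open>null\<close> implies a (g - f) in
  \<open>null\<close>.\<close>

lemma coset_smult:
  assumes a: "a \<in> carrier R" and f: "f \<in> carrier F"
  shows "a \<odot>\<^bsub>T\<^esub> (null +>\<^bsub>F\<^esub> f) = null +>\<^bsub>F\<^esub> (a \<odot>\<^bsub>F\<^esub> f)"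
proof -
  have "null +>\<^bsub>F\<^esub> (a \<odot>\<^bsub>F\<^esub> g) = null +>\<^bsub>F\<^esub> (a \<odot>\<^bsub>F\<^esub> f)" if "g \<in> null +>\<^bsub>F\<^esub> f" for g
  proof -
    have g: "g \<in> carrier F" by (rule N.a_elemrcos_carrier[OF f that])
    have "g \<oplus>\<^bsub>F\<^esub> \<ominus>\<^bsub>F\<^esub> f \<in> null" by (rule N.a_rcos_module_imp[OF f that])
    then have "a \<odot>\<^bsub>F\<^esub> (g \<oplus>\<^bsub>F\<^esub> \<ominus>\<^bsub>F\<^esub> f) \<in> null" by (rule smult_null[OF a])
    then have "a \<odot>\<^bsub>F\<^esub> g \<ominus>\<^bsub>F\<^esub> a \<odot>\<^bsub>F\<^esub> f \<in> null"
      using F.smult_r_distr[OF a g F.a_inv_closed[OF f]] F.smult_r_minus[OF a f]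
      by (simp only: a_minus_def)
    then show ?thesis by (rule coset_eq[OF F.smult_closed[OF a g] F.smult_closed[OF a f]])
  qed
  moreover have "f \<in> null +>\<^bsub>F\<^esub> f" by (rule N.a_rcos_self[OF f])
  ultimately show ?thesis unfolding tensor_simps by blast
qed

text \<open>Addition and zero of T are those of the factor group F / null. The equations
  \<open>c\<close> are used from right to left, which turns each claim about T into one about that
  group.\<close>

lemma abelian_group_tensor: "abelian_group T"
proof -
  interpret C: comm_group "F A_Mod null" by (rule N.a_factorgroup_is_comm_group)
  have c: "carrier (F A_Mod null) = carrier T" "one (F A_Mod null) = \<zero>\<^bsub>T\<^esub>"
    "\<And>s t. s \<otimes>\<^bsub>F A_Mod null\<^esub> t = s \<oplus>\<^bsub>T\<^esub> t"
    by (simp_all add: tensor_simps A_FactGroup_def FactGroup_def A_RCOSETS_def set_add_def)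
  note [simp] = c[symmetric]
  show ?thesis
  proof (rule abelian_groupI)
    fix x assume "x \<in> carrier T"
    then show "\<exists>y\<in>carrier T. y \<oplus>\<^bsub>T\<^esub> x = \<zero>\<^bsub>T\<^esub>"
      using C.l_inv[of x] C.inv_closed[of x] by (auto simp del: free_module_simps)
  qed (simp_all add: C.m_assoc C.m_comm C.m_lcomm del: add_A_FactGroup)
qed

sublocale T: Module.module R T
proof (rule Module.moduleI)
  show "cring R" by unfold_locales
  show "abelian_group T" by (rule abelian_group_tensor)
next
  fix a b x y assume a: "a \<in> carrier R" and b: "b \<in> carrier R"
    and x: "x \<in> carrier T" and y: "y \<in> carrier T"
  obtain f where f: "f \<in> carrier F" "x = null +>\<^bsub>F\<^esub> f" using x by (rule tensor_carrierE)
  obtain g where g: "g \<in> carrier F" "y = null +>\<^bsub>F\<^esub> g" using y by (rule tensor_carrierE)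
  show "(a \<oplus> b) \<odot>\<^bsub>T\<^esub> x = a \<odot>\<^bsub>T\<^esub> x \<oplus>\<^bsub>T\<^esub> b \<odot>\<^bsub>T\<^esub> x"
    using a b f by (simp add: coset_smult coset_add F.smult_l_distr del: free_module_simps)
  show "a \<odot>\<^bsub>T\<^esub> (x \<oplus>\<^bsub>T\<^esub> y) = a \<odot>\<^bsub>T\<^esub> x \<oplus>\<^bsub>T\<^esub> a \<odot>\<^bsub>T\<^esub> y"
    using a f g by (simp add: coset_smult coset_add F.smult_r_distr del: free_module_simps)
  show "(a \<otimes> b) \<odot>\<^bsub>T\<^esub> x = a \<odot>\<^bsub>T\<^esub> (b \<odot>\<^bsub>T\<^esub> x)"
    using a b f by (simp add: coset_smult F.smult_assoc1 del: free_module_simps)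
next
  fix a x assume "a \<in> carrier R" "x \<in> carrier T"
  then show "a \<odot>\<^bsub>T\<^esub> x \<in> carrier T"
    by (elim tensor_carrierE) (simp add: coset_smult coset_closed del: free_module_simps)
next
  fix x assume "x \<in> carrier T"
  then show "\<one> \<odot>\<^bsub>T\<^esub> x = x"
    by (elim tensor_carrierE) (simp add: coset_smult del: free_module_simps)
qed

lemma pure_closed [simp, intro]:
  "\<lbrakk>v \<in> carrier V; w \<in> carrier W\<rbrakk> \<Longrightarrow> pure v w \<in> carrier T"
  unfolding pure_tensor_def by (intro coset_closed free_gen_closed)

lemma relator_in_null: "x \<in> tensor_relators R V W \<Longrightarrow> x \<in> null"
  using F.in_own_span[OF relators_subset] unfolding tensor_null_def by blast

lemma pure_add_left:
  assumes "v \<in> carrier V" "v' \<in> carrier V" "w \<in> carrier W"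
  shows "pure (v \<oplus>\<^bsub>V\<^esub> v') w = pure v w \<oplus>\<^bsub>T\<^esub> pure v' w"
  unfolding pure_tensor_def
  apply (subst coset_add, (intro free_gen_closed assms)+)
  apply (rule coset_eq)
    apply (intro free_gen_closed V.M.add.m_closed assms F.M.add.m_closed)+
  apply (rule relator_in_null)
  using assms unfolding tensor_relators_def Let_def by blast

lemma pure_add_right:
  assumes "v \<in> carrier V" "w \<in> carrier W" "w' \<in> carrier W"
  shows "pure v (w \<oplus>\<^bsub>W\<^esub> w') = pure v w \<oplus>\<^bsub>T\<^esub> pure v w'"
  unfolding pure_tensor_def
  apply (subst coset_add, (intro free_gen_closed assms)+)
  apply (rule coset_eq)
    apply (intro free_gen_closed W.M.add.m_closed assms F.M.add.m_closed)+
  apply (rule relator_in_null)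
  using assms unfolding tensor_relators_def Let_def by blast

lemma pure_smult_left:
  assumes "a \<in> carrier R" "v \<in> carrier V" "w \<in> carrier W"
  shows "pure (a \<odot>\<^bsub>V\<^esub> v) w = a \<odot>\<^bsub>T\<^esub> pure v w"
  unfolding pure_tensor_def
  apply (subst coset_smult, (intro free_gen_closed assms)+)
  apply (rule coset_eq)
    apply (intro free_gen_closed V.smult_closed assms F.smult_closed)+
  apply (rule relator_in_null)
  using assms unfolding tensor_relators_def Let_def by blast

lemma pure_smult_right:
  assumes "a \<in> carrier R" "v \<in> carrier V" "w \<in> carrier W"
  shows "pure v (a \<odot>\<^bsub>W\<^esub> w) = a \<odot>\<^bsub>T\<^esub> pure v w"
  unfolding pure_tensor_def
  apply (subst coset_smult, (intro free_gen_closed assms)+)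
  apply (rule coset_eq)
    apply (intro free_gen_closed W.smult_closed assms F.smult_closed)+
  apply (rule relator_in_null)
  using assms unfolding tensor_relators_def Let_def by blast

text \<open>Induction on a finite set containing the support, splitting off one point. There is no
  case for the zero function: V and W contain zero, so it is a zero multiple of a generator.\<close>

lemma free_module_induct [consumes 1, case_names gen add]:
  assumes f: "f \<in> carrier F"
    and gen: "\<And>a v w. \<lbrakk>a \<in> carrier R; v \<in> carrier V; w \<in> carrier W\<rbrakk> \<Longrightarrow> P (a \<odot>\<^bsub>F\<^esub> free_gen R (v, w))"
    and add: "\<And>f g. \<lbrakk>f \<in> carrier F; g \<in> carrier F; P f; P g\<rbrakk> \<Longrightarrow> P (f \<oplus>\<^bsub>F\<^esub> g)"
  shows "P f"
proof -
  have "finite A \<Longrightarrow> f \<in> carrier F \<Longrightarrow> {s. f s \<noteq> \<zero>} \<subseteq> A \<Longrightarrow> P f" for A f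
  proof (induction A arbitrary: f rule: finite_induct)
    case empty
    have "f = \<zero> \<odot>\<^bsub>F\<^esub> free_gen R (\<zero>\<^bsub>V\<^esub>, \<zero>\<^bsub>W\<^esub>)"
      using empty by (auto simp: fun_eq_iff free_gen_def)
    then show ?case using gen[of \<zero> "\<zero>\<^bsub>V\<^esub>" "\<zero>\<^bsub>W\<^esub>"] by simp
  next
    case (insert s A)
    show ?case
    proof (cases "f s = \<zero>")
      case True
      then show ?thesis using insert by blast
    next
      case False
      obtain v w where s: "s = (v, w)" "v \<in> carrier V" "w \<in> carrier W"
        using False insert.prems(1) by (cases s) (simp, blast)
      define g where "g = f(s := \<zero>)"
      have g: "g \<in> carrier F"
        using insert.prems(1) unfolding g_def
        by (auto elim!: rev_finite_subset)
      have "{t. g t \<noteq> \<zero>} \<subseteq> A" using insert.prems unfolding g_def by auto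
      then have "P g" using insert.IH g by blast
      moreover have fs: "f s \<in> carrier R" using insert.prems(1) by (cases s) simp
      then have "P (f s \<odot>\<^bsub>F\<^esub> free_gen R (v, w))" using gen s by blast
      moreover have "f s \<odot>\<^bsub>F\<^esub> free_gen R (v, w) \<in> carrier F"
        by (rule F.smult_closed[OF fs free_gen_closed[OF s(2,3)]])
      moreover have "f = f s \<odot>\<^bsub>F\<^esub> free_gen R (v, w) \<oplus>\<^bsub>F\<^esub> g"
        using insert.prems(1) unfolding g_def s by (auto simp: fun_eq_iff free_gen_def)
      ultimately show ?thesis using add[OF _ g, of "f s \<odot>\<^bsub>F\<^esub> free_gen R (v, w)"] by (simp only:)
    qed
  qed
  then show ?thesis using f by auto
qed

text \<open>A scalar in front of a generator moves into the left factor, which leaves only pure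
  tensors and sums.\<close>

lemma tensor_induct [consumes 1, case_names pure add]:
  assumes t: "t \<in> carrier T"
    and pure: "\<And>v w. \<lbrakk>v \<in> carrier V; w \<in> carrier W\<rbrakk> \<Longrightarrow> P (pure v w)"
    and add: "\<And>s t. \<lbrakk>s \<in> carrier T; t \<in> carrier T; P s; P t\<rbrakk> \<Longrightarrow> P (s \<oplus>\<^bsub>T\<^esub> t)"
  shows "P t"
proof -
  obtain f where f: "f \<in> carrier F" and t: "t = null +>\<^bsub>F\<^esub> f" using t by (rule tensor_carrierE)
  show ?thesis unfolding t using f
  proof (induction f rule: free_module_induct)
    case (gen a v w)
    then have "pure (a \<odot>\<^bsub>V\<^esub> v) w = null +>\<^bsub>F\<^esub> (a \<odot>\<^bsub>F\<^esub> free_gen R (v, w))"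
      using pure_smult_left[OF gen] coset_smult[OF gen(1) free_gen_closed[OF gen(2,3)]]
      by (simp only: pure_tensor_def)
    then show ?case using pure[of "a \<odot>\<^bsub>V\<^esub> v" w] gen by simp
  next
    case (add f g)
    then show ?case
      unfolding coset_add[OF add(1,2), symmetric] by (intro assms(3) coset_closed)
  qed
qed

end

section \<open>The universal property of the tensor product\<close>

locale tensor_lifting = tensor_modules R V W + P: Module.module R P
  for R :: "('k, 'm) ring_scheme" (structure)
    and V :: "('k, 'v, 'x) module_scheme" and W :: "('k, 'w, 'y) module_scheme"
    and P :: "('k, 'p, 'z) module_scheme" +
  fixes b
  assumes bilinear: "bilinear_map R V W P b"
begin

lemma b_closed: "\<lbrakk>v \<in> carrier V; w \<in> carrier W\<rbrakk> \<Longrightarrow> b v w \<in> carrier P"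
  using bilinear by (simp add: bilinear_map_def)

text \<open>The support of a sum or a multiple can shrink; summing over any larger finite set makes
  \<open>free_lift\<close> linear term by term.\<close>

lemma free_lift_superset:
  assumes f: "f \<in> carrier F" and A: "finite A" "{s. f s \<noteq> \<zero>} \<subseteq> A" "A \<subseteq> carrier V \<times> carrier W"
  shows "free_lift R P b f = (\<Oplus>\<^bsub>P\<^esub>s\<in>A. f s \<odot>\<^bsub>P\<^esub> b (fst s) (snd s))"
  unfolding free_lift_def
  by (rule P.add.finprod_mono_neutral_cong_left) (use f A b_closed in \<open>auto 0 3\<close>)

lemma free_lift_hom: "free_lift R P b \<in> module_hom R F P"
proof -
  have supp: "{s. f s \<noteq> \<zero>} \<subseteq> carrier V \<times> carrier W" "finite {s. f s \<noteq> \<zero>}"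
    if "f \<in> carrier F" for f
    using that by auto
  have val: "f s \<in> carrier R" if "f \<in> carrier F" for f s
    using that by (cases s) simp
  have b: "b (fst s) (snd s) \<in> carrier P" if "s \<in> A" "A \<subseteq> carrier V \<times> carrier W" for s A
    using that b_closed by (metis mem_Times_iff subsetD)
  show ?thesis
    unfolding module_hom_def
  proof (intro CollectI conjI allI impI funcsetI)
    fix f assume f: "f \<in> carrier F"
    show "free_lift R P b f \<in> carrier P"
      unfolding free_lift_def
      by (intro P.finsum_closed funcsetI P.smult_closed val[OF f] b[OF _ supp(1)[OF f]])
  next
    fix f g assume fg: "f \<in> carrier F \<and> g \<in> carrier F"
    then have f: "f \<in> carrier F" and g: "g \<in> carrier F" by auto
    define A where "A = {s. f s \<noteq> \<zero>} \<union> {s. g s \<noteq> \<zero>}"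
    have A: "finite A" "A \<subseteq> carrier V \<times> carrier W"
      unfolding A_def using supp[OF f] supp[OF g] by (simp_all del: free_module_simps)
    have sub: "{s. f s \<noteq> \<zero>} \<subseteq> A" "{s. g s \<noteq> \<zero>} \<subseteq> A" "{s. (f \<oplus>\<^bsub>F\<^esub> g) s \<noteq> \<zero>} \<subseteq> A"
      by (auto simp: A_def)
    have "free_lift R P b (f \<oplus>\<^bsub>F\<^esub> g) = (\<Oplus>\<^bsub>P\<^esub>s\<in>A. (f \<oplus>\<^bsub>F\<^esub> g) s \<odot>\<^bsub>P\<^esub> b (fst s) (snd s))"
      by (rule free_lift_superset[OF F.add.m_closed[OF f g] A(1) sub(3) A(2)])
    also have "\<dots> = (\<Oplus>\<^bsub>P\<^esub>s\<in>A. f s \<odot>\<^bsub>P\<^esub> b (fst s) (snd s) \<oplus>\<^bsub>P\<^esub> g s \<odot>\<^bsub>P\<^esub> b (fst s) (snd s))"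
      by (intro P.finsum_cong' refl funcsetI P.M.add.m_closed P.smult_closed val[OF f] val[OF g] b[OF _ A(2)])
        (simp only: free_module_simps P.smult_l_distr val[OF f] val[OF g] b[OF _ A(2)])+
    also have "\<dots> = free_lift R P b f \<oplus>\<^bsub>P\<^esub> free_lift R P b g"
      unfolding free_lift_superset[OF f A(1) sub(1) A(2)] free_lift_superset[OF g A(1) sub(2) A(2)]
      by (intro P.finsum_addf funcsetI P.smult_closed val[OF f] val[OF g] b[OF _ A(2)])
    finally show "free_lift R P b (f \<oplus>\<^bsub>F\<^esub> g) = free_lift R P b f \<oplus>\<^bsub>P\<^esub> free_lift R P b g" .
  next
    fix a f assume af: "a \<in> carrier R \<and> f \<in> carrier F"
    then have a: "a \<in> carrier R" and f: "f \<in> carrier F" by auto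
    define A where "A = {s. f s \<noteq> \<zero>}"
    have A: "finite A" "A \<subseteq> carrier V \<times> carrier W"
      unfolding A_def using supp[OF f] by (simp_all del: free_module_simps)
    have sub: "{s. f s \<noteq> \<zero>} \<subseteq> A" "{s. (a \<odot>\<^bsub>F\<^esub> f) s \<noteq> \<zero>} \<subseteq> A"
      using a by (auto simp: A_def)
    have "free_lift R P b (a \<odot>\<^bsub>F\<^esub> f) = (\<Oplus>\<^bsub>P\<^esub>s\<in>A. (a \<odot>\<^bsub>F\<^esub> f) s \<odot>\<^bsub>P\<^esub> b (fst s) (snd s))"
      by (rule free_lift_superset[OF F.smult_closed[OF a f] A(1) sub(2) A(2)])
    also have "\<dots> = (\<Oplus>\<^bsub>P\<^esub>s\<in>A. a \<odot>\<^bsub>P\<^esub> (f s \<odot>\<^bsub>P\<^esub> b (fst s) (snd s)))"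
      by (intro P.finsum_cong' refl funcsetI P.smult_closed a val[OF f] b[OF _ A(2)])
        (simp only: free_module_simps P.smult_assoc1 a val[OF f] b[OF _ A(2)])+
    also have "\<dots> = a \<odot>\<^bsub>P\<^esub> free_lift R P b f"
      unfolding free_lift_superset[OF f A(1) sub(1) A(2)]
      by (intro P.finsum_smult_ldistr[symmetric] funcsetI P.smult_closed A(1) a val[OF f] b[OF _ A(2)])
    finally show "free_lift R P b (a \<odot>\<^bsub>F\<^esub> f) = a \<odot>\<^bsub>P\<^esub> free_lift R P b f" .
  qed
qed

sublocale lift: mod_hom R F P "free_lift R P b"
  by unfold_locales (rule free_lift_hom)

lemma free_lift_gen:
  assumes "v \<in> carrier V" "w \<in> carrier W"
  shows "free_lift R P b (free_gen R (v, w)) = b v w"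
  by (subst free_lift_superset[of _ "{(v, w)}"]) (use assms b_closed in \<open>auto simp: free_gen_def\<close>)

text \<open>Bilinearity puts every relator into the kernel, and the kernel, being a submodule, then
  contains their span.\<close>

lemma free_lift_null: "x \<in> null \<Longrightarrow> free_lift R P b x = \<zero>\<^bsub>P\<^esub>"
proof -
  have "tensor_relators R V W \<subseteq> lift.ker"
  proof
    fix x assume x: "x \<in> tensor_relators R V W"
    have gen: "free_gen R (v, w) \<in> carrier F" "free_lift R P b (free_gen R (v, w)) = b v w"
       if "v \<in> carrier V" "w \<in> carrier W" for v w
      using that free_gen_closed free_lift_gen by auto
    have "free_lift R P b x = \<zero>\<^bsub>P\<^esub>"
      using x bilinear b_closed unfolding tensor_relators_def Let_def bilinear_map_def
      by (auto simp: gen P.M.minus_eq P.M.r_neg simp del: free_module_simps)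
    then show "x \<in> lift.ker"
      using relators_subset x by (auto simp: lift.ker_def simp del: free_module_simps)
  qed
  then have "null \<subseteq> lift.ker"
    unfolding tensor_null_def by (intro F.span_is_subset lift.ker_is_submodule)
  then show "x \<in> null \<Longrightarrow> ?thesis" by (auto simp: lift.ker_def)
qed

abbreviation "tlift \<equiv> tensor_lift R P b"

lemma tensor_lift_coset:
  assumes f: "f \<in> carrier F"
  shows "tlift (null +>\<^bsub>F\<^esub> f) = free_lift R P b f"
proof -
  have "free_lift R P b g = free_lift R P b f" if g: "g \<in> null +>\<^bsub>F\<^esub> f" for g
  proof -
    obtain x where x: "x \<in> null" "g = x \<oplus>\<^bsub>F\<^esub> f"
      using g by (auto simp: a_r_coset_def' simp del: free_module_simps)
    then have "x \<in> carrier F" using null_subset by blast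
    then show ?thesis using x f free_lift_null[OF x(1)] by (simp del: free_module_simps)
  qed
  then have "free_lift R P b ` (null +>\<^bsub>F\<^esub> f) = (\<lambda>_. free_lift R P b f) ` (null +>\<^bsub>F\<^esub> f)"
    by (intro image_cong refl)
  then have "free_lift R P b ` (null +>\<^bsub>F\<^esub> f) = {free_lift R P b f}"
    using N.a_rcos_self[OF f] by (simp only: image_constant)
  then show ?thesis unfolding tensor_lift_def free_lift_def[symmetric] by simp
qed

lemma tensor_lift_pure: "\<lbrakk>v \<in> carrier V; w \<in> carrier W\<rbrakk> \<Longrightarrow> tlift (pure v w) = b v w"
  unfolding pure_tensor_def by (simp only: tensor_lift_coset free_gen_closed free_lift_gen)

lemma tensor_lift_closed [intro]: "t \<in> carrier T \<Longrightarrow> tlift t \<in> carrier P"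
  by (elim tensor_carrierE) (simp add: tensor_lift_coset del: free_module_simps)

lemma tensor_lift_add:
  "\<lbrakk>s \<in> carrier T; t \<in> carrier T\<rbrakk> \<Longrightarrow> tlift (s \<oplus>\<^bsub>T\<^esub> t) = tlift s \<oplus>\<^bsub>P\<^esub> tlift t"
  by (elim tensor_carrierE)
    (simp only: tensor_lift_coset coset_add lift.f_add F.add.m_closed)

lemma tensor_lift_smult:
  "\<lbrakk>a \<in> carrier R; t \<in> carrier T\<rbrakk> \<Longrightarrow> tlift (a \<odot>\<^bsub>T\<^esub> t) = a \<odot>\<^bsub>P\<^esub> tlift t"
  by (elim tensor_carrierE)
    (simp only: tensor_lift_coset coset_smult lift.f_smult F.smult_closed)

end

section \<open>Spaces of equivariant functions\<close>

lemma (in abelian_monoid) finsum_swap: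
  assumes "finite A" "finite B" "\<And>a b. \<lbrakk>a \<in> A; b \<in> B\<rbrakk> \<Longrightarrow> f a b \<in> carrier G"
  shows "(\<Oplus>a\<in>A. \<Oplus>b\<in>B. f a b) = (\<Oplus>b\<in>B. \<Oplus>a\<in>A. f a b)"
  using assms(1,3)
proof (induction A rule: finite_induct)
  case empty
  then show ?case by (simp add: add.finprod_one)
next
  case (insert a A)
  then show ?case
    by (simp add: Pi_def finsum_addf[symmetric] del: finsum_addf cong: finsum_cong)
qed

lemma (in abelian_monoid) finsum_delta:
  assumes "finite A" "a \<in> A" "f a \<in> carrier G"
  shows "(\<Oplus>b\<in>A. if b = a then f b else \<zero>) = f a"
proof -
  have "(\<Oplus>b\<in>A. if b = a then f b else \<zero>) = (\<Oplus>b\<in>{a}. f b)"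
    by (rule add.finprod_mono_neutral_cong_right) (use assms in auto)
  then show ?thesis using assms by simp
qed

text \<open>A finite form of the Stone-Weierstrass theorem: a separating algebra of functions on S
  that contains the constants is everything. \<open>cong\<close> makes Q insensitive to values
  outside S, since the functions are total.\<close>

locale function_subalgebra = field M for M (structure) +
  fixes S :: "'s set" and Q :: "('s \<Rightarrow> 'a) \<Rightarrow> bool"
  assumes finite_S: "finite S"
    and closed: "\<lbrakk>Q x; s \<in> S\<rbrakk> \<Longrightarrow> x s \<in> carrier M"
    and const: "a \<in> carrier M \<Longrightarrow> Q (\<lambda>s. a)"
    and add: "\<lbrakk>Q x; Q y\<rbrakk> \<Longrightarrow> Q (\<lambda>s. x s \<oplus> y s)"
    and mult: "\<lbrakk>Q x; Q y\<rbrakk> \<Longrightarrow> Q (\<lambda>s. x s \<otimes> y s)"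
    and cong: "\<lbrakk>Q x; \<And>s. s \<in> S \<Longrightarrow> x s = y s\<rbrakk> \<Longrightarrow> Q y"
    and separate: "\<lbrakk>s \<in> S; s' \<in> S; s \<noteq> s'\<rbrakk> \<Longrightarrow> \<exists>x. Q x \<and> x s \<noteq> x s'"
begin

text \<open>Take the affine function (y - y s') / (y s - y s') of a separating y.\<close>

lemma separate_normalised:
  assumes s: "s \<in> S" "s' \<in> S" "s \<noteq> s'"
  shows "\<exists>x. Q x \<and> x s = \<one> \<and> x s' = \<zero>"
proof -
  obtain y where y: "Q y" "y s \<noteq> y s'" using separate s by blast
  define d where "d = y s \<ominus> y s'"
  have c: "y s \<in> carrier M" "y s' \<in> carrier M" using closed y s by auto
  then have "d \<in> carrier M" "d \<noteq> \<zero>" using y(2) unfolding d_def by auto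
  then have d: "inv d \<in> carrier M" "inv d \<otimes> d = \<one>" using field_Units by auto
  have "Q (\<lambda>t. inv d \<otimes> (y t \<oplus> \<ominus> y s'))"
    using c d y by (intro mult add const) auto
  moreover have "inv d \<otimes> (y s \<oplus> \<ominus> y s') = \<one>" using d(2) by (simp add: d_def a_minus_def)
  moreover have "inv d \<otimes> (y s' \<oplus> \<ominus> y s') = \<zero>" using d c by (simp add: r_neg)
  ultimately show ?thesis by blast
qed

text \<open>A product of normalised separating functions, one for each point of S other than s; the
  induction adds the points at which the product vanishes one by one.\<close>

lemma delta:
  assumes s: "s \<in> S"
  shows "Q (\<lambda>t. if t = s then \<one> else \<zero>)"
proof -
  have "\<exists>x. Q x \<and> x s = \<one> \<and> (\<forall>t\<in>A. x t = \<zero>)" if "A \<subseteq> S - {s}" for A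
    using finite_subset[OF that finite_Diff[OF finite_S]] that
  proof (induction A rule: finite_induct)
    case empty
    then show ?case using const[of \<one>] by auto
  next
    case (insert a A)
    then obtain x where x: "Q x" "x s = \<one>" "\<forall>t\<in>A. x t = \<zero>" by auto
    obtain y where y: "Q y" "y s = \<one>" "y a = \<zero>"
      using separate_normalised[of s a] s insert by auto
    have c: "x t \<in> carrier M" "y t \<in> carrier M" if "t \<in> insert a A" for t
      using closed[OF x(1)] closed[OF y(1)] insert.prems that by auto
    show ?case
      by (rule exI[of _ "\<lambda>t. x t \<otimes> y t"]) (use x y c mult[OF x(1) y(1)] in auto)
  qed
  from this[OF subset_refl] obtain x where x: "Q x \<and> x s = \<one> \<and> (\<forall>t\<in>S - {s}. x t = \<zero>)"
    by (rule exE)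
  show ?thesis by (rule cong[of x]) (use x in auto)
qed

lemma all_functions:
  assumes x: "\<And>s. s \<in> S \<Longrightarrow> x s \<in> carrier M"
  shows "Q x"
proof -
  have "Q (\<lambda>t. if t \<in> A then x t else \<zero>)" if "A \<subseteq> S" for A
    using finite_subset[OF that finite_S] that
  proof (induction A rule: finite_induct)
    case empty
    then show ?case using const[of \<zero>] by simp
  next
    case (insert a A)
    have "Q (\<lambda>t. (if t \<in> A then x t else \<zero>) \<oplus> x a \<otimes> (if t = a then \<one> else \<zero>))"
      using insert x by (intro add mult const delta insert.IH) auto
    then show ?case by (rule cong) (use insert x in auto)
  qed
  from this[OF subset_refl] show ?thesis by (rule cong) simp
qed

end

text \<open>The M-span of \<Phi> among functions on S; values outside S are left free. Multiples are
  built into \<open>mspan_base\<close>. Zero arises only as a zero multiple of a generator, so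
  nothing lies in the span of an empty \<Phi>.\<close>

inductive mspan :: "('a, 'b) ring_scheme \<Rightarrow> 's set \<Rightarrow> ('s \<Rightarrow> 'a) set \<Rightarrow> ('s \<Rightarrow> 'a) \<Rightarrow> bool"
  for M and S and \<Phi> where
  mspan_base: "\<lbrakk>f \<in> \<Phi>; m \<in> carrier M; \<And>s. s \<in> S \<Longrightarrow> x s = m \<otimes>\<^bsub>M\<^esub> f s\<rbrakk> \<Longrightarrow> mspan M S \<Phi> x"
| mspan_add: "\<lbrakk>mspan M S \<Phi> x; mspan M S \<Phi> y; \<And>s. s \<in> S \<Longrightarrow> z s = x s \<oplus>\<^bsub>M\<^esub> y s\<rbrakk>
    \<Longrightarrow> mspan M S \<Phi> z"

lemma mspan_cong:
  assumes "mspan M S \<Phi> x" "\<And>s. s \<in> S \<Longrightarrow> x s = y s"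
  shows "mspan M S \<Phi> y"
  using assms
proof (induction x arbitrary: y rule: mspan.induct)
  case (mspan_base f m x)
  then show ?case by (intro mspan.mspan_base[of f \<Phi> m]) auto
next
  case (mspan_add x x' z)
  show ?case by (rule mspan.mspan_add[OF mspan_add(1,2)]) (use mspan_add in auto)
qed

context field
begin

lemma mspan_closed:
  assumes "mspan R S \<Phi> x" "\<And>f s. \<lbrakk>f \<in> \<Phi>; s \<in> S\<rbrakk> \<Longrightarrow> f s \<in> carrier R" "s \<in> S"
  shows "x s \<in> carrier R"
  using assms by (induction x rule: mspan.induct) auto

lemma mspan_smult:
  assumes "mspan R S \<Phi> x" "\<And>f s. \<lbrakk>f \<in> \<Phi>; s \<in> S\<rbrakk> \<Longrightarrow> f s \<in> carrier R" "a \<in> carrier R"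
  shows "mspan R S \<Phi> (\<lambda>s. a \<otimes> x s)"
  using assms
proof (induction x rule: mspan.induct)
  case (mspan_base f m x)
  then show ?case by (intro mspan.mspan_base[of f \<Phi> "a \<otimes> m"]) (auto simp: m_assoc)
next
  case (mspan_add x y z)
  have c: "x s \<in> carrier R" "y s \<in> carrier R" if "s \<in> S" for s
    using mspan_closed[of S \<Phi> x s] mspan_closed[of S \<Phi> y s] mspan_add that by auto
  have "mspan R S \<Phi> (\<lambda>s. a \<otimes> x s)" "mspan R S \<Phi> (\<lambda>s. a \<otimes> y s)" using mspan_add by auto
  then show ?case
    by (rule mspan.mspan_add) (use mspan_add c in \<open>auto simp: r_distr\<close>)
qed

text \<open>The index set has to be nonempty, since the rules of \<open>mspan\<close> provide no
  empty sum.\<close>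

lemma mspan_sum:
  assumes A: "finite A" "A \<noteq> {}" and x: "\<And>a. a \<in> A \<Longrightarrow> mspan R S \<Phi> (x a)"
    and c: "\<And>f s. \<lbrakk>f \<in> \<Phi>; s \<in> S\<rbrakk> \<Longrightarrow> f s \<in> carrier R"
  shows "mspan R S \<Phi> (\<lambda>s. \<Oplus>a\<in>A. x a s)"
  using A x
proof (induction A rule: finite_ne_induct)
  case (singleton a)
  then have "x a s \<in> carrier R" if "s \<in> S" for s using mspan_closed[of S \<Phi> "x a" s] c that by auto
  then show ?case by (intro mspan_cong[OF singleton]) auto
next
  case (insert a A)
  have "x b s \<in> carrier R" if "s \<in> S" "b \<in> insert a A" for s b
    using mspan_closed[of S \<Phi> "x b" s] insert(5) c that by auto
  then have eq: "(\<Oplus>b\<in>insert a A. x b s) = x a s \<oplus> (\<Oplus>b\<in>A. x b s)" if "s \<in> S" for s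
    using insert(1,3) that by (intro finsum_insert) auto
  have a: "mspan R S \<Phi> (x a)" by (rule insert(5)) simp
  have sum: "mspan R S \<Phi> (\<lambda>s. \<Oplus>b\<in>A. x b s)" by (rule insert(4)) (simp add: insert(5))
  show ?case by (rule mspan_add[OF a sum eq])
qed

end

text \<open>G is only a set of ring endomorphisms whose common fixed elements form K. It may be
  empty, in which case K is all of M; that instance later puts the group algebra over M into the
  same framework.\<close>

locale descent = field M for M (structure) +
  fixes K :: "'a set" and G :: "('a \<Rightarrow> 'a) set"
  assumes subfield_K: "subfield K M"
    and hom: "\<tau> \<in> G \<Longrightarrow> \<tau> \<in> Ring.ring_hom M M"
    and fixed: "\<lbrakk>x \<in> carrier M; \<And>\<tau>. \<tau> \<in> G \<Longrightarrow> \<tau> x = x\<rbrakk> \<Longrightarrow> x \<in> K"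
    and fix_K: "\<lbrakk>\<tau> \<in> G; x \<in> K\<rbrakk> \<Longrightarrow> \<tau> x = x"
begin

abbreviation "R \<equiv> M\<lparr>carrier := K\<rparr>"

lemma K_subset: "K \<subseteq> carrier M"
  using subfield_K subfieldE(3) by blast

lemma K_closed [simp, intro]: "k \<in> K \<Longrightarrow> k \<in> carrier M"
  using K_subset by blast

lemma field_R: "field R"
  using subfield_iff(2) subfield_K by blast

lemma hom_ring: "\<tau> \<in> G \<Longrightarrow> ring_hom_cring M M \<tau>"
  using hom by (intro ring_hom_cringI cring_axioms) auto

lemma hom_finsum:
  "\<lbrakk>\<tau> \<in> G; \<And>a. a \<in> A \<Longrightarrow> f a \<in> carrier M\<rbrakk> \<Longrightarrow> \<tau> (\<Oplus>a\<in>A. f a) = (\<Oplus>a\<in>A. \<tau> (f a))"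
  using ring_hom_cring.hom_finsum[OF hom_ring, of \<tau> f A] by (simp add: Pi_def o_def)

lemma hom_simps [simp]:
  "\<lbrakk>\<tau> \<in> G; x \<in> carrier M\<rbrakk> \<Longrightarrow> \<tau> x \<in> carrier M"
  "\<lbrakk>\<tau> \<in> G; x \<in> carrier M; y \<in> carrier M\<rbrakk> \<Longrightarrow> \<tau> (x \<otimes> y) = \<tau> x \<otimes> \<tau> y"
  "\<lbrakk>\<tau> \<in> G; x \<in> carrier M; y \<in> carrier M\<rbrakk> \<Longrightarrow> \<tau> (x \<oplus> y) = \<tau> x \<oplus> \<tau> y"
  "\<tau> \<in> G \<Longrightarrow> \<tau> \<one> = \<one>"
  "\<tau> \<in> G \<Longrightarrow> \<tau> \<zero> = \<zero>"
  by (rule ring_hom_closed[OF hom] ring_hom_mult[OF hom] ring_hom_add[OF hom] ring_hom_one[OF hom]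
    ring_hom_cring.hom_zero[OF hom_ring]; assumption)+

lemma module_self: "Module.module R (self_algebra M)"
proof (rule Module.moduleI)
  show "cring R" using field_R by (rule fieldE)
  show "abelian_group (self_algebra M)"
  proof (rule abelian_groupI)
    fix x assume "x \<in> carrier (self_algebra M)"
    then show "\<exists>y\<in>carrier (self_algebra M). y \<oplus>\<^bsub>self_algebra M\<^esub> x = \<zero>\<^bsub>self_algebra M\<^esub>"
      by (intro bexI[of _ "\<ominus> x"]) (auto simp: self_algebra_def l_neg)
  qed (auto simp: self_algebra_def a_ac)
qed (auto simp: self_algebra_def l_distr r_distr m_assoc)

end

text \<open>V is a K-form of the space of all functions from S to M: \<iota> embeds it as
  equivariant functions whose M-span is everything. That V contains every equivariant function is
  not assumed but derived in \<open>descend\<close>.\<close>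

locale form = descent M K G + V: Module.module "M\<lparr>carrier := K\<rparr>" V
  for M :: "('a, 'b) ring_scheme" (structure) and K G
    and V :: "('a, 'v, 'x) module_scheme" +
  fixes S :: "'s set" and act :: "('a \<Rightarrow> 'a) \<Rightarrow> 's \<Rightarrow> 's" and \<iota> :: "'v \<Rightarrow> 's \<Rightarrow> 'a"
  assumes finite_S [simp]: "finite S"
    and act_image: "\<tau> \<in> G \<Longrightarrow> act \<tau> ` S = S"
    and \<iota>_closed [simp]: "\<lbrakk>v \<in> carrier V; s \<in> S\<rbrakk> \<Longrightarrow> \<iota> v s \<in> carrier M"
    and \<iota>_add: "\<lbrakk>v \<in> carrier V; w \<in> carrier V; s \<in> S\<rbrakk> \<Longrightarrow> \<iota> (v \<oplus>\<^bsub>V\<^esub> w) s = \<iota> v s \<oplus> \<iota> w s"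
    and \<iota>_smult: "\<lbrakk>k \<in> K; v \<in> carrier V; s \<in> S\<rbrakk> \<Longrightarrow> \<iota> (k \<odot>\<^bsub>V\<^esub> v) s = k \<otimes> \<iota> v s"
    and \<iota>_equivariant: "\<lbrakk>\<tau> \<in> G; v \<in> carrier V; s \<in> S\<rbrakk> \<Longrightarrow> \<iota> v (act \<tau> s) = \<tau> (\<iota> v s)"
    and \<iota>_inj0: "\<lbrakk>v \<in> carrier V; \<And>s. s \<in> S \<Longrightarrow> \<iota> v s = \<zero>\<rbrakk> \<Longrightarrow> v = \<zero>\<^bsub>V\<^esub>"
    and span: "(\<And>s. s \<in> S \<Longrightarrow> x s \<in> carrier M) \<Longrightarrow> mspan M S (\<iota> ` carrier V) x"
begin

lemma act_closed: "\<lbrakk>\<tau> \<in> G; s \<in> S\<rbrakk> \<Longrightarrow> act \<tau> s \<in> S"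
  using act_image by blast

lemma \<iota>_zero: "s \<in> S \<Longrightarrow> \<iota> \<zero>\<^bsub>V\<^esub> s = \<zero>"
  using \<iota>_add[of "\<zero>\<^bsub>V\<^esub>" "\<zero>\<^bsub>V\<^esub>" s] \<iota>_closed[of "\<zero>\<^bsub>V\<^esub>" s] by simp

lemma \<iota>_inj:
  assumes v: "v \<in> carrier V" "w \<in> carrier V" and eq: "\<And>s. s \<in> S \<Longrightarrow> \<iota> v s = \<iota> w s"
  shows "v = w"
proof -
  have "\<iota> (\<ominus>\<^bsub>V\<^esub> w) s = \<ominus> \<iota> w s" if "s \<in> S" for s
    using \<iota>_add[of w "\<ominus>\<^bsub>V\<^esub> w" s] v that \<iota>_zero[OF that]
    by (simp add: V.M.r_neg) (metis V.M.a_inv_closed \<iota>_closed a_comm minus_equality)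
  then have "\<iota> (v \<ominus>\<^bsub>V\<^esub> w) s = \<zero>" if "s \<in> S" for s
    using that v eq[OF that] by (simp add: V.M.minus_eq \<iota>_add r_neg)
  then show ?thesis using \<iota>_inj0[of "v \<ominus>\<^bsub>V\<^esub> w"] v by simp
qed

lemma \<iota>_finsum:
  assumes "\<And>a. a \<in> A \<Longrightarrow> f a \<in> carrier V" "s \<in> S"
  shows "\<iota> (\<Oplus>\<^bsub>V\<^esub>a\<in>A. f a) s = (\<Oplus>a\<in>A. \<iota> (f a) s)"
  using assms
  by (induction A rule: infinite_finite_induct) (simp_all add: \<iota>_zero \<iota>_add Pi_def)

text \<open>Here and in \<open>lin_free\<close> the coefficients come from M, although the vectors
  lie in the K-space V.\<close>

definition spanning :: "'v set \<Rightarrow> bool" where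
  "spanning B \<longleftrightarrow> finite B \<and> B \<subseteq> carrier V \<and>
     (\<forall>x. (\<forall>s\<in>S. x s \<in> carrier M) \<longrightarrow>
       (\<exists>m. (\<forall>b\<in>B. m b \<in> carrier M) \<and> (\<forall>s\<in>S. x s = (\<Oplus>b\<in>B. m b \<otimes> \<iota> b s))))"

lemma combination_superset:
  assumes B: "finite B" "B \<subseteq> C" "finite C" "C \<subseteq> carrier V" and m: "\<forall>b\<in>B. m b \<in> carrier M"
  shows "\<exists>m'. (\<forall>b\<in>C. m' b \<in> carrier M) \<and>
    (\<forall>s\<in>S. (\<Oplus>b\<in>B. m b \<otimes> \<iota> b s) = (\<Oplus>b\<in>C. m' b \<otimes> \<iota> b s))"
proof (intro exI[of _ "\<lambda>b. if b \<in> B then m b else \<zero>"] conjI ballI)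
  fix s assume s: "s \<in> S"
  show "(\<Oplus>b\<in>B. m b \<otimes> \<iota> b s) = (\<Oplus>b\<in>C. (if b \<in> B then m b else \<zero>) \<otimes> \<iota> b s)"
    by (rule add.finprod_mono_neutral_cong_left) (use s B m in \<open>auto simp: subset_iff\<close>)
qed (use m in auto)

lemma mspan_combination:
  assumes "mspan M S (\<iota> ` carrier V) x"
  shows "\<exists>B m. finite B \<and> B \<subseteq> carrier V \<and> (\<forall>b\<in>B. m b \<in> carrier M) \<and>
    (\<forall>s\<in>S. x s = (\<Oplus>b\<in>B. m b \<otimes> \<iota> b s))"
  using assms
proof (induction x rule: mspan.induct)
  case (mspan_base f m x)
  then obtain v where "v \<in> carrier V" "f = \<iota> v" by auto
  then show ?case
    using mspan_base by (intro exI[of _ "{v}"] exI[of _ "\<lambda>_. m"]) auto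
next
  case (mspan_add x y z)
  obtain B m where B: "finite B" "B \<subseteq> carrier V" "\<forall>b\<in>B. m b \<in> carrier M"
    "\<forall>s\<in>S. x s = (\<Oplus>b\<in>B. m b \<otimes> \<iota> b s)" using mspan_add.IH(1) by (elim exE conjE)
  obtain C n where C: "finite C" "C \<subseteq> carrier V" "\<forall>b\<in>C. n b \<in> carrier M"
    "\<forall>s\<in>S. y s = (\<Oplus>b\<in>C. n b \<otimes> \<iota> b s)" using mspan_add.IH(2) by (elim exE conjE)
  obtain m' where m': "\<forall>b\<in>B \<union> C. m' b \<in> carrier M"
    "\<forall>s\<in>S. (\<Oplus>b\<in>B. m b \<otimes> \<iota> b s) = (\<Oplus>b\<in>B \<union> C. m' b \<otimes> \<iota> b s)"
    using combination_superset[of B "B \<union> C" m] B C by auto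
  obtain n' where n': "\<forall>b\<in>B \<union> C. n' b \<in> carrier M"
    "\<forall>s\<in>S. (\<Oplus>b\<in>C. n b \<otimes> \<iota> b s) = (\<Oplus>b\<in>B \<union> C. n' b \<otimes> \<iota> b s)"
    using combination_superset[of C "B \<union> C" n] B C by auto
  have cl: "b \<in> carrier V" if "b \<in> B \<union> C" for b using B C that by auto
  have "z s = (\<Oplus>b\<in>B \<union> C. (m' b \<oplus> n' b) \<otimes> \<iota> b s)" if s: "s \<in> S" for s
  proof -
    have "(\<Oplus>b\<in>B \<union> C. (m' b \<oplus> n' b) \<otimes> \<iota> b s) =
        (\<Oplus>b\<in>B \<union> C. m' b \<otimes> \<iota> b s \<oplus> n' b \<otimes> \<iota> b s)"
      using m' n' cl s by (intro finsum_cong') (auto simp: l_distr)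
    also have "\<dots> = (\<Oplus>b\<in>B \<union> C. m' b \<otimes> \<iota> b s) \<oplus> (\<Oplus>b\<in>B \<union> C. n' b \<otimes> \<iota> b s)"
      using m' n' cl s by (intro finsum_addf) (auto simp: Pi_def)
    finally show ?thesis using mspan_add(3) s B C m' n' by simp
  qed
  then show ?case
    using B C m' n' by (intro exI[of _ "B \<union> C"] exI[of _ "\<lambda>b. m' b \<oplus> n' b"]) auto
qed

text \<open>The indicator function of a point involves finitely many vectors, and S is finite, so
  the union of these sets of vectors spans.\<close>

lemma ex_spanning: "\<exists>B. spanning B"
proof -
  \<comment> \<open>A finite set and its coefficients are packed into one pair, so that
    \<open>choice\<close> selects both at once.\<close>
  define P where "P t q \<longleftrightarrow> finite (fst q) \<and> fst q \<subseteq> carrier V \<and> (\<forall>b\<in>fst q. snd q b \<in> carrier M) \<and>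
      (\<forall>s\<in>S. (if s = t then \<one> else \<zero>) = (\<Oplus>b\<in>fst q. snd q b \<otimes> \<iota> b s))" for t q
  have "\<exists>q. P t q" for t
  proof -
    have "mspan M S (\<iota> ` carrier V) (\<lambda>s. if s = t then \<one> else \<zero>)"
      by (rule span) auto
    from mspan_combination[OF this]
    obtain B m where "finite B \<and> B \<subseteq> carrier V \<and> (\<forall>b\<in>B. m b \<in> carrier M) \<and>
      (\<forall>s\<in>S. (if s = t then \<one> else \<zero>) = (\<Oplus>b\<in>B. m b \<otimes> \<iota> b s))"
      by (elim exE)
    then show ?thesis unfolding P_def by (intro exI[of _ "(B, m)"]) simp
  qed
  then obtain q where q: "\<forall>t. P t (q t)" using choice[of P] by auto
  define B m where "B t = fst (q t)" and "m t = snd (q t)" for t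
  have B: "finite (B t)" "B t \<subseteq> carrier V" "b \<in> B t \<Longrightarrow> m t b \<in> carrier M"
    "s \<in> S \<Longrightarrow> (if s = t then \<one> else \<zero>) = (\<Oplus>b\<in>B t. m t b \<otimes> \<iota> b s)" for t b s
    using q unfolding P_def B_def m_def by auto
  define C where "C = \<Union> (B ` S)"
  have C: "finite C" "C \<subseteq> carrier V" "\<And>t. t \<in> S \<Longrightarrow> B t \<subseteq> C"
    using B unfolding C_def by auto
  define P' where "P' t m' \<longleftrightarrow> (\<forall>b\<in>C. m' b \<in> carrier M) \<and>
      (\<forall>s\<in>S. (if s = t then \<one> else \<zero>) = (\<Oplus>b\<in>C. m' b \<otimes> \<iota> b s))" for t m'
  have "\<exists>m'. t \<in> S \<longrightarrow> P' t m'" for t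
    unfolding P'_def using combination_superset[of "B t" C "m t"] B C by (cases "t \<in> S") auto
  then obtain m' where "\<forall>t. t \<in> S \<longrightarrow> P' t (m' t)"
    using choice[of "\<lambda>t m'. t \<in> S \<longrightarrow> P' t m'"] by auto
  then have m': "\<lbrakk>t \<in> S; b \<in> C\<rbrakk> \<Longrightarrow> m' t b \<in> carrier M"
    "\<lbrakk>t \<in> S; s \<in> S\<rbrakk> \<Longrightarrow> (if s = t then \<one> else \<zero>) = (\<Oplus>b\<in>C. m' t b \<otimes> \<iota> b s)" for t b s
    unfolding P'_def by auto
  have "spanning C"
    unfolding spanning_def
  proof (intro conjI C allI impI)
    fix x assume x: "\<forall>s\<in>S. x s \<in> carrier M"
    have i: "\<iota> b s \<in> carrier M" if "b \<in> C" "s \<in> S" for b s using that C by auto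
    have "x s = (\<Oplus>b\<in>C. (\<Oplus>t\<in>S. x t \<otimes> m' t b) \<otimes> \<iota> b s)" if s: "s \<in> S" for s
    proof -
      have "x s = (\<Oplus>t\<in>S. if t = s then x t else \<zero>)"
        using s x by (intro finsum_delta[symmetric]) auto
      also have "\<dots> = (\<Oplus>t\<in>S. x t \<otimes> (\<Oplus>b\<in>C. m' t b \<otimes> \<iota> b s))"
        using s x by (intro finsum_cong') (auto simp flip: m'(2))
      also have "\<dots> = (\<Oplus>t\<in>S. \<Oplus>b\<in>C. x t \<otimes> m' t b \<otimes> \<iota> b s)"
        using s x m'(1) C i
        by (intro finsum_cong') (auto simp: finsum_rdistr m_assoc Pi_def intro!: finsum_cong')
      also have "\<dots> = (\<Oplus>b\<in>C. \<Oplus>t\<in>S. x t \<otimes> m' t b \<otimes> \<iota> b s)"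
        using s x m'(1) C i by (intro finsum_swap) auto
      also have "\<dots> = (\<Oplus>b\<in>C. (\<Oplus>t\<in>S. x t \<otimes> m' t b) \<otimes> \<iota> b s)"
        by (intro finsum_cong' refl funcsetI m_closed finsum_closed finsum_ldistr[symmetric])
          (use s x m'(1) C i in auto)
      finally show ?thesis .
    qed
    then have "\<forall>s\<in>S. x s = (\<Oplus>b\<in>C. (\<Oplus>t\<in>S. x t \<otimes> m' t b) \<otimes> \<iota> b s)" by (rule ballI)
    moreover have "\<forall>b\<in>C. (\<Oplus>t\<in>S. x t \<otimes> m' t b) \<in> carrier M"
      using x m'(1) by (intro ballI finsum_closed funcsetI m_closed) simp_all
    ultimately show "\<exists>m. (\<forall>b\<in>C. m b \<in> carrier M) \<and> (\<forall>s\<in>S. x s = (\<Oplus>b\<in>C. m b \<otimes> \<iota> b s))"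
      by (intro exI[of _ "\<lambda>b. \<Oplus>t\<in>S. x t \<otimes> m' t b"] conjI)
  qed
  then show ?thesis by blast
qed

definition lin_free :: "'v set \<Rightarrow> bool" where
  "lin_free B \<longleftrightarrow> (\<forall>m. (\<forall>b\<in>B. m b \<in> carrier M) \<and> (\<forall>s\<in>S. (\<Oplus>b\<in>B. m b \<otimes> \<iota> b s) = \<zero>) \<longrightarrow>
     (\<forall>b\<in>B. m b = \<zero>))"

text \<open>A spanning set of minimal size is independent.\<close>

lemma ex_basis: "\<exists>B. spanning B \<and> lin_free B"
proof -
  obtain B where B: "spanning B" "\<And>C. spanning C \<Longrightarrow> card B \<le> card C"
    using ex_has_least_nat[of spanning _ card] ex_spanning by metis
  have fin: "finite B" "B \<subseteq> carrier V" using B(1) unfolding spanning_def by auto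
  have "lin_free B"
    unfolding lin_free_def
  proof (intro allI impI ballI, elim conjE, rule ccontr)
    fix m c assume m: "\<forall>b\<in>B. m b \<in> carrier M" "\<forall>s\<in>S. (\<Oplus>b\<in>B. m b \<otimes> \<iota> b s) = \<zero>"
      and c: "c \<in> B" "m c \<noteq> \<zero>"
    have i: "\<iota> b s \<in> carrier M" if "b \<in> B" "s \<in> S" for b s using that fin by auto
    have u: "inv (m c) \<in> carrier M" "inv (m c) \<otimes> m c = \<one>" using m c field_Units by auto
    have "spanning (B - {c})"
      unfolding spanning_def
    proof (intro conjI allI impI)
      fix x assume "\<forall>s\<in>S. x s \<in> carrier M"
      then obtain n where n: "\<forall>b\<in>B. n b \<in> carrier M" "\<forall>s\<in>S. x s = (\<Oplus>b\<in>B. n b \<otimes> \<iota> b s)"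
        using B(1) unfolding spanning_def by blast
      \<comment> \<open>Adding e times the relation \<open>m\<close> to the expansion
        \<open>n\<close> removes the coefficient of c, since e m(c) = - n(c).\<close>
      define e where "e = \<ominus> (n c \<otimes> inv (m c))"
      have e: "e \<in> carrier M" using n u c by (simp add: e_def)
      define n' where "n' b = n b \<oplus> e \<otimes> m b" for b
      have n': "n' b \<in> carrier M" if "b \<in> B" for b using that n m e by (simp add: n'_def)
      have "e \<otimes> m c = \<ominus> n c"
        using u n m c by (simp add: e_def l_minus m_assoc)
      then have n'c: "n' c = \<zero>" using n c by (simp add: n'_def r_neg)
      have "x s = (\<Oplus>b\<in>B - {c}. n' b \<otimes> \<iota> b s)" if s: "s \<in> S" for s
      proof -
        have "x s = (\<Oplus>b\<in>B. n b \<otimes> \<iota> b s) \<oplus> e \<otimes> (\<Oplus>b\<in>B. m b \<otimes> \<iota> b s)"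
          using n m s e i by (simp add: Pi_def)
        also have "\<dots> = (\<Oplus>b\<in>B. n b \<otimes> \<iota> b s \<oplus> e \<otimes> (m b \<otimes> \<iota> b s))"
          using n m s e i fin by (subst finsum_rdistr) (auto simp: Pi_def finsum_addf)
        also have "\<dots> = (\<Oplus>b\<in>B. n' b \<otimes> \<iota> b s)"
          using n m s e i by (intro finsum_cong') (auto simp: n'_def l_distr m_assoc)
        also have "\<dots> = (\<Oplus>b\<in>B - {c}. n' b \<otimes> \<iota> b s)"
          by (rule add.finprod_mono_neutral_cong_right) (use fin n' i s n'c c in auto)
        finally show ?thesis .
      qed
      then show "\<exists>m. (\<forall>b\<in>B - {c}. m b \<in> carrier M) \<and> (\<forall>s\<in>S. x s = (\<Oplus>b\<in>B - {c}. m b \<otimes> \<iota> b s))"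
        using n' by (intro exI[of _ n']) auto
    qed (use fin in auto)
    then show False using B(2)[of "B - {c}"] card_Diff1_less[OF fin(1) c(1)] by simp
  qed
  then show ?thesis using B by blast
qed

text \<open>The heart of descent. Applying \<tau> to the expansion of x at t gives an expansion of x
  at act \<tau> t with the coefficients \<tau>(m b). As act \<tau> is onto, this is a second
  expansion of x on all of S. Independence forces \<tau>(m b) = m b, and \<open>fixed\<close> puts m
  b into K.\<close>

lemma invariant_coefficients:
  assumes B: "spanning B" "lin_free B"
    and x: "\<And>s. s \<in> S \<Longrightarrow> x s \<in> carrier M"
    and eqv: "\<And>\<tau> s. \<lbrakk>\<tau> \<in> G; s \<in> S\<rbrakk> \<Longrightarrow> x (act \<tau> s) = \<tau> (x s)"
  obtains k where "\<And>b. b \<in> B \<Longrightarrow> k b \<in> K" "\<And>s. s \<in> S \<Longrightarrow> x s = (\<Oplus>b\<in>B. k b \<otimes> \<iota> b s)"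
proof -
  have fin: "finite B" "B \<subseteq> carrier V" using B(1) unfolding spanning_def by auto
  obtain m where m: "\<forall>b\<in>B. m b \<in> carrier M" "\<forall>s\<in>S. x s = (\<Oplus>b\<in>B. m b \<otimes> \<iota> b s)"
    using B(1) x unfolding spanning_def by blast
  have i: "\<iota> b s \<in> carrier M" if "b \<in> B" "s \<in> S" for b s using that fin by auto
  have "\<tau> (m b) = m b" if \<tau>: "\<tau> \<in> G" and b: "b \<in> B" for \<tau> b
  proof -
    have "(\<Oplus>b\<in>B. (\<tau> (m b) \<oplus> \<ominus> m b) \<otimes> \<iota> b s) = \<zero>" if "s \<in> S" for s
    proof -
      obtain t where t: "t \<in> S" "s = act \<tau> t" using act_image[OF \<tau>] \<open>s \<in> S\<close> by blast
      have st: "act \<tau> t \<in> S" using t \<open>s \<in> S\<close> by simp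
      have i': "\<iota> b s = \<tau> (\<iota> b t)" if "b \<in> B" for b
        using \<iota>_equivariant \<tau> t that fin by auto
      have "\<tau> (x t) = (\<Oplus>b\<in>B. \<tau> (m b) \<otimes> \<iota> b s)"
      proof -
        have "\<tau> (x t) = (\<Oplus>b\<in>B. \<tau> (m b \<otimes> \<iota> b t))"
          using m t \<tau> i by (simp add: hom_finsum)
        also have "\<dots> = (\<Oplus>b\<in>B. \<tau> (m b) \<otimes> \<iota> b s)"
          using m t \<tau> i i' by (intro finsum_cong') auto
        finally show ?thesis .
      qed
      moreover have "x s = (\<Oplus>b\<in>B. m b \<otimes> \<iota> b s)" using m \<open>s \<in> S\<close> by simp
      moreover have "x s = \<tau> (x t)" using eqv[OF \<tau> t(1)] t by simp
      ultimately have eq: "(\<Oplus>b\<in>B. \<tau> (m b) \<otimes> \<iota> b s) = (\<Oplus>b\<in>B. m b \<otimes> \<iota> b s)" by simp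
      have "(\<Oplus>b\<in>B. (\<tau> (m b) \<oplus> \<ominus> m b) \<otimes> \<iota> b s) =
          (\<Oplus>b\<in>B. \<tau> (m b) \<otimes> \<iota> b s \<oplus> \<ominus> \<one> \<otimes> (m b \<otimes> \<iota> b s))"
        using m \<tau> i \<open>s \<in> S\<close> by (intro finsum_cong') (auto simp: l_distr l_minus)
      also have "\<dots> = (\<Oplus>b\<in>B. \<tau> (m b) \<otimes> \<iota> b s) \<oplus> (\<Oplus>b\<in>B. \<ominus> \<one> \<otimes> (m b \<otimes> \<iota> b s))"
        using m \<tau> i \<open>s \<in> S\<close> by (intro finsum_addf) (auto simp: Pi_def)
      also have "(\<Oplus>b\<in>B. \<ominus> \<one> \<otimes> (m b \<otimes> \<iota> b s)) = \<ominus> \<one> \<otimes> (\<Oplus>b\<in>B. m b \<otimes> \<iota> b s)"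
        using m \<tau> i \<open>s \<in> S\<close> fin by (intro finsum_rdistr[symmetric]) (auto simp: Pi_def)
      also have "(\<Oplus>b\<in>B. \<tau> (m b) \<otimes> \<iota> b s) \<oplus> \<ominus> \<one> \<otimes> (\<Oplus>b\<in>B. m b \<otimes> \<iota> b s) = \<zero>"
        unfolding eq using m i \<open>s \<in> S\<close> by (simp add: l_minus r_neg Pi_def)
      finally show ?thesis .
    qed
    then have "\<tau> (m b) \<oplus> \<ominus> m b = \<zero>"
      using B(2)[unfolded lin_free_def, rule_format, of "\<lambda>b. \<tau> (m b) \<oplus> \<ominus> m b" b] m \<tau> b by auto
    then show ?thesis 
      using m \<tau> b r_right_minus_eq[of "\<tau> (m b)" "m b"] by (simp add: a_minus_def)
  qed
  then show ?thesis using that[of m] m fixed by blast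
qed

text \<open>This is how elements of V are produced: the comultiplication, the action and the
  preimages under the Galois map are all given first as equivariant functions.\<close>

lemma descend:
  assumes x: "\<And>s. s \<in> S \<Longrightarrow> x s \<in> carrier M"
    and eqv: "\<And>\<tau> s. \<lbrakk>\<tau> \<in> G; s \<in> S\<rbrakk> \<Longrightarrow> x (act \<tau> s) = \<tau> (x s)"
  shows "\<exists>v\<in>carrier V. \<forall>s\<in>S. \<iota> v s = x s"
proof -
  obtain B where B: "spanning B" "lin_free B" using ex_basis by blast
  then have fin: "finite B" "B \<subseteq> carrier V" unfolding spanning_def by auto
  obtain k where k: "\<And>b. b \<in> B \<Longrightarrow> k b \<in> K" "\<And>s. s \<in> S \<Longrightarrow> x s = (\<Oplus>b\<in>B. k b \<otimes> \<iota> b s)"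
    using invariant_coefficients[OF B x eqv] by blast
  have kb: "k b \<odot>\<^bsub>V\<^esub> b \<in> carrier V" if "b \<in> B" for b
    using that k fin by (intro V.smult_closed) auto
  show ?thesis
  proof (intro bexI[of _ "\<Oplus>\<^bsub>V\<^esub>b\<in>B. k b \<odot>\<^bsub>V\<^esub> b"] ballI)
    fix s assume s: "s \<in> S"
    show "\<iota> (\<Oplus>\<^bsub>V\<^esub>b\<in>B. k b \<odot>\<^bsub>V\<^esub> b) s = x s"
      using kb s k fin
      by (simp add: \<iota>_finsum) (intro finsum_cong', auto simp: \<iota>_smult)
  qed (use kb in \<open>auto intro!: V.finsum_closed\<close>)
qed

text \<open>An M-basis of all functions that lies in V is a K-basis of V.\<close>

lemma combination_basis:
  assumes B: "spanning B" "lin_free B" and v: "v \<in> carrier V"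
  obtains k where "\<And>b. b \<in> B \<Longrightarrow> k b \<in> K" "v = (\<Oplus>\<^bsub>V\<^esub>b\<in>B. k b \<odot>\<^bsub>V\<^esub> b)"
proof -
  have fin: "finite B" "B \<subseteq> carrier V" using B(1) unfolding spanning_def by auto
  obtain k where k: "\<And>b. b \<in> B \<Longrightarrow> k b \<in> K" "\<And>s. s \<in> S \<Longrightarrow> \<iota> v s = (\<Oplus>b\<in>B. k b \<otimes> \<iota> b s)"
    using invariant_coefficients[OF B, of "\<iota> v"] v \<iota>_equivariant by auto
  have kb: "k b \<odot>\<^bsub>V\<^esub> b \<in> carrier V" if "b \<in> B" for b
    using that k fin by (intro V.smult_closed) auto
  have "v = (\<Oplus>\<^bsub>V\<^esub>b\<in>B. k b \<odot>\<^bsub>V\<^esub> b)"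
  proof (rule \<iota>_inj[OF v])
    fix s assume s: "s \<in> S"
    show "\<iota> v s = \<iota> (\<Oplus>\<^bsub>V\<^esub>b\<in>B. k b \<odot>\<^bsub>V\<^esub> b) s"
      using kb s k fin
      by (simp add: \<iota>_finsum) (intro finsum_cong', auto simp: \<iota>_smult)
  qed (use kb in \<open>auto intro!: V.finsum_closed\<close>)
  then show ?thesis using that k by blast
qed

end

section \<open>The product on a tensor product of algebras\<close>

locale tensor_algebras = tensor_modules R V W
  for R :: "('k, 'm) ring_scheme" (structure)
    and V :: "('k, 'v, 'x) module_scheme" and W :: "('k, 'w, 'y) module_scheme" +
  assumes mult_V: "bilinear_map R V V V (monoid.mult V)"
    and mult_W: "bilinear_map R W W W (monoid.mult W)"
begin

lemma mult_V_simps [simp]: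
  "\<lbrakk>v \<in> carrier V; v' \<in> carrier V\<rbrakk> \<Longrightarrow> v \<otimes>\<^bsub>V\<^esub> v' \<in> carrier V"
  "\<lbrakk>v \<in> carrier V; v' \<in> carrier V; u \<in> carrier V\<rbrakk> \<Longrightarrow> (v \<oplus>\<^bsub>V\<^esub> v') \<otimes>\<^bsub>V\<^esub> u = v \<otimes>\<^bsub>V\<^esub> u \<oplus>\<^bsub>V\<^esub> v' \<otimes>\<^bsub>V\<^esub> u"
  "\<lbrakk>v \<in> carrier V; v' \<in> carrier V; u \<in> carrier V\<rbrakk> \<Longrightarrow> u \<otimes>\<^bsub>V\<^esub> (v \<oplus>\<^bsub>V\<^esub> v') = u \<otimes>\<^bsub>V\<^esub> v \<oplus>\<^bsub>V\<^esub> u \<otimes>\<^bsub>V\<^esub> v'"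
  "\<lbrakk>a \<in> carrier R; v \<in> carrier V; u \<in> carrier V\<rbrakk> \<Longrightarrow> (a \<odot>\<^bsub>V\<^esub> v) \<otimes>\<^bsub>V\<^esub> u = a \<odot>\<^bsub>V\<^esub> (v \<otimes>\<^bsub>V\<^esub> u)"
  "\<lbrakk>a \<in> carrier R; v \<in> carrier V; u \<in> carrier V\<rbrakk> \<Longrightarrow> u \<otimes>\<^bsub>V\<^esub> (a \<odot>\<^bsub>V\<^esub> v) = a \<odot>\<^bsub>V\<^esub> (u \<otimes>\<^bsub>V\<^esub> v)"
  using mult_V by (auto simp: bilinear_map_def)

lemma mult_W_simps [simp]:
  "\<lbrakk>v \<in> carrier W; v' \<in> carrier W\<rbrakk> \<Longrightarrow> v \<otimes>\<^bsub>W\<^esub> v' \<in> carrier W"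
  "\<lbrakk>v \<in> carrier W; v' \<in> carrier W; u \<in> carrier W\<rbrakk> \<Longrightarrow> (v \<oplus>\<^bsub>W\<^esub> v') \<otimes>\<^bsub>W\<^esub> u = v \<otimes>\<^bsub>W\<^esub> u \<oplus>\<^bsub>W\<^esub> v' \<otimes>\<^bsub>W\<^esub> u"
  "\<lbrakk>v \<in> carrier W; v' \<in> carrier W; u \<in> carrier W\<rbrakk> \<Longrightarrow> u \<otimes>\<^bsub>W\<^esub> (v \<oplus>\<^bsub>W\<^esub> v') = u \<otimes>\<^bsub>W\<^esub> v \<oplus>\<^bsub>W\<^esub> u \<otimes>\<^bsub>W\<^esub> v'"
  "\<lbrakk>a \<in> carrier R; v \<in> carrier W; u \<in> carrier W\<rbrakk> \<Longrightarrow> (a \<odot>\<^bsub>W\<^esub> v) \<otimes>\<^bsub>W\<^esub> u = a \<odot>\<^bsub>W\<^esub> (v \<otimes>\<^bsub>W\<^esub> u)"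
  "\<lbrakk>a \<in> carrier R; v \<in> carrier W; u \<in> carrier W\<rbrakk> \<Longrightarrow> u \<otimes>\<^bsub>W\<^esub> (a \<odot>\<^bsub>W\<^esub> v) = a \<odot>\<^bsub>W\<^esub> (u \<otimes>\<^bsub>W\<^esub> v)"
  using mult_W by (auto simp: bilinear_map_def)

text \<open>Left multiplication by the pure tensor of v and w; the product of \<open>tensor\<close>
  is this map lifted once more in v and w.\<close>

definition inner :: "'v \<Rightarrow> 'w \<Rightarrow> ('v \<times> 'w \<Rightarrow> 'k) set \<Rightarrow> ('v \<times> 'w \<Rightarrow> 'k) set" where
  "inner v w = tensor_lift R T (\<lambda>v' w'. pure (v \<otimes>\<^bsub>V\<^esub> v') (w \<otimes>\<^bsub>W\<^esub> w'))"

lemma lifting_inner: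
  assumes "v \<in> carrier V" "w \<in> carrier W"
  shows "tensor_lifting R V W T (\<lambda>v' w'. pure (v \<otimes>\<^bsub>V\<^esub> v') (w \<otimes>\<^bsub>W\<^esub> w'))"
  using assms
  by unfold_locales
    (intro bilinear_mapI, simp_all add: pure_add_left pure_add_right pure_smult_left pure_smult_right)

lemma inner_simps:
  assumes "v \<in> carrier V" "w \<in> carrier W"
  shows "t \<in> carrier T \<Longrightarrow> inner v w t \<in> carrier T"
    "\<lbrakk>s \<in> carrier T; t \<in> carrier T\<rbrakk> \<Longrightarrow> inner v w (s \<oplus>\<^bsub>T\<^esub> t) = inner v w s \<oplus>\<^bsub>T\<^esub> inner v w t"
    "\<lbrakk>v' \<in> carrier V; w' \<in> carrier W\<rbrakk> \<Longrightarrow> inner v w (pure v' w') = pure (v \<otimes>\<^bsub>V\<^esub> v') (w \<otimes>\<^bsub>W\<^esub> w')"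
  using tensor_lifting.tensor_lift_closed[OF lifting_inner[OF assms]]
    tensor_lifting.tensor_lift_add[OF lifting_inner[OF assms]]
    tensor_lifting.tensor_lift_pure[OF lifting_inner[OF assms]]
  unfolding inner_def by auto

lemma inner_add_left:
  assumes "v \<in> carrier V" "v' \<in> carrier V" "w \<in> carrier W" "t \<in> carrier T"
  shows "inner (v \<oplus>\<^bsub>V\<^esub> v') w t = inner v w t \<oplus>\<^bsub>T\<^esub> inner v' w t"
  using assms(4)
  by (induction t rule: tensor_induct)
    (use assms(1-3) in \<open>simp_all add: inner_simps pure_add_left T.M.a_ac\<close>)

lemma inner_add_right:
  assumes "v \<in> carrier V" "w \<in> carrier W" "w' \<in> carrier W" "t \<in> carrier T"
  shows "inner v (w \<oplus>\<^bsub>W\<^esub> w') t = inner v w t \<oplus>\<^bsub>T\<^esub> inner v w' t"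
  using assms(4)
  by (induction t rule: tensor_induct)
    (use assms(1-3) in \<open>simp_all add: inner_simps pure_add_right T.M.a_ac\<close>)

lemma inner_smult_left:
  assumes "a \<in> carrier R" "v \<in> carrier V" "w \<in> carrier W" "t \<in> carrier T"
  shows "inner (a \<odot>\<^bsub>V\<^esub> v) w t = a \<odot>\<^bsub>T\<^esub> inner v w t"
  using assms(4)
  by (induction t rule: tensor_induct)
    (use assms(1-3) in \<open>simp_all add: inner_simps pure_smult_left T.smult_r_distr\<close>)

lemma inner_smult_right:
  assumes "a \<in> carrier R" "v \<in> carrier V" "w \<in> carrier W" "t \<in> carrier T"
  shows "inner v (a \<odot>\<^bsub>W\<^esub> w) t = a \<odot>\<^bsub>T\<^esub> inner v w t"
  using assms(4)
  by (induction t rule: tensor_induct)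
    (use assms(1-3) in \<open>simp_all add: inner_simps pure_smult_right T.smult_r_distr\<close>)

lemma lifting_outer:
  assumes "t \<in> carrier T"
  shows "tensor_lifting R V W T (\<lambda>v w. inner v w t)"
  using assms
  by unfold_locales
    (intro bilinear_mapI, simp_all add: inner_simps inner_add_left inner_add_right
      inner_smult_left inner_smult_right)

text \<open>The product is defined by lifting into \<open>tensor_module\<close>, which differs from
  T in its product and unit only, and a lift uses neither of the two.\<close>

lemma tensor_lift_tensor_module: "tensor_lift R (tensor_module R V W) = tensor_lift R T"
  by (intro ext) (simp add: tensor_lift_def tensor_def tensor_module_def Let_def finsum_def)

lemma tensor_mult: "s \<otimes>\<^bsub>T\<^esub> t = tensor_lift R T (\<lambda>v w. inner v w t) s"
proof -
  have "s \<otimes>\<^bsub>T\<^esub> t = tensor_lift R (tensor_module R V W) (\<lambda>v w. tensor_lift R (tensor_module R V W)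
      (\<lambda>v' w'. pure (v \<otimes>\<^bsub>V\<^esub> v') (w \<otimes>\<^bsub>W\<^esub> w')) t) s"
    by (simp add: tensor_def Let_def)
  then show ?thesis by (simp only: inner_def tensor_lift_tensor_module)
qed

lemma tensor_mult_closed: "\<lbrakk>s \<in> carrier T; t \<in> carrier T\<rbrakk> \<Longrightarrow> s \<otimes>\<^bsub>T\<^esub> t \<in> carrier T"
  unfolding tensor_mult by (rule tensor_lifting.tensor_lift_closed[OF lifting_outer])

lemma tensor_mult_add_left:
  "\<lbrakk>r \<in> carrier T; s \<in> carrier T; t \<in> carrier T\<rbrakk> \<Longrightarrow> (r \<oplus>\<^bsub>T\<^esub> s) \<otimes>\<^bsub>T\<^esub> t = r \<otimes>\<^bsub>T\<^esub> t \<oplus>\<^bsub>T\<^esub> s \<otimes>\<^bsub>T\<^esub> t"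
  unfolding tensor_mult by (rule tensor_lifting.tensor_lift_add[OF lifting_outer])

lemma tensor_mult_pure_left:
  "\<lbrakk>v \<in> carrier V; w \<in> carrier W; t \<in> carrier T\<rbrakk> \<Longrightarrow> pure v w \<otimes>\<^bsub>T\<^esub> t = inner v w t"
  unfolding tensor_mult by (rule tensor_lifting.tensor_lift_pure[OF lifting_outer])

lemma tensor_one: "\<one>\<^bsub>T\<^esub> = pure \<one>\<^bsub>V\<^esub> \<one>\<^bsub>W\<^esub>"
  by (simp add: tensor_def Let_def)

end

section \<open>Tensors as functions on a product of finite sets\<close>

definition tensor_values ::
    "('a, 'b) ring_scheme \<Rightarrow> 'a set \<Rightarrow> ('v \<Rightarrow> 's \<Rightarrow> 'a) \<Rightarrow> ('w \<Rightarrow> 't \<Rightarrow> 'a)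
      \<Rightarrow> ('v \<times> 'w \<Rightarrow> 'a) set \<Rightarrow> 's \<times> 't \<Rightarrow> 'a" where
  "tensor_values M K \<iota> \<kappa> t p =
     tensor_lift (M\<lparr>carrier := K\<rparr>) (self_algebra M) (\<lambda>v w. \<iota> v (fst p) \<otimes>\<^bsub>M\<^esub> \<kappa> w (snd p)) t"

text \<open>Induction on x, with an induction on y nested in its base case; two generators multiply
  to a member of \<Omega>.\<close>

lemma mspan_product:
  assumes "field M" and x: "mspan M S \<Phi> x" and y: "mspan M S' \<Psi> y"
    and cl: "\<And>f s. \<lbrakk>f \<in> \<Phi>; s \<in> S\<rbrakk> \<Longrightarrow> f s \<in> carrier M" "\<And>g s. \<lbrakk>g \<in> \<Psi>; s \<in> S'\<rbrakk> \<Longrightarrow> g s \<in> carrier M"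
    and prod: "\<And>f g. \<lbrakk>f \<in> \<Phi>; g \<in> \<Psi>\<rbrakk> \<Longrightarrow>
      \<exists>h\<in>\<Omega>. \<forall>p\<in>S \<times> S'. h p = f (fst p) \<otimes>\<^bsub>M\<^esub> g (snd p)"
  shows "mspan M (S \<times> S') \<Omega> (\<lambda>p. x (fst p) \<otimes>\<^bsub>M\<^esub> y (snd p))"
proof -
  interpret field M by fact
  show ?thesis
    using x
  proof (induction x rule: mspan.induct)
    case (mspan_base f m x)
    note f = this
    show ?case
      using y
    proof (induction y rule: mspan.induct)
      case (mspan_base g n y)
      obtain h where h: "h \<in> \<Omega>" "\<forall>p\<in>S \<times> S'. h p = f (fst p) \<otimes>\<^bsub>M\<^esub> g (snd p)"
        using prod[OF f(1) mspan_base(1)] by blast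
      show ?case
        by (rule mspan.mspan_base[OF h(1), of "m \<otimes>\<^bsub>M\<^esub> n"])
          (use h f mspan_base cl in \<open>auto simp: m_ac\<close>)
    next
      case (mspan_add y y' z)
      have "y s \<in> carrier M" "y' s \<in> carrier M" if "s \<in> S'" for s
        using mspan_closed[of S' \<Psi> y s] mspan_closed[of S' \<Psi> y' s] mspan_add cl that by auto
      then show ?case
        by (intro mspan.mspan_add[OF mspan_add(4,5)]) (use f mspan_add cl in \<open>auto simp: r_distr\<close>)
    qed
  next
    case (mspan_add x x' z)
    have "x s \<in> carrier M" "x' s \<in> carrier M" if "s \<in> S" for s
      using mspan_closed[of S \<Phi> x s] mspan_closed[of S \<Phi> x' s] mspan_add cl that by auto
    moreover have "y s \<in> carrier M" if "s \<in> S'" for s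
      using mspan_closed[of S' \<Psi> y s] y cl that by auto
    ultimately show ?case
      by (intro mspan.mspan_add[OF mspan_add(4,5)]) (use mspan_add in \<open>auto simp: l_distr\<close>)
  qed
qed

locale form_pair = V: form M K G V S act \<iota> + W: form M K G W S' act' \<kappa>
  for M :: "('a, 'b) ring_scheme" (structure) and K G
    and V :: "('a, 'v, 'x) module_scheme" and S :: "'s set" and act \<iota>
    and W :: "('a, 'w, 'y) module_scheme" and S' :: "'t set" and act' \<kappa>
begin

sublocale TM: tensor_modules "M\<lparr>carrier := K\<rparr>" V W
  by unfold_locales

abbreviation "values \<equiv> tensor_values M K \<iota> \<kappa>"

lemma lifting_values:
  assumes "p \<in> S \<times> S'"
  shows "tensor_lifting V.R V W (self_algebra M) (\<lambda>v w. \<iota> v (fst p) \<otimes> \<kappa> w (snd p))"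
proof -
  have "bilinear_map V.R V W (self_algebra M) (\<lambda>v w. \<iota> v (fst p) \<otimes> \<kappa> w (snd p))"
    using assms
    by (intro bilinear_mapI) (auto simp: self_algebra_def V.\<iota>_add W.\<iota>_add V.\<iota>_smult W.\<iota>_smult
        V.l_distr V.r_distr V.m_ac)
  then show ?thesis
    by (intro tensor_lifting.intro tensor_lifting_axioms.intro TM.tensor_modules_axioms V.module_self)
qed

lemma values_simps:
  assumes "p \<in> S \<times> S'"
  shows values_closed: "t \<in> carrier TM.T \<Longrightarrow> values t p \<in> carrier M"
    and values_add: "\<lbrakk>s \<in> carrier TM.T; t \<in> carrier TM.T\<rbrakk> \<Longrightarrow>
      values (s \<oplus>\<^bsub>TM.T\<^esub> t) p = values s p \<oplus> values t p"
    and values_smult: "\<lbrakk>k \<in> K; t \<in> carrier TM.T\<rbrakk> \<Longrightarrow> values (k \<odot>\<^bsub>TM.T\<^esub> t) p = k \<otimes> values t p"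
    and values_pure: "\<lbrakk>v \<in> carrier V; w \<in> carrier W\<rbrakk> \<Longrightarrow>
      values (TM.pure v w) p = \<iota> v (fst p) \<otimes> \<kappa> w (snd p)"
  using tensor_lifting.tensor_lift_closed[OF lifting_values[OF assms]]
    tensor_lifting.tensor_lift_add[OF lifting_values[OF assms]]
    tensor_lifting.tensor_lift_smult[OF lifting_values[OF assms]]
    tensor_lifting.tensor_lift_pure[OF lifting_values[OF assms]]
  unfolding tensor_values_def by (auto simp: self_algebra_def)

lemma pure_finsum_right:
  assumes "v \<in> carrier V" "\<And>a. a \<in> A \<Longrightarrow> f a \<in> carrier W" "finite A"
  shows "TM.pure v (\<Oplus>\<^bsub>W\<^esub>a\<in>A. f a) = (\<Oplus>\<^bsub>TM.T\<^esub>a\<in>A. TM.pure v (f a))"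
  using assms(3,2)
proof (induction A rule: finite_induct)
  case empty
  have "TM.pure v \<zero>\<^bsub>W\<^esub> \<oplus>\<^bsub>TM.T\<^esub> TM.pure v \<zero>\<^bsub>W\<^esub> = TM.pure v \<zero>\<^bsub>W\<^esub>"
    using TM.pure_add_right[of v "\<zero>\<^bsub>W\<^esub>" "\<zero>\<^bsub>W\<^esub>"] assms(1) by simp
  then show ?case using assms(1) by simp
next
  case (insert a A)
  then show ?case using assms(1) by (simp add: Pi_def TM.pure_add_right)
qed

text \<open>A normal form for tensors: the coefficients in K of the right factors move to the left,
  which leaves one vector of V for each basis element of W.\<close>

lemma tensor_basis:
  assumes B: "W.spanning B" "W.lin_free B" and t: "t \<in> carrier TM.T"
  shows "\<exists>u. (\<forall>b\<in>B. u b \<in> carrier V) \<and> t = (\<Oplus>\<^bsub>TM.T\<^esub>b\<in>B. TM.pure (u b) b)"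
proof -
  have fin: "finite B" "B \<subseteq> carrier W" using B(1) unfolding W.spanning_def by auto
  show ?thesis
    using t
  proof (induction t rule: TM.tensor_induct)
    case (pure v w)
    obtain k where k: "\<And>b. b \<in> B \<Longrightarrow> k b \<in> K" "w = (\<Oplus>\<^bsub>W\<^esub>b\<in>B. k b \<odot>\<^bsub>W\<^esub> b)"
      using W.combination_basis[OF B pure(2)] by auto
    have b: "b \<in> carrier W" if "b \<in> B" for b using that fin by auto
    have "TM.pure v w = (\<Oplus>\<^bsub>TM.T\<^esub>b\<in>B. TM.pure v (k b \<odot>\<^bsub>W\<^esub> b))"
      unfolding k(2) using pure k(1) b fin by (intro pure_finsum_right) auto
    also have "\<dots> = (\<Oplus>\<^bsub>TM.T\<^esub>b\<in>B. TM.pure (k b \<odot>\<^bsub>V\<^esub> v) b)"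
      using pure k(1) b by (intro TM.T.M.finsum_cong') (auto simp: TM.pure_smult_left TM.pure_smult_right)
    finally show ?case
      using pure k(1) by (intro exI[of _ "\<lambda>b. k b \<odot>\<^bsub>V\<^esub> v"]) auto
  next
    case (add s t)
    obtain u where u: "\<forall>b\<in>B. u b \<in> carrier V" "s = (\<Oplus>\<^bsub>TM.T\<^esub>b\<in>B. TM.pure (u b) b)"
      using add(3) by (elim exE conjE)
    obtain u' where u': "\<forall>b\<in>B. u' b \<in> carrier V" "t = (\<Oplus>\<^bsub>TM.T\<^esub>b\<in>B. TM.pure (u' b) b)"
      using add(4) by (elim exE conjE)
    have "s \<oplus>\<^bsub>TM.T\<^esub> t = (\<Oplus>\<^bsub>TM.T\<^esub>b\<in>B. TM.pure (u b) b \<oplus>\<^bsub>TM.T\<^esub> TM.pure (u' b) b)"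
      unfolding u(2) u'(2) using u u' fin by (intro TM.T.M.finsum_addf[symmetric]) (auto simp: Pi_def)
    also have "\<dots> = (\<Oplus>\<^bsub>TM.T\<^esub>b\<in>B. TM.pure (u b \<oplus>\<^bsub>V\<^esub> u' b) b)"
      using u u' fin by (intro TM.T.M.finsum_cong') (auto simp: TM.pure_add_left)
    finally show ?case
      using u u' by (intro exI[of _ "\<lambda>b. u b \<oplus>\<^bsub>V\<^esub> u' b"]) auto
  qed
qed

lemma values_zero:
  assumes p: "p \<in> S \<times> S'"
  shows "values \<zero>\<^bsub>TM.T\<^esub> p = \<zero>"
  using values_add[OF p, of "\<zero>\<^bsub>TM.T\<^esub>" "\<zero>\<^bsub>TM.T\<^esub>"] values_closed[OF p, of "\<zero>\<^bsub>TM.T\<^esub>"] by simp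

lemma values_finsum:
  assumes "\<And>a. a \<in> A \<Longrightarrow> f a \<in> carrier TM.T" "p \<in> S \<times> S'"
  shows "values (\<Oplus>\<^bsub>TM.T\<^esub>a\<in>A. f a) p = (\<Oplus>a\<in>A. values (f a) p)"
  using assms
  by (induction A rule: infinite_finite_induct)
    (simp_all add: values_zero values_add values_closed Pi_def del: mem_Sigma_iff)

lemma values_equivariant:
  assumes "\<tau> \<in> G" "t \<in> carrier TM.T" "p \<in> S \<times> S'"
  shows "values t (act \<tau> (fst p), act' \<tau> (snd p)) = \<tau> (values t p)"
proof -
  have q: "(act \<tau> (fst p), act' \<tau> (snd p)) \<in> S \<times> S'"
    using assms V.act_closed W.act_closed by auto
  show ?thesis
    using assms(2)
  proof (induction t rule: TM.tensor_induct)
    case (pure v w)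
    then show ?case
      using assms(1,3) V.\<iota>_equivariant W.\<iota>_equivariant
      unfolding values_pure[OF q pure] values_pure[OF assms(3) pure] by auto
  next
    case (add s t)
    then show ?case
      using assms(1) values_closed[OF assms(3)]
      by (simp add: values_add[OF q] values_add[OF assms(3)])
  qed
qed

text \<open>In the normal form the scalars \<iota> (u b) s, for fixed s, are coefficients in M of a
  vanishing combination of the basis functions of W. Independence over K would not be enough here;
  \<open>lin_free\<close> is independence over M.\<close>

lemma values_inj0:
  assumes t: "t \<in> carrier TM.T" and zero: "\<And>p. p \<in> S \<times> S' \<Longrightarrow> values t p = \<zero>"
  shows "t = \<zero>\<^bsub>TM.T\<^esub>"
proof -
  obtain B where B: "W.spanning B" "W.lin_free B" using W.ex_basis by auto
  then have fin: "finite B" "B \<subseteq> carrier W" unfolding W.spanning_def by auto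
  obtain u where u: "\<forall>b\<in>B. u b \<in> carrier V" "t = (\<Oplus>\<^bsub>TM.T\<^esub>b\<in>B. TM.pure (u b) b)"
    using tensor_basis[OF B t] by (elim exE conjE)
  have "u b = \<zero>\<^bsub>V\<^esub>" if b: "b \<in> B" for b
  proof (rule V.\<iota>_inj0)
    fix s assume s: "s \<in> S"
    have "(\<Oplus>b\<in>B. \<iota> (u b) s \<otimes> \<kappa> b s') = \<zero>" if s': "s' \<in> S'" for s'
    proof -
      have p: "(s, s') \<in> S \<times> S'" using s s' by simp
      have bW: "b \<in> carrier W" if "b \<in> B" for b using fin that by auto
      have "\<zero> = values t (s, s')" using zero[OF p] by simp
      also have "\<dots> = (\<Oplus>b\<in>B. values (TM.pure (u b) b) (s, s'))"
        unfolding u(2) by (rule values_finsum[OF _ p]) (use u fin in auto)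
      also have "\<dots> = (\<Oplus>b\<in>B. \<iota> (u b) s \<otimes> \<kappa> b s')"
        by (rule V.finsum_cong') (use u bW s s' values_pure[OF p] in auto)
      finally show ?thesis by simp
    qed
    then show "\<iota> (u b) s = \<zero>"
      using B(2)[unfolded W.lin_free_def, rule_format, of "\<lambda>b. \<iota> (u b) s" b] u s b by auto
  qed (use u b in auto)
  moreover have "TM.pure \<zero>\<^bsub>V\<^esub> b = \<zero>\<^bsub>TM.T\<^esub>" if "b \<in> B" for b
  proof -
    have b: "b \<in> carrier W" using that fin by auto
    then show ?thesis
      using TM.pure_add_left[of "\<zero>\<^bsub>V\<^esub>" "\<zero>\<^bsub>V\<^esub>" b] TM.pure_closed[of "\<zero>\<^bsub>V\<^esub>" b] by simp
  qed
  ultimately show ?thesis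
    unfolding u(2) by (intro TM.T.M.add.finprod_one_eqI) simp
qed

lemma values_span:
  assumes x: "\<And>p. p \<in> S \<times> S' \<Longrightarrow> x p \<in> carrier M"
  shows "mspan M (S \<times> S') (values ` carrier TM.T) x"
\<comment> \<open>\<open>mspan_sum\<close> needs a nonempty index set; on an empty domain every
  function is a multiple of any generator.\<close>
proof (cases "S \<times> S' = {}")
  case True
  show ?thesis
    by (rule mspan_base[of "values \<zero>\<^bsub>TM.T\<^esub>" _ \<zero>]) (use True in auto)
next
  case False
  have cl: "h p \<in> carrier M" if "h \<in> values ` carrier TM.T" "p \<in> S \<times> S'" for h p
    using that values_closed by blast
  have fin: "finite (S \<times> S')" by simp
  define \<delta> where "\<delta> q p = (if fst p = fst q then \<one> else \<zero>) \<otimes> (if snd p = snd q then \<one> else \<zero>)"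
    for q p :: "'s \<times> 't"
  have \<delta>: "mspan M (S \<times> S') (values ` carrier TM.T) (\<delta> q)" for q
    unfolding \<delta>_def
  proof (rule mspan_product[OF V.field_axioms])
    show "mspan M S (\<iota> ` carrier V) (\<lambda>s. if s = fst q then \<one> else \<zero>)"
      by (rule V.span) auto
    show "mspan M S' (\<kappa> ` carrier W) (\<lambda>s. if s = snd q then \<one> else \<zero>)"
      by (rule W.span) auto
    fix f g assume "f \<in> \<iota> ` carrier V" "g \<in> \<kappa> ` carrier W"
    then obtain v w where vw: "v \<in> carrier V" "w \<in> carrier W" "f = \<iota> v" "g = \<kappa> w" by auto
    show "\<exists>h\<in>values ` carrier TM.T. \<forall>p\<in>S \<times> S'. h p = f (fst p) \<otimes> g (snd p)"
      by (rule bexI[of _ "values (TM.pure v w)"]) (use vw in \<open>auto simp: values_pure\<close>)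
  qed auto
  have "mspan M (S \<times> S') (values ` carrier TM.T) (\<lambda>p. \<Oplus>q\<in>S \<times> S'. x q \<otimes> \<delta> q p)"
  proof (rule V.mspan_sum[OF fin False])
    fix q assume q: "q \<in> S \<times> S'"
    show "mspan M (S \<times> S') (values ` carrier TM.T) (\<lambda>p. x q \<otimes> \<delta> q p)"
      by (rule V.mspan_smult[OF \<delta> _ x[OF q]]) (rule cl)
  qed (rule cl)
  then show ?thesis
  proof (rule mspan_cong)
    fix p assume p: "p \<in> S \<times> S'"
    have "(\<Oplus>q\<in>S \<times> S'. x q \<otimes> \<delta> q p) = (\<Oplus>q\<in>S \<times> S'. if q = p then x q else \<zero>)"
      using x by (intro V.finsum_cong') (auto simp: \<delta>_def)
    also have "\<dots> = x p" using p x by (intro V.finsum_delta fin) auto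
    finally show "(\<Oplus>q\<in>S \<times> S'. x q \<otimes> \<delta> q p) = x p" .
  qed
qed

text \<open>A tensor product of forms is again a form, so \<open>descend\<close> applies to H
  \<otimes> H, and the construction can be repeated for H \<otimes> (H \<otimes> H).\<close>

sublocale T: form M K G TM.T "S \<times> S'" "\<lambda>\<tau> p. (act \<tau> (fst p), act' \<tau> (snd p))" "values"
proof (unfold_locales, goal_cases)
  case (2 \<tau>)
  have "(\<lambda>p. (act \<tau> (fst p), act' \<tau> (snd p))) ` (S \<times> S') = (act \<tau> ` S) \<times> (act' \<tau> ` S')"
    by force
  then show ?case using V.act_image[OF 2] W.act_image[OF 2] by simp
next
  case (7 t)
  then show ?case by (rule values_inj0)
next
  case (8 x)
  then show ?case by (rule values_span)
qed (use values_closed values_add values_smult values_equivariant in auto)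

end

section \<open>Group algebras\<close>

lemma (in ring) finsum_mult:
  assumes "finite A" "finite B" "\<And>a. a \<in> A \<Longrightarrow> f a \<in> carrier R" "\<And>b. b \<in> B \<Longrightarrow> g b \<in> carrier R"
  shows "(\<Oplus>a\<in>A. f a) \<otimes> (\<Oplus>b\<in>B. g b) = (\<Oplus>a\<in>A. \<Oplus>b\<in>B. f a \<otimes> g b)"
proof -
  have "(\<Oplus>a\<in>A. f a) \<otimes> (\<Oplus>b\<in>B. g b) = (\<Oplus>a\<in>A. f a \<otimes> (\<Oplus>b\<in>B. g b))"
    using assms by (intro finsum_ldistr finsum_closed) auto
  also have "\<dots> = (\<Oplus>a\<in>A. \<Oplus>b\<in>B. f a \<otimes> g b)"
    using assms by (intro finsum_cong' refl finsum_rdistr funcsetI finsum_closed m_closed) auto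
  finally show ?thesis .
qed

lemma (in abelian_monoid) finsum_reindex_onto:
  assumes "inj_on h A" "h ` A = B" "\<And>b. b \<in> B \<Longrightarrow> f b \<in> carrier G"
  shows "(\<Oplus>b\<in>B. f b) = (\<Oplus>a\<in>A. f (h a))"
  using finsum_reindex[of f h A] assms by auto

text \<open>Functions are pulled back along d from S to S'; the case of interest is the diagonal map
  into S \<times> S.\<close>

lemma mspan_mono:
  assumes "mspan M S \<Phi> x"
    and "\<And>f. f \<in> \<Phi> \<Longrightarrow> \<exists>g\<in>\<Psi>. \<forall>t\<in>S'. g t = f (d t)" "\<And>t. t \<in> S' \<Longrightarrow> d t \<in> S"
  shows "mspan M S' \<Psi> (\<lambda>t. x (d t))"
  using assms
proof (induction x rule: mspan.induct)
  case (mspan_base f m x)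
  obtain g where g: "g \<in> \<Psi>" "\<forall>t\<in>S'. g t = f (d t)" using mspan_base(4)[OF mspan_base(1)] by auto
  show ?case by (rule mspan.mspan_base[OF g(1) mspan_base(2)]) (use g mspan_base in auto)
next
  case (mspan_add x y z)
  show ?case by (rule mspan.mspan_add[of _ _ _ "\<lambda>t. x (d t)" "\<lambda>t. y (d t)"]) (use mspan_add in auto)
qed

text \<open>The pointwise product is the restriction to the diagonal of the external product on S
  \<times> S.\<close>

lemma mspan_mult:
  assumes "field M" and x: "mspan M S \<Phi> x" and y: "mspan M S \<Phi> y"
    and cl: "\<And>f s. \<lbrakk>f \<in> \<Phi>; s \<in> S\<rbrakk> \<Longrightarrow> f s \<in> carrier M"
    and prod: "\<And>f g. \<lbrakk>f \<in> \<Phi>; g \<in> \<Phi>\<rbrakk> \<Longrightarrow> \<exists>h\<in>\<Phi>. \<forall>s\<in>S. h s = f s \<otimes>\<^bsub>M\<^esub> g s"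
  shows "mspan M S \<Phi> (\<lambda>s. x s \<otimes>\<^bsub>M\<^esub> y s)"
proof -
  define \<Omega> where "\<Omega> = {\<lambda>p. f (fst p) \<otimes>\<^bsub>M\<^esub> g (snd p) | f g. f \<in> \<Phi> \<and> g \<in> \<Phi>}"
  have "mspan M (S \<times> S) \<Omega> (\<lambda>p. x (fst p) \<otimes>\<^bsub>M\<^esub> y (snd p))"
    using assms(1) x y
  proof (rule mspan_product)
    show "\<exists>h\<in>\<Omega>. \<forall>p\<in>S \<times> S. h p = f (fst p) \<otimes>\<^bsub>M\<^esub> g (snd p)" if "f \<in> \<Phi>" "g \<in> \<Phi>" for f g
      using that by (intro bexI[of _ "\<lambda>p. f (fst p) \<otimes>\<^bsub>M\<^esub> g (snd p)"]) (auto simp: \<Omega>_def)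
  qed (simp_all add: cl)
  then have "mspan M S \<Phi> (\<lambda>s. (\<lambda>p. x (fst p) \<otimes>\<^bsub>M\<^esub> y (snd p)) (s, s))"
  proof (rule mspan_mono)
    fix h assume "h \<in> \<Omega>"
    then obtain f g where "f \<in> \<Phi>" "g \<in> \<Phi>" "h = (\<lambda>p. f (fst p) \<otimes>\<^bsub>M\<^esub> g (snd p))"
      unfolding \<Omega>_def by auto
    then show "\<exists>g\<in>\<Phi>. \<forall>t\<in>S. g t = h (t, t)" using prod by auto
  qed auto
  then show ?thesis by simp
qed

locale finite_group_algebra = field M + Q: group Q for M (structure) and Q :: "('q, 'c) monoid_scheme" +
  assumes finite_Q [simp]: "finite (carrier Q)"
begin

abbreviation "A \<equiv> group_algebra M Q"

lemma A_simps:
  "carrier A = carrier Q \<rightarrow>\<^sub>E carrier M"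
  "x \<otimes>\<^bsub>A\<^esub> y = (\<lambda>n\<in>carrier Q. \<Oplus>m\<in>carrier Q. x m \<otimes> y (inv\<^bsub>Q\<^esub> m \<otimes>\<^bsub>Q\<^esub> n))"
  "\<one>\<^bsub>A\<^esub> = (\<lambda>n\<in>carrier Q. if n = \<one>\<^bsub>Q\<^esub> then \<one> else \<zero>)"
  "\<zero>\<^bsub>A\<^esub> = (\<lambda>n\<in>carrier Q. \<zero>)"
  "x \<oplus>\<^bsub>A\<^esub> y = (\<lambda>n\<in>carrier Q. x n \<oplus> y n)"
  "a \<odot>\<^bsub>A\<^esub> x = (\<lambda>n\<in>carrier Q. a \<otimes> x n)"
  by (simp_all add: group_algebra_def)

lemma A_value: "\<lbrakk>x \<in> carrier A; n \<in> carrier Q\<rbrakk> \<Longrightarrow> x n \<in> carrier M"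
  by (auto simp: A_simps)

lemma A_eqI:
  "\<lbrakk>x \<in> carrier A; y \<in> carrier A; \<And>n. n \<in> carrier Q \<Longrightarrow> x n = y n\<rbrakk> \<Longrightarrow> x = y"
  unfolding A_simps by (rule PiE_ext)

lemma A_closed:
  "\<one>\<^bsub>A\<^esub> \<in> carrier A" "\<zero>\<^bsub>A\<^esub> \<in> carrier A"
  "\<lbrakk>x \<in> carrier A; y \<in> carrier A\<rbrakk> \<Longrightarrow> x \<oplus>\<^bsub>A\<^esub> y \<in> carrier A"
  "\<lbrakk>x \<in> carrier A; y \<in> carrier A\<rbrakk> \<Longrightarrow> x \<otimes>\<^bsub>A\<^esub> y \<in> carrier A"
  "\<lbrakk>a \<in> carrier M; x \<in> carrier A\<rbrakk> \<Longrightarrow> a \<odot>\<^bsub>A\<^esub> x \<in> carrier A"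
  unfolding A_simps by (auto intro!: finsum_closed)

lemma A_mult: "n \<in> carrier Q \<Longrightarrow>
    (x \<otimes>\<^bsub>A\<^esub> y) n = (\<Oplus>m\<in>carrier Q. x m \<otimes> y (inv\<^bsub>Q\<^esub> m \<otimes>\<^bsub>Q\<^esub> n))"
  by (simp add: A_simps)

lemma A_at:
  assumes "n \<in> carrier Q"
  shows "(x \<oplus>\<^bsub>A\<^esub> y) n = x n \<oplus> y n" "(a \<odot>\<^bsub>A\<^esub> x) n = a \<otimes> x n" "\<zero>\<^bsub>A\<^esub> n = \<zero>"
    "\<one>\<^bsub>A\<^esub> n = (if n = \<one>\<^bsub>Q\<^esub> then \<one> else \<zero>)"
  using assms by (simp_all add: A_simps)

lemma Q_reindex:
  assumes "k \<in> carrier Q" "\<And>m. m \<in> carrier Q \<Longrightarrow> g m \<in> carrier M"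
  shows "(\<Oplus>m\<in>carrier Q. g m) = (\<Oplus>m\<in>carrier Q. g (k \<otimes>\<^bsub>Q\<^esub> m))"
proof (rule finsum_reindex_onto)
  show "(\<lambda>m. k \<otimes>\<^bsub>Q\<^esub> m) ` carrier Q = carrier Q"
    using assms(1) by (rule Q.surj_const_mult)
  show "inj_on (\<lambda>m. k \<otimes>\<^bsub>Q\<^esub> m) (carrier Q)"
    using assms(1) by (rule Q.inj_on_cmult)
qed (use assms in auto)

lemma A_mult_assoc:
  assumes x: "x \<in> carrier A" and y: "y \<in> carrier A" and z: "z \<in> carrier A"
  shows "(x \<otimes>\<^bsub>A\<^esub> y) \<otimes>\<^bsub>A\<^esub> z = x \<otimes>\<^bsub>A\<^esub> (y \<otimes>\<^bsub>A\<^esub> z)"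
proof (rule A_eqI)
  fix n assume n: "n \<in> carrier Q"
  let ?N = "carrier Q"
  note v = A_value[OF x] A_value[OF y] A_value[OF z]
  have "((x \<otimes>\<^bsub>A\<^esub> y) \<otimes>\<^bsub>A\<^esub> z) n =
      (\<Oplus>m\<in>?N. (\<Oplus>k\<in>?N. x k \<otimes> y (inv\<^bsub>Q\<^esub> k \<otimes>\<^bsub>Q\<^esub> m)) \<otimes> z (inv\<^bsub>Q\<^esub> m \<otimes>\<^bsub>Q\<^esub> n))"
    unfolding A_mult[OF n] using n v
    by (intro finsum_cong' refl funcsetI m_closed finsum_closed) (simp_all add: A_mult)
  also have "\<dots> = (\<Oplus>m\<in>?N. \<Oplus>k\<in>?N. x k \<otimes> y (inv\<^bsub>Q\<^esub> k \<otimes>\<^bsub>Q\<^esub> m) \<otimes> z (inv\<^bsub>Q\<^esub> m \<otimes>\<^bsub>Q\<^esub> n))"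
    using n v by (intro finsum_cong' refl funcsetI m_closed finsum_closed finsum_ldistr) simp_all
  also have "\<dots> = (\<Oplus>k\<in>?N. \<Oplus>m\<in>?N. x k \<otimes> y (inv\<^bsub>Q\<^esub> k \<otimes>\<^bsub>Q\<^esub> m) \<otimes> z (inv\<^bsub>Q\<^esub> m \<otimes>\<^bsub>Q\<^esub> n))"
    using n v by (intro finsum_swap) simp_all
  also have "\<dots> = (\<Oplus>k\<in>?N. x k \<otimes> (\<Oplus>m\<in>?N. y m \<otimes> z (inv\<^bsub>Q\<^esub> m \<otimes>\<^bsub>Q\<^esub> (inv\<^bsub>Q\<^esub> k \<otimes>\<^bsub>Q\<^esub> n))))"
  proof (intro finsum_cong' refl funcsetI m_closed finsum_closed)
    fix k assume k: "k \<in> ?N"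
    \<comment> \<open>Substituting k m for m turns the inner sum into the convolution of y and z at
      k^-1 n.\<close>
    have "(\<Oplus>m\<in>?N. x k \<otimes> y (inv\<^bsub>Q\<^esub> k \<otimes>\<^bsub>Q\<^esub> m) \<otimes> z (inv\<^bsub>Q\<^esub> m \<otimes>\<^bsub>Q\<^esub> n)) =
        (\<Oplus>m\<in>?N. x k \<otimes> y (inv\<^bsub>Q\<^esub> k \<otimes>\<^bsub>Q\<^esub> (k \<otimes>\<^bsub>Q\<^esub> m)) \<otimes> z (inv\<^bsub>Q\<^esub> (k \<otimes>\<^bsub>Q\<^esub> m) \<otimes>\<^bsub>Q\<^esub> n))"
      using n v k by (intro Q_reindex[of k]) simp_all
    also have "\<dots> = (\<Oplus>m\<in>?N. x k \<otimes> (y m \<otimes> z (inv\<^bsub>Q\<^esub> m \<otimes>\<^bsub>Q\<^esub> (inv\<^bsub>Q\<^esub> k \<otimes>\<^bsub>Q\<^esub> n))))"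
      using n v k
      by (intro finsum_cong' refl funcsetI m_closed)
        (simp_all add: Q.inv_mult_group Q.m_assoc[symmetric] m_assoc)
    also have "\<dots> = x k \<otimes> (\<Oplus>m\<in>?N. y m \<otimes> z (inv\<^bsub>Q\<^esub> m \<otimes>\<^bsub>Q\<^esub> (inv\<^bsub>Q\<^esub> k \<otimes>\<^bsub>Q\<^esub> n)))"
      using n v k by (intro finsum_rdistr[symmetric] funcsetI m_closed) simp_all
    finally show "(\<Oplus>m\<in>?N. x k \<otimes> y (inv\<^bsub>Q\<^esub> k \<otimes>\<^bsub>Q\<^esub> m) \<otimes> z (inv\<^bsub>Q\<^esub> m \<otimes>\<^bsub>Q\<^esub> n)) =
        x k \<otimes> (\<Oplus>m\<in>?N. y m \<otimes> z (inv\<^bsub>Q\<^esub> m \<otimes>\<^bsub>Q\<^esub> (inv\<^bsub>Q\<^esub> k \<otimes>\<^bsub>Q\<^esub> n)))" .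
  qed (use n v in simp_all)
  also have "\<dots> = (x \<otimes>\<^bsub>A\<^esub> (y \<otimes>\<^bsub>A\<^esub> z)) n"
    unfolding A_mult[OF n] using n v
    by (intro finsum_cong' refl funcsetI m_closed finsum_closed) (simp_all add: A_mult finsum_closed)
  finally show "((x \<otimes>\<^bsub>A\<^esub> y) \<otimes>\<^bsub>A\<^esub> z) n = (x \<otimes>\<^bsub>A\<^esub> (y \<otimes>\<^bsub>A\<^esub> z)) n" .
qed (use x y z A_closed in simp_all)

lemma A_l_one:
  assumes x: "x \<in> carrier A"
  shows "\<one>\<^bsub>A\<^esub> \<otimes>\<^bsub>A\<^esub> x = x"
proof (rule A_eqI)
  fix n assume n: "n \<in> carrier Q"
  have "(\<one>\<^bsub>A\<^esub> \<otimes>\<^bsub>A\<^esub> x) n =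
      (\<Oplus>m\<in>carrier Q. if m = \<one>\<^bsub>Q\<^esub> then x (inv\<^bsub>Q\<^esub> m \<otimes>\<^bsub>Q\<^esub> n) else \<zero>)"
    unfolding A_mult[OF n] using n A_value[OF x] by (intro finsum_cong') (auto simp: A_simps(3))
  also have "\<dots> = x n" using n A_value[OF x] by (subst finsum_delta) auto
  finally show "(\<one>\<^bsub>A\<^esub> \<otimes>\<^bsub>A\<^esub> x) n = x n" .
qed (use x A_closed in simp_all)

lemma inv_mult_eq_one_iff:
  assumes "m \<in> carrier Q" "n \<in> carrier Q"
  shows "inv\<^bsub>Q\<^esub> m \<otimes>\<^bsub>Q\<^esub> n = \<one>\<^bsub>Q\<^esub> \<longleftrightarrow> m = n"
  using assms Q.inv_solve_left'[of "\<one>\<^bsub>Q\<^esub>" m n] by auto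

lemma A_r_one:
  assumes x: "x \<in> carrier A"
  shows "x \<otimes>\<^bsub>A\<^esub> \<one>\<^bsub>A\<^esub> = x"
proof (rule A_eqI)
  fix n assume n: "n \<in> carrier Q"
  have "(x \<otimes>\<^bsub>A\<^esub> \<one>\<^bsub>A\<^esub>) n = (\<Oplus>m\<in>carrier Q. if m = n then x m else \<zero>)"
    unfolding A_mult[OF n] using n A_value[OF x]
    by (intro finsum_cong') (auto simp: A_simps(3) inv_mult_eq_one_iff)
  also have "\<dots> = x n" using n A_value[OF x] by (subst finsum_delta) auto
  finally show "(x \<otimes>\<^bsub>A\<^esub> \<one>\<^bsub>A\<^esub>) n = x n" .
qed (use x A_closed in simp_all)

lemma A_l_distr:
  assumes x: "x \<in> carrier A" and y: "y \<in> carrier A" and z: "z \<in> carrier A"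
  shows "(x \<oplus>\<^bsub>A\<^esub> y) \<otimes>\<^bsub>A\<^esub> z = x \<otimes>\<^bsub>A\<^esub> z \<oplus>\<^bsub>A\<^esub> y \<otimes>\<^bsub>A\<^esub> z"
proof (rule A_eqI)
  fix n assume n: "n \<in> carrier Q"
  note v = A_value[OF x] A_value[OF y] A_value[OF z]
  have "((x \<oplus>\<^bsub>A\<^esub> y) \<otimes>\<^bsub>A\<^esub> z) n = (\<Oplus>m\<in>carrier Q. x m \<otimes> z (inv\<^bsub>Q\<^esub> m \<otimes>\<^bsub>Q\<^esub> n) \<oplus>
      y m \<otimes> z (inv\<^bsub>Q\<^esub> m \<otimes>\<^bsub>Q\<^esub> n))"
    unfolding A_mult[OF n] using n v
    by (intro finsum_cong' refl funcsetI) (simp_all add: A_simps(5) l_distr)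
  also have "\<dots> = (x \<otimes>\<^bsub>A\<^esub> z \<oplus>\<^bsub>A\<^esub> y \<otimes>\<^bsub>A\<^esub> z) n"
    using n v by (subst finsum_addf) (auto simp: A_simps(2,5))
  finally show "((x \<oplus>\<^bsub>A\<^esub> y) \<otimes>\<^bsub>A\<^esub> z) n = (x \<otimes>\<^bsub>A\<^esub> z \<oplus>\<^bsub>A\<^esub> y \<otimes>\<^bsub>A\<^esub> z) n" .
qed (use x y z A_closed in simp_all)

lemma A_r_distr:
  assumes x: "x \<in> carrier A" and y: "y \<in> carrier A" and z: "z \<in> carrier A"
  shows "z \<otimes>\<^bsub>A\<^esub> (x \<oplus>\<^bsub>A\<^esub> y) = z \<otimes>\<^bsub>A\<^esub> x \<oplus>\<^bsub>A\<^esub> z \<otimes>\<^bsub>A\<^esub> y"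
proof (rule A_eqI)
  fix n assume n: "n \<in> carrier Q"
  note v = A_value[OF x] A_value[OF y] A_value[OF z]
  have "(z \<otimes>\<^bsub>A\<^esub> (x \<oplus>\<^bsub>A\<^esub> y)) n = (\<Oplus>m\<in>carrier Q. z m \<otimes> x (inv\<^bsub>Q\<^esub> m \<otimes>\<^bsub>Q\<^esub> n) \<oplus>
      z m \<otimes> y (inv\<^bsub>Q\<^esub> m \<otimes>\<^bsub>Q\<^esub> n))"
    unfolding A_mult[OF n] using n v
    by (intro finsum_cong' refl funcsetI) (simp_all add: A_simps(5) r_distr)
  also have "\<dots> = (z \<otimes>\<^bsub>A\<^esub> x \<oplus>\<^bsub>A\<^esub> z \<otimes>\<^bsub>A\<^esub> y) n"
    using n v by (subst finsum_addf) (auto simp: A_simps(2,5))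
  finally show "(z \<otimes>\<^bsub>A\<^esub> (x \<oplus>\<^bsub>A\<^esub> y)) n = (z \<otimes>\<^bsub>A\<^esub> x \<oplus>\<^bsub>A\<^esub> z \<otimes>\<^bsub>A\<^esub> y) n" .
qed (use x y z A_closed in simp_all)

lemma A_smult_left:
  assumes a: "a \<in> carrier M" and x: "x \<in> carrier A" and y: "y \<in> carrier A"
  shows "(a \<odot>\<^bsub>A\<^esub> x) \<otimes>\<^bsub>A\<^esub> y = a \<odot>\<^bsub>A\<^esub> (x \<otimes>\<^bsub>A\<^esub> y)"
proof (rule A_eqI)
  fix n assume n: "n \<in> carrier Q"
  note v = A_value[OF x] A_value[OF y]
  have "((a \<odot>\<^bsub>A\<^esub> x) \<otimes>\<^bsub>A\<^esub> y) n = (\<Oplus>m\<in>carrier Q. a \<otimes> (x m \<otimes> y (inv\<^bsub>Q\<^esub> m \<otimes>\<^bsub>Q\<^esub> n)))"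
    unfolding A_mult[OF n] using n v a
    by (intro finsum_cong' refl funcsetI) (simp_all add: A_simps(6) m_assoc)
  also have "\<dots> = (a \<odot>\<^bsub>A\<^esub> (x \<otimes>\<^bsub>A\<^esub> y)) n"
    using n v a by (subst finsum_rdistr[symmetric]) (auto simp: A_simps(2,6))
  finally show "((a \<odot>\<^bsub>A\<^esub> x) \<otimes>\<^bsub>A\<^esub> y) n = (a \<odot>\<^bsub>A\<^esub> (x \<otimes>\<^bsub>A\<^esub> y)) n" .
qed (use a x y A_closed in simp_all)

lemma A_smult_right:
  assumes a: "a \<in> carrier M" and x: "x \<in> carrier A" and y: "y \<in> carrier A"
  shows "x \<otimes>\<^bsub>A\<^esub> (a \<odot>\<^bsub>A\<^esub> y) = a \<odot>\<^bsub>A\<^esub> (x \<otimes>\<^bsub>A\<^esub> y)"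
proof (rule A_eqI)
  fix n assume n: "n \<in> carrier Q"
  note v = A_value[OF x] A_value[OF y]
  have "(x \<otimes>\<^bsub>A\<^esub> (a \<odot>\<^bsub>A\<^esub> y)) n = (\<Oplus>m\<in>carrier Q. a \<otimes> (x m \<otimes> y (inv\<^bsub>Q\<^esub> m \<otimes>\<^bsub>Q\<^esub> n)))"
    unfolding A_mult[OF n] using n v a
    by (intro finsum_cong' refl funcsetI) (simp_all add: A_simps(6) m_lcomm)
  also have "\<dots> = (a \<odot>\<^bsub>A\<^esub> (x \<otimes>\<^bsub>A\<^esub> y)) n"
    using n v a by (subst finsum_rdistr[symmetric]) (auto simp: A_simps(2,6))
  finally show "(x \<otimes>\<^bsub>A\<^esub> (a \<odot>\<^bsub>A\<^esub> y)) n = (a \<odot>\<^bsub>A\<^esub> (x \<otimes>\<^bsub>A\<^esub> y)) n" .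
qed (use a x y A_closed in simp_all)

lemma module_A: "Module.module M A"
proof (rule module_criteria)
  show "cring M" by (rule is_cring)
  show "\<forall>v\<in>carrier A. \<exists>w\<in>carrier A. v \<oplus>\<^bsub>A\<^esub> w = \<zero>\<^bsub>A\<^esub>"
  proof
    fix v assume v: "v \<in> carrier A"
    have "(\<lambda>n\<in>carrier Q. \<ominus> v n) \<in> carrier A" using v by (auto simp: A_simps)
    moreover have "v \<oplus>\<^bsub>A\<^esub> (\<lambda>n\<in>carrier Q. \<ominus> v n) = \<zero>\<^bsub>A\<^esub>"
      using A_value[OF v] by (auto simp: A_simps r_neg)
    ultimately show "\<exists>w\<in>carrier A. v \<oplus>\<^bsub>A\<^esub> w = \<zero>\<^bsub>A\<^esub>" by auto
  qed
qed (auto simp: A_closed A_value A_at a_ac m_assoc l_distr r_distr intro!: A_eqI)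

end

section \<open>Descent of the group algebra\<close>

text \<open>The situation of Greither and Pareigis with the permutations abstracted away: \<Omega>
  stands for the cosets of G', \<open>x0\<close> for G' itself, \<open>ev C\<close> for the
  embedding of L given by a coset, \<open>a\<close> for left translation, \<open>act\<close> for the
  regular action of Q and \<open>c\<close> for conjugation by left translations.\<close>

locale galois_action = descent M K G + finite_group_algebra M Q
  for M :: "('a, 'b) ring_scheme" (structure) and K G and Q :: "('q, 'c) monoid_scheme" +
  fixes L :: "'a set" and \<Omega> :: "'x set" and ev :: "'x \<Rightarrow> 'a \<Rightarrow> 'a" and x0 :: 'x
    and a :: "('a \<Rightarrow> 'a) \<Rightarrow> 'x \<Rightarrow> 'x" and act :: "'q \<Rightarrow> 'x \<Rightarrow> 'x"
    and c :: "('a \<Rightarrow> 'a) \<Rightarrow> 'q \<Rightarrow> 'q"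
  assumes subfield_L: "subfield L M" and K_L: "K \<subseteq> L"
    and finite_X [simp]: "finite \<Omega>" and x0 [simp]: "x0 \<in> \<Omega>"
    and ev_closed [simp]: "\<And>C y. \<lbrakk>C \<in> \<Omega>; y \<in> L\<rbrakk> \<Longrightarrow> ev C y \<in> carrier M"
    and ev_add: "\<And>C y z. \<lbrakk>C \<in> \<Omega>; y \<in> L; z \<in> L\<rbrakk> \<Longrightarrow> ev C (y \<oplus> z) = ev C y \<oplus> ev C z"
    and ev_mult: "\<And>C y z. \<lbrakk>C \<in> \<Omega>; y \<in> L; z \<in> L\<rbrakk> \<Longrightarrow> ev C (y \<otimes> z) = ev C y \<otimes> ev C z"
    and ev_K: "\<And>C k. \<lbrakk>C \<in> \<Omega>; k \<in> K\<rbrakk> \<Longrightarrow> ev C k = k"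
    and ev_x0: "\<And>y. y \<in> L \<Longrightarrow> ev x0 y = y"
    and ev_separate: "\<And>C D. \<lbrakk>C \<in> \<Omega>; D \<in> \<Omega>; C \<noteq> D\<rbrakk> \<Longrightarrow> \<exists>y\<in>L. ev C y \<noteq> ev D y"
    and a_image: "\<And>\<tau>. \<tau> \<in> G \<Longrightarrow> a \<tau> ` \<Omega> = \<Omega>"
    and ev_a: "\<And>\<tau> C y. \<lbrakk>\<tau> \<in> G; C \<in> \<Omega>; y \<in> L\<rbrakk> \<Longrightarrow> ev (a \<tau> C) y = \<tau> (ev C y)"
    and act_closed [simp]: "\<And>n C. \<lbrakk>n \<in> carrier Q; C \<in> \<Omega>\<rbrakk> \<Longrightarrow> act n C \<in> \<Omega>"
    and act_mult: "\<And>n m C. \<lbrakk>n \<in> carrier Q; m \<in> carrier Q; C \<in> \<Omega>\<rbrakk> \<Longrightarrow> act (n \<otimes>\<^bsub>Q\<^esub> m) C = act n (act m C)"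
    and act_one: "\<And>C. C \<in> \<Omega> \<Longrightarrow> act \<one>\<^bsub>Q\<^esub> C = C"
    and act_free: "\<And>n m C. \<lbrakk>n \<in> carrier Q; m \<in> carrier Q; C \<in> \<Omega>; act n C = act m C\<rbrakk> \<Longrightarrow> n = m"
    and act_transitive: "\<And>C D. \<lbrakk>C \<in> \<Omega>; D \<in> \<Omega>\<rbrakk> \<Longrightarrow> \<exists>n\<in>carrier Q. act n C = D"
    and c_closed [simp]: "\<And>\<tau> n. \<lbrakk>\<tau> \<in> G; n \<in> carrier Q\<rbrakk> \<Longrightarrow> c \<tau> n \<in> carrier Q"
    and c_act: "\<And>\<tau> n C. \<lbrakk>\<tau> \<in> G; n \<in> carrier Q; C \<in> \<Omega>\<rbrakk> \<Longrightarrow> act (c \<tau> n) (a \<tau> C) = a \<tau> (act n C)"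
begin

lemma L_closed [simp, intro]: "y \<in> L \<Longrightarrow> y \<in> carrier M"
  using subfieldE(3)[OF subfield_L] by blast

lemma L_ops [simp]:
  "\<one> \<in> L" "\<zero> \<in> L" "\<lbrakk>y \<in> L; z \<in> L\<rbrakk> \<Longrightarrow> y \<oplus> z \<in> L" "\<lbrakk>y \<in> L; z \<in> L\<rbrakk> \<Longrightarrow> y \<otimes> z \<in> L" "y \<in> L \<Longrightarrow> \<ominus> y \<in> L"
  using subringE(2,3,5,6,7)[OF subcring.axioms(1)[OF subdomain.axioms(1)[OF subfield.axioms(1)[OF subfield_L]]]]
  by auto

lemma K_ops [simp]:
  "\<one> \<in> K" "\<zero> \<in> K" "\<lbrakk>y \<in> K; z \<in> K\<rbrakk> \<Longrightarrow> y \<oplus> z \<in> K" "\<lbrakk>y \<in> K; z \<in> K\<rbrakk> \<Longrightarrow> y \<otimes> z \<in> K" "y \<in> K \<Longrightarrow> \<ominus> y \<in> K"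
  using subringE(2,3,5,6,7)[OF subcring.axioms(1)[OF subdomain.axioms(1)[OF subfield.axioms(1)[OF subfield_K]]]]
  by auto

lemma K_in_L [simp]: "k \<in> K \<Longrightarrow> k \<in> L"
  using K_L by blast

lemma a_closed' [simp]: "\<lbrakk>\<tau> \<in> G; C \<in> \<Omega>\<rbrakk> \<Longrightarrow> a \<tau> C \<in> \<Omega>"
  using a_image by blast

lemma inj_a: "\<tau> \<in> G \<Longrightarrow> inj_on (a \<tau>) \<Omega>"
  using a_image finite_X by (metis eq_card_imp_inj_on)

text \<open>\<open>c\<close> is not assumed to be multiplicative. Since Q acts freely, two elements
  of Q are equal once they agree at the single point a \<tau> x0.\<close>

lemma c_mult:
  assumes "\<tau> \<in> G" "n \<in> carrier Q" "m \<in> carrier Q"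
  shows "c \<tau> (n \<otimes>\<^bsub>Q\<^esub> m) = c \<tau> n \<otimes>\<^bsub>Q\<^esub> c \<tau> m"
  by (rule act_free[of _ _ "a \<tau> x0"]) (use assms in \<open>auto simp: c_act act_mult\<close>)

lemma c_one: "\<tau> \<in> G \<Longrightarrow> c \<tau> \<one>\<^bsub>Q\<^esub> = \<one>\<^bsub>Q\<^esub>"
  by (rule act_free[of _ _ "a \<tau> x0"]) (auto simp: c_act act_one)

lemma c_inv:
  assumes "\<tau> \<in> G" "n \<in> carrier Q"
  shows "c \<tau> (inv\<^bsub>Q\<^esub> n) = inv\<^bsub>Q\<^esub> (c \<tau> n)"
  using assms c_mult[of \<tau> "inv\<^bsub>Q\<^esub> n" n] by (intro Q.inv_equality[symmetric]) (auto simp: c_one)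

lemma inj_c:
  assumes "\<tau> \<in> G"
  shows "inj_on (c \<tau>) (carrier Q)"
proof (rule inj_onI)
  fix n m assume nm: "n \<in> carrier Q" "m \<in> carrier Q" "c \<tau> n = c \<tau> m"
  then have "a \<tau> (act n x0) = a \<tau> (act m x0)" using assms c_act[of \<tau> n x0] c_act[of \<tau> m x0] by simp
  then have "act n x0 = act m x0" using inj_a[OF assms] nm by (auto dest: inj_onD)
  then show "n = m" using act_free nm x0 by blast
qed

lemma c_image: "\<tau> \<in> G \<Longrightarrow> c \<tau> ` carrier Q = carrier Q"
  by (rule endo_inj_surj) (auto simp: inj_c)

section \<open>L as a space of functions on the cosets\<close>

abbreviation "E \<equiv> M\<lparr>carrier := L\<rparr>"
abbreviation "LA \<equiv> self_algebra E"

lemma LA_simps: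
  "carrier LA = L" "\<zero>\<^bsub>LA\<^esub> = \<zero>" "x \<oplus>\<^bsub>LA\<^esub> y = x \<oplus> y" "x \<odot>\<^bsub>LA\<^esub> y = x \<otimes> y" "x \<otimes>\<^bsub>LA\<^esub> y = x \<otimes> y" "\<one>\<^bsub>LA\<^esub> = \<one>"
  by (simp_all add: self_algebra_def)

lemma module_LA: "Module.module R LA"
proof (rule module_criteria)
  show "cring R" using field_R by (rule fieldE)
  show "\<forall>v\<in>carrier LA. \<exists>w\<in>carrier LA. v \<oplus>\<^bsub>LA\<^esub> w = \<zero>\<^bsub>LA\<^esub>"
  proof
    fix v assume "v \<in> carrier LA"
    then show "\<exists>w\<in>carrier LA. v \<oplus>\<^bsub>LA\<^esub> w = \<zero>\<^bsub>LA\<^esub>"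
      by (intro bexI[of _ "\<ominus> v"]) (auto simp: LA_simps r_neg)
  qed
qed (auto simp: LA_simps a_ac m_assoc l_distr r_distr)

text \<open>The functions C -> ev C y are closed under products because each ev C is multiplicative,
  and they separate the points of \<Omega>. Hence their M-span is a separating algebra.\<close>

lemma evaluations_span:
  assumes x: "\<And>C. C \<in> \<Omega> \<Longrightarrow> x C \<in> carrier M"
  shows "mspan M \<Omega> ((\<lambda>y C. ev C y) ` L) x"
proof -
  let ?\<Phi> = "(\<lambda>y C. ev C y) ` L"
  have cl: "f C \<in> carrier M" if "f \<in> ?\<Phi>" "C \<in> \<Omega>" for f C using that by auto
  interpret function_subalgebra M \<Omega> "mspan M \<Omega> ?\<Phi>"
  proof (unfold_locales, goal_cases)
    case 1
    then show ?case by simp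
  next
    case (2 x s)
    show ?case by (rule mspan_closed[OF 2(1) _ 2(2)]) (rule cl)
  next
    case (3 k)
    have "ev C \<one> = \<one>" if "C \<in> \<Omega>" for C using ev_K[OF that, of \<one>] by simp
    then show ?case using 3 by (intro mspan_base[of "\<lambda>C. ev C \<one>" _ k]) auto
  next
    case (4 x y)
    then show ?case by (rule mspan_add) simp
  next
    case (5 x y)
    show ?case
    proof (rule mspan_mult[OF field_axioms 5])
      fix f g assume "f \<in> ?\<Phi>" "g \<in> ?\<Phi>"
      then obtain y z where "y \<in> L" "z \<in> L" "f = (\<lambda>C. ev C y)" "g = (\<lambda>C. ev C z)" by auto
      then show "\<exists>h\<in>?\<Phi>. \<forall>C\<in>\<Omega>. h C = f C \<otimes> g C"
        by (intro bexI[of _ "\<lambda>C. ev C (y \<otimes> z)"]) (auto simp: ev_mult)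
    qed (rule cl)
  next
    case (6 x y)
    then show ?case by (rule mspan_cong)
  next
    case (7 C D)
    obtain y where y: "y \<in> L" "ev C y \<noteq> ev D y" using ev_separate 7 by blast
    have "mspan M \<Omega> ?\<Phi> (\<lambda>C. ev C y)" using y by (intro mspan_base[of "\<lambda>C. ev C y" _ \<one>]) auto
    then show ?case using y(2) by blast
  qed
  show ?thesis by (rule all_functions) (rule x)
qed

sublocale L: form M K G LA \<Omega> a "\<lambda>y C. ev C y"
proof (intro form.intro form_axioms.intro)
  show "descent M K G" by (rule descent_axioms)
  show "Module.module (M\<lparr>carrier := K\<rparr>) LA" by (rule module_LA)
  show "v = \<zero>\<^bsub>LA\<^esub>" if "v \<in> carrier LA" "\<And>s. s \<in> \<Omega> \<Longrightarrow> ev s v = \<zero>" for v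
    using that(2)[OF x0] that(1) ev_x0 by (simp add: LA_simps)
  show "mspan M \<Omega> ((\<lambda>y C. ev C y) ` carrier LA) x" if "\<And>s. s \<in> \<Omega> \<Longrightarrow> x s \<in> carrier M" for x
    unfolding LA_simps using that by (rule evaluations_span)
qed (auto simp: LA_simps a_image ev_add ev_mult ev_K ev_a)

text \<open>The invariants M[Q]^G. Invariance of the sum of the x(n) n, where G acts on the
  coefficients and through \<open>c\<close> on Q, amounts to equivariance of x.\<close>

definition D :: "('q \<Rightarrow> 'a) set" where
  "D = {x \<in> carrier A. \<forall>\<tau>\<in>G. \<forall>n\<in>carrier Q. x (c \<tau> n) = \<tau> (x n)}"

lemma D_subset: "x \<in> D \<Longrightarrow> x \<in> carrier A"
  by (simp add: D_def)

lemma D_value [simp]: "\<lbrakk>x \<in> D; n \<in> carrier Q\<rbrakk> \<Longrightarrow> x n \<in> carrier M"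
  using A_value D_subset by blast

lemma D_equivariant: "\<lbrakk>x \<in> D; \<tau> \<in> G; n \<in> carrier Q\<rbrakk> \<Longrightarrow> x (c \<tau> n) = \<tau> (x n)"
  by (simp add: D_def)

lemma D_restrict:
  assumes "\<And>n. n \<in> carrier Q \<Longrightarrow> x n \<in> carrier M"
    and "\<And>\<tau> n. \<lbrakk>\<tau> \<in> G; n \<in> carrier Q\<rbrakk> \<Longrightarrow> x (c \<tau> n) = \<tau> (x n)"
  shows "restrict x (carrier Q) \<in> D"
  using assms by (auto simp: D_def A_simps)

lemma c_reindex:
  assumes "\<tau> \<in> G" "\<And>m. m \<in> carrier Q \<Longrightarrow> g m \<in> carrier M"
  shows "(\<Oplus>m\<in>carrier Q. g m) = (\<Oplus>m\<in>carrier Q. g (c \<tau> m))"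
  by (rule finsum_reindex_onto) (use assms inj_c c_image in auto)

lemma c_eq_one_iff: "\<lbrakk>\<tau> \<in> G; n \<in> carrier Q\<rbrakk> \<Longrightarrow> c \<tau> n = \<one>\<^bsub>Q\<^esub> \<longleftrightarrow> n = \<one>\<^bsub>Q\<^esub>"
  using inj_onD[OF inj_c, of \<tau> n "\<one>\<^bsub>Q\<^esub>"] c_one[of \<tau>] by auto

lemma D_closed:
  "\<one>\<^bsub>A\<^esub> \<in> D" "\<zero>\<^bsub>A\<^esub> \<in> D"
  "\<lbrakk>x \<in> D; y \<in> D\<rbrakk> \<Longrightarrow> x \<oplus>\<^bsub>A\<^esub> y \<in> D"
  "\<lbrakk>k \<in> K; x \<in> D\<rbrakk> \<Longrightarrow> k \<odot>\<^bsub>A\<^esub> x \<in> D"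
  "x \<in> D \<Longrightarrow> (\<lambda>n\<in>carrier Q. x (inv\<^bsub>Q\<^esub> n)) \<in> D"
  unfolding A_simps
  by (intro D_restrict; simp add: D_equivariant c_eq_one_iff fix_K flip: c_inv)+

lemma D_mult:
  assumes x: "x \<in> D" and y: "y \<in> D"
  shows "x \<otimes>\<^bsub>A\<^esub> y \<in> D"
  unfolding A_simps(2)
proof (rule D_restrict)
  fix \<tau> n assume \<tau>: "\<tau> \<in> G" and n: "n \<in> carrier Q"
  have "(\<Oplus>m\<in>carrier Q. x m \<otimes> y (inv\<^bsub>Q\<^esub> m \<otimes>\<^bsub>Q\<^esub> c \<tau> n)) =
      (\<Oplus>m\<in>carrier Q. x (c \<tau> m) \<otimes> y (inv\<^bsub>Q\<^esub> (c \<tau> m) \<otimes>\<^bsub>Q\<^esub> c \<tau> n))"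
    by (rule c_reindex[OF \<tau>]) (use \<tau> n x y in auto)
  also have "\<dots> = (\<Oplus>m\<in>carrier Q. \<tau> (x m \<otimes> y (inv\<^bsub>Q\<^esub> m \<otimes>\<^bsub>Q\<^esub> n)))"
    using \<tau> n x y by (intro finsum_cong' refl funcsetI)
      (simp_all add: c_inv[symmetric] c_mult[symmetric] D_equivariant)
  also have "\<dots> = \<tau> (\<Oplus>m\<in>carrier Q. x m \<otimes> y (inv\<^bsub>Q\<^esub> m \<otimes>\<^bsub>Q\<^esub> n))"
    using \<tau> n x y by (intro hom_finsum[symmetric]) auto
  finally show "(\<Oplus>m\<in>carrier Q. x m \<otimes> y (inv\<^bsub>Q\<^esub> m \<otimes>\<^bsub>Q\<^esub> c \<tau> n)) =
      \<tau> (\<Oplus>m\<in>carrier Q. x m \<otimes> y (inv\<^bsub>Q\<^esub> m \<otimes>\<^bsub>Q\<^esub> n))" .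
qed (use x y in \<open>auto intro!: finsum_closed\<close>)

text \<open>Equivariant functions on \<open>Q\<close> come from the graphs of the elements of \<open>Q\<close> in \<open>\<Omega> \<times> \<Omega>\<close>.\<close>

lemma graph_sum_D:
  assumes "y \<in> L" "z \<in> L"
  shows "(\<lambda>n\<in>carrier Q. \<Oplus>C\<in>\<Omega>. ev C y \<otimes> ev (act n C) z) \<in> D"
proof (rule D_restrict)
  fix \<tau> n assume \<tau>: "\<tau> \<in> G" and n: "n \<in> carrier Q"
  have "(\<Oplus>C\<in>\<Omega>. ev C y \<otimes> ev (act (c \<tau> n) C) z) =
      (\<Oplus>C\<in>\<Omega>. ev (a \<tau> C) y \<otimes> ev (act (c \<tau> n) (a \<tau> C)) z)"
    by (rule finsum_reindex_onto) (use \<tau> n assms inj_a a_image in auto)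
  also have "\<dots> = (\<Oplus>C\<in>\<Omega>. \<tau> (ev C y \<otimes> ev (act n C) z))"
    using \<tau> n assms by (intro finsum_cong' refl funcsetI) (simp_all add: c_act ev_a)
  also have "\<dots> = \<tau> (\<Oplus>C\<in>\<Omega>. ev C y \<otimes> ev (act n C) z)"
    using \<tau> n assms by (intro hom_finsum[symmetric]) auto
  finally show "(\<Oplus>C\<in>\<Omega>. ev C y \<otimes> ev (act (c \<tau> n) C) z) = \<tau> (\<Oplus>C\<in>\<Omega>. ev C y \<otimes> ev (act n C) z)" .
qed (use assms in \<open>auto intro!: finsum_closed\<close>)

text \<open>The sum over the graph is linear in the function that y defines on \<Omega>, so any
  function in the span may replace it. With the indicator function of x0 only the point act n x0
  remains.\<close>

lemma mspan_graph_sum: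
  assumes "mspan M \<Omega> ((\<lambda>y C. ev C y) ` L) x" "z \<in> L"
  shows "mspan M (carrier Q) D (\<lambda>n. \<Oplus>C\<in>\<Omega>. x C \<otimes> ev (act n C) z)"
  using assms(1)
proof (induction x rule: mspan.induct)
  case (mspan_base f m x)
  then obtain y where y: "y \<in> L" "f = (\<lambda>C. ev C y)" by auto
  show ?case
  proof (rule mspan.mspan_base[OF graph_sum_D[OF y(1) assms(2)] mspan_base(2)])
    fix n assume n: "n \<in> carrier Q"
    have "(\<Oplus>C\<in>\<Omega>. x C \<otimes> ev (act n C) z) = (\<Oplus>C\<in>\<Omega>. m \<otimes> (ev C y \<otimes> ev (act n C) z))"
      using n y mspan_base assms(2) by (intro finsum_cong' refl funcsetI) (simp_all add: m_assoc)
    also have "\<dots> = m \<otimes> (\<Oplus>C\<in>\<Omega>. ev C y \<otimes> ev (act n C) z)"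
      using n y mspan_base assms(2) by (intro finsum_rdistr[symmetric]) auto
    finally show "(\<Oplus>C\<in>\<Omega>. x C \<otimes> ev (act n C) z) =
        m \<otimes> (\<lambda>n\<in>carrier Q. \<Oplus>C\<in>\<Omega>. ev C y \<otimes> ev (act n C) z) n"
      using n by simp
  qed
next
  case (mspan_add x y w)
  have cl: "x C \<in> carrier M" "y C \<in> carrier M" if "C \<in> \<Omega>" for C
  proof -
    show "x C \<in> carrier M" by (rule mspan_closed[OF mspan_add(1) _ that]) auto
    show "y C \<in> carrier M" by (rule mspan_closed[OF mspan_add(2) _ that]) auto
  qed
  show ?case
  proof (rule mspan.mspan_add[OF mspan_add(4,5)])
    fix n assume n: "n \<in> carrier Q"
    have "(\<Oplus>C\<in>\<Omega>. w C \<otimes> ev (act n C) z) =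
        (\<Oplus>C\<in>\<Omega>. x C \<otimes> ev (act n C) z \<oplus> y C \<otimes> ev (act n C) z)"
      using n cl mspan_add(3) assms(2) by (intro finsum_cong' refl funcsetI) (simp_all add: l_distr)
    also have "\<dots> = (\<Oplus>C\<in>\<Omega>. x C \<otimes> ev (act n C) z) \<oplus> (\<Oplus>C\<in>\<Omega>. y C \<otimes> ev (act n C) z)"
      using n cl assms(2) by (intro finsum_addf) auto
    finally show "(\<Oplus>C\<in>\<Omega>. w C \<otimes> ev (act n C) z) =
      (\<Oplus>C\<in>\<Omega>. x C \<otimes> ev (act n C) z) \<oplus> (\<Oplus>C\<in>\<Omega>. y C \<otimes> ev (act n C) z)" .
  qed
qed

text \<open>The product in play is the pointwise one, not convolution. For separation, n and m move
  x0 to different points, and some z in L distinguishes these. The function n -> ev (act n x0) z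
  need not be equivariant itself, but lies in the span by \<open>mspan_graph_sum\<close>.\<close>

lemma D_span:
  assumes x: "\<And>n. n \<in> carrier Q \<Longrightarrow> x n \<in> carrier M"
  shows "mspan M (carrier Q) D x"
proof -
  have cl: "f n \<in> carrier M" if "f \<in> D" "n \<in> carrier Q" for f n using that by simp
  interpret function_subalgebra M "carrier Q" "mspan M (carrier Q) D"
  proof (unfold_locales, goal_cases)
    case 1
    then show ?case by simp
  next
    case (2 x s)
    show ?case by (rule mspan_closed[OF 2(1) _ 2(2)]) (rule cl)
  next
    case (3 k)
    have "(\<lambda>n\<in>carrier Q. \<one>) \<in> D" by (rule D_restrict) auto
    then show ?case using 3 by (intro mspan_base[of "\<lambda>n\<in>carrier Q. \<one>" _ k]) auto
  next
    case (4 x y)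
    then show ?case by (rule mspan_add) simp
  next
    case (5 x y)
    show ?case
    proof (rule mspan_mult[OF field_axioms 5])
      fix f g assume fg: "f \<in> D" "g \<in> D"
      then have "(\<lambda>n\<in>carrier Q. f n \<otimes> g n) \<in> D" by (intro D_restrict) (auto simp: D_equivariant)
      then show "\<exists>h\<in>D. \<forall>n\<in>carrier Q. h n = f n \<otimes> g n" by (rule bexI[rotated]) auto
    qed (rule cl)
  next
    case (6 x y)
    then show ?case by (rule mspan_cong)
  next
    case (7 n m)
    then have "act n x0 \<noteq> act m x0" using act_free x0 by blast
    then obtain z where z: "z \<in> L" "ev (act n x0) z \<noteq> ev (act m x0) z"
      using ev_separate[of "act n x0" "act m x0"] 7 by auto
    have "mspan M (carrier Q) D (\<lambda>n. \<Oplus>C\<in>\<Omega>. (if C = x0 then \<one> else \<zero>) \<otimes> ev (act n C) z)"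
      by (rule mspan_graph_sum[OF evaluations_span z(1)]) auto
    then have "mspan M (carrier Q) D (\<lambda>n. ev (act n x0) z)"
    proof (rule mspan_cong)
      fix n assume n: "n \<in> carrier Q"
      have "(\<Oplus>C\<in>\<Omega>. (if C = x0 then \<one> else \<zero>) \<otimes> ev (act n C) z) =
          (\<Oplus>C\<in>\<Omega>. if C = x0 then ev (act n C) z else \<zero>)"
        using n z by (intro finsum_cong' refl funcsetI) auto
      also have "\<dots> = ev (act n x0) z" using n z by (intro finsum_delta) auto
      finally show "(\<Oplus>C\<in>\<Omega>. (if C = x0 then \<one> else \<zero>) \<otimes> ev (act n C) z) = ev (act n x0) z" .
    qed
    then show ?case using z(2) by blast
  qed
  show ?thesis by (rule all_functions) (rule x)
qed

end

section \<open>The Hopf algebra of invariants on a prescribed carrier\<close>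

lemma (in abelian_monoid) finsum2_addf:
  assumes "finite A" "finite B"
    "\<And>a b. \<lbrakk>a \<in> A; b \<in> B\<rbrakk> \<Longrightarrow> f a b \<in> carrier G" "\<And>a b. \<lbrakk>a \<in> A; b \<in> B\<rbrakk> \<Longrightarrow> g a b \<in> carrier G"
  shows "(\<Oplus>a\<in>A. \<Oplus>b\<in>B. f a b) \<oplus> (\<Oplus>a\<in>A. \<Oplus>b\<in>B. g a b) = (\<Oplus>a\<in>A. \<Oplus>b\<in>B. f a b \<oplus> g a b)"
proof -
  have "(\<Oplus>a\<in>A. \<Oplus>b\<in>B. f a b \<oplus> g a b) = (\<Oplus>a\<in>A. (\<Oplus>b\<in>B. f a b) \<oplus> (\<Oplus>b\<in>B. g a b))"
    using assms by (intro finsum_cong' refl funcsetI finsum_addf add.m_closed finsum_closed) auto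
  also have "\<dots> = (\<Oplus>a\<in>A. \<Oplus>b\<in>B. f a b) \<oplus> (\<Oplus>a\<in>A. \<Oplus>b\<in>B. g a b)"
    using assms by (intro finsum_addf funcsetI finsum_closed) auto
  finally show ?thesis by simp
qed

text \<open>Additive quantities agree once they agree on pure tensors. Below, \<phi> usually reads
  off one value of the lifted tensor and \<psi> computes it from the values of t. \<open>pl\<close>
  is a bare operation, so that \<phi> and \<psi> may take values anywhere.\<close>

lemma (in tensor_lifting) tensor_lift_eqI:
  assumes "t \<in> carrier T"
    and "\<And>x y. \<lbrakk>x \<in> carrier P; y \<in> carrier P\<rbrakk> \<Longrightarrow> \<phi> (x \<oplus>\<^bsub>P\<^esub> y) = pl (\<phi> x) (\<phi> y)"
    and "\<And>s t. \<lbrakk>s \<in> carrier T; t \<in> carrier T\<rbrakk> \<Longrightarrow> \<psi> (s \<oplus>\<^bsub>T\<^esub> t) = pl (\<psi> s) (\<psi> t)"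
    and "\<And>v w. \<lbrakk>v \<in> carrier V; w \<in> carrier W\<rbrakk> \<Longrightarrow> \<phi> (b v w) = \<psi> (pure v w)"
  shows "\<phi> (tlift t) = \<psi> t"
  using assms(1)
proof (induction t rule: tensor_induct)
  case (pure v w)
  then show ?case using assms(4) by (simp add: tensor_lift_pure)
next
  case (add s t)
  then show ?case using assms(2,3) tensor_lift_closed by (simp add: tensor_lift_add)
qed

text \<open>HC is any set in bijection with the invariants, since the elements of the Hopf algebra
  have to live in a prescribed type; all operations are transported along f.\<close>

locale hopf_model = galois_action M K G Q L \<Omega> ev x0 a act c
  for M :: "('a, 'b) ring_scheme" (structure) and K G and Q :: "('q, 'c) monoid_scheme"
    and L and \<Omega> :: "'x set" and ev x0 a act c +
  fixes HC :: "'h set" and f :: "'h \<Rightarrow> 'q \<Rightarrow> 'a"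
  assumes f_bij: "bij_betw f HC D"
begin

definition g :: "('q \<Rightarrow> 'a) \<Rightarrow> 'h" where
  "g = inv_into HC f"

lemma f_closed [simp]: "h \<in> HC \<Longrightarrow> f h \<in> D"
  using f_bij by (auto simp: bij_betw_def)

lemma f_closed_A [simp]: "h \<in> HC \<Longrightarrow> f h \<in> carrier A"
  using D_subset f_closed by blast

lemma g_closed [simp]: "x \<in> D \<Longrightarrow> g x \<in> HC"
  unfolding g_def using f_bij by (metis bij_betw_def inv_into_into)

lemma f_g [simp]: "x \<in> D \<Longrightarrow> f (g x) = x"
  unfolding g_def using f_bij by (metis bij_betw_inv_into_right)

lemma f_eqI:
  assumes "h \<in> HC" "h' \<in> HC" "\<And>n. n \<in> carrier Q \<Longrightarrow> f h n = f h' n"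
  shows "h = h'"
proof -
  have "f h = f h'" using assms by (intro A_eqI) auto
  then show ?thesis using f_bij assms by (auto simp: bij_betw_def dest: inj_onD)
qed

text \<open>The comultiplication takes values in H \<otimes> H, which must be available before it
  can be defined. H0 carries a dummy comultiplication, and \<open>tensor_H0\<close> says that tensor
  products do not see it.\<close>

definition H0 :: "('a, 'h) hopf" where
  "H0 = \<lparr>carrier = HC,
     monoid.mult = \<lambda>h h'. g (f h \<otimes>\<^bsub>A\<^esub> f h'),
     monoid.one = g \<one>\<^bsub>A\<^esub>,
     ring.zero = g \<zero>\<^bsub>A\<^esub>,
     ring.add = \<lambda>h h'. g (f h \<oplus>\<^bsub>A\<^esub> f h'),
     module.smult = \<lambda>k h. g (k \<odot>\<^bsub>A\<^esub> f h),
     comult = \<lambda>h. {},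
     counit = \<lambda>h. \<Oplus>n\<in>carrier Q. f h n,
     antipode = \<lambda>h. g (\<lambda>n\<in>carrier Q. f h (inv\<^bsub>Q\<^esub> n))\<rparr>"

text \<open>The function on Q \<times> Q that belongs to the sum of the x(n) n \<otimes> n with x =
  f h: every n is grouplike.\<close>

definition diagonal :: "'h \<Rightarrow> 'q \<times> 'q \<Rightarrow> 'a" where
  "diagonal h p = (if fst p = snd p then f h (fst p) else \<zero>)"

text \<open>A tensor with these values exists by \<open>descend\<close> and is unique because the
  values determine a tensor, so the choice is harmless.\<close>

definition H :: "('a, 'h) hopf" where
  "H = H0\<lparr>comult := \<lambda>h. SOME t. t \<in> carrier (tensor R H0 H0) \<and>
     (\<forall>p\<in>carrier Q \<times> carrier Q. tensor_values M K f f t p = diagonal h p)\<rparr>"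

lemma H_simps:
  "carrier H = HC"
  "h \<otimes>\<^bsub>H\<^esub> h' = g (f h \<otimes>\<^bsub>A\<^esub> f h')"
  "\<one>\<^bsub>H\<^esub> = g \<one>\<^bsub>A\<^esub>"
  "\<zero>\<^bsub>H\<^esub> = g \<zero>\<^bsub>A\<^esub>"
  "h \<oplus>\<^bsub>H\<^esub> h' = g (f h \<oplus>\<^bsub>A\<^esub> f h')"
  "k \<odot>\<^bsub>H\<^esub> h = g (k \<odot>\<^bsub>A\<^esub> f h)"
  "counit H h = (\<Oplus>n\<in>carrier Q. f h n)"
  "antipode H h = g (\<lambda>n\<in>carrier Q. f h (inv\<^bsub>Q\<^esub> n))"
  by (simp_all add: H_def H0_def)

lemma comult_H: "comult H h = (SOME t. t \<in> carrier (tensor R H0 H0) \<and>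
     (\<forall>p\<in>carrier Q \<times> carrier Q. tensor_values M K f f t p = diagonal h p))"
  by (simp add: H_def)

lemma tensor_H0: "tensor R H0 H0 = tensor R H H"
  by (simp add: tensor_def tensor_module_def tensor_null_def tensor_relators_def pure_tensor_def
      H_def H0_def)

lemma H_closed [simp]:
  "\<one>\<^bsub>H\<^esub> \<in> HC" "\<zero>\<^bsub>H\<^esub> \<in> HC"
  "\<lbrakk>h \<in> HC; h' \<in> HC\<rbrakk> \<Longrightarrow> h \<oplus>\<^bsub>H\<^esub> h' \<in> HC"
  "\<lbrakk>h \<in> HC; h' \<in> HC\<rbrakk> \<Longrightarrow> h \<otimes>\<^bsub>H\<^esub> h' \<in> HC"
  "\<lbrakk>k \<in> K; h \<in> HC\<rbrakk> \<Longrightarrow> k \<odot>\<^bsub>H\<^esub> h \<in> HC"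
  "h \<in> HC \<Longrightarrow> antipode H h \<in> HC"
  unfolding H_simps by (simp_all add: D_closed D_mult)

lemma f_hom:
  "f \<one>\<^bsub>H\<^esub> = \<one>\<^bsub>A\<^esub>" "f \<zero>\<^bsub>H\<^esub> = \<zero>\<^bsub>A\<^esub>"
  "\<lbrakk>h \<in> HC; h' \<in> HC\<rbrakk> \<Longrightarrow> f (h \<oplus>\<^bsub>H\<^esub> h') = f h \<oplus>\<^bsub>A\<^esub> f h'"
  "\<lbrakk>h \<in> HC; h' \<in> HC\<rbrakk> \<Longrightarrow> f (h \<otimes>\<^bsub>H\<^esub> h') = f h \<otimes>\<^bsub>A\<^esub> f h'"
  "\<lbrakk>k \<in> K; h \<in> HC\<rbrakk> \<Longrightarrow> f (k \<odot>\<^bsub>H\<^esub> h) = k \<odot>\<^bsub>A\<^esub> f h"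
  "h \<in> HC \<Longrightarrow> f (antipode H h) = (\<lambda>n\<in>carrier Q. f h (inv\<^bsub>Q\<^esub> n))"
  unfolding H_simps by (simp_all add: D_closed D_mult)

lemma f_value [simp]: "\<lbrakk>h \<in> HC; n \<in> carrier Q\<rbrakk> \<Longrightarrow> f h n \<in> carrier M"
  by simp

lemma f_at:
  assumes "n \<in> carrier Q"
  shows "f \<one>\<^bsub>H\<^esub> n = (if n = \<one>\<^bsub>Q\<^esub> then \<one> else \<zero>)" "f \<zero>\<^bsub>H\<^esub> n = \<zero>"
    "\<lbrakk>h \<in> HC; h' \<in> HC\<rbrakk> \<Longrightarrow> f (h \<oplus>\<^bsub>H\<^esub> h') n = f h n \<oplus> f h' n"
    "\<lbrakk>h \<in> HC; h' \<in> HC\<rbrakk> \<Longrightarrow> f (h \<otimes>\<^bsub>H\<^esub> h') n = (\<Oplus>m\<in>carrier Q. f h m \<otimes> f h' (inv\<^bsub>Q\<^esub> m \<otimes>\<^bsub>Q\<^esub> n))"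
    "\<lbrakk>k \<in> K; h \<in> HC\<rbrakk> \<Longrightarrow> f (k \<odot>\<^bsub>H\<^esub> h) n = k \<otimes> f h n"
    "h \<in> HC \<Longrightarrow> f (antipode H h) n = f h (inv\<^bsub>Q\<^esub> n)"
  using assms by (simp_all add: f_hom A_at A_mult)

lemma module_H: "Module.module R H"
proof (rule module_criteria)
  show "cring R" using field_R by (rule fieldE)
  show "\<forall>h\<in>carrier H. \<exists>h'\<in>carrier H. h \<oplus>\<^bsub>H\<^esub> h' = \<zero>\<^bsub>H\<^esub>"
  proof
    fix h assume "h \<in> carrier H"
    then have h: "h \<in> HC" by (simp add: H_simps)
    have "h \<oplus>\<^bsub>H\<^esub> ((\<ominus> \<one>) \<odot>\<^bsub>H\<^esub> h) = \<zero>\<^bsub>H\<^esub>"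
      by (rule f_eqI) (use h in \<open>simp_all add: f_at l_minus r_neg\<close>)
    then show "\<exists>h'\<in>carrier H. h \<oplus>\<^bsub>H\<^esub> h' = \<zero>\<^bsub>H\<^esub>"
      using h by (intro bexI[of _ "(\<ominus> \<one>) \<odot>\<^bsub>H\<^esub> h"]) (simp_all add: H_simps(1))
  qed
qed (auto simp: H_simps(1) f_at a_ac m_assoc l_distr r_distr intro!: f_eqI)

sublocale H: form M K G H "carrier Q" c f
proof (intro form.intro form_axioms.intro)
  show "descent M K G" by (rule descent_axioms)
  show "Module.module (M\<lparr>carrier := K\<rparr>) H" by (rule module_H)
  show "v = \<zero>\<^bsub>H\<^esub>" if "v \<in> carrier H" "\<And>s. s \<in> carrier Q \<Longrightarrow> f v s = \<zero>" for v
    by (rule f_eqI) (use that in \<open>simp_all add: H_simps(1) f_at\<close>)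
  have "f ` carrier H = D" using f_bij by (simp add: H_simps(1) bij_betw_def)
  then show "mspan M (carrier Q) (f ` carrier H) x" if "\<And>s. s \<in> carrier Q \<Longrightarrow> x s \<in> carrier M" for x
    using D_span that by simp
qed (auto simp: H_simps(1) f_at c_image D_equivariant)

sublocale HH: form_pair M K G H "carrier Q" c f H "carrier Q" c f
  by unfold_locales

abbreviation "T2 \<equiv> tensor R H H"
abbreviation "pure2 \<equiv> pure_tensor R H H"

sublocale HHH: form_pair M K G H "carrier Q" c f T2 "carrier Q \<times> carrier Q"
    "\<lambda>\<tau> p. (c \<tau> (fst p), c \<tau> (snd p))" HH.values
  by unfold_locales

text \<open>The diagonal function is equivariant because c \<tau> is injective: it preserves both
  equality and inequality of the two arguments.\<close>

lemma comult_closed [simp]: "h \<in> HC \<Longrightarrow> comult H h \<in> carrier T2"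
  and values_comult: "\<lbrakk>h \<in> HC; p \<in> carrier Q \<times> carrier Q\<rbrakk> \<Longrightarrow> HH.values (comult H h) p = diagonal h p"
proof -
  assume h: "h \<in> HC"
  have "\<exists>t\<in>carrier T2. \<forall>p\<in>carrier Q \<times> carrier Q. HH.values t p = diagonal h p"
  proof (rule HH.T.descend)
    fix \<tau> p assume \<tau>: "\<tau> \<in> G" and p: "p \<in> carrier Q \<times> carrier Q"
    have "c \<tau> (fst p) = c \<tau> (snd p) \<longleftrightarrow> fst p = snd p"
      using inj_c[OF \<tau>] p by (auto simp: inj_on_def)
    then show "diagonal h (c \<tau> (fst p), c \<tau> (snd p)) = \<tau> (diagonal h p)"
      using \<tau> p h by (auto simp: diagonal_def D_equivariant)
  qed (use h in \<open>auto simp: diagonal_def\<close>)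
  then have "\<exists>t. t \<in> carrier T2 \<and> (\<forall>p\<in>carrier Q \<times> carrier Q. HH.values t p = diagonal h p)" by blast
  from someI_ex[OF this] have *: "comult H h \<in> carrier T2 \<and>
    (\<forall>p\<in>carrier Q \<times> carrier Q. HH.values (comult H h) p = diagonal h p)"
    unfolding comult_H tensor_H0 .
  then show "comult H h \<in> carrier T2" by simp
  show "HH.values (comult H h) p = diagonal h p" if "p \<in> carrier Q \<times> carrier Q"
    using bspec[OF conjunct2[OF *] that] .
qed

lemma T2_eqI:
  "\<lbrakk>s \<in> carrier T2; t \<in> carrier T2;
    \<And>n m. \<lbrakk>n \<in> carrier Q; m \<in> carrier Q\<rbrakk> \<Longrightarrow> HH.values s (n, m) = HH.values t (n, m)\<rbrakk> \<Longrightarrow> s = t"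
  by (rule HH.T.\<iota>_inj) auto

lemma values2_simps [simp]:
  assumes "n \<in> carrier Q" "m \<in> carrier Q"
  shows "t \<in> carrier T2 \<Longrightarrow> HH.values t (n, m) \<in> carrier M"
    "\<lbrakk>s \<in> carrier T2; t \<in> carrier T2\<rbrakk> \<Longrightarrow>
      HH.values (s \<oplus>\<^bsub>T2\<^esub> t) (n, m) = HH.values s (n, m) \<oplus> HH.values t (n, m)"
    "\<lbrakk>k \<in> K; t \<in> carrier T2\<rbrakk> \<Longrightarrow> HH.values (k \<odot>\<^bsub>T2\<^esub> t) (n, m) = k \<otimes> HH.values t (n, m)"
    "\<lbrakk>h \<in> HC; h' \<in> HC\<rbrakk> \<Longrightarrow> HH.values (pure2 h h') (n, m) = f h n \<otimes> f h' m"
    "h \<in> HC \<Longrightarrow> HH.values (comult H h) (n, m) = (if n = m then f h n else \<zero>)"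
  using assms HH.values_closed[of "(n, m)"] HH.values_add[of "(n, m)"] HH.values_smult[of "(n, m)"]
    HH.values_pure[of "(n, m)"] values_comult[of h "(n, m)"]
  by (simp_all add: H_simps(1) diagonal_def)

lemma assoc_algebra_H: "assoc_algebra R H"
proof (intro assoc_algebra.intro assoc_algebra_axioms.intro module_H)
  have ag: "abelian_group H" by (rule H.V.abelian_group_axioms)
  have m: "monoid H"
    by (rule monoidI) (auto simp: H_simps(1) f_hom A_mult_assoc A_l_one A_r_one intro!: f_eqI)
  show "ring H"
    by (rule ringI[OF ag m]) (auto simp: H_simps(1) f_hom A_l_distr A_r_distr intro!: f_eqI)
qed (auto simp: H_simps(1) f_hom A_smult_left A_smult_right intro!: f_eqI)

sublocale HA: assoc_algebra R H
  by (rule assoc_algebra_H)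

lemma bilinear_mult_H: "bilinear_map R H H H (monoid.mult H)"
  by (intro bilinear_mapI)
    (simp_all add: HA.A_ring.l_distr HA.A_ring.r_distr HA.smult_mult_left HA.smult_mult_right)

sublocale HM: tensor_algebras R H H
  by (intro tensor_algebras.intro tensor_algebras_axioms.intro HH.TM.tensor_modules_axioms
      bilinear_mult_H)

text \<open>On values, the product of H \<otimes> H is convolution over the group Q \<times> Q, as
  in M[Q \<times> Q]. Tensor induction on both factors reduces this to pure tensors, where the
  double sum factors.\<close>

lemma values_mult:
  assumes s: "s \<in> carrier T2" and t: "t \<in> carrier T2" and n: "n \<in> carrier Q" "m \<in> carrier Q"
  shows "HH.values (s \<otimes>\<^bsub>T2\<^esub> t) (n, m) = (\<Oplus>k\<in>carrier Q. \<Oplus>l\<in>carrier Q.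
    HH.values s (k, l) \<otimes> HH.values t (inv\<^bsub>Q\<^esub> k \<otimes>\<^bsub>Q\<^esub> n, inv\<^bsub>Q\<^esub> l \<otimes>\<^bsub>Q\<^esub> m))"
  using s
proof (induction s rule: HH.TM.tensor_induct)
  case (pure v w)
  then have vw: "v \<in> HC" "w \<in> HC" by (simp_all add: H_simps(1))
  show ?case
    using t
  proof (induction t rule: HH.TM.tensor_induct)
    case (pure v' w')
    then have vw': "v' \<in> HC" "w' \<in> HC" by (simp_all add: H_simps(1))
    have "HH.values (pure2 v w \<otimes>\<^bsub>T2\<^esub> pure2 v' w') (n, m) = f (v \<otimes>\<^bsub>H\<^esub> v') n \<otimes> f (w \<otimes>\<^bsub>H\<^esub> w') m"
      using vw vw' n by (simp add: HM.tensor_mult_pure_left HM.inner_simps H_simps(1))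
    also have "\<dots> = (\<Oplus>k\<in>carrier Q. \<Oplus>l\<in>carrier Q. (f v k \<otimes> f v' (inv\<^bsub>Q\<^esub> k \<otimes>\<^bsub>Q\<^esub> n)) \<otimes>
        (f w l \<otimes> f w' (inv\<^bsub>Q\<^esub> l \<otimes>\<^bsub>Q\<^esub> m)))"
      using vw vw' n by (simp add: f_at) (intro finsum_mult, auto)
    also have "\<dots> = (\<Oplus>k\<in>carrier Q. \<Oplus>l\<in>carrier Q. HH.values (pure2 v w) (k, l) \<otimes>
        HH.values (pure2 v' w') (inv\<^bsub>Q\<^esub> k \<otimes>\<^bsub>Q\<^esub> n, inv\<^bsub>Q\<^esub> l \<otimes>\<^bsub>Q\<^esub> m))"
      using vw vw' n by (intro finsum_cong' refl funcsetI finsum_closed) (simp_all add: m_ac)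
    finally show ?case .
  next
    case (add s t)
    have "HH.values (pure2 v w \<otimes>\<^bsub>T2\<^esub> (s \<oplus>\<^bsub>T2\<^esub> t)) (n, m) =
        HH.values (pure2 v w \<otimes>\<^bsub>T2\<^esub> s) (n, m) \<oplus> HH.values (pure2 v w \<otimes>\<^bsub>T2\<^esub> t) (n, m)"
      using vw add(1,2) n by (simp add: HM.tensor_mult_pure_left HM.inner_simps H_simps(1))
    also have "\<dots> = (\<Oplus>k\<in>carrier Q. \<Oplus>l\<in>carrier Q.
        HH.values (pure2 v w) (k, l) \<otimes> HH.values s (inv\<^bsub>Q\<^esub> k \<otimes>\<^bsub>Q\<^esub> n, inv\<^bsub>Q\<^esub> l \<otimes>\<^bsub>Q\<^esub> m) \<oplus>
        HH.values (pure2 v w) (k, l) \<otimes> HH.values t (inv\<^bsub>Q\<^esub> k \<otimes>\<^bsub>Q\<^esub> n, inv\<^bsub>Q\<^esub> l \<otimes>\<^bsub>Q\<^esub> m))"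
      unfolding add(3,4) using vw add(1,2) n by (intro finsum2_addf) simp_all
    also have "\<dots> = (\<Oplus>k\<in>carrier Q. \<Oplus>l\<in>carrier Q. HH.values (pure2 v w) (k, l) \<otimes>
        HH.values (s \<oplus>\<^bsub>T2\<^esub> t) (inv\<^bsub>Q\<^esub> k \<otimes>\<^bsub>Q\<^esub> n, inv\<^bsub>Q\<^esub> l \<otimes>\<^bsub>Q\<^esub> m))"
      using vw add(1,2) n by (intro finsum_cong' refl funcsetI finsum_closed) (simp_all add: r_distr)
    finally show ?case .
  qed
next
  case (add r s)
  have "HH.values ((r \<oplus>\<^bsub>T2\<^esub> s) \<otimes>\<^bsub>T2\<^esub> t) (n, m) =
      HH.values (r \<otimes>\<^bsub>T2\<^esub> t) (n, m) \<oplus> HH.values (s \<otimes>\<^bsub>T2\<^esub> t) (n, m)"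
    using add(1,2) n t by (simp add: HM.tensor_mult_add_left HM.tensor_mult_closed)
  also have "\<dots> = (\<Oplus>k\<in>carrier Q. \<Oplus>l\<in>carrier Q.
      HH.values r (k, l) \<otimes> HH.values t (inv\<^bsub>Q\<^esub> k \<otimes>\<^bsub>Q\<^esub> n, inv\<^bsub>Q\<^esub> l \<otimes>\<^bsub>Q\<^esub> m) \<oplus>
      HH.values s (k, l) \<otimes> HH.values t (inv\<^bsub>Q\<^esub> k \<otimes>\<^bsub>Q\<^esub> n, inv\<^bsub>Q\<^esub> l \<otimes>\<^bsub>Q\<^esub> m))"
    unfolding add(3,4) using add(1,2) n t by (intro finsum2_addf) simp_all
  also have "\<dots> = (\<Oplus>k\<in>carrier Q. \<Oplus>l\<in>carrier Q. HH.values (r \<oplus>\<^bsub>T2\<^esub> s) (k, l) \<otimes>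
      HH.values t (inv\<^bsub>Q\<^esub> k \<otimes>\<^bsub>Q\<^esub> n, inv\<^bsub>Q\<^esub> l \<otimes>\<^bsub>Q\<^esub> m))"
    using add(1,2) n t by (intro finsum_cong' refl funcsetI finsum_closed) (simp_all add: l_distr)
  finally show ?case .
qed

text \<open>Reindexing the sum by c \<tau> applies \<tau> to every term, so the sum is fixed by
  G.\<close>

lemma counit_K:
  assumes h: "h \<in> HC"
  shows "counit H h \<in> K"
proof (rule fixed)
  show "counit H h \<in> carrier M" using h by (auto simp: H_simps(7) intro!: finsum_closed)
  fix \<tau> assume \<tau>: "\<tau> \<in> G"
  have "counit H h = (\<Oplus>n\<in>carrier Q. f h (c \<tau> n))"
    unfolding H_simps(7) by (rule c_reindex[OF \<tau>]) (use h in auto)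
  also have "\<dots> = \<tau> (counit H h)"
    unfolding H_simps(7) using \<tau> h by (simp add: hom_finsum D_equivariant cong: finsum_cong)
  finally show "\<tau> (counit H h) = counit H h" by simp
qed

section \<open>The Hopf algebra axioms, checked on values\<close>

lemma comult_linear: "comult H \<in> module_hom R H T2"
  unfolding module_hom_def H_simps(1)
  by (intro CollectI conjI allI impI funcsetI T2_eqI) (auto simp: f_at)

text \<open>The diagonal of Q \<times> Q is a subgroup, so the convolution of two functions
  supported on it is supported there as well, and is there the convolution of h and h'.\<close>

lemma comult_ring_hom: "comult H \<in> Ring.ring_hom H T2"
proof (rule ring_hom_memI)
  fix h h' assume "h \<in> carrier H" "h' \<in> carrier H"
  then have h: "h \<in> HC" "h' \<in> HC" by (simp_all add: H_simps(1))
  show "comult H (h \<otimes>\<^bsub>H\<^esub> h') = comult H h \<otimes>\<^bsub>T2\<^esub> comult H h'"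
  proof (rule T2_eqI)
    fix n m assume n: "n \<in> carrier Q" "m \<in> carrier Q"
    have "HH.values (comult H h \<otimes>\<^bsub>T2\<^esub> comult H h') (n, m) = (\<Oplus>k\<in>carrier Q. \<Oplus>l\<in>carrier Q.
        if l = k then f h k \<otimes> (if inv\<^bsub>Q\<^esub> k \<otimes>\<^bsub>Q\<^esub> n = inv\<^bsub>Q\<^esub> l \<otimes>\<^bsub>Q\<^esub> m
          then f h' (inv\<^bsub>Q\<^esub> k \<otimes>\<^bsub>Q\<^esub> n) else \<zero>) else \<zero>)"
      using h n by (subst values_mult) (auto intro!: finsum_cong' finsum_closed)
    also have "\<dots> = (\<Oplus>k\<in>carrier Q. f h k \<otimes> (if inv\<^bsub>Q\<^esub> k \<otimes>\<^bsub>Q\<^esub> n = inv\<^bsub>Q\<^esub> k \<otimes>\<^bsub>Q\<^esub> m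
          then f h' (inv\<^bsub>Q\<^esub> k \<otimes>\<^bsub>Q\<^esub> n) else \<zero>))"
      using h n by (intro finsum_cong' refl funcsetI finsum_delta) auto
    also have "\<dots> = (if n = m then \<Oplus>k\<in>carrier Q. f h k \<otimes> f h' (inv\<^bsub>Q\<^esub> k \<otimes>\<^bsub>Q\<^esub> n) else \<zero>)"
    proof (cases "n = m")
      case False
      then have "inv\<^bsub>Q\<^esub> k \<otimes>\<^bsub>Q\<^esub> n \<noteq> inv\<^bsub>Q\<^esub> k \<otimes>\<^bsub>Q\<^esub> m" if "k \<in> carrier Q" for k
        using n that by simp
      then show ?thesis using False h by (auto intro!: add.finprod_one_eqI)
    qed simp
    finally show "HH.values (comult H (h \<otimes>\<^bsub>H\<^esub> h')) (n, m) =
        HH.values (comult H h \<otimes>\<^bsub>T2\<^esub> comult H h') (n, m)"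
      using h n by (simp add: f_at)
  qed (use h in \<open>simp_all add: HM.tensor_mult_closed\<close>)
next
  show "comult H \<one>\<^bsub>H\<^esub> = \<one>\<^bsub>T2\<^esub>"
    unfolding HM.tensor_one by (rule T2_eqI) (auto simp: f_at)
qed (use comult_linear in \<open>auto simp: H_simps(1) module_hom_def\<close>)

lemma counit_ring_hom: "counit H \<in> Ring.ring_hom H R"
proof (rule ring_hom_memI)
  fix h h' assume "h \<in> carrier H" "h' \<in> carrier H"
  then have h: "h \<in> HC" "h' \<in> HC" by (simp_all add: H_simps(1))
  show "counit H (h \<oplus>\<^bsub>H\<^esub> h') = counit H h \<oplus>\<^bsub>R\<^esub> counit H h'"
    unfolding H_simps(7) using h by (simp add: f_at finsum_addf Pi_def cong: finsum_cong)
  have "counit H (h \<otimes>\<^bsub>H\<^esub> h') =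
      (\<Oplus>n\<in>carrier Q. \<Oplus>m\<in>carrier Q. f h m \<otimes> f h' (inv\<^bsub>Q\<^esub> m \<otimes>\<^bsub>Q\<^esub> n))"
    unfolding H_simps(7) using h by (intro finsum_cong' refl funcsetI finsum_closed) (simp_all add: f_at)
  also have "\<dots> = (\<Oplus>m\<in>carrier Q. \<Oplus>n\<in>carrier Q. f h m \<otimes> f h' (inv\<^bsub>Q\<^esub> m \<otimes>\<^bsub>Q\<^esub> n))"
    using h by (intro finsum_swap) auto
  also have "\<dots> = (\<Oplus>m\<in>carrier Q. \<Oplus>n\<in>carrier Q. f h m \<otimes> f h' n)"
  proof (rule finsum_cong'[OF refl])
    fix m assume m: "m \<in> carrier Q"
    show "(\<Oplus>n\<in>carrier Q. f h m \<otimes> f h' (inv\<^bsub>Q\<^esub> m \<otimes>\<^bsub>Q\<^esub> n)) = (\<Oplus>n\<in>carrier Q. f h m \<otimes> f h' n)"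
      using h m by (intro Q_reindex[of "inv\<^bsub>Q\<^esub> m" "\<lambda>n. f h m \<otimes> f h' n", symmetric]) auto
  qed (use h in \<open>auto intro!: finsum_closed\<close>)
  also have "\<dots> = counit H h \<otimes> counit H h'"
    unfolding H_simps(7) using h by (intro finsum_mult[symmetric]) auto
  finally show "counit H (h \<otimes>\<^bsub>H\<^esub> h') = counit H h \<otimes>\<^bsub>R\<^esub> counit H h'" by simp
next
  show "counit H h \<in> carrier R" if "h \<in> carrier H" for h
    using counit_K that by (simp add: H_simps(1))
  have "counit H \<one>\<^bsub>H\<^esub> = (\<Oplus>n\<in>carrier Q. if n = \<one>\<^bsub>Q\<^esub> then \<one> else \<zero>)"
    unfolding H_simps(7) by (intro finsum_cong' refl funcsetI) (auto simp: f_at)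
  also have "\<dots> = \<one>" by (intro finsum_delta) auto
  finally show "counit H \<one>\<^bsub>H\<^esub> = \<one>\<^bsub>R\<^esub>" by simp
qed

lemma counit_smult:
  assumes "k \<in> K" "h \<in> HC"
  shows "counit H (k \<odot>\<^bsub>H\<^esub> h) = k \<otimes> counit H h"
proof -
  have "counit H (k \<odot>\<^bsub>H\<^esub> h) = (\<Oplus>n\<in>carrier Q. k \<otimes> f h n)"
    unfolding H_simps(7) using assms by (intro finsum_cong' refl funcsetI) (simp_all add: f_at)
  also have "\<dots> = k \<otimes> counit H h"
    unfolding H_simps(7) using assms by (intro finsum_rdistr[symmetric]) auto
  finally show ?thesis .
qed

lemma counit_add:
  "\<lbrakk>h \<in> HC; h' \<in> HC\<rbrakk> \<Longrightarrow> counit H (h \<oplus>\<^bsub>H\<^esub> h') = counit H h \<oplus> counit H h'"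
  using ring_hom_add[OF counit_ring_hom] by (simp add: H_simps(1))

lemma antipode_hom:
  "\<lbrakk>v \<in> HC; w \<in> HC\<rbrakk> \<Longrightarrow> antipode H (v \<oplus>\<^bsub>H\<^esub> w) = antipode H v \<oplus>\<^bsub>H\<^esub> antipode H w"
  "\<lbrakk>k \<in> K; v \<in> HC\<rbrakk> \<Longrightarrow> antipode H (k \<odot>\<^bsub>H\<^esub> v) = k \<odot>\<^bsub>H\<^esub> antipode H v"
  by (rule f_eqI; simp add: f_at)+

lemma antipode_linear: "antipode H \<in> module_hom R H H"
  unfolding module_hom_def by (auto simp: H_simps(1) antipode_hom)

lemma lifting_to_H:
  assumes "bilinear_map R H H H b"
  shows "tensor_lifting R H H H b"
  by (intro tensor_lifting.intro tensor_lifting_axioms.intro HH.TM.tensor_modules_axioms module_H assms)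

lemma values_sum_add:
  assumes "finite I" "\<And>i. i \<in> I \<Longrightarrow> \<pi> i \<in> carrier Q \<and> \<rho> i \<in> carrier Q"
    and "s \<in> carrier T2" "t \<in> carrier T2"
  shows "(\<Oplus>i\<in>I. HH.values (s \<oplus>\<^bsub>T2\<^esub> t) (\<pi> i, \<rho> i)) =
    (\<Oplus>i\<in>I. HH.values s (\<pi> i, \<rho> i)) \<oplus> (\<Oplus>i\<in>I. HH.values t (\<pi> i, \<rho> i))"
  using assms by (simp add: finsum_addf Pi_def cong: finsum_cong)

text \<open>Applying the counit to the left factor sums the values over the first argument; of the
  diagonal function only the term at n survives.\<close>

lemma counit_left_H:
  assumes h: "h \<in> HC"
  shows "tensor_lift R H (\<lambda>h1 h2. counit H h1 \<odot>\<^bsub>H\<^esub> h2) (comult H h) = h"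
proof -
  have bil: "bilinear_map R H H H (\<lambda>h1 h2. counit H h1 \<odot>\<^bsub>H\<^esub> h2)"
    by (intro bilinear_mapI)
      (auto simp: H_simps(1) counit_K counit_add counit_smult f_at l_distr r_distr m_assoc
        intro!: f_eqI m_lcomm)
  interpret t: tensor_lifting R H H H "\<lambda>h1 h2. counit H h1 \<odot>\<^bsub>H\<^esub> h2"
    by (rule lifting_to_H[OF bil])
  show ?thesis
  proof (rule f_eqI)
    fix n assume n: "n \<in> carrier Q"
    have "f (t.tlift (comult H h)) n = (\<Oplus>k\<in>carrier Q. HH.values (comult H h) (k, n))"
    proof (rule t.tensor_lift_eqI[where pl="add M"])
      fix v w assume "v \<in> carrier H" "w \<in> carrier H"
      then have vw: "v \<in> HC" "w \<in> HC" by (simp_all add: H_simps(1))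
      have "f (counit H v \<odot>\<^bsub>H\<^esub> w) n = (\<Oplus>k\<in>carrier Q. f v k) \<otimes> f w n"
        using vw n by (simp add: f_at counit_K) (simp add: H_simps(7))
      also have "\<dots> = (\<Oplus>k\<in>carrier Q. f v k \<otimes> f w n)"
        using vw n by (intro finsum_ldistr) auto
      finally show "f (counit H v \<odot>\<^bsub>H\<^esub> w) n = (\<Oplus>k\<in>carrier Q. HH.values (pure2 v w) (k, n))"
        using vw n by (simp cong: finsum_cong)
    qed (use h n in \<open>simp_all add: H_simps(1) f_at values_sum_add\<close>)
    also have "\<dots> = (\<Oplus>k\<in>carrier Q. if k = n then f h k else \<zero>)"
      using h n by (intro finsum_cong' refl funcsetI) auto
    also have "\<dots> = f h n" using h n by (intro finsum_delta) auto
    finally show "f (t.tlift (comult H h)) n = f h n" .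
  qed (use h t.tensor_lift_closed[of "comult H h"] in \<open>simp_all add: H_simps(1)\<close>)
qed

lemma counit_right_H:
  assumes h: "h \<in> HC"
  shows "tensor_lift R H (\<lambda>h1 h2. counit H h2 \<odot>\<^bsub>H\<^esub> h1) (comult H h) = h"
proof -
  have bil: "bilinear_map R H H H (\<lambda>h1 h2. counit H h2 \<odot>\<^bsub>H\<^esub> h1)"
    by (intro bilinear_mapI)
      (auto simp: H_simps(1) counit_K counit_add counit_smult f_at l_distr r_distr m_assoc
        intro!: f_eqI m_lcomm)
  interpret t: tensor_lifting R H H H "\<lambda>h1 h2. counit H h2 \<odot>\<^bsub>H\<^esub> h1"
    by (rule lifting_to_H[OF bil])
  show ?thesis
  proof (rule f_eqI)
    fix n assume n: "n \<in> carrier Q"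
    have "f (t.tlift (comult H h)) n = (\<Oplus>k\<in>carrier Q. HH.values (comult H h) (n, k))"
    proof (rule t.tensor_lift_eqI[where pl="add M"])
      fix v w assume "v \<in> carrier H" "w \<in> carrier H"
      then have vw: "v \<in> HC" "w \<in> HC" by (simp_all add: H_simps(1))
      have "f (counit H w \<odot>\<^bsub>H\<^esub> v) n = (\<Oplus>k\<in>carrier Q. f w k) \<otimes> f v n"
        using vw n by (simp add: f_at counit_K) (simp add: H_simps(7))
      also have "\<dots> = (\<Oplus>k\<in>carrier Q. f w k \<otimes> f v n)"
        using vw n by (intro finsum_ldistr) auto
      finally show "f (counit H w \<odot>\<^bsub>H\<^esub> v) n = (\<Oplus>k\<in>carrier Q. HH.values (pure2 v w) (n, k))"
        using vw n by (simp add: m_comm cong: finsum_cong)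
    qed (use h n in \<open>simp_all add: H_simps(1) f_at values_sum_add\<close>)
    also have "\<dots> = (\<Oplus>k\<in>carrier Q. if k = n then f h k else \<zero>)"
      using h n by (intro finsum_cong' refl funcsetI) auto
    also have "\<dots> = f h n" using h n by (intro finsum_delta) auto
    finally show "f (t.tlift (comult H h)) n = f h n" .
  qed (use h t.tensor_lift_closed[of "comult H h"] in \<open>simp_all add: H_simps(1)\<close>)
qed

lemma inj_inv: "inj_on (m_inv Q) (carrier Q)"
  by (rule inj_onI) (metis Q.inv_inv)

lemma antipode_left_H:
  assumes h: "h \<in> HC"
  shows "tensor_lift R H (\<lambda>h1 h2. antipode H h1 \<otimes>\<^bsub>H\<^esub> h2) (comult H h) = counit H h \<odot>\<^bsub>H\<^esub> \<one>\<^bsub>H\<^esub>"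
proof -
  have bil: "bilinear_map R H H H (\<lambda>h1 h2. antipode H h1 \<otimes>\<^bsub>H\<^esub> h2)"
    by (intro bilinear_mapI) (simp_all add: H_simps(1) antipode_hom HA.A_ring.l_distr HA.A_ring.r_distr
        HA.smult_mult_left HA.smult_mult_right)
  interpret t: tensor_lifting R H H H "\<lambda>h1 h2. antipode H h1 \<otimes>\<^bsub>H\<^esub> h2"
    by (rule lifting_to_H[OF bil])
  show ?thesis
  proof (rule f_eqI)
    fix n assume n: "n \<in> carrier Q"
    \<comment> \<open>On a pure tensor of v and w the left side is the sum over m of v(m^-1) w(m^-1
      n). The two arguments meet on the diagonal exactly if n = 1.\<close>
    have "f (t.tlift (comult H h)) n =
        (\<Oplus>m\<in>carrier Q. HH.values (comult H h) (inv\<^bsub>Q\<^esub> m, inv\<^bsub>Q\<^esub> m \<otimes>\<^bsub>Q\<^esub> n))"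
    proof (rule t.tensor_lift_eqI[where pl="add M"])
      fix v w assume "v \<in> carrier H" "w \<in> carrier H"
      then show "f (antipode H v \<otimes>\<^bsub>H\<^esub> w) n =
          (\<Oplus>m\<in>carrier Q. HH.values (pure2 v w) (inv\<^bsub>Q\<^esub> m, inv\<^bsub>Q\<^esub> m \<otimes>\<^bsub>Q\<^esub> n))"
        using n by (simp add: f_at H_simps(1) cong: finsum_cong)
    qed (use h n in \<open>simp_all add: H_simps(1) f_at values_sum_add\<close>)
    also have "\<dots> = (\<Oplus>m\<in>carrier Q. if n = \<one>\<^bsub>Q\<^esub> then f h (inv\<^bsub>Q\<^esub> m) else \<zero>)"
      using h n by (intro finsum_cong' refl funcsetI) auto
    also have "\<dots> = (if n = \<one>\<^bsub>Q\<^esub> then \<Oplus>m\<in>carrier Q. f h (inv\<^bsub>Q\<^esub> m) else \<zero>)"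
      by simp
    also have "(\<Oplus>m\<in>carrier Q. f h (inv\<^bsub>Q\<^esub> m)) = counit H h"
      unfolding H_simps(7)
      by (rule finsum_reindex_onto[OF inj_inv endo_inj_surj[OF finite_Q _ inj_inv], symmetric])
        (use h in auto)
    finally show "f (t.tlift (comult H h)) n = f (counit H h \<odot>\<^bsub>H\<^esub> \<one>\<^bsub>H\<^esub>) n"
      using n h by (simp add: f_at counit_K)
  qed (use h t.tensor_lift_closed[of "comult H h"] in \<open>simp_all add: H_simps(1) counit_K\<close>)
qed

lemma antipode_right_H:
  assumes h: "h \<in> HC"
  shows "tensor_lift R H (\<lambda>h1 h2. h1 \<otimes>\<^bsub>H\<^esub> antipode H h2) (comult H h) = counit H h \<odot>\<^bsub>H\<^esub> \<one>\<^bsub>H\<^esub>"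
proof -
  have bil: "bilinear_map R H H H (\<lambda>h1 h2. h1 \<otimes>\<^bsub>H\<^esub> antipode H h2)"
    by (intro bilinear_mapI) (simp_all add: H_simps(1) antipode_hom HA.A_ring.l_distr HA.A_ring.r_distr
        HA.smult_mult_left HA.smult_mult_right)
  interpret t: tensor_lifting R H H H "\<lambda>h1 h2. h1 \<otimes>\<^bsub>H\<^esub> antipode H h2"
    by (rule lifting_to_H[OF bil])
  show ?thesis
  proof (rule f_eqI)
    fix n assume n: "n \<in> carrier Q"
    \<comment> \<open>Here the arguments are m and (m^-1 n)^-1 = n^-1 m, which again agree exactly
      if n = 1.\<close>
    have "f (t.tlift (comult H h)) n =
        (\<Oplus>m\<in>carrier Q. HH.values (comult H h) (m, inv\<^bsub>Q\<^esub> (inv\<^bsub>Q\<^esub> m \<otimes>\<^bsub>Q\<^esub> n)))"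
    proof (rule t.tensor_lift_eqI[where pl="add M"])
      fix v w assume "v \<in> carrier H" "w \<in> carrier H"
      then show "f (v \<otimes>\<^bsub>H\<^esub> antipode H w) n =
          (\<Oplus>m\<in>carrier Q. HH.values (pure2 v w) (m, inv\<^bsub>Q\<^esub> (inv\<^bsub>Q\<^esub> m \<otimes>\<^bsub>Q\<^esub> n)))"
        using n by (simp add: f_at H_simps(1) cong: finsum_cong)
    qed (use h n in \<open>simp_all add: H_simps(1) f_at values_sum_add\<close>)
    also have "\<dots> = (\<Oplus>m\<in>carrier Q. if n = \<one>\<^bsub>Q\<^esub> then f h m else \<zero>)"
    proof (intro finsum_cong' refl funcsetI)
      fix m assume m: "m \<in> carrier Q"
      have "m = inv\<^bsub>Q\<^esub> (inv\<^bsub>Q\<^esub> m \<otimes>\<^bsub>Q\<^esub> n) \<longleftrightarrow> n = \<one>\<^bsub>Q\<^esub>"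
        using m n Q.r_cancel_one[of m "inv\<^bsub>Q\<^esub> n"] by (auto simp: Q.inv_mult_group)
      then show "HH.values (comult H h) (m, inv\<^bsub>Q\<^esub> (inv\<^bsub>Q\<^esub> m \<otimes>\<^bsub>Q\<^esub> n)) =
          (if n = \<one>\<^bsub>Q\<^esub> then f h m else \<zero>)"
        using h m n by simp
    qed (use h in auto)
    also have "\<dots> = (if n = \<one>\<^bsub>Q\<^esub> then counit H h else \<zero>)"
      by (simp add: H_simps(7))
    finally show "f (t.tlift (comult H h)) n = f (counit H h \<odot>\<^bsub>H\<^esub> \<one>\<^bsub>H\<^esub>) n"
      using n h by (simp add: f_at counit_K)
  qed (use h t.tensor_lift_closed[of "comult H h"] in \<open>simp_all add: H_simps(1) counit_K\<close>)
qed

text \<open>Exchanging the factors exchanges the arguments, and the diagonal function is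
  symmetric.\<close>

lemma cocomm_H:
  assumes h: "h \<in> HC"
  shows "tensor_lift R T2 (\<lambda>h1 h2. pure2 h2 h1) (comult H h) = comult H h"
proof -
  have bil: "bilinear_map R H H T2 (\<lambda>h1 h2. pure2 h2 h1)"
    by (intro bilinear_mapI)
      (simp_all add: HH.TM.pure_add_left HH.TM.pure_add_right HH.TM.pure_smult_left HH.TM.pure_smult_right)
  interpret t: tensor_lifting R H H T2 "\<lambda>h1 h2. pure2 h2 h1"
    by (intro tensor_lifting.intro tensor_lifting_axioms.intro HH.TM.tensor_modules_axioms
        HH.TM.T.module_axioms bil)
  show ?thesis
  proof (rule T2_eqI)
    fix n m assume n: "n \<in> carrier Q" "m \<in> carrier Q"
    have "HH.values (t.tlift (comult H h)) (n, m) = HH.values (comult H h) (m, n)"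
    proof (rule t.tensor_lift_eqI[where pl="add M" and \<phi>="\<lambda>u. HH.values u (n, m)"
          and \<psi>="\<lambda>u. HH.values u (m, n)"])
      fix v w assume "v \<in> carrier H" "w \<in> carrier H"
      then show "HH.values (pure2 w v) (n, m) = HH.values (pure2 v w) (m, n)"
        using n by (simp add: H_simps(1) m_comm)
    qed (use h n in simp_all)
    then show "HH.values (t.tlift (comult H h)) (n, m) = HH.values (comult H h) (n, m)"
      using h n by auto
  qed (use h t.tensor_lift_closed[of "comult H h"] in simp_all)
qed

abbreviation "T3 \<equiv> tensor R H T2"
abbreviation "pure3 \<equiv> pure_tensor R H T2"

lemma T3_eqI:
  "\<lbrakk>s \<in> carrier T3; t \<in> carrier T3;
    \<And>n m k. \<lbrakk>n \<in> carrier Q; m \<in> carrier Q; k \<in> carrier Q\<rbrakk> \<Longrightarrow>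
      HHH.values s (n, m, k) = HHH.values t (n, m, k)\<rbrakk> \<Longrightarrow> s = t"
  by (rule HHH.T.\<iota>_inj) auto

lemma values3_simps [simp]:
  assumes "n \<in> carrier Q" "m \<in> carrier Q" "k \<in> carrier Q"
  shows "t \<in> carrier T3 \<Longrightarrow> HHH.values t (n, m, k) \<in> carrier M"
    "\<lbrakk>s \<in> carrier T3; t \<in> carrier T3\<rbrakk> \<Longrightarrow>
      HHH.values (s \<oplus>\<^bsub>T3\<^esub> t) (n, m, k) = HHH.values s (n, m, k) \<oplus> HHH.values t (n, m, k)"
    "\<lbrakk>r \<in> K; t \<in> carrier T3\<rbrakk> \<Longrightarrow> HHH.values (r \<odot>\<^bsub>T3\<^esub> t) (n, m, k) = r \<otimes> HHH.values t (n, m, k)"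
    "\<lbrakk>h \<in> HC; u \<in> carrier T2\<rbrakk> \<Longrightarrow> HHH.values (pure3 h u) (n, m, k) = f h n \<otimes> HH.values u (m, k)"
  using assms HHH.values_closed[of "(n, m, k)"] HHH.values_add[of "(n, m, k)"]
    HHH.values_smult[of "(n, m, k)"] HHH.values_pure[of "(n, m, k)"]
  by (simp_all add: H_simps(1))

lemma lifting_to_T3:
  assumes "bilinear_map R H H T3 b"
  shows "tensor_lifting R H H T3 b"
  by (intro tensor_lifting.intro tensor_lifting_axioms.intro HH.TM.tensor_modules_axioms
      HHH.TM.T.module_axioms assms)

lemma coassoc_H:
  assumes h: "h \<in> HC"
  shows "tensor_lift R T3
        (\<lambda>h1 h2. tensor_lift R T3 (\<lambda>h11 h12. pure3 h11 (pure2 h12 h2)) (comult H h1)) (comult H h)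
      = tensor_lift R T3 (\<lambda>h1 h2. pure3 h1 (comult H h2)) (comult H h)"
proof -
  have "bilinear_map R H H T3 (\<lambda>h11 h12. pure3 h11 (pure2 h12 h2))" if "h2 \<in> HC" for h2
    using that by (intro bilinear_mapI T3_eqI)
      (simp_all add: H_simps(1) f_at l_distr r_distr m_ac)
  note inner = this[THEN lifting_to_T3]
  \<comment> \<open>Comultiplication of the left factor followed by the associator. Its values are
    computed before it is lifted, because its bilinearity is read off from them too.\<close>
  define \<beta> where "\<beta> h1 h2 = tensor_lift R T3 (\<lambda>h11 h12. pure3 h11 (pure2 h12 h2)) (comult H h1)"
    for h1 h2
  have \<beta>_closed: "\<beta> h1 h2 \<in> carrier T3" if "h1 \<in> HC" "h2 \<in> HC" for h1 h2
    unfolding \<beta>_def using tensor_lifting.tensor_lift_closed[OF inner[OF that(2)]] that by simp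
  have \<beta>_values: "HHH.values (\<beta> h1 h2) (n, m, k) = (if n = m then f h1 n \<otimes> f h2 k else \<zero>)"
    if "h1 \<in> HC" "h2 \<in> HC" "n \<in> carrier Q" "m \<in> carrier Q" "k \<in> carrier Q" for h1 h2 n m k
  proof -
    have "HHH.values (\<beta> h1 h2) (n, m, k) = HH.values (comult H h1) (n, m) \<otimes> f h2 k"
      unfolding \<beta>_def
    proof (rule tensor_lifting.tensor_lift_eqI[OF inner[OF that(2)], where pl="add M"
          and \<phi>="\<lambda>u. HHH.values u (n, m, k)" and \<psi>="\<lambda>u. HH.values u (n, m) \<otimes> f h2 k"])
      fix v w assume "v \<in> carrier H" "w \<in> carrier H"
      then show "HHH.values (pure3 v (pure2 w h2)) (n, m, k) = HH.values (pure2 v w) (n, m) \<otimes> f h2 k"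
        using that by (simp add: H_simps(1) m_assoc)
    qed (use that in \<open>simp_all add: l_distr\<close>)
    then show ?thesis using that by simp
  qed
  have bil1: "bilinear_map R H H T3 \<beta>"
    by (intro bilinear_mapI T3_eqI)
      (simp_all add: H_simps(1) \<beta>_closed \<beta>_values f_at l_distr r_distr m_ac)
  have bil2: "bilinear_map R H H T3 (\<lambda>h1 h2. pure3 h1 (comult H h2))"
    by (intro bilinear_mapI T3_eqI)
      (simp_all add: H_simps(1) f_at l_distr r_distr m_ac)
  interpret t1: tensor_lifting R H H T3 \<beta> by (rule lifting_to_T3[OF bil1])
  interpret t2: tensor_lifting R H H T3 "\<lambda>h1 h2. pure3 h1 (comult H h2)"
    by (rule lifting_to_T3[OF bil2])
  have "t1.tlift (comult H h) = t2.tlift (comult H h)"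
  proof (rule T3_eqI)
    fix n m k assume q: "n \<in> carrier Q" "m \<in> carrier Q" "k \<in> carrier Q"
    \<comment> \<open>Both sides turn out to have the value f h n at (n, n, n) and zero
      elsewhere.\<close>
    have "HHH.values (t1.tlift (comult H h)) (n, m, k) =
        (if n = m then HH.values (comult H h) (n, k) else \<zero>)"
      by (rule t1.tensor_lift_eqI[where pl="add M" and \<phi>="\<lambda>u. HHH.values u (n, m, k)"
          and \<psi>="\<lambda>u. if n = m then HH.values u (n, k) else \<zero>"])
        (use h q in \<open>simp_all add: H_simps(1) \<beta>_values\<close>)
    moreover have "HHH.values (t2.tlift (comult H h)) (n, m, k) =
        (if m = k then HH.values (comult H h) (n, m) else \<zero>)"
      by (rule t2.tensor_lift_eqI[where pl="add M" and \<phi>="\<lambda>u. HHH.values u (n, m, k)"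
          and \<psi>="\<lambda>u. if m = k then HH.values u (n, m) else \<zero>"])
        (use h q in \<open>simp_all add: H_simps(1)\<close>)
    ultimately show "HHH.values (t1.tlift (comult H h)) (n, m, k) =
        HHH.values (t2.tlift (comult H h)) (n, m, k)"
      using h q by auto
  qed (use h t1.tensor_lift_closed[of "comult H h"] t2.tensor_lift_closed[of "comult H h"] in simp_all)
  then show ?thesis unfolding \<beta>_def .
qed

theorem cocommutative_hopf_algebra_H: "cocommutative_hopf_algebra R H"
proof (intro cocommutative_hopf_algebra.intro hopf_algebra.intro assoc_algebra_H
    hopf_algebra_axioms.intro cocommutative_hopf_algebra_axioms.intro)
  show "counit H (k \<odot>\<^bsub>H\<^esub> h) = k \<otimes>\<^bsub>R\<^esub> counit H h" if "k \<in> carrier R" "h \<in> carrier H" for k h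
    using that counit_smult by (simp add: H_simps(1))
qed (simp_all only: H_simps(1) comult_ring_hom comult_linear counit_ring_hom antipode_linear
    coassoc_H counit_left_H counit_right_H antipode_left_H antipode_right_H cocomm_H)

end

section \<open>The Hopf Galois structure\<close>

lemma additive_finsum:
  assumes "abelian_group V" "abelian_group W"
    and closed: "\<And>x. x \<in> carrier V \<Longrightarrow> \<phi> x \<in> carrier W"
    and add: "\<And>x y. \<lbrakk>x \<in> carrier V; y \<in> carrier V\<rbrakk> \<Longrightarrow> \<phi> (x \<oplus>\<^bsub>V\<^esub> y) = \<phi> x \<oplus>\<^bsub>W\<^esub> \<phi> y"
    and f: "\<And>i. i \<in> I \<Longrightarrow> f i \<in> carrier V" and I: "finite I"
  shows "\<phi> (\<Oplus>\<^bsub>V\<^esub>i\<in>I. f i) = (\<Oplus>\<^bsub>W\<^esub>i\<in>I. \<phi> (f i))"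
proof -
  interpret V: abelian_group V by fact
  interpret W: abelian_group W by fact
  have "\<phi> \<zero>\<^bsub>V\<^esub> \<oplus>\<^bsub>W\<^esub> \<phi> \<zero>\<^bsub>V\<^esub> = \<phi> \<zero>\<^bsub>V\<^esub>" using add[of "\<zero>\<^bsub>V\<^esub>" "\<zero>\<^bsub>V\<^esub>"] by simp
  then have zero: "\<phi> \<zero>\<^bsub>V\<^esub> = \<zero>\<^bsub>W\<^esub>" using closed[of "\<zero>\<^bsub>V\<^esub>"] by simp
  show ?thesis
    using I f
    by (induction I rule: finite_induct) (simp_all add: zero add closed Pi_def)
qed

text \<open>This serves to compare comultiplications: H \<otimes> H is formed over K but is mapped
  into the tensor square of M[Q] over M.\<close>

lemma module_restrict_scalars:
  assumes "Module.module M P" "subfield K M" "field M"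
  shows "Module.module (M\<lparr>carrier := K\<rparr>) P"
proof -
  interpret P: Module.module M P by fact
  have K: "K \<subseteq> carrier M" using assms(2) subfieldE(3) by blast
  have "cring (M\<lparr>carrier := K\<rparr>)"
    by (rule fieldE(1)[OF ring.subfield_iff(2)[OF P.R.ring_axioms assms(2)]])
  then show ?thesis
    using K P.abelian_group_axioms
    by (intro Module.moduleI) (auto simp: P.smult_l_distr P.smult_r_distr P.smult_assoc1 subset_iff)
qed

section \<open>K-linear endomorphisms of L and the action of H\<close>

context hopf_model
begin

abbreviation "EndL \<equiv> end_algebra R LA"

lemma End_simps:
  "carrier EndL = module_hom R LA LA \<inter> extensional L"
  "\<phi> \<oplus>\<^bsub>EndL\<^esub> \<psi> = (\<lambda>y\<in>L. \<phi> y \<oplus> \<psi> y)"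
  "k \<odot>\<^bsub>EndL\<^esub> \<phi> = (\<lambda>y\<in>L. k \<otimes> \<phi> y)"
  "\<phi> \<otimes>\<^bsub>EndL\<^esub> \<psi> = compose L \<phi> \<psi>"
  "\<one>\<^bsub>EndL\<^esub> = (\<lambda>y\<in>L. y)"
  "\<zero>\<^bsub>EndL\<^esub> = (\<lambda>y\<in>L. \<zero>)"
  by (simp_all add: end_algebra_def LA_simps)

lemma End_iff:
  "\<phi> \<in> carrier EndL \<longleftrightarrow> \<phi> \<in> extensional L \<and> (\<forall>y\<in>L. \<phi> y \<in> L) \<and>
     (\<forall>y\<in>L. \<forall>z\<in>L. \<phi> (y \<oplus> z) = \<phi> y \<oplus> \<phi> z) \<and> (\<forall>k\<in>K. \<forall>y\<in>L. \<phi> (k \<otimes> y) = k \<otimes> \<phi> y)"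
  by (auto simp: End_simps(1) module_hom_def LA_simps)

lemma End_value [simp]: "\<lbrakk>\<phi> \<in> carrier EndL; y \<in> L\<rbrakk> \<Longrightarrow> \<phi> y \<in> L"
  by (simp add: End_iff)

lemma End_hom:
  "\<lbrakk>\<phi> \<in> carrier EndL; y \<in> L; z \<in> L\<rbrakk> \<Longrightarrow> \<phi> (y \<oplus> z) = \<phi> y \<oplus> \<phi> z"
  "\<lbrakk>\<phi> \<in> carrier EndL; k \<in> K; y \<in> L\<rbrakk> \<Longrightarrow> \<phi> (k \<otimes> y) = k \<otimes> \<phi> y"
  by (simp_all add: End_iff)

lemma End_eqI:
  "\<lbrakk>\<phi> \<in> carrier EndL; \<psi> \<in> carrier EndL; \<And>y. y \<in> L \<Longrightarrow> \<phi> y = \<psi> y\<rbrakk> \<Longrightarrow> \<phi> = \<psi>"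
  by (rule extensionalityI[of _ L]) (auto simp: End_iff)

lemma End_closed:
  "\<zero>\<^bsub>EndL\<^esub> \<in> carrier EndL"
  "\<lbrakk>\<phi> \<in> carrier EndL; \<psi> \<in> carrier EndL\<rbrakk> \<Longrightarrow> \<phi> \<oplus>\<^bsub>EndL\<^esub> \<psi> \<in> carrier EndL"
  "\<lbrakk>k \<in> K; \<phi> \<in> carrier EndL\<rbrakk> \<Longrightarrow> k \<odot>\<^bsub>EndL\<^esub> \<phi> \<in> carrier EndL"
  by (intro End_iff[THEN iffD2] conjI ballI;
    simp add: End_simps(2,3,6) End_hom a_ac r_distr m_lcomm)+

lemma End_at:
  assumes "y \<in> L"
  shows "(\<phi> \<oplus>\<^bsub>EndL\<^esub> \<psi>) y = \<phi> y \<oplus> \<psi> y" "(k \<odot>\<^bsub>EndL\<^esub> \<phi>) y = k \<otimes> \<phi> y" "\<zero>\<^bsub>EndL\<^esub> y = \<zero>"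
  using assms by (simp_all add: End_simps)

lemma module_End: "Module.module R EndL"
proof (rule module_criteria)
  show "cring R" using field_R by (rule fieldE)
  show "\<forall>\<phi>\<in>carrier EndL. \<exists>\<psi>\<in>carrier EndL. \<phi> \<oplus>\<^bsub>EndL\<^esub> \<psi> = \<zero>\<^bsub>EndL\<^esub>"
  proof
    fix \<phi> assume \<phi>: "\<phi> \<in> carrier EndL"
    have c: "(\<ominus> \<one>) \<odot>\<^bsub>EndL\<^esub> \<phi> \<in> carrier EndL" using \<phi> by (intro End_closed) auto
    have "\<phi> \<oplus>\<^bsub>EndL\<^esub> ((\<ominus> \<one>) \<odot>\<^bsub>EndL\<^esub> \<phi>) = \<zero>\<^bsub>EndL\<^esub>"
      by (rule End_eqI) (use \<phi> c in \<open>auto simp: End_closed End_at l_minus r_neg\<close>)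
    then show "\<exists>\<psi>\<in>carrier EndL. \<phi> \<oplus>\<^bsub>EndL\<^esub> \<psi> = \<zero>\<^bsub>EndL\<^esub>" using c by blast
  qed
qed (auto simp: End_closed End_at a_ac m_assoc l_distr r_distr intro!: End_eqI)

definition \<mu> :: "'h \<Rightarrow> 'a \<Rightarrow> 'a" where
  "\<mu> h = (\<lambda>y\<in>L. \<Oplus>n\<in>carrier Q. f h n \<otimes> ev (act (inv\<^bsub>Q\<^esub> n) x0) y)"

lemma L_eqI: "\<lbrakk>y \<in> L; z \<in> L; \<And>C. C \<in> \<Omega> \<Longrightarrow> ev C y = ev C z\<rbrakk> \<Longrightarrow> y = z"
  using L.\<iota>_inj[of y z] by (simp add: LA_simps)

text \<open>The sum that defines \<mu> belongs to the point x0. Formed at every C, it is an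
  equivariant function on \<Omega> and so comes from an element of L, whose value at x0 is \<mu> h
  y. This shows that \<mu> h maps L into L and also computes every embedding of the result.\<close>

lemma \<mu>_closed [simp]: "\<lbrakk>h \<in> HC; y \<in> L\<rbrakk> \<Longrightarrow> \<mu> h y \<in> L"
  and ev_\<mu>: "\<lbrakk>h \<in> HC; y \<in> L; C \<in> \<Omega>\<rbrakk> \<Longrightarrow>
    ev C (\<mu> h y) = (\<Oplus>n\<in>carrier Q. f h n \<otimes> ev (act (inv\<^bsub>Q\<^esub> n) C) y)"
proof -
  assume h: "h \<in> HC" and y: "y \<in> L"
  let ?x = "\<lambda>C. \<Oplus>n\<in>carrier Q. f h n \<otimes> ev (act (inv\<^bsub>Q\<^esub> n) C) y"
  have "\<exists>l\<in>carrier LA. \<forall>C\<in>\<Omega>. ev C l = ?x C"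
  proof (rule L.descend)
    fix \<tau> C assume \<tau>: "\<tau> \<in> G" and C: "C \<in> \<Omega>"
    have "?x (a \<tau> C) = (\<Oplus>n\<in>carrier Q. f h (c \<tau> n) \<otimes> ev (act (inv\<^bsub>Q\<^esub> (c \<tau> n)) (a \<tau> C)) y)"
      by (rule c_reindex[OF \<tau>]) (use h y \<tau> C in auto)
    also have "\<dots> = (\<Oplus>n\<in>carrier Q. \<tau> (f h n \<otimes> ev (act (inv\<^bsub>Q\<^esub> n) C) y))"
      using h y \<tau> C
      by (intro finsum_cong' refl funcsetI) (simp_all add: c_inv[symmetric] c_act ev_a D_equivariant)
    also have "\<dots> = \<tau> (?x C)" using h y \<tau> C by (intro hom_finsum[symmetric]) auto
    finally show "?x (a \<tau> C) = \<tau> (?x C)" .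
  qed (use h y in \<open>auto intro!: finsum_closed\<close>)
  then obtain l where l: "l \<in> L" "\<And>C. C \<in> \<Omega> \<Longrightarrow> ev C l = ?x C" by (auto simp: LA_simps)
  have "\<mu> h y = l" using l(2)[OF x0] l(1) y by (simp add: \<mu>_def ev_x0)
  then show "\<mu> h y \<in> L" "C \<in> \<Omega> \<Longrightarrow> ev C (\<mu> h y) = ?x C" using l by auto
qed

lemma \<mu>_add:
  "\<lbrakk>h \<in> HC; y \<in> L; z \<in> L\<rbrakk> \<Longrightarrow> \<mu> h (y \<oplus> z) = \<mu> h y \<oplus> \<mu> h z"
  by (rule L_eqI) (simp_all add: ev_\<mu> ev_add r_distr finsum_addf Pi_def cong: finsum_cong)

lemma \<mu>_smult:
  assumes "h \<in> HC" "y \<in> L" "k \<in> K"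
  shows "\<mu> h (k \<otimes> y) = k \<otimes> \<mu> h y"
proof (rule L_eqI)
  fix C assume C: "C \<in> \<Omega>"
  have "ev C (\<mu> h (k \<otimes> y)) = (\<Oplus>n\<in>carrier Q. k \<otimes> (f h n \<otimes> ev (act (inv\<^bsub>Q\<^esub> n) C) y))"
    using assms C unfolding ev_\<mu>[OF assms(1) L_ops(4)[OF K_in_L[OF assms(3)] assms(2)] C]
    by (intro finsum_cong' refl funcsetI) (simp_all add: ev_mult ev_K m_lcomm)
  also have "\<dots> = k \<otimes> (\<Oplus>n\<in>carrier Q. f h n \<otimes> ev (act (inv\<^bsub>Q\<^esub> n) C) y)"
    using assms C by (intro finsum_rdistr[symmetric]) auto
  also have "\<dots> = ev C (k \<otimes> \<mu> h y)"
    using assms C by (simp add: ev_mult ev_K ev_\<mu>)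
  finally show "ev C (\<mu> h (k \<otimes> y)) = ev C (k \<otimes> \<mu> h y)" .
qed (use assms in auto)

lemma \<mu>_add_left:
  "\<lbrakk>h \<in> HC; h' \<in> HC; y \<in> L\<rbrakk> \<Longrightarrow> \<mu> (h \<oplus>\<^bsub>H\<^esub> h') y = \<mu> h y \<oplus> \<mu> h' y"
  by (rule L_eqI) (simp_all add: ev_\<mu> ev_add f_at l_distr finsum_addf Pi_def cong: finsum_cong)

lemma \<mu>_smult_left:
  assumes "h \<in> HC" "y \<in> L" "k \<in> K"
  shows "\<mu> (k \<odot>\<^bsub>H\<^esub> h) y = k \<otimes> \<mu> h y"
proof (rule L_eqI)
  fix C assume C: "C \<in> \<Omega>"
  have "ev C (\<mu> (k \<odot>\<^bsub>H\<^esub> h) y) = (\<Oplus>n\<in>carrier Q. k \<otimes> (f h n \<otimes> ev (act (inv\<^bsub>Q\<^esub> n) C) y))"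
    using assms C unfolding ev_\<mu>[OF H_closed(5)[OF assms(3,1)] assms(2) C]
    by (intro finsum_cong' refl funcsetI) (simp_all add: f_at m_assoc)
  also have "\<dots> = k \<otimes> (\<Oplus>n\<in>carrier Q. f h n \<otimes> ev (act (inv\<^bsub>Q\<^esub> n) C) y)"
    using assms C by (intro finsum_rdistr[symmetric]) auto
  also have "\<dots> = ev C (k \<otimes> \<mu> h y)"
    using assms C by (simp add: ev_mult ev_K ev_\<mu>)
  finally show "ev C (\<mu> (k \<odot>\<^bsub>H\<^esub> h) y) = ev C (k \<otimes> \<mu> h y)" .
qed (use assms in auto)

lemma \<mu>_End [simp]: "h \<in> HC \<Longrightarrow> \<mu> h \<in> carrier EndL"
  unfolding End_iff by (auto simp: \<mu>_add \<mu>_smult) (simp add: \<mu>_def)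

text \<open>The inverse in the definition of \<mu> makes H act from the left: (m n)^-1 applies m^-1
  first and then n^-1, as the composite of the two actions does.\<close>

lemma \<mu>_mult:
  assumes h: "h \<in> HC" "h' \<in> HC" and y: "y \<in> L"
  shows "\<mu> (h \<otimes>\<^bsub>H\<^esub> h') y = \<mu> h (\<mu> h' y)"
proof (rule L_eqI)
  fix C assume C: "C \<in> \<Omega>"
  let ?N = "carrier Q"
  have act: "act (inv\<^bsub>Q\<^esub> (m \<otimes>\<^bsub>Q\<^esub> n)) C = act (inv\<^bsub>Q\<^esub> n) (act (inv\<^bsub>Q\<^esub> m) C)"
    if "m \<in> ?N" "n \<in> ?N" for m n
    using that C by (simp add: Q.inv_mult_group act_mult)
  have "ev C (\<mu> (h \<otimes>\<^bsub>H\<^esub> h') y) = (\<Oplus>n\<in>?N. (\<Oplus>m\<in>?N. f h m \<otimes> f h' (inv\<^bsub>Q\<^esub> m \<otimes>\<^bsub>Q\<^esub> n)) \<otimes>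
      ev (act (inv\<^bsub>Q\<^esub> n) C) y)"
    using h y C unfolding ev_\<mu>[OF H_closed(4)[OF h] y C]
    by (intro finsum_cong' refl funcsetI m_closed finsum_closed) (simp_all add: f_at)
  also have "\<dots> = (\<Oplus>n\<in>?N. \<Oplus>m\<in>?N. f h m \<otimes> f h' (inv\<^bsub>Q\<^esub> m \<otimes>\<^bsub>Q\<^esub> n) \<otimes> ev (act (inv\<^bsub>Q\<^esub> n) C) y)"
    using h y C by (intro finsum_cong' refl funcsetI m_closed finsum_closed finsum_ldistr) auto
  also have "\<dots> = (\<Oplus>m\<in>?N. \<Oplus>n\<in>?N. f h m \<otimes> f h' (inv\<^bsub>Q\<^esub> m \<otimes>\<^bsub>Q\<^esub> n) \<otimes> ev (act (inv\<^bsub>Q\<^esub> n) C) y)"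
    using h y C by (intro finsum_swap) auto
  also have "\<dots> = (\<Oplus>m\<in>?N. f h m \<otimes> ev (act (inv\<^bsub>Q\<^esub> m) C) (\<mu> h' y))"
  proof (rule finsum_cong'[OF refl])
    fix m assume m: "m \<in> ?N"
    have "(\<Oplus>n\<in>?N. f h m \<otimes> f h' (inv\<^bsub>Q\<^esub> m \<otimes>\<^bsub>Q\<^esub> n) \<otimes> ev (act (inv\<^bsub>Q\<^esub> n) C) y) =
        (\<Oplus>n\<in>?N. f h m \<otimes> f h' (inv\<^bsub>Q\<^esub> m \<otimes>\<^bsub>Q\<^esub> (m \<otimes>\<^bsub>Q\<^esub> n)) \<otimes> ev (act (inv\<^bsub>Q\<^esub> (m \<otimes>\<^bsub>Q\<^esub> n)) C) y)"
      using h y C m by (intro Q_reindex[of m]) auto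
    also have "\<dots> = (\<Oplus>n\<in>?N. f h m \<otimes> (f h' n \<otimes> ev (act (inv\<^bsub>Q\<^esub> n) (act (inv\<^bsub>Q\<^esub> m) C)) y))"
      using h y C m
      by (intro finsum_cong' refl funcsetI) (simp_all add: act Q.m_assoc[symmetric] m_assoc)
    also have "\<dots> = f h m \<otimes> (\<Oplus>n\<in>?N. f h' n \<otimes> ev (act (inv\<^bsub>Q\<^esub> n) (act (inv\<^bsub>Q\<^esub> m) C)) y)"
      using h y C m by (intro finsum_rdistr[symmetric]) auto
    also have "\<dots> = f h m \<otimes> ev (act (inv\<^bsub>Q\<^esub> m) C) (\<mu> h' y)"
      using h y C m by (simp add: ev_\<mu>)
    finally show "(\<Oplus>n\<in>?N. f h m \<otimes> f h' (inv\<^bsub>Q\<^esub> m \<otimes>\<^bsub>Q\<^esub> n) \<otimes> ev (act (inv\<^bsub>Q\<^esub> n) C) y) =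
        f h m \<otimes> ev (act (inv\<^bsub>Q\<^esub> m) C) (\<mu> h' y)" .
  qed (use h y C in auto)
  also have "\<dots> = ev C (\<mu> h (\<mu> h' y))" using h y C by (simp add: ev_\<mu>)
  finally show "ev C (\<mu> (h \<otimes>\<^bsub>H\<^esub> h') y) = ev C (\<mu> h (\<mu> h' y))" .
qed (use h y in auto)

lemma \<mu>_one:
  assumes y: "y \<in> L"
  shows "\<mu> \<one>\<^bsub>H\<^esub> y = y"
proof (rule L_eqI)
  fix C assume C: "C \<in> \<Omega>"
  have "ev C (\<mu> \<one>\<^bsub>H\<^esub> y) = (\<Oplus>n\<in>carrier Q. if n = \<one>\<^bsub>Q\<^esub> then ev (act (inv\<^bsub>Q\<^esub> n) C) y else \<zero>)"
    using y C unfolding ev_\<mu>[OF H_closed(1) y C]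
    by (intro finsum_cong' refl funcsetI) (auto simp: f_at)
  also have "\<dots> = ev C y" using y C by (subst finsum_delta) (auto simp: act_one)
  finally show "ev C (\<mu> \<one>\<^bsub>H\<^esub> y) = ev C y" .
qed (use y in auto)

lemma \<mu>_linear: "\<mu> \<in> module_hom R H EndL"
  unfolding module_hom_def H_simps(1)
  by (intro CollectI conjI allI impI funcsetI End_eqI)
    (auto simp: End_closed End_at \<mu>_add_left \<mu>_smult_left)

lemma \<mu>_ring_hom: "\<mu> \<in> Ring.ring_hom H EndL"
proof (rule ring_hom_memI)
  fix h h' assume "h \<in> carrier H" "h' \<in> carrier H"
  then have h: "h \<in> HC" "h' \<in> HC" by (simp_all add: H_simps(1))
  show "\<mu> (h \<oplus>\<^bsub>H\<^esub> h') = \<mu> h \<oplus>\<^bsub>EndL\<^esub> \<mu> h'"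
    using module_hom_add[OF \<mu>_linear] h by (simp add: H_simps(1))
  show "\<mu> (h \<otimes>\<^bsub>H\<^esub> h') = \<mu> h \<otimes>\<^bsub>EndL\<^esub> \<mu> h'"
    using h unfolding End_simps(4)
    by (intro extensionalityI[of _ L]) (simp_all add: compose_def \<mu>_mult, simp add: \<mu>_def)
next
  show "\<mu> \<one>\<^bsub>H\<^esub> = \<one>\<^bsub>EndL\<^esub>"
    unfolding End_simps(5)
    by (intro extensionalityI[of _ L]) (simp_all add: \<mu>_one, simp add: \<mu>_def)
qed (simp add: H_simps(1))

lemma \<mu>_action_one:
  assumes "h \<in> HC"
  shows "\<mu> h \<one> = counit H h"
  using assms unfolding \<mu>_def H_simps(7) restrict_apply' [OF L_ops(1)]
  by (intro finsum_cong' refl funcsetI) (auto simp: ev_K)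

text \<open>Each n acts through a multiplicative embedding; on the side of H this is expressed by
  the diagonal comultiplication.\<close>

lemma \<mu>_action_mult:
  assumes h: "h \<in> HC" and y: "y \<in> L" "z \<in> L"
  shows "\<mu> h (y \<otimes> z) = tensor_lift R LA (\<lambda>h1 h2. \<mu> h1 y \<otimes> \<mu> h2 z) (comult H h)"
proof -
  have bil: "bilinear_map R H H LA (\<lambda>h1 h2. \<mu> h1 y \<otimes> \<mu> h2 z)"
    by (intro bilinear_mapI) (use y in \<open>simp_all add: H_simps(1) LA_simps \<mu>_add_left \<mu>_smult_left
        l_distr r_distr m_ac\<close>)
  interpret t: tensor_lifting R H H LA "\<lambda>h1 h2. \<mu> h1 y \<otimes> \<mu> h2 z"
    by (intro tensor_lifting.intro tensor_lifting_axioms.intro HH.TM.tensor_modules_axioms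
        module_LA bil)
  let ?N = "carrier Q"
  have t: "t.tlift (comult H h) \<in> L"
    using t.tensor_lift_closed[of "comult H h"] h by (simp add: LA_simps)
  show ?thesis
  proof (rule L_eqI)
    fix C assume C: "C \<in> \<Omega>"
    let ?e = "\<lambda>n. act (inv\<^bsub>Q\<^esub> n) C"
    have "ev C (t.tlift (comult H h)) = (\<Oplus>n\<in>?N. \<Oplus>m\<in>?N. HH.values (comult H h) (n, m) \<otimes>
        (ev (?e n) y \<otimes> ev (?e m) z))"
    proof (rule t.tensor_lift_eqI[where pl="add M" and \<phi>="ev C" and
          \<psi>="\<lambda>u. \<Oplus>n\<in>?N. \<Oplus>m\<in>?N. HH.values u (n, m) \<otimes> (ev (?e n) y \<otimes> ev (?e m) z)"])
      fix v w assume "v \<in> carrier H" "w \<in> carrier H"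
      then have vw: "v \<in> HC" "w \<in> HC" by (simp_all add: H_simps(1))
      have "ev C (\<mu> v y \<otimes> \<mu> w z) = (\<Oplus>n\<in>?N. f v n \<otimes> ev (?e n) y) \<otimes> (\<Oplus>m\<in>?N. f w m \<otimes> ev (?e m) z)"
        using vw y C by (simp add: ev_mult ev_\<mu>)
      also have "\<dots> = (\<Oplus>n\<in>?N. \<Oplus>m\<in>?N. (f v n \<otimes> ev (?e n) y) \<otimes> (f w m \<otimes> ev (?e m) z))"
        using vw y C by (intro finsum_mult) auto
      also have "\<dots> = (\<Oplus>n\<in>?N. \<Oplus>m\<in>?N. HH.values (pure2 v w) (n, m) \<otimes> (ev (?e n) y \<otimes> ev (?e m) z))"
        using vw y C by (intro finsum_cong' refl funcsetI finsum_closed) (simp_all add: m_ac)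
      finally show "ev C (\<mu> v y \<otimes> \<mu> w z) =
          (\<Oplus>n\<in>?N. \<Oplus>m\<in>?N. HH.values (pure2 v w) (n, m) \<otimes> (ev (?e n) y \<otimes> ev (?e m) z))" .
    next
      fix s t assume st: "s \<in> carrier T2" "t \<in> carrier T2"
      show "(\<Oplus>n\<in>?N. \<Oplus>m\<in>?N. HH.values (s \<oplus>\<^bsub>T2\<^esub> t) (n, m) \<otimes> (ev (?e n) y \<otimes> ev (?e m) z)) =
          (\<Oplus>n\<in>?N. \<Oplus>m\<in>?N. HH.values s (n, m) \<otimes> (ev (?e n) y \<otimes> ev (?e m) z)) \<oplus>
          (\<Oplus>n\<in>?N. \<Oplus>m\<in>?N. HH.values t (n, m) \<otimes> (ev (?e n) y \<otimes> ev (?e m) z))"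
        using st y C by (subst finsum2_addf)
          (auto simp: l_distr intro!: finsum_cong' finsum_closed)
    qed (use h C in \<open>simp_all add: LA_simps ev_add\<close>)
    also have "\<dots> = (\<Oplus>n\<in>?N. \<Oplus>m\<in>?N. if m = n then f h n \<otimes> (ev (?e n) y \<otimes> ev (?e m) z) else \<zero>)"
      using h y C by (intro finsum_cong' refl funcsetI finsum_closed) auto
    also have "\<dots> = (\<Oplus>n\<in>?N. f h n \<otimes> (ev (?e n) y \<otimes> ev (?e n) z))"
      using h y C by (intro finsum_cong' refl funcsetI finsum_delta) auto
    also have "\<dots> = ev C (\<mu> h (y \<otimes> z))"
      using h y C by (simp add: ev_\<mu> ev_mult cong: finsum_cong)
    finally show "ev C (\<mu> h (y \<otimes> z)) = ev C (t.tlift (comult H h))" by simp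
  qed (use h y t in auto)
qed

text \<open>The finite M-basis of the functions on Q that \<open>ex_basis\<close> finds in H spans H
  over K.\<close>

lemma fin_dim_H: "vectorspace.fin_dim R H"
proof -
  interpret vs: vectorspace R H
    by (intro vectorspace.intro module_H field_R)
  obtain B where B: "H.spanning B" "H.lin_free B" using H.ex_basis by auto
  then have fin: "finite B" "B \<subseteq> carrier H" unfolding H.spanning_def by auto
  have "carrier H \<subseteq> H.V.span B"
  proof
    fix v assume "v \<in> carrier H"
    then obtain k where k: "\<And>b. b \<in> B \<Longrightarrow> k b \<in> K" "v = (\<Oplus>\<^bsub>H\<^esub>b\<in>B. k b \<odot>\<^bsub>H\<^esub> b)"
      using H.combination_basis[OF B] by auto
    then show "v \<in> H.V.span B"
      unfolding H.V.span_def H.V.lincomb_def using fin(1) by auto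
  qed
  then have "H.V.span B = carrier H" using H.V.span_is_subset2[OF fin(2)] by auto
  then show ?thesis unfolding vs.fin_dim_def using fin by blast
qed

section \<open>Bijectivity of the Galois map\<close>

sublocale LH: form_pair M K G LA \<Omega> a "\<lambda>y C. ev C y" H "carrier Q" c f
  by unfold_locales

definition \<theta> where
  "\<theta> = tensor_lift R EndL (\<lambda>x h. \<lambda>y\<in>L. x \<otimes> \<mu> h y)"

lemma bilinear_\<theta>: "bilinear_map R LA H EndL (\<lambda>x h. \<lambda>y\<in>L. x \<otimes> \<mu> h y)"
proof -
  have "(\<lambda>y\<in>L. x \<otimes> \<mu> h y) \<in> carrier EndL" if "x \<in> L" "h \<in> HC" for x h
    using that by (auto simp: End_iff \<mu>_add \<mu>_smult r_distr m_lcomm)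
  then show ?thesis
    by (intro bilinear_mapI End_eqI)
      (simp_all add: H_simps(1) LA_simps End_closed End_at \<mu>_add_left \<mu>_smult_left l_distr r_distr m_ac)
qed

sublocale \<theta>: tensor_lifting R LA H EndL "\<lambda>x h. \<lambda>y\<in>L. x \<otimes> \<mu> h y"
  by (intro tensor_lifting.intro tensor_lifting_axioms.intro LH.TM.tensor_modules_axioms
        module_End bilinear_\<theta>)

text \<open>For fixed C this displays ev C (\<theta> t y) as an M-combination of embeddings of y,
  with the values of t as coefficients. Bijectivity of \<theta> thus becomes uniqueness and
  existence of such coefficients for every K-linear endomorphism.\<close>

lemma ev_\<theta>:
  assumes t: "t \<in> carrier (tensor R LA H)" and C: "C \<in> \<Omega>" and y: "y \<in> L"
  shows "ev C (\<theta> t y) = (\<Oplus>n\<in>carrier Q. LH.values t (C, n) \<otimes> ev (act (inv\<^bsub>Q\<^esub> n) C) y)"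
  unfolding \<theta>_def
proof (rule \<theta>.tensor_lift_eqI[where pl="add M" and \<phi>="\<lambda>\<phi>. ev C (\<phi> y)" and
      \<psi>="\<lambda>t. \<Oplus>n\<in>carrier Q. LH.values t (C, n) \<otimes> ev (act (inv\<^bsub>Q\<^esub> n) C) y", OF t])
  fix v w assume "v \<in> carrier LA" "w \<in> carrier H"
  then have vw: "v \<in> L" "w \<in> HC" by (simp_all add: LA_simps H_simps(1))
  have "ev C ((\<lambda>y\<in>L. v \<otimes> \<mu> w y) y) = ev C v \<otimes> (\<Oplus>n\<in>carrier Q. f w n \<otimes> ev (act (inv\<^bsub>Q\<^esub> n) C) y)"
    using vw C y by (simp add: ev_mult ev_\<mu>)
  also have "\<dots> = (\<Oplus>n\<in>carrier Q. ev C v \<otimes> (f w n \<otimes> ev (act (inv\<^bsub>Q\<^esub> n) C) y))"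
    using vw C y by (intro finsum_rdistr) auto
  also have "\<dots> = (\<Oplus>n\<in>carrier Q. LH.values (LH.TM.pure v w) (C, n) \<otimes> ev (act (inv\<^bsub>Q\<^esub> n) C) y)"
    using vw C y
    by (intro finsum_cong' refl funcsetI) (simp_all add: LH.values_pure LA_simps H_simps(1) m_assoc)
  finally show "ev C ((\<lambda>y\<in>L. v \<otimes> \<mu> w y) y) =
      (\<Oplus>n\<in>carrier Q. LH.values (LH.TM.pure v w) (C, n) \<otimes> ev (act (inv\<^bsub>Q\<^esub> n) C) y)" .
next
  fix s t assume st: "s \<in> carrier (tensor R LA H)" "t \<in> carrier (tensor R LA H)"
  show "(\<Oplus>n\<in>carrier Q. LH.values (s \<oplus>\<^bsub>LH.TM.T\<^esub> t) (C, n) \<otimes> ev (act (inv\<^bsub>Q\<^esub> n) C) y) =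
      (\<Oplus>n\<in>carrier Q. LH.values s (C, n) \<otimes> ev (act (inv\<^bsub>Q\<^esub> n) C) y) \<oplus>
      (\<Oplus>n\<in>carrier Q. LH.values t (C, n) \<otimes> ev (act (inv\<^bsub>Q\<^esub> n) C) y)"
  proof -
    have "(\<Oplus>n\<in>carrier Q. LH.values (s \<oplus>\<^bsub>LH.TM.T\<^esub> t) (C, n) \<otimes> ev (act (inv\<^bsub>Q\<^esub> n) C) y) =
        (\<Oplus>n\<in>carrier Q. LH.values s (C, n) \<otimes> ev (act (inv\<^bsub>Q\<^esub> n) C) y \<oplus>
          LH.values t (C, n) \<otimes> ev (act (inv\<^bsub>Q\<^esub> n) C) y)"
      using st C y by (intro finsum_cong' refl funcsetI)
        (simp_all add: LH.values_add LH.values_closed l_distr)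
    also have "\<dots> = (\<Oplus>n\<in>carrier Q. LH.values s (C, n) \<otimes> ev (act (inv\<^bsub>Q\<^esub> n) C) y) \<oplus>
        (\<Oplus>n\<in>carrier Q. LH.values t (C, n) \<otimes> ev (act (inv\<^bsub>Q\<^esub> n) C) y)"
      using st C y by (intro finsum_addf funcsetI) (simp_all add: LH.values_closed)
    finally show ?thesis .
  qed
next
  fix \<phi> \<psi> assume "\<phi> \<in> carrier EndL" "\<psi> \<in> carrier EndL"
  then show "ev C ((\<phi> \<oplus>\<^bsub>EndL\<^esub> \<psi>) y) = ev C (\<phi> y) \<oplus> ev C (\<psi> y)"
    using C y by (simp add: End_at ev_add)
qed

text \<open>Artin's independence of the embeddings \<open>ev C\<close>, in the form of uniqueness of coefficients.\<close>

lemma coefficients_unique: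
  assumes d: "inj_on d (carrier Q)" "\<And>n. n \<in> carrier Q \<Longrightarrow> d n \<in> \<Omega>"
    and w: "\<And>n. n \<in> carrier Q \<Longrightarrow> w n \<in> carrier M" "\<And>n. n \<in> carrier Q \<Longrightarrow> w' n \<in> carrier M"
    and eq: "\<And>y. y \<in> L \<Longrightarrow> (\<Oplus>n\<in>carrier Q. w n \<otimes> ev (d n) y) = (\<Oplus>n\<in>carrier Q. w' n \<otimes> ev (d n) y)"
    and m: "m \<in> carrier Q"
  shows "w m = w' m"
proof -
  let ?N = "carrier Q"
  \<comment> \<open>Both sides are linear in the function C -> ev C y, so they agree on the span of
    these functions, which contains the indicator function of d m.\<close>
  have *: "(\<Oplus>n\<in>?N. w n \<otimes> x (d n)) = (\<Oplus>n\<in>?N. w' n \<otimes> x (d n))"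
    if "mspan M \<Omega> ((\<lambda>y C. ev C y) ` L) x" for x
    using that
  proof (induction x rule: mspan.induct)
    case (mspan_base g k x)
    then obtain y where y: "y \<in> L" "g = (\<lambda>C. ev C y)" by auto
    have "(\<Oplus>n\<in>?N. u n \<otimes> x (d n)) = k \<otimes> (\<Oplus>n\<in>?N. u n \<otimes> ev (d n) y)"
      if u: "\<And>n. n \<in> ?N \<Longrightarrow> u n \<in> carrier M" for u
    proof -
      have "(\<Oplus>n\<in>?N. u n \<otimes> x (d n)) = (\<Oplus>n\<in>?N. k \<otimes> (u n \<otimes> ev (d n) y))"
        using mspan_base y d(2) u by (intro finsum_cong' refl funcsetI) (simp_all add: m_lcomm)
      also have "\<dots> = k \<otimes> (\<Oplus>n\<in>?N. u n \<otimes> ev (d n) y)"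
        using mspan_base y d(2) u by (intro finsum_rdistr[symmetric]) auto
      finally show ?thesis .
    qed
    then show ?case using w eq[OF y(1)] by simp
  next
    case (mspan_add x x' z)
    have cl: "x C \<in> carrier M" "x' C \<in> carrier M" if "C \<in> \<Omega>" for C
    proof -
      show "x C \<in> carrier M" by (rule mspan_closed[OF mspan_add(1) _ that]) auto
      show "x' C \<in> carrier M" by (rule mspan_closed[OF mspan_add(2) _ that]) auto
    qed
    have "(\<Oplus>n\<in>?N. u n \<otimes> z (d n)) = (\<Oplus>n\<in>?N. u n \<otimes> x (d n)) \<oplus> (\<Oplus>n\<in>?N. u n \<otimes> x' (d n))"
      if u: "\<And>n. n \<in> ?N \<Longrightarrow> u n \<in> carrier M" for u
    proof -
      have "(\<Oplus>n\<in>?N. u n \<otimes> z (d n)) = (\<Oplus>n\<in>?N. u n \<otimes> x (d n) \<oplus> u n \<otimes> x' (d n))"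
        using mspan_add(3) cl d(2) u by (intro finsum_cong' refl funcsetI) (simp_all add: r_distr)
      also have "\<dots> = (\<Oplus>n\<in>?N. u n \<otimes> x (d n)) \<oplus> (\<Oplus>n\<in>?N. u n \<otimes> x' (d n))"
        using cl d(2) u by (intro finsum_addf) auto
      finally show ?thesis .
    qed
    then show ?case using w mspan_add.IH by simp
  qed
  have delta: "(\<Oplus>n\<in>?N. u n \<otimes> (if d n = d m then \<one> else \<zero>)) = u m"
    if u: "\<And>n. n \<in> ?N \<Longrightarrow> u n \<in> carrier M" for u
  proof -
    have "(\<Oplus>n\<in>?N. u n \<otimes> (if d n = d m then \<one> else \<zero>)) = (\<Oplus>n\<in>?N. if n = m then u n else \<zero>)"
      using u m d(1) by (intro finsum_cong' refl funcsetI) (auto simp: inj_on_def)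
    also have "\<dots> = u m" using u m by (intro finsum_delta) auto
    finally show ?thesis .
  qed
  have "mspan M \<Omega> ((\<lambda>y C. ev C y) ` L) (\<lambda>C. if C = d m then \<one> else \<zero>)"
    by (rule evaluations_span) auto
  from *[OF this] show ?thesis using delta[of w] delta[of w'] w by simp
qed

lemma bij_orbit:
  assumes C: "C \<in> \<Omega>"
  shows "bij_betw (\<lambda>n. act (inv\<^bsub>Q\<^esub> n) C) (carrier Q) \<Omega>"
proof (rule bij_betw_imageI)
  show "inj_on (\<lambda>n. act (inv\<^bsub>Q\<^esub> n) C) (carrier Q)"
  proof (rule inj_onI)
    fix n m assume nm: "n \<in> carrier Q" "m \<in> carrier Q" "act (inv\<^bsub>Q\<^esub> n) C = act (inv\<^bsub>Q\<^esub> m) C"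
    then have "inv\<^bsub>Q\<^esub> n = inv\<^bsub>Q\<^esub> m" by (intro act_free[OF _ _ C]) auto
    then show "n = m" using nm by (metis Q.inv_inv)
  qed
  show "(\<lambda>n. act (inv\<^bsub>Q\<^esub> n) C) ` carrier Q = \<Omega>"
  proof (intro equalityI subsetI)
    fix D assume "D \<in> \<Omega>"
    then obtain n where "n \<in> carrier Q" "act n C = D" using act_transitive[OF C] by blast
    then show "D \<in> (\<lambda>n. act (inv\<^bsub>Q\<^esub> n) C) ` carrier Q"
      by (intro image_eqI[of _ _ "inv\<^bsub>Q\<^esub> n"]) auto
  qed (use C in auto)
qed

text \<open>A dual basis argument. Let the indicator function of the n-th orbit point d n have the
  coefficients m n b in a basis B of L. Then y has the coefficients k b equal to the sum over n of m
  n b ev (d n) y. As \<phi> is K-linear, ev C (\<phi> y) is the sum of the k b ev C (\<phi> b), and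
  collecting the terms for each n gives w n.\<close>

lemma coefficients_exist:
  assumes \<phi>: "\<phi> \<in> carrier EndL" and C: "C \<in> \<Omega>"
  shows "\<exists>w. (\<forall>n\<in>carrier Q. w n \<in> carrier M) \<and>
    (\<forall>y\<in>L. ev C (\<phi> y) = (\<Oplus>n\<in>carrier Q. w n \<otimes> ev (act (inv\<^bsub>Q\<^esub> n) C) y))"
proof -
  let ?N = "carrier Q"
  let ?d = "\<lambda>n. act (inv\<^bsub>Q\<^esub> n) C"
  have d: "inj_on ?d ?N" "?d ` ?N = \<Omega>" using bij_orbit[OF C] by (auto simp: bij_betw_def)
  obtain B where B: "L.spanning B" "L.lin_free B" using L.ex_basis by auto
  then have fin: "finite B" "B \<subseteq> L" unfolding L.spanning_def by (auto simp: LA_simps)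
  have bL: "b \<in> L" if "b \<in> B" for b using fin that by auto
  define P where "P n m \<longleftrightarrow> (\<forall>b\<in>B. m b \<in> carrier M) \<and>
    (\<forall>D\<in>\<Omega>. (if D = ?d n then \<one> else \<zero>) = (\<Oplus>b\<in>B. m b \<otimes> ev D b))" for n m
  have "\<exists>m. P n m" for n
    using B(1)[unfolded L.spanning_def, THEN conjunct2, THEN conjunct2, rule_format,
        of "\<lambda>D. if D = ?d n then \<one> else \<zero>"] unfolding P_def by auto
  then obtain m where m: "\<forall>n. P n (m n)" using choice[of P] by auto
  have m1: "m n b \<in> carrier M" if "b \<in> B" for n b using m that unfolding P_def by auto
  have m2: "(\<Oplus>b\<in>B. m n b \<otimes> ev D b) = (if D = ?d n then \<one> else \<zero>)" if "D \<in> \<Omega>" for n D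
    using m that unfolding P_def by auto
  define w where "w n = (\<Oplus>b\<in>B. m n b \<otimes> ev C (\<phi> b))" for n
  have w: "w n \<in> carrier M" for n
    unfolding w_def using m1 \<phi> C bL by (intro finsum_closed) auto
  have "ev C (\<phi> y) = (\<Oplus>n\<in>?N. w n \<otimes> ev (?d n) y)" if y: "y \<in> L" for y
  proof -
    obtain k where k: "\<And>b. b \<in> B \<Longrightarrow> k b \<in> K" "y = (\<Oplus>\<^bsub>LA\<^esub>b\<in>B. k b \<odot>\<^bsub>LA\<^esub> b)"
      using L.combination_basis[OF B, of y] y by (auto simp: LA_simps(1))
    have kM: "k b \<in> carrier M" if "b \<in> B" for b using k that by auto
    have kb: "k b \<odot>\<^bsub>LA\<^esub> b \<in> carrier LA" if "b \<in> B" for b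
      using that k(1) bL by (simp add: LA_simps)
    \<comment> \<open>A second expansion of y, a priori with coefficients in M, obtained by writing
      C -> ev C y as a combination of indicator functions. Independence identifies it with the
      expansion over K.\<close>
    define k' where "k' b = (\<Oplus>n\<in>?N. m n b \<otimes> ev (?d n) y)" for b
    have k': "k' b \<in> carrier M" if "b \<in> B" for b
      unfolding k'_def using that m1 C y by (intro finsum_closed) auto
    have "k b = k' b" if b: "b \<in> B" for b
    proof -
      have "(\<Oplus>b\<in>B. (k b \<oplus> \<ominus> k' b) \<otimes> ev D b) = \<zero>" if D: "D \<in> \<Omega>" for D
      proof -
        have "(\<Oplus>b\<in>B. k' b \<otimes> ev D b) = (\<Oplus>b\<in>B. \<Oplus>n\<in>?N. m n b \<otimes> ev (?d n) y \<otimes> ev D b)"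
          unfolding k'_def
          by (intro finsum_cong' refl funcsetI finsum_closed finsum_ldistr)
            (use m1 C y D bL in auto)
        also have "\<dots> = (\<Oplus>n\<in>?N. \<Oplus>b\<in>B. m n b \<otimes> ev (?d n) y \<otimes> ev D b)"
          using m1 C y D bL fin by (intro finsum_swap) auto
        also have "\<dots> = (\<Oplus>n\<in>?N. ev (?d n) y \<otimes> (\<Oplus>b\<in>B. m n b \<otimes> ev D b))"
        proof (rule finsum_cong'[OF refl])
          fix n assume n: "n \<in> ?N"
          have "(\<Oplus>b\<in>B. m n b \<otimes> ev (?d n) y \<otimes> ev D b) = (\<Oplus>b\<in>B. ev (?d n) y \<otimes> (m n b \<otimes> ev D b))"
            using m1 C y D bL n by (intro finsum_cong' refl funcsetI) (simp_all add: m_ac)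
          also have "\<dots> = ev (?d n) y \<otimes> (\<Oplus>b\<in>B. m n b \<otimes> ev D b)"
            using m1 C y D bL n fin by (intro finsum_rdistr[symmetric]) auto
          finally show "(\<Oplus>b\<in>B. m n b \<otimes> ev (?d n) y \<otimes> ev D b) =
              ev (?d n) y \<otimes> (\<Oplus>b\<in>B. m n b \<otimes> ev D b)" .
        qed (use m1 C y D bL in \<open>auto intro!: finsum_closed\<close>)
        also have "\<dots> = (\<Oplus>n\<in>?N. ev (?d n) y \<otimes> (if ?d n = D then \<one> else \<zero>))"
          using C y D by (intro finsum_cong' refl funcsetI) (auto simp: m2)
        also have "\<dots> = (\<Oplus>D'\<in>\<Omega>. ev D' y \<otimes> (if D' = D then \<one> else \<zero>))"
          using y by (intro finsum_reindex_onto[OF d, symmetric]) auto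
        also have "\<dots> = (\<Oplus>D'\<in>\<Omega>. if D' = D then ev D' y else \<zero>)"
          using y by (intro finsum_cong' refl funcsetI) auto
        also have "\<dots> = ev D y" using y D by (intro finsum_delta) auto
        finally have 1: "(\<Oplus>b\<in>B. k' b \<otimes> ev D b) = ev D y" .
        have 2: "(\<Oplus>b\<in>B. k b \<otimes> ev D b) = ev D y"
          unfolding k(2) using kb D
          by (subst L.\<iota>_finsum) (use k(1) bL D in \<open>auto simp: LA_simps ev_mult ev_K intro!: finsum_cong'\<close>)
        have "(\<Oplus>b\<in>B. (k b \<oplus> \<ominus> k' b) \<otimes> ev D b) =
            (\<Oplus>b\<in>B. k b \<otimes> ev D b \<oplus> \<ominus> \<one> \<otimes> (k' b \<otimes> ev D b))"
          using kM k' bL D by (intro finsum_cong' refl funcsetI) (simp_all add: l_distr l_minus)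
        also have "\<dots> = (\<Oplus>b\<in>B. k b \<otimes> ev D b) \<oplus> (\<Oplus>b\<in>B. \<ominus> \<one> \<otimes> (k' b \<otimes> ev D b))"
          using kM k' bL D by (intro finsum_addf) auto
        also have "(\<Oplus>b\<in>B. \<ominus> \<one> \<otimes> (k' b \<otimes> ev D b)) = \<ominus> \<one> \<otimes> (\<Oplus>b\<in>B. k' b \<otimes> ev D b)"
          using k' bL D fin by (intro finsum_rdistr[symmetric]) auto
        finally show ?thesis unfolding 1 2 using y D by (simp add: l_minus r_neg)
      qed
      then have "k b \<oplus> \<ominus> k' b = \<zero>"
        using B(2)[unfolded L.lin_free_def, rule_format, of "\<lambda>b. k b \<oplus> \<ominus> k' b" b] kM k' b by auto
      then show ?thesis using r_right_minus_eq[of "k b" "k' b"] kM k' b by (simp add: a_minus_def)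
    qed
    have "ev C (\<phi> y) = (\<Oplus>b\<in>B. ev C (\<phi> (k b \<odot>\<^bsub>LA\<^esub> b)))"
      unfolding k(2)
    proof (rule additive_finsum[where \<phi>="\<lambda>y. ev C (\<phi> y)" and V=LA])
      show "abelian_group LA" by (rule L.V.abelian_group_axioms)
      show "abelian_group M" by (rule abelian_group_axioms)
      show "ev C (\<phi> x) \<in> carrier M" if "x \<in> carrier LA" for x
        using that \<phi> C by (simp add: LA_simps)
      show "ev C (\<phi> (x \<oplus>\<^bsub>LA\<^esub> z)) = ev C (\<phi> x) \<oplus> ev C (\<phi> z)"
        if "x \<in> carrier LA" "z \<in> carrier LA" for x z
      proof -
        have "\<phi> (x \<oplus> z) = \<phi> x \<oplus> \<phi> z" using that \<phi> by (simp add: LA_simps End_iff)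
        then show ?thesis using that \<phi> C by (simp add: LA_simps ev_add)
      qed
    qed (use kb fin in auto)
    also have "\<dots> = (\<Oplus>b\<in>B. k' b \<otimes> ev C (\<phi> b))"
    proof (rule finsum_cong'[OF refl])
      fix b assume b: "b \<in> B"
      have "\<phi> (k b \<otimes> b) = k b \<otimes> \<phi> b" using \<phi> k(1) b bL by (simp add: End_iff)
      then show "ev C (\<phi> (k b \<odot>\<^bsub>LA\<^esub> b)) = k' b \<otimes> ev C (\<phi> b)"
        using \<phi> k(1)[OF b] bL[OF b] C \<open>\<And>b. b \<in> B \<Longrightarrow> k b = k' b\<close>[OF b, symmetric]
        by (simp add: LA_simps ev_mult ev_K)
    qed (use k' \<phi> C bL in auto)
    also have "\<dots> = (\<Oplus>b\<in>B. \<Oplus>n\<in>?N. m n b \<otimes> ev (?d n) y \<otimes> ev C (\<phi> b))"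
      unfolding k'_def
      by (intro finsum_cong' refl funcsetI finsum_closed finsum_ldistr)
        (use m1 C y bL \<phi> in auto)
    also have "\<dots> = (\<Oplus>n\<in>?N. \<Oplus>b\<in>B. m n b \<otimes> ev (?d n) y \<otimes> ev C (\<phi> b))"
      using m1 C y \<phi> bL fin by (intro finsum_swap) auto
    also have "\<dots> = (\<Oplus>n\<in>?N. w n \<otimes> ev (?d n) y)"
    proof (rule finsum_cong'[OF refl])
      fix n assume n: "n \<in> ?N"
      have "(\<Oplus>b\<in>B. m n b \<otimes> ev (?d n) y \<otimes> ev C (\<phi> b)) = (\<Oplus>b\<in>B. m n b \<otimes> ev C (\<phi> b) \<otimes> ev (?d n) y)"
        using m1 C y bL n \<phi> by (intro finsum_cong' refl funcsetI) (simp_all add: m_ac)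
      also have "\<dots> = w n \<otimes> ev (?d n) y"
        unfolding w_def using m1 C y bL n fin \<phi> by (intro finsum_ldistr[symmetric]) auto
      finally show "(\<Oplus>b\<in>B. m n b \<otimes> ev (?d n) y \<otimes> ev C (\<phi> b)) = w n \<otimes> ev (?d n) y" .
    qed (use w C y in auto)
    finally show ?thesis .
  qed
  then show ?thesis using w by (intro exI[of _ w]) simp
qed

lemma \<theta>_inj: "inj_on \<theta> (carrier (tensor R LA H))"
proof (rule inj_onI)
  fix s t assume st: "s \<in> carrier (tensor R LA H)" "t \<in> carrier (tensor R LA H)" "\<theta> s = \<theta> t"
  show "s = t"
  proof (rule LH.T.\<iota>_inj[OF st(1,2)])
    fix p assume "p \<in> \<Omega> \<times> carrier Q"
    then obtain C n where p: "p = (C, n)" "C \<in> \<Omega>" "n \<in> carrier Q" by auto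
    have "LH.values s (C, n) = LH.values t (C, n)"
    proof (rule coefficients_unique[where d="\<lambda>n. act (inv\<^bsub>Q\<^esub> n) C" and w="\<lambda>n. LH.values s (C, n)"
          and w'="\<lambda>n. LH.values t (C, n)"])
      show "inj_on (\<lambda>n. act (inv\<^bsub>Q\<^esub> n) C) (carrier Q)"
        using bij_orbit[OF p(2)] by (simp add: bij_betw_def)
      show "(\<Oplus>n\<in>carrier Q. LH.values s (C, n) \<otimes> ev (act (inv\<^bsub>Q\<^esub> n) C) y) =
          (\<Oplus>n\<in>carrier Q. LH.values t (C, n) \<otimes> ev (act (inv\<^bsub>Q\<^esub> n) C) y)" if "y \<in> L" for y
        using ev_\<theta>[OF st(1) p(2) that] ev_\<theta>[OF st(2) p(2) that] st(3) by simp
    qed (use p st in \<open>auto intro!: LH.values_closed\<close>)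
    then show "LH.values s p = LH.values t p" using p by simp
  qed
qed

lemma \<theta>_surj:
  assumes \<phi>: "\<phi> \<in> carrier EndL"
  shows "\<exists>t\<in>carrier (tensor R LA H). \<theta> t = \<phi>"
proof -
  let ?N = "carrier Q"
  define P where "P C w \<longleftrightarrow> (\<forall>n\<in>?N. w n \<in> carrier M) \<and>
    (\<forall>y\<in>L. ev C (\<phi> y) = (\<Oplus>n\<in>?N. w n \<otimes> ev (act (inv\<^bsub>Q\<^esub> n) C) y))" for C w
  have "\<exists>w. C \<in> \<Omega> \<longrightarrow> P C w" for C
    using coefficients_exist[OF \<phi>] unfolding P_def by auto
  then obtain w where "\<forall>C. C \<in> \<Omega> \<longrightarrow> P C (w C)"
    using choice[of "\<lambda>C w. C \<in> \<Omega> \<longrightarrow> P C w"] by auto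
  then have w: "\<And>C n. \<lbrakk>C \<in> \<Omega>; n \<in> ?N\<rbrakk> \<Longrightarrow> w C n \<in> carrier M"
    "\<And>C y. \<lbrakk>C \<in> \<Omega>; y \<in> L\<rbrakk> \<Longrightarrow> ev C (\<phi> y) = (\<Oplus>n\<in>?N. w C n \<otimes> ev (act (inv\<^bsub>Q\<^esub> n) C) y)"
    unfolding P_def by auto
  \<comment> \<open>Applying \<tau> to the expansion at C gives an expansion at a \<tau> C over the
    same embeddings, so uniqueness applies. Equivariance is what lets the coefficients descend to a
    tensor.\<close>
  have "w (a \<tau> C) (c \<tau> m) = \<tau> (w C m)" if \<tau>: "\<tau> \<in> G" and C: "C \<in> \<Omega>" and m: "m \<in> ?N" for \<tau> C m
  proof (rule coefficients_unique[where d="\<lambda>n. a \<tau> (act (inv\<^bsub>Q\<^esub> n) C)" and m=m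
        and w="\<lambda>n. w (a \<tau> C) (c \<tau> n)" and w'="\<lambda>n. \<tau> (w C n)"])
    show "inj_on (\<lambda>n. a \<tau> (act (inv\<^bsub>Q\<^esub> n) C)) ?N"
      using comp_inj_on[of "\<lambda>n. act (inv\<^bsub>Q\<^esub> n) C" ?N "a \<tau>"] bij_orbit[OF C] inj_a[OF \<tau>]
      by (simp add: bij_betw_def comp_def)
    fix y assume y: "y \<in> L"
    have "(\<Oplus>n\<in>?N. \<tau> (w C n) \<otimes> ev (a \<tau> (act (inv\<^bsub>Q\<^esub> n) C)) y) =
        (\<Oplus>n\<in>?N. \<tau> (w C n \<otimes> ev (act (inv\<^bsub>Q\<^esub> n) C) y))"
      using \<tau> C y w(1) by (intro finsum_cong' refl funcsetI) (simp_all add: ev_a)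
    also have "\<dots> = \<tau> (ev C (\<phi> y))"
      unfolding w(2)[OF C y] using \<tau> C y w(1) by (intro hom_finsum[symmetric]) auto
    also have "\<dots> = ev (a \<tau> C) (\<phi> y)" using \<tau> C y \<phi> by (simp add: ev_a)
    also have "\<dots> = (\<Oplus>n\<in>?N. w (a \<tau> C) n \<otimes> ev (act (inv\<^bsub>Q\<^esub> n) (a \<tau> C)) y)"
      using \<tau> C y w(2) by simp
    also have "\<dots> = (\<Oplus>n\<in>?N. w (a \<tau> C) (c \<tau> n) \<otimes> ev (act (inv\<^bsub>Q\<^esub> (c \<tau> n)) (a \<tau> C)) y)"
      by (rule c_reindex[OF \<tau>]) (use \<tau> C y w(1) in auto)
    also have "\<dots> = (\<Oplus>n\<in>?N. w (a \<tau> C) (c \<tau> n) \<otimes> ev (a \<tau> (act (inv\<^bsub>Q\<^esub> n) C)) y)"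
      using \<tau> C y w(1) by (intro finsum_cong' refl funcsetI) (simp_all add: c_inv[symmetric] c_act)
    finally show "(\<Oplus>n\<in>?N. w (a \<tau> C) (c \<tau> n) \<otimes> ev (a \<tau> (act (inv\<^bsub>Q\<^esub> n) C)) y) =
        (\<Oplus>n\<in>?N. \<tau> (w C n) \<otimes> ev (a \<tau> (act (inv\<^bsub>Q\<^esub> n) C)) y)" by simp
  qed (use \<tau> C m w(1) in auto)
  then have "\<exists>t\<in>carrier (tensor R LA H). \<forall>p\<in>\<Omega> \<times> ?N. LH.values t p = w (fst p) (snd p)"
    by (intro LH.T.descend) (use w(1) in auto)
  then obtain t where t: "t \<in> carrier (tensor R LA H)" "\<forall>p\<in>\<Omega> \<times> ?N. LH.values t p = w (fst p) (snd p)"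
    by blast
  have cl: "\<theta> t \<in> carrier EndL" unfolding \<theta>_def by (rule \<theta>.tensor_lift_closed[OF t(1)])
  have "\<theta> t = \<phi>"
  proof (rule End_eqI[OF cl \<phi>])
    fix y assume y: "y \<in> L"
    show "\<theta> t y = \<phi> y"
    proof (rule L_eqI)
      fix C assume C: "C \<in> \<Omega>"
      show "ev C (\<theta> t y) = ev C (\<phi> y)"
        unfolding ev_\<theta>[OF t(1) C y] w(2)[OF C y]
        using C y t(2) w(1) by (intro finsum_cong' refl funcsetI) auto
    qed (use y cl \<phi> in auto)
  qed
  then show ?thesis using t(1) by blast
qed

lemma \<theta>_bij: "bij_betw \<theta> (carrier (tensor R LA H)) (carrier EndL)"
proof (rule bij_betw_imageI[OF \<theta>_inj])
  show "\<theta> ` carrier (tensor R LA H) = carrier EndL"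
    using \<theta>_surj \<theta>.tensor_lift_closed unfolding \<theta>_def by blast
qed

theorem hopf_galois_structure_H: "hopf_galois_structure E K H \<mu>"
proof -
  have R: "E\<lparr>carrier := K\<rparr> = R" by simp
  have field_E: "field E" using subfield_iff(2) subfield_L by blast
  then interpret E: field E .
  have "subfield K E"
  proof (rule E.subfield_iff(1))
    show "field (E\<lparr>carrier := K\<rparr>)" using field_R by simp
  qed (use K_L in auto)
  moreover have "\<theta> \<in> module_hom R (tensor R LA H) EndL"
    unfolding module_hom_def \<theta>_def
    using \<theta>.tensor_lift_closed \<theta>.tensor_lift_add \<theta>.tensor_lift_smult by auto
  ultimately show ?thesis
    unfolding hopf_galois_structure_def R
    using field_E cocommutative_hopf_algebra_H fin_dim_H \<mu>_linear \<mu>_ring_hom \<mu>_action_mult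
      \<mu>_action_one \<theta>_bij
    by (simp add: H_simps(1) \<theta>_def)
qed

end

section \<open>Comparison with the group algebra over the large field\<close>

context finite_group_algebra
begin

text \<open>With K = M and no automorphisms every function is equivariant, and M[Q] becomes a form
  over M. Tensors over M can then be compared by their values, like those over K.\<close>

lemma descent_trivial: "descent M (carrier M) {}"
  by (intro descent.intro descent_axioms.intro field_axioms carrier_is_subfield) auto

sublocale A0: form M "carrier M" "{}" A "carrier Q" "\<lambda>_ n. n" "\<lambda>x n. x n"
proof (intro form.intro form_axioms.intro)
  show "descent M (carrier M) {}" by (rule descent_trivial)
  show "Module.module (M\<lparr>carrier := carrier M\<rparr>) A" using module_A by simp
  show "v = \<zero>\<^bsub>A\<^esub>" if "v \<in> carrier A" "\<And>s. s \<in> carrier Q \<Longrightarrow> v s = \<zero>" for v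
    by (rule A_eqI) (use that in \<open>auto simp: A_at A_closed\<close>)
  show "mspan M (carrier Q) ((\<lambda>x n. x n) ` carrier A) x"
    if x: "\<And>s. s \<in> carrier Q \<Longrightarrow> x s \<in> carrier M" for x
  proof (rule mspan_base)
    show "restrict x (carrier Q) \<in> (\<lambda>x n. x n) ` carrier A" using x by (auto simp: A_simps)
  qed (use x in auto)
qed (auto simp: A_at A_value)

sublocale AA: form_pair M "carrier M" "{}" A "carrier Q" "\<lambda>_ n. n" "\<lambda>x n. x n"
    A "carrier Q" "\<lambda>_ n. n" "\<lambda>x n. x n"
  by unfold_locales

abbreviation "TA \<equiv> tensor M A A"
abbreviation "pureA \<equiv> pure_tensor M A A"

definition unit_vector :: "'q \<Rightarrow> 'q \<Rightarrow> 'a" where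
  "unit_vector n = (\<lambda>m\<in>carrier Q. if m = n then \<one> else \<zero>)"

lemma unit_vector_closed [simp]: "unit_vector n \<in> carrier A"
  by (auto simp: A_simps unit_vector_def)

lemma unit_vector_at: "m \<in> carrier Q \<Longrightarrow> unit_vector n m = (if m = n then \<one> else \<zero>)"
  by (simp add: unit_vector_def)

lemma module_TA: "Module.module M TA"
  using AA.TM.T.module_axioms by simp

lemma pureA_closed [simp]: "\<lbrakk>x \<in> carrier A; y \<in> carrier A\<rbrakk> \<Longrightarrow> pureA x y \<in> carrier TA"
  using AA.TM.pure_closed by simp

lemma valuesA_simps [simp]:
  assumes "n \<in> carrier Q" "m \<in> carrier Q"
  shows "t \<in> carrier TA \<Longrightarrow> AA.values t (n, m) \<in> carrier M"
    "\<lbrakk>s \<in> carrier TA; t \<in> carrier TA\<rbrakk> \<Longrightarrow>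
      AA.values (s \<oplus>\<^bsub>TA\<^esub> t) (n, m) = AA.values s (n, m) \<oplus> AA.values t (n, m)"
    "\<lbrakk>k \<in> carrier M; t \<in> carrier TA\<rbrakk> \<Longrightarrow> AA.values (k \<odot>\<^bsub>TA\<^esub> t) (n, m) = k \<otimes> AA.values t (n, m)"
    "\<lbrakk>x \<in> carrier A; y \<in> carrier A\<rbrakk> \<Longrightarrow> AA.values (pureA x y) (n, m) = x n \<otimes> y m"
  using assms AA.values_closed[of "(n, m)"] AA.values_add[of "(n, m)"] AA.values_smult[of "(n, m)"]
    AA.values_pure[of "(n, m)"] by simp_all

lemma TA_eqI:
  "\<lbrakk>s \<in> carrier TA; t \<in> carrier TA;
    \<And>n m. \<lbrakk>n \<in> carrier Q; m \<in> carrier Q\<rbrakk> \<Longrightarrow> AA.values s (n, m) = AA.values t (n, m)\<rbrakk> \<Longrightarrow> s = t"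
  using AA.T.\<iota>_inj[of s t] by auto

abbreviation "AH \<equiv> group_hopf_algebra M Q"

lemma AH_simps:
  "carrier AH = carrier A" "x \<otimes>\<^bsub>AH\<^esub> y = x \<otimes>\<^bsub>A\<^esub> y" "x \<oplus>\<^bsub>AH\<^esub> y = x \<oplus>\<^bsub>A\<^esub> y"
  "\<one>\<^bsub>AH\<^esub> = \<one>\<^bsub>A\<^esub>" "\<zero>\<^bsub>AH\<^esub> = \<zero>\<^bsub>A\<^esub>" "k \<odot>\<^bsub>AH\<^esub> x = k \<odot>\<^bsub>A\<^esub> x"
  "comult AH x = (\<Oplus>\<^bsub>TA\<^esub>n\<in>carrier Q. x n \<odot>\<^bsub>TA\<^esub> pureA (unit_vector n) (unit_vector n))"
  "counit AH x = (\<Oplus>n\<in>carrier Q. x n)"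
  "antipode AH x = (\<lambda>n\<in>carrier Q. x (inv\<^bsub>Q\<^esub> n))"
  by (simp_all add: group_hopf_algebra_def Let_def module.defs hopf.defs unit_vector_def)

text \<open>\<open>greither_pareigis_structure\<close> forms tensors of the Hopf algebra
  \<open>AH\<close>, while the comultiplication of \<open>AH\<close> refers to the underlying
  algebra \<open>A\<close>.\<close>

lemma tensor_AH: "tensor M AH AH = TA" and pure_tensor_AH: "pure_tensor M AH AH = pureA"
proof -
  have "pure_tensor M AH AH = pureA"
    by (intro ext) (simp add: pure_tensor_def tensor_null_def tensor_relators_def AH_simps)
  moreover have "tensor_module M AH AH = tensor_module M A A"
    by (simp add: tensor_module_def tensor_null_def tensor_relators_def AH_simps)
  ultimately show "tensor M AH AH = TA" "pure_tensor M AH AH = pureA"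
    by (simp_all add: tensor_def AH_simps)
qed

lemma comult_AH_closed: "x \<in> carrier A \<Longrightarrow> comult AH x \<in> carrier TA"
proof -
  interpret TA: Module.module M TA by (rule module_TA)
  show "x \<in> carrier A \<Longrightarrow> ?thesis"
    unfolding AH_simps by (intro TA.finsum_closed funcsetI TA.smult_closed pureA_closed)
      (simp_all add: A_value)
qed

lemma values_comult_AH:
  assumes x: "x \<in> carrier A" and k: "k \<in> carrier Q" "l \<in> carrier Q"
  shows "AA.values (comult AH x) (k, l) = (if k = l then x k else \<zero>)"
proof -
  interpret TA: Module.module M TA by (rule module_TA)
  have "AA.values (comult AH x) (k, l) =
      (\<Oplus>n\<in>carrier Q. AA.values (x n \<odot>\<^bsub>TA\<^esub> pureA (unit_vector n) (unit_vector n)) (k, l))"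
    unfolding AH_simps
    by (rule additive_finsum[where \<phi>="\<lambda>t. AA.values t (k, l)" and V=TA])
      (use x k A_value[OF x] TA.abelian_group_axioms abelian_group_axioms in auto)
  also have "\<dots> = (\<Oplus>n\<in>carrier Q. if n = k then (if n = l then x n else \<zero>) else \<zero>)"
    using x k A_value[OF x] by (intro finsum_cong' refl funcsetI) (auto simp: unit_vector_at)
  also have "\<dots> = (if k = l then x k else \<zero>)"
    using k A_value[OF x] by (subst finsum_delta) auto
  finally show ?thesis .
qed

end

context hopf_model
begin

lemma f_ring_hom: "f \<in> Ring.ring_hom H AH"
  by (rule ring_hom_memI) (simp_all add: H_simps(1) AH_simps f_hom)

text \<open>Both sides lie in the tensor square over M, where both have the diagonal function of h
  as their values.\<close>

lemma comult_compatible: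
  assumes h: "h \<in> HC"
  shows "comult AH (f h) =
    tensor_lift R (tensor M AH AH) (\<lambda>h1 h2. pure_tensor M AH AH (f h1) (f h2)) (comult H h)"
  unfolding tensor_AH pure_tensor_AH
proof -
  interpret TA: Module.module R TA
    by (rule module_restrict_scalars[OF module_TA subfield_K field_axioms])
  have TA_smult: "k \<odot>\<^bsub>TA\<^esub> t \<in> carrier TA" if "k \<in> K" "t \<in> carrier TA" for k t
    using TA.smult_closed that by simp
  have bil: "bilinear_map R H H TA (\<lambda>h1 h2. pureA (f h1) (f h2))"
    by (intro bilinear_mapI TA_eqI) (simp_all add: H_simps(1) TA_smult f_at l_distr r_distr m_ac)
  interpret t: tensor_lifting R H H TA "\<lambda>h1 h2. pureA (f h1) (f h2)"
    by (intro tensor_lifting.intro tensor_lifting_axioms.intro HH.TM.tensor_modules_axioms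
        TA.module_axioms bil)
  show "comult AH (f h) = t.tlift (comult H h)"
  proof (rule TA_eqI)
    fix k l assume k: "k \<in> carrier Q" "l \<in> carrier Q"
    have "AA.values (t.tlift (comult H h)) (k, l) = HH.values (comult H h) (k, l)"
      by (rule t.tensor_lift_eqI[where pl="add M" and \<phi>="\<lambda>u. AA.values u (k, l)"
          and \<psi>="\<lambda>u. HH.values u (k, l)"]) (use h k in \<open>simp_all add: H_simps(1)\<close>)
    then show "AA.values (comult AH (f h)) (k, l) = AA.values (t.tlift (comult H h)) (k, l)"
      using h k by (simp add: values_comult_AH)
  qed (use h t.tensor_lift_closed[of "comult H h"] in \<open>simp_all add: comult_AH_closed\<close>)
qed

end

section \<open>Baer's abelian group structure\<close>

definition add_mult :: "nat \<Rightarrow> 'z \<Rightarrow> 'z :: ab_group_add" where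
  "add_mult n x = ((+) x ^^ n) 0"

lemma add_mult_simps [simp]: "add_mult 0 x = 0" "add_mult (Suc n) x = x + add_mult n x"
  by (simp_all add: add_mult_def)

lemma add_mult_add: "add_mult (m + n) x = add_mult m x + add_mult n x"
  by (induction m) (simp_all add: add.assoc)

text \<open>
  A group of class two whose multiplication is the addition of \<open>'z\<close>, taken modulo some
  subgroup, twisted by an alternating form \<open>\<beta>\<close>. The number \<open>h\<close> plays the part of one half.
\<close>

locale baer = T: group T for T :: "('t, 'u) monoid_scheme" (structure) +
  fixes \<Psi> :: "'z :: ab_group_add \<Rightarrow> 't" and \<beta> :: "'z \<Rightarrow> 'z \<Rightarrow> 'z" and h :: nat
  assumes range: "range \<Psi> = carrier T"
    and mult: "\<Psi> x \<otimes> \<Psi> y = \<Psi> (x + y + \<beta> x y)"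
    and \<beta>_add_left: "\<beta> (x + y) z = \<beta> x z + \<beta> y z"
    and \<beta>_add_right: "\<beta> x (y + z) = \<beta> x y + \<beta> x z"
    and \<beta>_alternating: "\<beta> x x = 0"
    and \<beta>_nested: "\<Psi> (\<beta> (\<beta> x y) z + w) = \<Psi> w"
    and cong: "\<Psi> x = \<Psi> y \<Longrightarrow> \<Psi> (x + z) = \<Psi> (y + z)"
    and half: "\<Psi> (add_mult (2 * h) x) = \<Psi> x"
begin

lemma \<Psi>_closed [simp]: "\<Psi> x \<in> carrier T"
  using range by auto

lemma \<Psi>_surj: "t \<in> carrier T \<Longrightarrow> \<exists>x. \<Psi> x = t"
  using range by (metis imageE)

lemma \<beta>_zero [simp]: "\<beta> 0 x = 0" "\<beta> x 0 = 0"
  using \<beta>_add_left[of 0 0 x] \<beta>_add_right[of x 0 0] by simp_all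

lemma \<beta>_antisym: "\<beta> x y + \<beta> y x = 0"
  using \<beta>_alternating[of "x + y"] unfolding \<beta>_add_left \<beta>_add_right
  by (simp add: \<beta>_alternating add.commute)

lemma \<Psi>_zero: "\<Psi> 0 = \<one>"
  using mult[of 0 0] T.r_cancel_one'[of "\<Psi> 0" "\<Psi> 0"] by simp

lemma \<beta>_add_mult: "\<beta> (add_mult n x) x = 0"
  by (induction n) (simp_all add: \<beta>_add_left \<beta>_alternating)

lemma \<Psi>_pow: "\<Psi> x [^] n = \<Psi> (add_mult n x)"
  by (induction n) (simp_all add: \<Psi>_zero mult \<beta>_add_mult add.commute)

text \<open>Baer's formula. The power with exponent h halves x; the terms \<beta>(x/2, y) and
  \<beta>(y, x/2) cancel, and the nested one is invisible to \<Psi>. As the right side uses the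
  group operations only, homomorphisms preserve the sum.\<close>

lemma sum_by_powers: "\<Psi> (x + y) = \<Psi> x [^] h \<otimes> \<Psi> y \<otimes> \<Psi> x [^] h"
proof -
  let ?x = "add_mult h x"
  have "\<Psi> x [^] h \<otimes> \<Psi> y \<otimes> \<Psi> x [^] h = \<Psi> (?x + y + \<beta> ?x y + ?x + \<beta> (?x + y + \<beta> ?x y) ?x)"
    by (simp add: \<Psi>_pow mult)
  also have "?x + y + \<beta> ?x y + ?x + \<beta> (?x + y + \<beta> ?x y) ?x =
      \<beta> (\<beta> ?x y) ?x + ((?x + ?x) + y + (\<beta> ?x y + \<beta> y ?x))"
    by (simp add: \<beta>_add_left \<beta>_alternating algebra_simps)
  also have "\<Psi> \<dots> = \<Psi> (add_mult (2 * h) x + y)"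
    unfolding \<beta>_nested by (simp add: \<beta>_antisym add_mult_add[symmetric] mult_2)
  finally show ?thesis using cong[OF half, of x y] by simp
qed

text \<open>This is what makes the translations normalised: right multiplication by a carries
  translation by u into translation by u + \<beta>(u, a). Here w is any label of the product of v
  and a.\<close>

lemma translate_mult:
  assumes "\<Psi> w = \<Psi> v \<otimes> \<Psi> a"
  shows "\<Psi> (u + v) \<otimes> \<Psi> a = \<Psi> (u + \<beta> u a + w)"
proof -
  have "\<Psi> (w + (u + \<beta> u a)) = \<Psi> (v + a + \<beta> v a + (u + \<beta> u a))"
    by (rule cong) (simp add: assms mult)
  moreover have "\<Psi> (u + v) \<otimes> \<Psi> a = \<Psi> (v + a + \<beta> v a + (u + \<beta> u a))"
    by (simp add: mult \<beta>_add_left algebra_simps)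
  ultimately show ?thesis by (simp add: add.commute)
qed

text \<open>\<alpha> acts on T only, and \<Psi> need not be injective; so the images are given by
  arbitrary labels x' and y'.\<close>

lemma hom_sum:
  assumes "\<alpha> \<in> hom T T" "\<alpha> (\<Psi> x) = \<Psi> x'" "\<alpha> (\<Psi> y) = \<Psi> y'"
  shows "\<alpha> (\<Psi> (x + y)) = \<Psi> (x' + y')"
proof -
  have pow: "\<alpha> (t [^] n) = \<alpha> t [^] n" if "t \<in> carrier T" for t and n :: nat
    using group_hom.hom_nat_pow[of T T \<alpha> t n] assms(1) that
    by (simp add: group_hom_def group_hom_axioms_def T.is_group)
  show ?thesis
    unfolding sum_by_powers using assms by (simp add: hom_mult pow)
qed

end

section \<open>The regular group of translations for Baer's addition\<close>

locale baer_regular = baer T \<Psi> \<beta> h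
  for T :: "('t, 'u) monoid_scheme" (structure) and \<Psi> :: "'z :: ab_group_add \<Rightarrow> 't" and \<beta> h +
  fixes \<Omega> :: "'x set" and N and \<phi> and x0
  assumes subgroup_N: "subgroup N (BijGroup \<Omega>)" and regular: "regular_perms \<Omega> N"
    and \<phi>: "\<phi> \<in> iso T ((BijGroup \<Omega>)\<lparr>carrier := N\<rparr>)" and x0: "x0 \<in> \<Omega>"
begin

lemma mult_BijGroup:
  "\<lbrakk>u \<in> carrier (BijGroup \<Omega>); v \<in> carrier (BijGroup \<Omega>)\<rbrakk> \<Longrightarrow> u \<otimes>\<^bsub>BijGroup \<Omega>\<^esub> v = compose \<Omega> u v"
  by (simp add: BijGroup_def)

lemma N_carrier: "n \<in> N \<Longrightarrow> n \<in> carrier (BijGroup \<Omega>)"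
  using subgroup.subset[OF subgroup_N] by blast

lemma N_Bij: "n \<in> N \<Longrightarrow> n \<in> Bij \<Omega>"
  using N_carrier by (simp add: BijGroup_def)

lemma \<phi>_closed: "t \<in> carrier T \<Longrightarrow> \<phi> t \<in> N"
  using \<phi> by (auto simp: iso_def hom_def)

lemma \<phi>_surj: "n \<in> N \<Longrightarrow> \<exists>t\<in>carrier T. \<phi> t = n"
  using \<phi> by (auto simp: iso_def bij_betw_def)

lemma \<phi>_inj: "\<lbrakk>s \<in> carrier T; t \<in> carrier T; \<phi> s = \<phi> t\<rbrakk> \<Longrightarrow> s = t"
  using \<phi> by (auto simp: iso_def bij_betw_def inj_on_def)

lemma \<phi>_mult:
  assumes "s \<in> carrier T" "t \<in> carrier T" "x \<in> \<Omega>"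
  shows "\<phi> (s \<otimes> t) x = \<phi> s (\<phi> t x)"
proof -
  have "\<phi> (s \<otimes> t) = compose \<Omega> (\<phi> s) (\<phi> t)"
    using \<phi> assms by (simp add: iso_def hom_def N_carrier \<phi>_closed flip: mult_BijGroup)
  then show ?thesis using assms by (simp add: compose_eq)
qed

lemma \<phi>_in: "\<lbrakk>t \<in> carrier T; x \<in> \<Omega>\<rbrakk> \<Longrightarrow> \<phi> t x \<in> \<Omega>"
  using Bij_imp_funcset[OF N_Bij[OF \<phi>_closed]] by blast

text \<open>Labels for \<Omega>: regularity identifies N with \<Omega> through x0, and \<Psi> labels
  the elements of N.\<close>

definition point :: "'z \<Rightarrow> 'x" where
  "point v = \<phi> (\<Psi> v) x0"

lemma point_closed [simp]: "point v \<in> \<Omega>"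
  unfolding point_def using \<phi>_in x0 by simp

lemma point_eq_iff: "point v = point w \<longleftrightarrow> \<Psi> v = \<Psi> w"
proof
  assume "point v = point w"
  then have "\<phi> (\<Psi> v) = \<phi> (\<Psi> w)"
    using regular x0 \<phi>_closed[of "\<Psi> v"] \<phi>_closed[of "\<Psi> w"] point_closed[of w]
    unfolding regular_perms_def point_def by (metis \<Psi>_closed)
  then show "\<Psi> v = \<Psi> w" using \<phi>_inj by simp
qed (simp add: point_def)

lemma point_surj: "x \<in> \<Omega> \<Longrightarrow> \<exists>v. point v = x"
  using regular x0 \<phi>_surj \<Psi>_surj unfolding regular_perms_def point_def by metis

lemma point_translate: "point v = point w \<Longrightarrow> point (z + v) = point (z + w)"
  using cong[of v w z] by (simp add: point_eq_iff add.commute)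

text \<open>Addition of z to a label; which label of x is chosen does not matter, by
  \<open>point_translate\<close>.\<close>

definition \<pi> :: "'z \<Rightarrow> 'x \<Rightarrow> 'x" where
  "\<pi> z = (\<lambda>x\<in>\<Omega>. point (z + (SOME v. point v = x)))"

lemma \<pi>_point: "\<pi> z (point v) = point (z + v)"
proof -
  have "point (SOME w. point w = point v) = point v" by (rule someI) simp
  from point_translate[OF this, of z] show ?thesis unfolding \<pi>_def by simp
qed

lemma perm_eqI:
  assumes "u \<in> extensional \<Omega>" "u' \<in> extensional \<Omega>" "\<And>v. u (point v) = u' (point v)"
  shows "u = u'"
  using assms point_surj by (intro extensionalityI[of u \<Omega> u']) auto

lemma \<pi>_extensional: "\<pi> z \<in> extensional \<Omega>"
  by (simp add: \<pi>_def)

lemma \<pi>_Bij: "\<pi> z \<in> Bij \<Omega>"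
proof -
  have "bij_betw (\<pi> z) \<Omega> \<Omega>"
  proof (rule bij_betw_byWitness[where f'="\<pi> (- z)"])
    show "\<forall>x\<in>\<Omega>. \<pi> (- z) (\<pi> z x) = x" "\<forall>x\<in>\<Omega>. \<pi> z (\<pi> (- z) x) = x"
      using point_surj by (metis \<pi>_point minus_add_cancel add_minus_cancel)+
    show "\<pi> z ` \<Omega> \<subseteq> \<Omega>" "\<pi> (- z) ` \<Omega> \<subseteq> \<Omega>" by (auto simp: \<pi>_def)
  qed
  then show ?thesis by (simp add: Bij_def \<pi>_extensional)
qed

lemma \<pi>_carrier [simp]: "\<pi> z \<in> carrier (BijGroup \<Omega>)"
  using \<pi>_Bij by (simp add: BijGroup_def)

lemma \<pi>_mult: "\<pi> y \<otimes>\<^bsub>BijGroup \<Omega>\<^esub> \<pi> z = \<pi> (y + z)"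
  by (rule perm_eqI)
    (simp_all add: mult_BijGroup \<pi>_extensional compose_eq \<pi>_point add.assoc)

lemma \<pi>_eq_iff: "\<pi> y = \<pi> z \<longleftrightarrow> \<Psi> y = \<Psi> z"
proof
  assume "\<pi> y = \<pi> z"
  then have "\<pi> y (point 0) = \<pi> z (point 0)" by simp
  then show "\<Psi> y = \<Psi> z" by (simp add: \<pi>_point point_eq_iff)
next
  assume "\<Psi> y = \<Psi> z"
  then show "\<pi> y = \<pi> z"
    by (intro perm_eqI) (simp_all add: \<pi>_extensional \<pi>_point point_eq_iff cong[OF \<open>\<Psi> y = \<Psi> z\<close>])
qed

lemma \<pi>_zero: "\<pi> 0 = \<one>\<^bsub>BijGroup \<Omega>\<^esub>"
  by (rule perm_eqI) (simp_all add: BijGroup_def \<pi>_extensional \<pi>_point)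

lemma subgroup_\<pi>: "subgroup (range \<pi>) (BijGroup \<Omega>)"
proof -
  interpret B: group "BijGroup \<Omega>" by (rule group_BijGroup)
  show ?thesis
  proof (rule B.subgroupI)
    fix u assume "u \<in> range \<pi>"
    then obtain z where z: "u = \<pi> z" by auto
    have "inv\<^bsub>BijGroup \<Omega>\<^esub> u = \<pi> (- z)"
      unfolding z by (rule B.inv_equality) (simp_all add: \<pi>_mult \<pi>_zero)
    then show "inv\<^bsub>BijGroup \<Omega>\<^esub> u \<in> range \<pi>" by simp
  qed (auto simp: \<pi>_mult)
qed

lemma regular_\<pi>: "regular_perms \<Omega> (range \<pi>)"
  unfolding regular_perms_def
proof (intro ballI)
  fix x y assume "x \<in> \<Omega>" "y \<in> \<Omega>"
  then obtain v w where vw: "x = point v" "y = point w" using point_surj by metis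
  show "\<exists>!n. n \<in> range \<pi> \<and> n x = y"
  proof (rule ex1I[of _ "\<pi> (w - v)"])
    show "\<pi> (w - v) \<in> range \<pi> \<and> \<pi> (w - v) x = y" by (simp add: vw \<pi>_point)
    fix n assume "n \<in> range \<pi> \<and> n x = y"
    then obtain z where z: "n = \<pi> z" "\<Psi> (z + v) = \<Psi> w" by (auto simp: vw \<pi>_point point_eq_iff)
    have "\<Psi> z = \<Psi> (w - v)" using cong[OF z(2), of "- v"] by simp
    then show "n = \<pi> (w - v)" by (simp add: z \<pi>_eq_iff)
  qed
qed

lemma normalised_\<pi>:
  assumes g: "g \<in> carrier (BijGroup \<Omega>)"
    and norm: "\<And>n. n \<in> N \<Longrightarrow> g \<otimes>\<^bsub>BijGroup \<Omega>\<^esub> n \<otimes>\<^bsub>BijGroup \<Omega>\<^esub> inv\<^bsub>BijGroup \<Omega>\<^esub> g \<in> N"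
    and n: "n \<in> range \<pi>"
  shows "g \<otimes>\<^bsub>BijGroup \<Omega>\<^esub> n \<otimes>\<^bsub>BijGroup \<Omega>\<^esub> inv\<^bsub>BijGroup \<Omega>\<^esub> g \<in> range \<pi>"
proof -
  interpret B: group "BijGroup \<Omega>" by (rule group_BijGroup)
  have g_in: "g x \<in> \<Omega>" if "x \<in> \<Omega>" for x
    using g that Bij_imp_funcset[of g \<Omega>] by (auto simp: BijGroup_def)
  \<comment> \<open>Conjugation by g, transported from N to T.\<close>
  define \<alpha> where "\<alpha> t = (SOME s. s \<in> carrier T \<and>
    \<phi> s = g \<otimes>\<^bsub>BijGroup \<Omega>\<^esub> \<phi> t \<otimes>\<^bsub>BijGroup \<Omega>\<^esub> inv\<^bsub>BijGroup \<Omega>\<^esub> g)" for t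
  have \<alpha>: "\<alpha> t \<in> carrier T" "\<phi> (\<alpha> t) = g \<otimes>\<^bsub>BijGroup \<Omega>\<^esub> \<phi> t \<otimes>\<^bsub>BijGroup \<Omega>\<^esub> inv\<^bsub>BijGroup \<Omega>\<^esub> g"
    if "t \<in> carrier T" for t
  proof -
    have "\<exists>s. s \<in> carrier T \<and> \<phi> s = g \<otimes>\<^bsub>BijGroup \<Omega>\<^esub> \<phi> t \<otimes>\<^bsub>BijGroup \<Omega>\<^esub> inv\<^bsub>BijGroup \<Omega>\<^esub> g"
      using \<phi>_surj[OF norm[OF \<phi>_closed[OF that]]] by auto
    from someI_ex[OF this] show "\<alpha> t \<in> carrier T"
      "\<phi> (\<alpha> t) = g \<otimes>\<^bsub>BijGroup \<Omega>\<^esub> \<phi> t \<otimes>\<^bsub>BijGroup \<Omega>\<^esub> inv\<^bsub>BijGroup \<Omega>\<^esub> g"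
      unfolding \<alpha>_def by auto
  qed
  have \<alpha>_act: "\<phi> (\<alpha> t) (g x) = g (\<phi> t x)" if t: "t \<in> carrier T" and x: "x \<in> \<Omega>" for t x
  proof -
    have "\<phi> (\<alpha> t) \<otimes>\<^bsub>BijGroup \<Omega>\<^esub> g = g \<otimes>\<^bsub>BijGroup \<Omega>\<^esub> \<phi> t"
      using \<alpha>[OF t] g N_carrier[OF \<phi>_closed[OF t]] by (simp add: B.m_assoc)
    then have "compose \<Omega> (\<phi> (\<alpha> t)) g = compose \<Omega> g (\<phi> t)"
      using g N_carrier \<phi>_closed \<alpha>(1)[OF t] t by (simp add: mult_BijGroup)
    then show ?thesis using x by (metis compose_eq)
  qed
  have "\<alpha> \<in> hom T T"
  proof (rule homI)
    fix s t assume st: "s \<in> carrier T" "t \<in> carrier T"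
    \<comment> \<open>Elements of the regular group N that agree at one point are equal, so it
      suffices to compare them at g x0.\<close>
    have "\<phi> (\<alpha> (s \<otimes> t)) (g x0) = \<phi> (\<alpha> s \<otimes> \<alpha> t) (g x0)"
      using st x0 g_in \<alpha>(1) by (simp add: \<phi>_mult \<alpha>_act \<phi>_in)
    then have "\<phi> (\<alpha> (s \<otimes> t)) = \<phi> (\<alpha> s \<otimes> \<alpha> t)"
      using regular g_in[OF x0] \<phi>_closed \<alpha>(1) st \<phi>_in unfolding regular_perms_def
      by (metis T.m_closed)
    then show "\<alpha> (s \<otimes> t) = \<alpha> s \<otimes> \<alpha> t" using \<phi>_inj \<alpha>(1) st by simp
  qed (use \<alpha> in auto)
  \<comment> \<open>With a as a label of g x0, \<open>g_point\<close> exhibits g as an element of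
    the holomorph, y -> \<alpha>(y) a.\<close>
  obtain a where a: "point a = g x0" using point_surj g_in[OF x0] by blast
  have g_point: "g (point v) = \<phi> (\<alpha> (\<Psi> v) \<otimes> \<Psi> a) x0" for v
    using \<alpha>_act[of "\<Psi> v" x0] x0 \<alpha>(1) a by (simp add: point_def \<phi>_mult)
  obtain u where u: "n = \<pi> u" using n by auto
  obtain u' where u': "\<alpha> (\<Psi> u) = \<Psi> u'" using \<Psi>_surj[OF \<alpha>(1)] by (metis \<Psi>_closed)
  \<comment> \<open>The amount of translation that \<open>translate_mult\<close> yields on the far
    side of the multiplication by a.\<close>
  let ?m = "u' + \<beta> u' a"
  have "g \<otimes>\<^bsub>BijGroup \<Omega>\<^esub> \<pi> u = \<pi> ?m \<otimes>\<^bsub>BijGroup \<Omega>\<^esub> g"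
  proof (rule perm_eqI)
    fix v
    obtain v' where v': "\<alpha> (\<Psi> v) = \<Psi> v'" using \<Psi>_surj[OF \<alpha>(1)] by (metis \<Psi>_closed)
    obtain w where w: "\<Psi> w = \<Psi> v' \<otimes> \<Psi> a" using \<Psi>_surj by (metis \<Psi>_closed T.m_closed)
    have "g (point (u + v)) = \<phi> (\<Psi> (u' + v') \<otimes> \<Psi> a) x0"
      unfolding g_point using hom_sum[OF \<open>\<alpha> \<in> hom T T\<close> u' v'] by simp
    also have "\<dots> = point (?m + w)" unfolding translate_mult[OF w] point_def ..
    also have "\<dots> = \<pi> ?m (point w)" by (simp add: \<pi>_point)
    also have "point w = g (point v)" by (simp only: g_point v' w point_def[of w])
    finally show "(g \<otimes>\<^bsub>BijGroup \<Omega>\<^esub> \<pi> u) (point v) = (\<pi> ?m \<otimes>\<^bsub>BijGroup \<Omega>\<^esub> g) (point v)"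
      using g by (simp add: mult_BijGroup compose_eq \<pi>_point)
  qed (use g in \<open>simp_all add: mult_BijGroup\<close>)
  then have "g \<otimes>\<^bsub>BijGroup \<Omega>\<^esub> \<pi> u \<otimes>\<^bsub>BijGroup \<Omega>\<^esub> inv\<^bsub>BijGroup \<Omega>\<^esub> g = \<pi> ?m"
    using g by (simp add: B.m_assoc)
  then show ?thesis unfolding u by simp
qed

text \<open>\<kappa> is a homomorphism with the same fibres as \<Psi>, hence as \<pi>, so it factors
  through \<pi> as an isomorphism.\<close>

lemma iso_\<pi>:
  assumes \<kappa>: "range \<kappa> = carrier Z" "\<And>x y. \<kappa> (x + y) = \<kappa> x \<otimes>\<^bsub>Z\<^esub> \<kappa> y"
    "\<And>x y. \<kappa> x = \<kappa> y \<longleftrightarrow> \<Psi> x = \<Psi> y"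
  shows "(BijGroup \<Omega>)\<lparr>carrier := range \<pi>\<rparr> \<cong> Z"
proof -
  define j where "j u = \<kappa> (SOME z. \<pi> z = u)" for u
  have j: "j (\<pi> z) = \<kappa> z" for z
  proof -
    have "\<pi> (SOME y. \<pi> y = \<pi> z) = \<pi> z" by (rule someI) simp
    then show ?thesis unfolding j_def by (simp add: \<kappa>(3) \<pi>_eq_iff)
  qed
  have "j \<in> iso ((BijGroup \<Omega>)\<lparr>carrier := range \<pi>\<rparr>) Z"
  proof (rule isoI)
    show "j \<in> hom ((BijGroup \<Omega>)\<lparr>carrier := range \<pi>\<rparr>) Z"
      by (rule homI) (use \<kappa>(1) in \<open>auto simp: j \<pi>_mult \<kappa>(2)\<close>)
    show "bij_betw j (carrier ((BijGroup \<Omega>)\<lparr>carrier := range \<pi>\<rparr>)) (carrier Z)"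
      using \<kappa>(1) by (auto simp: bij_betw_def inj_on_def image_image j \<kappa>(3) \<pi>_eq_iff)
  qed
  then show ?thesis by (rule is_isoI)
qed

end

section \<open>The nonabelian groups of order \<open>p\<^sup>3\<close>\<close>

text \<open>Both bracketings of a triple product give the same sum up to \<beta>(\<beta>(x, y), z)
  and \<beta>(x, \<beta>(y, z)), which \<Psi> ignores. The inverse of \<Psi> x is \<Psi> (- x)
  because \<beta> is alternating.\<close>

lemma group_twisted:
  fixes T (structure) and \<Psi> :: "'z :: ab_group_add \<Rightarrow> 't"
  assumes range: "range \<Psi> = carrier T" and one: "\<one> = \<Psi> 0"
    and mult: "\<And>x y. \<Psi> x \<otimes> \<Psi> y = \<Psi> (x + y + \<beta> x y)"
    and add_left: "\<And>x y z. \<beta> (x + y) z = \<beta> x z + \<beta> y z"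
    and add_right: "\<And>x y z. \<beta> x (y + z) = \<beta> x y + \<beta> x z"
    and alternating: "\<And>x. \<beta> x x = 0"
    and nested: "\<And>x y z w. \<Psi> (\<beta> (\<beta> x y) z + w) = \<Psi> w" "\<And>x y z w. \<Psi> (\<beta> x (\<beta> y z) + w) = \<Psi> w"
  shows "group T"
proof (rule groupI)
  have zero: "\<beta> 0 x = 0" for x using add_left[of 0 0 x] by simp
  have neg: "\<beta> (- x) x = 0" for x using add_left[of "- x" x x] by (simp add: zero alternating)
  fix s assume "s \<in> carrier T"
  then obtain x where x: "s = \<Psi> x" using range by (metis imageE)
  show "\<one> \<otimes> s = s" by (simp add: x one mult zero)
  show "\<exists>t\<in>carrier T. t \<otimes> s = \<one>"
    using range by (intro bexI[of _ "\<Psi> (- x)"]) (auto simp: x one mult neg)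
  fix t assume "t \<in> carrier T"
  then obtain y where y: "t = \<Psi> y" using range by (metis imageE)
  show "s \<otimes> t \<in> carrier T" using range by (auto simp: x y mult)
  fix r assume "r \<in> carrier T"
  then obtain z where z: "r = \<Psi> z" using range by (metis imageE)
  let ?sum = "x + y + z + \<beta> x y + \<beta> x z + \<beta> y z"
  have "s \<otimes> t \<otimes> r = \<Psi> (\<beta> (\<beta> x y) z + ?sum)"
    by (simp add: x y z mult add_left algebra_simps)
  also have "\<dots> = \<Psi> (\<beta> x (\<beta> y z) + ?sum)" by (simp only: nested)
  also have "\<dots> = s \<otimes> (t \<otimes> r)"
    by (simp add: x y z mult add_right algebra_simps)
  finally show "s \<otimes> t \<otimes> r = s \<otimes> (t \<otimes> r)" .
qed (use range one in auto)

section \<open>Exponential coordinates on the two groups of matrices\<close>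

lemma add_mult_int: "add_mult n (x :: int) = int n * x"
  by (induction n) (simp_all add: algebra_simps)

lemma add_mult_Pair: "add_mult n (x, y) = (add_mult n x, add_mult n y)"
  by (induction n) (simp_all add: zero_prod_def)

text \<open>The matrix I + X + X^2 / 2, with h for 1/2, where X is strictly upper triangular with
  entries x and z next to the diagonal and y in the corner. The only entry of X^2 is x z, in the
  corner.\<close>

definition heisenberg_matrix :: "nat \<Rightarrow> nat \<Rightarrow> int \<times> int \<times> int \<Rightarrow> int mat" where
  "heisenberg_matrix p h v = (case v of (x, y, z) \<Rightarrow>
     mat_of_rows_list 3 [[1, x mod int p, (y + int h * x * z) mod int p], [0, 1, z mod int p], [0, 0, 1]])"

text \<open>Half the commutator of the two strictly triangular matrices, as in the
  Baker-Campbell-Hausdorff formula.\<close>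

definition heisenberg_form :: "nat \<Rightarrow> int \<times> int \<times> int \<Rightarrow> int \<times> int \<times> int \<Rightarrow> int \<times> int \<times> int" where
  "heisenberg_form h v w = (case v of (x, y, z) \<Rightarrow> case w of (x', y', z') \<Rightarrow>
     (0, int h * (x * z' - x' * z), 0))"

text \<open>Again I + X + X^2 / 2, now for X with first row (p b, x) and second row zero. Modulo p^2
  the only entry of X^2 is p b x.\<close>

definition G_matrix :: "nat \<Rightarrow> nat \<Rightarrow> int \<times> int \<Rightarrow> int mat" where
  "G_matrix p h v = (case v of (x, b) \<Rightarrow>
     mat_of_rows_list 2 [[(1 + int p * b) mod int (p\<^sup>2), (x + int h * int p * b * x) mod int (p\<^sup>2)], [0, 1]])"

definition G_form :: "nat \<Rightarrow> nat \<Rightarrow> int \<times> int \<Rightarrow> int \<times> int \<Rightarrow> int \<times> int" where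
  "G_form p h v w = (case v of (x, b) \<Rightarrow> case w of (x', b') \<Rightarrow>
     (int p * int h * (b * x' - b' * x), 0))"


lemma mult_heisenberg:
  "mat_mult_mod p (mat_of_rows_list 3 [[1, a, b], [0, 1, c], [0, 0, 1]])
     (mat_of_rows_list 3 [[1, a', b'], [0, 1, c'], [0, 0, 1]]) =
   mat_of_rows_list 3 [[1 mod int p, (a + a') mod int p, (b + b' + a * c') mod int p],
     [0, 1 mod int p, (c + c') mod int p], [0, 0, 1 mod int p]]"
proof (rule eq_matI)
  fix i j :: nat
  assume "i < dim_row (mat_of_rows_list 3 [[1 mod int p, (a + a') mod int p, (b + b' + a * c') mod int p],
     [0, 1 mod int p, (c + c') mod int p], [0, 0, 1 mod int p]])"
    "j < dim_col (mat_of_rows_list 3 [[1 mod int p, (a + a') mod int p, (b + b' + a * c') mod int p],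
     [0, 1 mod int p, (c + c') mod int p], [0, 0, 1 mod int p]])"
  then have "i \<in> {0, 1, 2}" "j \<in> {0, 1, 2}" by (auto simp: mat_of_rows_list_def)
  then show "mat_mult_mod p (mat_of_rows_list 3 [[1, a, b], [0, 1, c], [0, 0, 1]])
     (mat_of_rows_list 3 [[1, a', b'], [0, 1, c'], [0, 0, 1]]) $$ (i, j) =
   mat_of_rows_list 3 [[1 mod int p, (a + a') mod int p, (b + b' + a * c') mod int p],
     [0, 1 mod int p, (c + c') mod int p], [0, 0, 1 mod int p]] $$ (i, j)"
    by (auto simp: mat_mult_mod_def mat_of_rows_list_def scalar_prod_def numeral_3_eq_3
        algebra_simps)
qed (auto simp: mat_mult_mod_def mat_of_rows_list_def)

lemma mult_affine:
  "mat_mult_mod m (mat_of_rows_list 2 [[u, a], [0, 1]]) (mat_of_rows_list 2 [[u', a'], [0, 1]]) =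
   mat_of_rows_list 2 [[(u * u') mod int m, (u * a' + a) mod int m], [0, 1 mod int m]]"
proof (rule eq_matI)
  fix i j :: nat
  assume "i < dim_row (mat_of_rows_list 2 [[(u * u') mod int m, (u * a' + a) mod int m], [0, 1 mod int m]])"
    "j < dim_col (mat_of_rows_list 2 [[(u * u') mod int m, (u * a' + a) mod int m], [0, 1 mod int m]])"
  then have "i \<in> {0, 1}" "j \<in> {0, 1}" by (auto simp: mat_of_rows_list_def)
  then show "mat_mult_mod m (mat_of_rows_list 2 [[u, a], [0, 1]]) (mat_of_rows_list 2 [[u', a'], [0, 1]]) $$ (i, j) =
   mat_of_rows_list 2 [[(u * u') mod int m, (u * a' + a) mod int m], [0, 1 mod int m]] $$ (i, j)"
    by (auto simp: mat_mult_mod_def mat_of_rows_list_def scalar_prod_def numeral_2_eq_2)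
qed (auto simp: mat_mult_mod_def mat_of_rows_list_def)

lemma heisenberg_rows_eq_iff:
  "mat_of_rows_list 3 [[1, a, b], [0, 1, c], [0, 0, 1]] = mat_of_rows_list 3 [[1, a', b'], [0, 1, c'], [0, 0, 1 :: int]]
    \<longleftrightarrow> a = a' \<and> b = b' \<and> c = c'" (is "?A = ?B \<longleftrightarrow> _")
proof
  assume "?A = ?B"
  then have "?A $$ (0, 1) = ?B $$ (0, 1)" "?A $$ (0, 2) = ?B $$ (0, 2)" "?A $$ (1, 2) = ?B $$ (1, 2)"
    by simp_all
  then show "a = a' \<and> b = b' \<and> c = c'" by (simp add: mat_of_rows_list_def)
qed simp

lemma affine_rows_eq_iff:
  "mat_of_rows_list 2 [[u, a], [0, 1]] = mat_of_rows_list 2 [[u', a'], [0, 1 :: int]] \<longleftrightarrow> u = u' \<and> a = a'"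
  (is "?A = ?B \<longleftrightarrow> _")
proof
  assume "?A = ?B"
  then have "?A $$ (0, 0) = ?B $$ (0, 0)" "?A $$ (0, 1) = ?B $$ (0, 1)" by simp_all
  then show "u = u' \<and> a = a'" by (simp add: mat_of_rows_list_def)
qed simp

text \<open>The corner entry differs from y by a term that depends only on x and z modulo p, so the
  coordinates can be read off one after another.\<close>

lemma heisenberg_matrix_eq_iff:
  "heisenberg_matrix p h (x, y, z) = heisenberg_matrix p h (x', y', z') \<longleftrightarrow>
    x mod int p = x' mod int p \<and> y mod int p = y' mod int p \<and> z mod int p = z' mod int p"
proof -
  have "y mod int p = y' mod int p \<longleftrightarrow> (y + int h * x * z) mod int p = (y' + int h * x' * z') mod int p"
    if "x mod int p = x' mod int p" "z mod int p = z' mod int p"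
  proof -
    have "int p dvd int h * (x * (z - z') + (x - x') * z')"
      using that by (intro dvd_mult dvd_add dvd_mult2) (simp_all add: mod_eq_dvd_iff)
    moreover have "(y + int h * x * z) - (y' + int h * x' * z') =
        (y - y') + int h * (x * (z - z') + (x - x') * z')"
      by (simp add: algebra_simps)
    ultimately show ?thesis
      unfolding mod_eq_dvd_iff by (metis dvd_add_left_iff)
  qed
  then show ?thesis by (auto simp: heisenberg_matrix_def heisenberg_rows_eq_iff)
qed

lemma heisenberg_matrix_mult:
  assumes p: "p > 1" and h: "2 * h = p + 1"
  shows "mat_mult_mod p (heisenberg_matrix p h v) (heisenberg_matrix p h w) =
    heisenberg_matrix p h (v + w + heisenberg_form h v w)"
proof -
  obtain x y z x' y' z' where vw: "v = (x, y, z)" "w = (x', y', z')" by (cases v; cases w) auto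
  have h': "int p = 2 * int h - 1" using h by linarith
  \<comment> \<open>The quadratic terms leave 2 h x z' against x z' in the matrix product, and 2 h -
    1 = p.\<close>
  have "(y + y' + int h * (x * z' - x' * z)) + int h * (x + x') * (z + z') -
      ((y + int h * x * z) + (y' + int h * x' * z') + x * z') = int p * (x * z')"
    unfolding h' by (simp add: algebra_simps)
  then have "((y + int h * x * z) + (y' + int h * x' * z') + x * z') mod int p =
      ((y + y' + int h * (x * z' - x' * z)) + int h * (x + x') * (z + z')) mod int p"
    by (metis dvd_triv_left mod_eq_dvd_iff)
  moreover have "((y + int h * x * z) mod int p + (y' + int h * x' * z') mod int p +
      x mod int p * (z' mod int p)) mod int p =
      ((y + int h * x * z) + (y' + int h * x' * z') + x * z') mod int p"
    by (intro mod_add_cong mod_mult_cong) simp_all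
  ultimately show ?thesis
    using p by (simp add: vw heisenberg_matrix_def heisenberg_form_def mult_heisenberg
        heisenberg_rows_eq_iff mod_add_eq)
qed

lemma range_heisenberg_matrix:
  assumes p: "p > 1"
  shows "range (heisenberg_matrix p h) = carrier (heisenberg_group p)"
proof (intro equalityI subsetI)
  fix A assume "A \<in> carrier (heisenberg_group p)"
  then obtain a b c where A: "A = mat_of_rows_list 3 [[1, a, b], [0, 1, c], [0, 0, 1]]"
    "a \<in> {0..<int p}" "b \<in> {0..<int p}" "c \<in> {0..<int p}"
    by (auto simp: heisenberg_group_def)
  \<comment> \<open>The quadratic part of the corner entry is subtracted in advance.\<close>
  then have "A = heisenberg_matrix p h (a, b - int h * a * c, c)" by (simp add: heisenberg_matrix_def)
  then show "A \<in> range (heisenberg_matrix p h)" by simp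
qed (use p in \<open>force simp: heisenberg_matrix_def heisenberg_group_def\<close>)

lemma one_heisenberg: "p > 1 \<Longrightarrow> \<one>\<^bsub>heisenberg_group p\<^esub> = heisenberg_matrix p h 0"
proof -
  have "1\<^sub>m 3 = mat_of_rows_list 3 [[1, 0, 0], [0, 1, 0], [0, 0, 1 :: int]]"
  proof (rule eq_matI)
    fix i j :: nat
    assume "i < dim_row (mat_of_rows_list 3 [[1, 0, 0], [0, 1, 0], [0, 0, 1 :: int]])"
      "j < dim_col (mat_of_rows_list 3 [[1, 0, 0], [0, 1, 0], [0, 0, 1 :: int]])"
    then have "i \<in> {0, 1, 2}" "j \<in> {0, 1, 2}" by (auto simp: mat_of_rows_list_def)
    then show "1\<^sub>m 3 $$ (i, j) = mat_of_rows_list 3 [[1, 0, 0], [0, 1, 0], [0, 0, 1 :: int]] $$ (i, j)"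
      by (auto simp: mat_of_rows_list_def)
  qed (auto simp: mat_of_rows_list_def)
  then show ?thesis by (simp add: heisenberg_group_def heisenberg_matrix_def zero_prod_def)
qed

lemma heisenberg_form_bilinear:
  "heisenberg_form h (u + v) w = heisenberg_form h u w + heisenberg_form h v w"
  "heisenberg_form h w (u + v) = heisenberg_form h w u + heisenberg_form h w v"
  "heisenberg_form h u u = 0"
  by (simp_all add: heisenberg_form_def zero_prod_def algebra_simps split: prod.split)

lemma heisenberg_form_nested:
  "heisenberg_matrix p k (heisenberg_form h (heisenberg_form h u v) w + x) = heisenberg_matrix p k x"
  "heisenberg_matrix p k (heisenberg_form h w (heisenberg_form h u v) + x) = heisenberg_matrix p k x"
proof -
  have "heisenberg_form h (heisenberg_form h u v) w = 0" "heisenberg_form h w (heisenberg_form h u v) = 0"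
    by (simp_all add: heisenberg_form_def zero_prod_def split: prod.split)
  then show
    "heisenberg_matrix p k (heisenberg_form h (heisenberg_form h u v) w + x) = heisenberg_matrix p k x"
    "heisenberg_matrix p k (heisenberg_form h w (heisenberg_form h u v) + x) = heisenberg_matrix p k x"
    by simp_all
qed

lemma baer_heisenberg:
  assumes p: "p > 1" and h: "2 * h = p + 1"
  shows "baer (heisenberg_group p) (heisenberg_matrix p h) (heisenberg_form h) h"
proof -
  have mult: "heisenberg_matrix p h x \<otimes>\<^bsub>heisenberg_group p\<^esub> heisenberg_matrix p h y =
      heisenberg_matrix p h (x + y + heisenberg_form h x y)" for x y
    using heisenberg_matrix_mult[OF p h] by (simp add: heisenberg_group_def)
  have "group (heisenberg_group p)"
    by (rule group_twisted[OF range_heisenberg_matrix[OF p] one_heisenberg[OF p] mult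
          heisenberg_form_bilinear heisenberg_form_nested])
  moreover have "heisenberg_matrix p h (add_mult (2 * h) x) = heisenberg_matrix p h x" for x
  proof -
    obtain a b c where x: "x = (a, b, c)" by (cases x) auto
    have "(int (2 * h) * k) mod int p = k mod int p" for k
      unfolding h by (simp add: algebra_simps)
    then show ?thesis by (simp only: x add_mult_Pair add_mult_int heisenberg_matrix_eq_iff)
  qed
  moreover have "heisenberg_matrix p h (x + z) = heisenberg_matrix p h (y + z)"
    if "heisenberg_matrix p h x = heisenberg_matrix p h y" for x y z
  proof -
    obtain a b c where x: "x = (a, b, c)" by (rule prod_cases3)
    obtain a' b' c' where y: "y = (a', b', c')" by (rule prod_cases3)
    obtain a'' b'' c'' where z: "z = (a'', b'', c'')" by (rule prod_cases3)
    note xyz = x y z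
    show ?thesis
      using that unfolding xyz add_Pair heisenberg_matrix_eq_iff
      by (intro conjI mod_add_cong refl) simp_all
  qed
  ultimately show ?thesis
    by (intro baer.intro baer_axioms.intro range_heisenberg_matrix[OF p] mult
          heisenberg_form_bilinear heisenberg_form_nested)
qed

lemma G_matrix_eq_iff:
  assumes p: "p > 1"
  shows "G_matrix p h (x, b) = G_matrix p h (x', b') \<longleftrightarrow>
    x mod int (p\<^sup>2) = x' mod int (p\<^sup>2) \<and> b mod int p = b' mod int p"
proof -
  have 1: "(1 + int p * b) mod int (p\<^sup>2) = (1 + int p * b') mod int (p\<^sup>2) \<longleftrightarrow> b mod int p = b' mod int p"
  proof -
    have "(1 + int p * b) - (1 + int p * b') = int p * (b - b')" by (simp add: algebra_simps)
    then show ?thesis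
      using p unfolding mod_eq_dvd_iff by (simp add: power2_eq_square)
  qed
  have 2: "(x + int h * int p * b * x) mod int (p\<^sup>2) = (x' + int h * int p * b' * x') mod int (p\<^sup>2) \<longleftrightarrow>
      x mod int (p\<^sup>2) = x' mod int (p\<^sup>2)" if b: "b mod int p = b' mod int p"
  proof -
    \<comment> \<open>Changing b by p t changes the corner entry by h p^2 t x, which vanishes modulo
      p^2.\<close>
    obtain t where t: "b = b' + int p * t" using b by (metis mod_eq_dvd_iff dvdE diff_eq_eq add.commute)
    let ?k = "int h * int p * b'"
    have e: "(x + int h * int p * b * x) - (x' + int h * int p * b' * x') =
        (1 + ?k) * (x - x') + int (p\<^sup>2) * (int h * t * x)"
      by (simp add: t power2_eq_square algebra_simps)
    \<comment> \<open>1 - k inverts 1 + k modulo p^2, because k = h p b' has a square divisible by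
      p^2.\<close>
    have "x - x' = (1 - ?k) * ((1 + ?k) * (x - x')) + int (p\<^sup>2) * ((int h * b')\<^sup>2 * (x - x'))"
      by (simp add: power2_eq_square algebra_simps)
    then have "int (p\<^sup>2) dvd x - x' \<longleftrightarrow> int (p\<^sup>2) dvd (1 + ?k) * (x - x')"
      by (metis dvd_add dvd_mult dvd_triv_left)
    then show ?thesis
      unfolding mod_eq_dvd_iff e by (metis dvd_add_left_iff dvd_triv_left)
  qed
  show ?thesis using 1 2 by (auto simp: G_matrix_def affine_rows_eq_iff)
qed

lemma one_mod_square: "p > 1 \<Longrightarrow> 1 mod int (p\<^sup>2) = 1"
proof -
  assume "p > 1"
  then have "p\<^sup>2 > 1" by (rule one_less_power) simp
  then have "int (p\<^sup>2) > 1" by linarith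
  then show ?thesis by (intro mod_pos_pos_trivial) simp_all
qed

lemma G_matrix_mult:
  assumes p: "p > 1" and h: "2 * h = p\<^sup>2 + 1"
  shows "mat_mult_mod (p\<^sup>2) (G_matrix p h v) (G_matrix p h w) = G_matrix p h (v + w + G_form p h v w)"
proof -
  obtain x b x' b' where vw: "v = (x, b)" "w = (x', b')" by (cases v; cases w) auto
  have h': "2 * int h = int (p\<^sup>2) + 1" using h by linarith
  let ?X = "x + x' + int p * int h * (b * x' - b' * x)"
  have "(1 + int p * b) * (1 + int p * b') - (1 + int p * (b + b')) = int (p\<^sup>2) * (b * b')"
    by (simp add: power2_eq_square algebra_simps)
  then have 1: "((1 + int p * b) * (1 + int p * b')) mod int (p\<^sup>2) = (1 + int p * (b + b')) mod int (p\<^sup>2)"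
    by (metis dvd_triv_left mod_eq_dvd_iff)
  \<comment> \<open>Apart from multiples of p^2, only p b x' (1 - 2 h) remains after multiplying
    out, and 1 - 2 h = - p^2.\<close>
  have "((1 + int p * b) * (x' + int h * int p * b' * x') + (x + int h * int p * b * x)) -
      (?X + int h * int p * (b + b') * ?X) =
      int p * b * x' * (1 - 2 * int h) +
      int (p\<^sup>2) * (int h * b * b' * x' - int h * int h * (b + b') * (b * x' - b' * x))"
    by (simp add: power2_eq_square algebra_simps)
  also have "\<dots> = int (p\<^sup>2) * (int h * b * b' * x' - int h * int h * (b + b') * (b * x' - b' * x) - int p * b * x')"
    unfolding h' by (simp add: algebra_simps)
  finally have 2: "((1 + int p * b) * (x' + int h * int p * b' * x') + (x + int h * int p * b * x)) mod int (p\<^sup>2) =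
      (?X + int h * int p * (b + b') * ?X) mod int (p\<^sup>2)"
    by (metis dvd_triv_left mod_eq_dvd_iff)
  have 3: "((1 + int p * b) mod int (p\<^sup>2) * ((x' + int h * int p * b' * x') mod int (p\<^sup>2)) +
      (x + int h * int p * b * x) mod int (p\<^sup>2)) mod int (p\<^sup>2) =
      ((1 + int p * b) * (x' + int h * int p * b' * x') + (x + int h * int p * b * x)) mod int (p\<^sup>2)"
    by (intro mod_add_cong mod_mult_cong) (simp_all del: of_nat_power)
  show ?thesis
    unfolding vw G_matrix_def G_form_def prod.case add_Pair mult_affine
      one_mod_square[OF p] affine_rows_eq_iff mod_mult_eq 1 3 2 by (simp del: of_nat_power)
qed

lemma range_G_matrix:
  assumes p: "p > 1"
  shows "range (G_matrix p h) = carrier (G_group p)"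
proof (intro equalityI subsetI)
  have pos: "int (p\<^sup>2) > 0" using p by simp
  fix A assume "A \<in> carrier (G_group p)"
  then obtain a b where A: "A = mat_of_rows_list 2 [[(1 + int p * b) mod int (p\<^sup>2), a], [0, 1]]"
    "a \<in> {0..<int (p\<^sup>2)}"
    by (auto simp: G_group_def)
  \<comment> \<open>1 - h p b inverts 1 + h p b modulo p^2, so this first coordinate produces the
    entry a.\<close>
  let ?x = "a * (1 - int h * int p * b)"
  have "a - (?x + int h * int p * b * ?x) = int (p\<^sup>2) * (int h * int h * b * b * a)"
    by (simp add: power2_eq_square algebra_simps)
  then have "a mod int (p\<^sup>2) = (?x + int h * int p * b * ?x) mod int (p\<^sup>2)"
    by (metis dvd_triv_left mod_eq_dvd_iff)
  then have "A = G_matrix p h (?x, b)" using A by (simp add: G_matrix_def)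
  then show "A \<in> range (G_matrix p h)" by simp
next
  have pos: "int (p\<^sup>2) > 0" using p by simp
  fix A assume "A \<in> range (G_matrix p h)"
  then obtain x b where A: "A = G_matrix p h (x, b)" by auto
  have "(1 + int p * b) mod int (p\<^sup>2) = (1 + int p * (b mod int (p\<^sup>2))) mod int (p\<^sup>2)"
    by (metis mod_add_right_eq mod_mult_right_eq)
  then show "A \<in> carrier (G_group p)"
    unfolding A G_matrix_def G_group_def prod.case partial_object.simps mem_Collect_eq
    using pos by (intro exI[of _ "(x + int h * int p * b * x) mod int (p\<^sup>2)"] exI[of _ "b mod int (p\<^sup>2)"]) simp
qed

lemma one_G: "p > 1 \<Longrightarrow> \<one>\<^bsub>G_group p\<^esub> = G_matrix p h 0"
proof -
  assume "p > 1"
  note 1 = one_mod_square[OF this]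
  have "1\<^sub>m 2 = mat_of_rows_list 2 [[1, 0], [0, 1 :: int]]"
  proof (rule eq_matI)
    fix i j :: nat
    assume "i < dim_row (mat_of_rows_list 2 [[1, 0], [0, 1 :: int]])"
      "j < dim_col (mat_of_rows_list 2 [[1, 0], [0, 1 :: int]])"
    then have "i \<in> {0, 1}" "j \<in> {0, 1}" by (auto simp: mat_of_rows_list_def)
    then show "1\<^sub>m 2 $$ (i, j) = mat_of_rows_list 2 [[1, 0], [0, 1 :: int]] $$ (i, j)"
      by (auto simp: mat_of_rows_list_def)
  qed (auto simp: mat_of_rows_list_def)
  then show ?thesis by (simp add: G_group_def G_matrix_def zero_prod_def 1 del: of_nat_power)
qed

lemma G_form_bilinear:
  "G_form p h (u + v) w = G_form p h u w + G_form p h v w"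
  "G_form p h w (u + v) = G_form p h w u + G_form p h w v"
  "G_form p h u u = 0"
  by (simp_all add: G_form_def zero_prod_def algebra_simps split: prod.split)

text \<open>Unlike for the Heisenberg group, nested forms need not be zero as integers: they are
  multiples of p^2 in the first coordinate, which \<open>G_matrix\<close> does not see. This is why
  \<open>baer\<close> states nilpotency only under \<Psi>.\<close>

lemma G_form_nested:
  assumes p: "p > 1"
  shows "G_matrix p k (G_form p h (G_form p h u v) w + x) = G_matrix p k x"
    "G_matrix p k (G_form p h w (G_form p h u v) + x) = G_matrix p k x"
proof -
  have dvd: "(int p * (k * (int p * l)) + y) mod int (p\<^sup>2) = y mod int (p\<^sup>2)" for k l y
  proof -
    have "int p * (k * (int p * l)) + y - y = int (p\<^sup>2) * (k * l)"
      by (simp add: power2_eq_square algebra_simps)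
    then show ?thesis by (metis dvd_triv_left mod_eq_dvd_iff)
  qed
  obtain a b a' b' a'' b'' c d where
    uvwx: "u = (a, b)" "v = (a', b')" "w = (a'', b'')" "x = (c, d)"
    by (cases u; cases v; cases w; cases x) auto
  have "G_form p h (G_form p h u v) w + x =
      (int p * ((- int h * int h * b'') * (int p * (b * a' - b' * a))) + c, d)"
    by (simp add: uvwx G_form_def algebra_simps)
  then show "G_matrix p k (G_form p h (G_form p h u v) w + x) = G_matrix p k x"
    by (simp only: uvwx G_matrix_eq_iff[OF p] dvd)
  have "G_form p h w (G_form p h u v) + x =
      (int p * ((int h * int h * b'') * (int p * (b * a' - b' * a))) + c, d)"
    by (simp add: uvwx G_form_def algebra_simps)
  then show "G_matrix p k (G_form p h w (G_form p h u v) + x) = G_matrix p k x"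
    by (simp only: uvwx G_matrix_eq_iff[OF p] dvd)
qed

lemma baer_G:
  assumes p: "p > 1" and h: "2 * h = p\<^sup>2 + 1"
  shows "baer (G_group p) (G_matrix p h) (G_form p h) h"
proof -
  have mult: "G_matrix p h x \<otimes>\<^bsub>G_group p\<^esub> G_matrix p h y = G_matrix p h (x + y + G_form p h x y)" for x y
    using G_matrix_mult[OF p h] by (simp add: G_group_def)
  have "group (G_group p)"
    by (rule group_twisted[OF range_G_matrix[OF p] one_G[OF p] mult G_form_bilinear G_form_nested[OF p]])
  moreover have "G_matrix p h (add_mult (2 * h) x) = G_matrix p h x" for x
  proof -
    obtain a b where x: "x = (a, b)" by (cases x)
    have "int (2 * h) * k - k = int (p\<^sup>2) * k" for k
      unfolding h by (simp add: algebra_simps)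
    then have "(int (2 * h) * k) mod int (p\<^sup>2) = k mod int (p\<^sup>2)" for k
      by (metis dvd_triv_left mod_eq_dvd_iff)
    \<comment> \<open>The second coordinate counts modulo p, so the same h has to act as one half
      modulo p too.\<close>
    moreover have "int (2 * h) * k - k = int p * (int p * k)" for k
      unfolding h by (simp add: algebra_simps power2_eq_square)
    then have "(int (2 * h) * k) mod int p = k mod int p" for k
      by (metis dvd_triv_left mod_eq_dvd_iff)
    ultimately show ?thesis by (simp only: x add_mult_Pair add_mult_int G_matrix_eq_iff[OF p])
  qed
  moreover have "G_matrix p h (x + z) = G_matrix p h (y + z)" if "G_matrix p h x = G_matrix p h y" for x y z
  proof -
    obtain a b where x: "x = (a, b)" by (cases x)
    obtain a' b' where y: "y = (a', b')" by (cases y)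
    obtain a'' b'' where z: "z = (a'', b'')" by (cases z)
    note xyz = x y z
    show ?thesis
      using that unfolding xyz add_Pair G_matrix_eq_iff[OF p]
      by (intro conjI mod_add_cong refl) simp_all
  qed
  ultimately show ?thesis
    by (intro baer.intro baer_axioms.intro range_G_matrix[OF p] mult G_form_bilinear G_form_nested[OF p])
qed

section \<open>Coordinates in products of cyclic groups\<close>

definition heisenberg_coordinates :: "nat \<Rightarrow> int \<times> int \<times> int \<Rightarrow> int \<times> int \<times> int" where
  "heisenberg_coordinates p v = (case v of (x, y, z) \<Rightarrow> (x mod int p, y mod int p, z mod int p))"

definition G_coordinates :: "nat \<Rightarrow> int \<times> int \<Rightarrow> int \<times> int" where
  "G_coordinates p v = (case v of (x, b) \<Rightarrow> (x mod int (p\<^sup>2), b mod int p))"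

text \<open>These are the properties that \<open>iso_\<pi>\<close> asks of \<kappa>: it is onto, it
  is additive, and it has the fibres of the parametrisation by matrices.\<close>

lemma heisenberg_coordinates:
  assumes "p > 1"
  shows "range (heisenberg_coordinates p) =
      carrier (integer_mod_group p \<times>\<times> integer_mod_group p \<times>\<times> integer_mod_group p)"
    "heisenberg_coordinates p (u + v) = heisenberg_coordinates p u
      \<otimes>\<^bsub>integer_mod_group p \<times>\<times> integer_mod_group p \<times>\<times> integer_mod_group p\<^esub> heisenberg_coordinates p v"
    "heisenberg_coordinates p u = heisenberg_coordinates p v \<longleftrightarrow>
      heisenberg_matrix p h u = heisenberg_matrix p h v"
proof -
  show "range (heisenberg_coordinates p) =
      carrier (integer_mod_group p \<times>\<times> integer_mod_group p \<times>\<times> integer_mod_group p)"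
  proof (intro equalityI subsetI)
    fix v assume v: "v \<in> carrier (integer_mod_group p \<times>\<times> integer_mod_group p \<times>\<times> integer_mod_group p)"
    then have "v = heisenberg_coordinates p v"
      using assms by (auto simp: heisenberg_coordinates_def carrier_integer_mod_group)
    then show "v \<in> range (heisenberg_coordinates p)" by simp
  qed (use assms in \<open>auto simp: heisenberg_coordinates_def carrier_integer_mod_group\<close>)
qed (auto simp: heisenberg_coordinates_def heisenberg_matrix_eq_iff mod_add_eq split: prod.split)

lemma G_coordinates:
  assumes p: "p > 1"
  shows "range (G_coordinates p) = carrier (integer_mod_group (p\<^sup>2) \<times>\<times> integer_mod_group p)"
    "G_coordinates p (u + v) =
      G_coordinates p u \<otimes>\<^bsub>integer_mod_group (p\<^sup>2) \<times>\<times> integer_mod_group p\<^esub> G_coordinates p v"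
    "G_coordinates p u = G_coordinates p v \<longleftrightarrow> G_matrix p h u = G_matrix p h v"
proof -
  have pos: "int (p\<^sup>2) > 0" "p\<^sup>2 \<noteq> 0" using p by simp_all
  show "range (G_coordinates p) = carrier (integer_mod_group (p\<^sup>2) \<times>\<times> integer_mod_group p)"
  proof (intro equalityI subsetI)
    fix v assume v: "v \<in> carrier (integer_mod_group (p\<^sup>2) \<times>\<times> integer_mod_group p)"
    then have "v = G_coordinates p v"
      using p pos by (auto simp: G_coordinates_def carrier_integer_mod_group simp del: of_nat_power)
    then show "v \<in> range (G_coordinates p)" by simp
  qed (use p pos in \<open>auto simp: G_coordinates_def carrier_integer_mod_group simp del: of_nat_power\<close>)
qed (auto simp: G_coordinates_def G_matrix_eq_iff[OF p] mod_add_eq simp del: of_nat_power split: prod.split)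

section \<open>Galois groups and their cosets\<close>

locale galois_setting = field M for M :: "('a, 'b) ring_scheme" (structure) +
  fixes K L :: "'a set"
  assumes subfield_K: "subfield K M" and subfield_L: "subfield L M" and K_L: "K \<subseteq> L"
begin

abbreviation "GK \<equiv> galois_group M K"
abbreviation "G' \<equiv> carrier (galois_group M L)"
abbreviation "\<Omega> \<equiv> galois_cosets M K L"
abbreviation "Sym \<equiv> galois_sym M K L"
abbreviation "ltrans \<equiv> left_translation M K L"

lemma L_sub: "L \<subseteq> carrier M"
  using subfieldE(3)[OF subfield_L] .

lemma galois_iff:
  "\<tau> \<in> carrier (galois_group M F) \<longleftrightarrow>
    \<tau> \<in> Bij (carrier M) \<and> \<tau> \<in> Ring.ring_hom M M \<and> (\<forall>k\<in>F. \<tau> k = k)"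
  by (simp add: galois_group_def)

lemma subgroup_galois:
  assumes F: "F \<subseteq> carrier M"
  shows "subgroup (carrier (galois_group M F)) (BijGroup (carrier M))"
proof -
  interpret B: group "BijGroup (carrier M)" by (rule group_BijGroup)
  show ?thesis
  proof (rule B.subgroupI)
    show "carrier (galois_group M F) \<subseteq> carrier (BijGroup (carrier M))"
      by (auto simp: galois_iff BijGroup_def)
    have "(\<lambda>x\<in>carrier M. x) \<in> carrier (galois_group M F)"
      unfolding galois_iff using id_Bij F by (auto intro!: ring_hom_memI)
    then show "carrier (galois_group M F) \<noteq> {}" by blast
  next
    fix \<tau> assume "\<tau> \<in> carrier (galois_group M F)"
    then have \<tau>: "\<tau> \<in> Bij (carrier M)" "\<tau> \<in> Ring.ring_hom M M" "\<forall>k\<in>F. \<tau> k = k"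
      by (auto simp: galois_iff)
    define \<rho> where "\<rho> = (\<lambda>x\<in>carrier M. inv_into (carrier M) \<tau> x)"
    have \<rho>: "\<rho> \<in> Bij (carrier M)" unfolding \<rho>_def by (rule restrict_inv_into_Bij[OF \<tau>(1)])
    have b: "bij_betw \<tau> (carrier M) (carrier M)" using \<tau>(1) by (simp add: Bij_def)
    have \<rho>c: "\<rho> x \<in> carrier M" "\<tau> (\<rho> x) = x" if "x \<in> carrier M" for x
      unfolding \<rho>_def using that b by (simp_all add: bij_betw_def inv_into_into f_inv_into_f)
    have \<rho>\<tau>: "\<rho> (\<tau> x) = x" if "x \<in> carrier M" for x
      using that b ring_hom_closed[OF \<tau>(2)] unfolding \<rho>_def by (simp add: bij_betw_def)
    have eqI: "x = y" if "x \<in> carrier M" "y \<in> carrier M" "\<tau> x = \<tau> y" for x y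
      using that b by (auto simp: bij_betw_def dest: inj_onD)
    have "\<rho> \<in> Ring.ring_hom M M"
    proof (rule ring_hom_memI)
      fix x y assume xy: "x \<in> carrier M" "y \<in> carrier M"
      show "\<rho> (x \<otimes> y) = \<rho> x \<otimes> \<rho> y"
        by (rule eqI) (use xy \<rho>c \<tau>(2) in \<open>simp_all add: ring_hom_mult\<close>)
      show "\<rho> (x \<oplus> y) = \<rho> x \<oplus> \<rho> y"
        by (rule eqI) (use xy \<rho>c \<tau>(2) in \<open>simp_all add: ring_hom_add\<close>)
    next
      show "\<rho> \<one> = \<one>" using \<rho>\<tau>[of \<one>] ring_hom_one[OF \<tau>(2)] by simp
    qed (use \<rho>c in simp)
    moreover have "\<forall>k\<in>F. \<rho> k = k" using \<rho>\<tau> \<tau>(3) F by (metis subsetD)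
    ultimately show "inv\<^bsub>BijGroup (carrier M)\<^esub> \<tau> \<in> carrier (galois_group M F)"
      unfolding galois_iff inv_BijGroup[OF \<tau>(1)] \<rho>_def[symmetric] using \<rho> by simp
  next
    fix \<tau> \<rho> assume "\<tau> \<in> carrier (galois_group M F)" "\<rho> \<in> carrier (galois_group M F)"
    then have \<tau>: "\<tau> \<in> Bij (carrier M)" "\<tau> \<in> Ring.ring_hom M M" "\<forall>k\<in>F. \<tau> k = k"
      and \<rho>: "\<rho> \<in> Bij (carrier M)" "\<rho> \<in> Ring.ring_hom M M" "\<forall>k\<in>F. \<rho> k = k"
      by (auto simp: galois_iff)
    have "compose (carrier M) \<tau> \<rho> \<in> Ring.ring_hom M M"
      using \<tau>(2) \<rho>(2) by (intro ring_hom_memI)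
        (auto simp: compose_eq ring_hom_closed ring_hom_mult ring_hom_add ring_hom_one)
    then show "\<tau> \<otimes>\<^bsub>BijGroup (carrier M)\<^esub> \<rho> \<in> carrier (galois_group M F)"
      using \<tau> \<rho> F compose_Bij[OF \<tau>(1) \<rho>(1)]
      unfolding galois_iff by (auto simp: BijGroup_def compose_eq)
  qed
qed

lemma galois_restrict:
  "galois_group M F = BijGroup (carrier M)\<lparr>carrier := carrier (galois_group M F)\<rparr>"
  by (simp add: galois_group_def)

lemma group_galois: "F \<subseteq> carrier M \<Longrightarrow> group (galois_group M F)"
  by (subst galois_restrict) (intro subgroup.subgroup_is_group subgroup_galois group_BijGroup)

lemma K_sub: "K \<subseteq> carrier M"
  using K_L L_sub by blast

sublocale GK: group GK
  by (rule group_galois[OF K_sub])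

lemma galois_apply:
  assumes "\<tau> \<in> carrier GK" "\<rho> \<in> carrier GK" "x \<in> carrier M"
  shows "(\<tau> \<otimes>\<^bsub>GK\<^esub> \<rho>) x = \<tau> (\<rho> x)"
proof -
  have "\<tau> \<otimes>\<^bsub>GK\<^esub> \<rho> = compose (carrier M) \<tau> \<rho>"
    using assms by (subst galois_restrict) (simp add: BijGroup_def galois_iff)
  then show ?thesis using assms by (simp add: compose_eq)
qed

lemma G'_sub: "G' \<subseteq> carrier GK"
  using K_L by (auto simp: galois_iff subset_iff)

lemma subgroup_G': "subgroup G' GK"
proof -
  have "subgroup G' (BijGroup (carrier M)\<lparr>carrier := carrier GK\<rparr>)"
    using subgroup_galois[OF L_sub] subgroup_galois[OF K_sub] G'_sub group.subgroup_incl[OF group_BijGroup]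
    by blast
  then show ?thesis by (simp add: galois_restrict[of K, symmetric])
qed

lemma coset_iff: "C \<in> \<Omega> \<longleftrightarrow> (\<exists>\<tau>\<in>carrier GK. C = \<tau> <#\<^bsub>GK\<^esub> G')"
  by (auto simp: galois_cosets_def LCOSETS_def)

lemma cosetE:
  assumes "C \<in> \<Omega>"
  obtains \<tau> where "\<tau> \<in> carrier GK" "C = \<tau> <#\<^bsub>GK\<^esub> G'"
  using assms coset_iff by auto

lemma trans_coset:
  assumes "\<tau> \<in> carrier GK" "\<rho> \<in> carrier GK"
  shows "ltrans \<tau> (\<rho> <#\<^bsub>GK\<^esub> G') = (\<tau> \<otimes>\<^bsub>GK\<^esub> \<rho>) <#\<^bsub>GK\<^esub> G'"
proof -
  have "\<rho> <#\<^bsub>GK\<^esub> G' \<in> \<Omega>" using assms coset_iff by auto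
  then show ?thesis using assms GK.lcos_m_assoc[OF G'_sub] by (simp add: left_translation_def)
qed

lemma one_coset: "G' = \<one>\<^bsub>GK\<^esub> <#\<^bsub>GK\<^esub> G'"
  using GK.lcos_mult_one[OF G'_sub] by simp

lemma G'_coset [simp]: "G' \<in> \<Omega>"
  using one_coset coset_iff by auto

lemma trans_closed: "\<lbrakk>\<tau> \<in> carrier GK; C \<in> \<Omega>\<rbrakk> \<Longrightarrow> ltrans \<tau> C \<in> \<Omega>"
  by (elim cosetE) (auto simp: trans_coset coset_iff)

lemma trans_inv:
  assumes "\<tau> \<in> carrier GK" "C \<in> \<Omega>"
  shows "ltrans (inv\<^bsub>GK\<^esub> \<tau>) (ltrans \<tau> C) = C" "ltrans \<tau> (ltrans (inv\<^bsub>GK\<^esub> \<tau>) C) = C"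
proof -
  obtain \<rho> where \<rho>: "\<rho> \<in> carrier GK" "C = \<rho> <#\<^bsub>GK\<^esub> G'" using assms(2) by (rule cosetE)
  show "ltrans (inv\<^bsub>GK\<^esub> \<tau>) (ltrans \<tau> C) = C"
    using assms(1) \<rho> by (simp add: trans_coset GK.m_assoc[symmetric])
  show "ltrans \<tau> (ltrans (inv\<^bsub>GK\<^esub> \<tau>) C) = C"
    using assms(1) \<rho> by (simp add: trans_coset GK.m_assoc[symmetric])
qed

lemma trans_bij:
  assumes "\<tau> \<in> carrier GK"
  shows "bij_betw (ltrans \<tau>) \<Omega> \<Omega>"
  by (rule bij_betw_byWitness[where f'="ltrans (inv\<^bsub>GK\<^esub> \<tau>)"])
    (use assms in \<open>auto simp: trans_inv trans_closed\<close>)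

lemma trans_Sym: "\<tau> \<in> carrier GK \<Longrightarrow> ltrans \<tau> \<in> carrier Sym"
  using trans_bij by (auto simp: BijGroup_def Bij_def left_translation_def)

text \<open>The embedding of L attached to a coset, spelled as in
  \<open>greither_pareigis_structure\<close>.\<close>

definition coset_value :: "('a \<Rightarrow> 'a) set \<Rightarrow> 'a \<Rightarrow> 'a" where
  "coset_value C y = the_elem ((\<lambda>\<tau>. \<tau> y) ` C)"

lemma coset_value:
  assumes \<tau>: "\<tau> \<in> carrier GK" and y: "y \<in> L"
  shows "coset_value (\<tau> <#\<^bsub>GK\<^esub> G') y = \<tau> y"
proof -
  have "(\<lambda>\<tau>. \<tau> y) ` (\<tau> <#\<^bsub>GK\<^esub> G') = (\<lambda>\<rho>. \<tau> y) ` G'"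
    unfolding l_coset_def using \<tau> y G'_sub L_sub
    by (auto simp: image_UN galois_apply galois_iff subset_iff)
  moreover have "G' \<noteq> {}" using subgroup.one_closed[OF subgroup_G'] by blast
  ultimately show ?thesis by (simp add: coset_value_def image_constant_conv)
qed

lemma coset_value_G': "y \<in> L \<Longrightarrow> coset_value G' y = y"
  using coset_value[of "\<one>\<^bsub>GK\<^esub>" y] one_coset galois_apply[of "\<one>\<^bsub>GK\<^esub>" "\<one>\<^bsub>GK\<^esub>" y] L_sub
    subgroup.one_closed[OF subgroup_G'] galois_iff[of "\<one>\<^bsub>GK\<^esub>" L] by simp

text \<open>Representatives that agree on L differ by an automorphism fixing L, that is, by an
  element of G'.\<close>

lemma coset_value_separate:
  assumes "C \<in> \<Omega>" "D \<in> \<Omega>" and eq: "\<And>y. y \<in> L \<Longrightarrow> coset_value C y = coset_value D y"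
  shows "C = D"
proof -
  obtain \<tau> where \<tau>: "\<tau> \<in> carrier GK" "C = \<tau> <#\<^bsub>GK\<^esub> G'" using assms(1) by (rule cosetE)
  obtain \<rho> where \<rho>: "\<rho> \<in> carrier GK" "D = \<rho> <#\<^bsub>GK\<^esub> G'" using assms(2) by (rule cosetE)
  let ?\<delta> = "inv\<^bsub>GK\<^esub> \<tau> \<otimes>\<^bsub>GK\<^esub> \<rho>"
  have \<delta>: "?\<delta> \<in> carrier GK" using \<tau> \<rho> by simp
  have "?\<delta> y = y" if y: "y \<in> L" for y
  proof -
    have yM: "y \<in> carrier M" using y L_sub by blast
    have "\<rho> y = \<tau> y" using eq[OF y] \<tau> \<rho> y by (simp add: coset_value)
    then have "?\<delta> y = (inv\<^bsub>GK\<^esub> \<tau>) (\<tau> y)"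
      using \<tau> \<rho> yM by (simp add: galois_apply)
    also have "\<dots> = (inv\<^bsub>GK\<^esub> \<tau> \<otimes>\<^bsub>GK\<^esub> \<tau>) y"
      by (rule galois_apply[symmetric]) (use \<tau> yM in simp_all)
    also have "\<dots> = y"
      using \<tau> y subgroup.one_closed[OF subgroup_G'] by (simp add: galois_iff)
    finally show ?thesis .
  qed
  then have "?\<delta> \<in> G'" using \<delta> by (simp add: galois_iff)
  then have "?\<delta> <#\<^bsub>GK\<^esub> G' = G'" using GK.coset_join3[OF \<delta> subgroup_G'] by simp
  then have "\<tau> <#\<^bsub>GK\<^esub> G' = \<tau> <#\<^bsub>GK\<^esub> (?\<delta> <#\<^bsub>GK\<^esub> G')" by simp
  also have "\<dots> = (\<tau> \<otimes>\<^bsub>GK\<^esub> ?\<delta>) <#\<^bsub>GK\<^esub> G'" using \<tau> \<delta> G'_sub by (simp add: GK.lcos_m_assoc)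
  also have "\<tau> \<otimes>\<^bsub>GK\<^esub> ?\<delta> = \<rho>" using \<tau> \<rho> by (simp add: GK.m_assoc[symmetric])
  finally show ?thesis using \<tau> \<rho> by simp
qed

end

section \<open>Normalised regular subgroups as instances of the abstract action\<close>

locale gp_subgroup = galois_setting M K L for M :: "('a, 'b) ring_scheme" (structure) and K L +
  fixes N
  assumes gp: "greither_pareigis_subgroup M K L N" and finite_N: "finite N"
begin

abbreviation "Q \<equiv> perm_group M K L N"
abbreviation "gconj \<equiv> galois_conj M K L"

lemma subgroup_N: "subgroup N Sym"
  and regular_N: "regular_perms \<Omega> N"
  and conj_closed: "\<And>\<tau> n. \<lbrakk>\<tau> \<in> carrier GK; n \<in> N\<rbrakk> \<Longrightarrow> gconj \<tau> n \<in> N"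
  using gp by (auto simp: greither_pareigis_subgroup_def)

sublocale S: group Sym by (rule group_BijGroup)

lemma N_Sym: "n \<in> N \<Longrightarrow> n \<in> carrier Sym"
  using subgroup.subset[OF subgroup_N] by blast

sublocale Q: group Q
  by (rule subgroup.subgroup_is_group[OF subgroup_N S.is_group])

sublocale fga: finite_group_algebra M Q
  by unfold_locales (simp add: finite_N)

lemma Sym_apply: "\<lbrakk>u \<in> carrier Sym; v \<in> carrier Sym; C \<in> \<Omega>\<rbrakk> \<Longrightarrow> (u \<otimes>\<^bsub>Sym\<^esub> v) C = u (v C)"
  by (simp add: BijGroup_def compose_eq)

lemma Sym_closed: "\<lbrakk>u \<in> carrier Sym; C \<in> \<Omega>\<rbrakk> \<Longrightarrow> u C \<in> \<Omega>"
  using Bij_imp_funcset[of u \<Omega>] by (auto simp: BijGroup_def)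

lemma finite_cosets: "finite \<Omega>"
proof -
  have "\<Omega> \<subseteq> (\<lambda>n. n G') ` N"
  proof
    fix C assume "C \<in> \<Omega>"
    then have "\<exists>!n. n \<in> N \<and> n G' = C" using regular_N G'_coset unfolding regular_perms_def by simp
    then obtain n where "n \<in> N" "n G' = C" by (elim ex1E conjE)
    then show "C \<in> (\<lambda>n. n G') ` N" by blast
  qed
  then show ?thesis using finite_N finite_subset by blast
qed

lemma conj_trans:
  assumes "\<tau> \<in> carrier GK" "n \<in> N" "C \<in> \<Omega>"
  shows "gconj \<tau> n (ltrans \<tau> C) = ltrans \<tau> (n C)"
proof -
  have t: "ltrans \<tau> \<in> carrier Sym" "n \<in> carrier Sym" using assms trans_Sym N_Sym by auto
  have "gconj \<tau> n \<otimes>\<^bsub>Sym\<^esub> ltrans \<tau> = ltrans \<tau> \<otimes>\<^bsub>Sym\<^esub> n"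
    using t by (simp add: galois_conj_def S.m_assoc)
  moreover have "(gconj \<tau> n \<otimes>\<^bsub>Sym\<^esub> ltrans \<tau>) C = gconj \<tau> n (ltrans \<tau> C)"
    using t N_Sym[OF conj_closed[OF assms(1,2)]] assms(3) by (rule_tac Sym_apply)
  ultimately show ?thesis using t assms(3) by (simp add: Sym_apply)
qed

lemma conj_eq_one_iff:
  assumes "\<tau> \<in> carrier GK" "n \<in> N"
  shows "gconj \<tau> n = \<one>\<^bsub>Sym\<^esub> \<longleftrightarrow> n = \<one>\<^bsub>Sym\<^esub>"
proof -
  have t: "ltrans \<tau> \<in> carrier Sym" "n \<in> carrier Sym" using assms trans_Sym N_Sym by auto
  have "gconj \<tau> n = \<one>\<^bsub>Sym\<^esub> \<longleftrightarrow> ltrans \<tau> \<otimes>\<^bsub>Sym\<^esub> n = ltrans \<tau>"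
    unfolding galois_conj_def using t S.inv_solve_right'[of "\<one>\<^bsub>Sym\<^esub>" "ltrans \<tau> \<otimes>\<^bsub>Sym\<^esub> n" "ltrans \<tau>"]
    by auto
  also have "\<dots> \<longleftrightarrow> n = \<one>\<^bsub>Sym\<^esub>" using t by (simp add: S.r_cancel_one)
  finally show ?thesis .
qed

lemma act_regular:
  assumes "n \<in> N" "m \<in> N" "C \<in> \<Omega>" "n C = m C"
  shows "n = m"
  using regular_N assms Sym_closed[OF N_Sym[OF assms(2)] assms(3)] unfolding regular_perms_def by metis

lemma galois_action:
  assumes fixed: "\<And>x. \<lbrakk>x \<in> carrier M; \<And>\<tau>. \<tau> \<in> carrier GK \<Longrightarrow> \<tau> x = x\<rbrakk> \<Longrightarrow> x \<in> K"
  shows "galois_action M K (carrier GK) Q L \<Omega> coset_value G' ltrans (\<lambda>n. n) gconj"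
proof (intro galois_action.intro galois_action_axioms.intro fga.finite_group_algebra_axioms)
  show "descent M K (carrier GK)"
    by (intro descent.intro descent_axioms.intro field_axioms subfield_K fixed)
      (auto simp: galois_iff)
  show "coset_value C y \<in> carrier M" if "C \<in> \<Omega>" "y \<in> L" for C y
    using that L_sub by (elim cosetE) (auto simp: coset_value galois_iff ring_hom_closed)
  have ops: "y \<oplus> z \<in> L" "y \<otimes> z \<in> L" if "y \<in> L" "z \<in> L" for y z
    using that subringE(6,7)[OF subcring.axioms(1)[OF subdomain.axioms(1)[OF subfield.axioms(1)[OF subfield_L]]]]
    by auto
  show "coset_value C (y \<oplus> z) = coset_value C y \<oplus> coset_value C z" if "C \<in> \<Omega>" "y \<in> L" "z \<in> L" for C y z
    using that L_sub by (elim cosetE) (auto simp: coset_value ops galois_iff intro!: ring_hom_add)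
  show "coset_value C (y \<otimes> z) = coset_value C y \<otimes> coset_value C z" if "C \<in> \<Omega>" "y \<in> L" "z \<in> L" for C y z
    using that L_sub by (elim cosetE) (auto simp: coset_value ops galois_iff intro!: ring_hom_mult)
  show "coset_value C k = k" if "C \<in> \<Omega>" "k \<in> K" for C k
    using that K_L by (elim cosetE) (auto simp: coset_value galois_iff)
  show "\<exists>y\<in>L. coset_value C y \<noteq> coset_value D y" if "C \<in> \<Omega>" "D \<in> \<Omega>" "C \<noteq> D" for C D
    using that coset_value_separate by blast
  show "ltrans \<tau> ` \<Omega> = \<Omega>" if "\<tau> \<in> carrier GK" for \<tau>
    using trans_bij[OF that] by (simp add: bij_betw_def)
  show "coset_value (ltrans \<tau> C) y = \<tau> (coset_value C y)"
    if "\<tau> \<in> carrier GK" "C \<in> \<Omega>" "y \<in> L" for \<tau> C y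
  proof -
    note t = that
    obtain \<rho> where "\<rho> \<in> carrier GK" "C = \<rho> <#\<^bsub>GK\<^esub> G'" using t(2) by (rule cosetE)
    then show ?thesis using t L_sub by (auto simp: trans_coset coset_value galois_apply)
  qed
  show "n (C :: ('a \<Rightarrow> 'a) set) \<in> \<Omega>" if "n \<in> carrier Q" "C \<in> \<Omega>" for n C
    using that Sym_closed N_Sym by simp
  show "(n \<otimes>\<^bsub>Q\<^esub> m) C = n (m C)" if "n \<in> carrier Q" "m \<in> carrier Q" "C \<in> \<Omega>" for n m C
    using that Sym_apply N_Sym by simp
  show "\<one>\<^bsub>Q\<^esub> C = C" if "C \<in> \<Omega>" for C
    using that by (simp add: BijGroup_def)
  show "n = m" if "n \<in> carrier Q" "m \<in> carrier Q" "C \<in> \<Omega>" "n C = m C" for n m C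
    using that act_regular by simp
  show "\<exists>n\<in>carrier Q. n C = D" if "C \<in> \<Omega>" "D \<in> \<Omega>" for C D
  proof -
    have "\<exists>!n. n \<in> N \<and> n C = D" using that regular_N unfolding regular_perms_def by simp
    then obtain n where "n \<in> N" "n C = D" by (elim ex1E conjE)
    then show ?thesis by (intro bexI[of _ n]) simp_all
  qed
  show "gconj \<tau> n \<in> carrier Q" if "\<tau> \<in> carrier GK" "n \<in> carrier Q" for \<tau> n
    using that conj_closed by simp
  show "gconj \<tau> n (ltrans \<tau> C) = ltrans \<tau> (n C)"
    if "\<tau> \<in> carrier GK" "n \<in> carrier Q" "C \<in> \<Omega>" for \<tau> n C
    using that conj_trans by simp
qed (use subfield_L K_L finite_cosets coset_value_G' in auto)

text \<open>The fixed field is read off from the counit, whose values on \<open>M[N]\<^sup>G \<cong> H\<close> lie in \<open>K\<close>.\<close>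

lemma fixed_field:
  assumes H: "hopf_galois_structure (M\<lparr>carrier := L\<rparr>) K H \<mu>"
    and struct: "greither_pareigis_structure M K L N H \<mu>"
    and x: "x \<in> carrier M" "\<And>\<tau>. \<tau> \<in> carrier GK \<Longrightarrow> \<tau> x = x"
  shows "x \<in> K"
proof -
  obtain f where f: "bij_betw f (carrier H) (descended_algebra M K L N)"
    "\<And>h. h \<in> carrier H \<Longrightarrow> counit fga.AH (f h) = counit H h"
    using struct unfolding greither_pareigis_structure_def Let_def by auto
  \<comment> \<open>x times the unit of M[N]. It is invariant because x is fixed by G and
    conjugation fixes the identity permutation, and its counit is x.\<close>
  let ?e = "\<lambda>n\<in>N. if n = \<one>\<^bsub>Sym\<^esub> then x else \<zero>"
  have "?e \<in> descended_algebra M K L N"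
    unfolding descended_algebra_def
  proof (intro CollectI conjI ballI)
    show "?e \<in> carrier fga.AH" using x(1) by (auto simp: fga.AH_simps fga.A_simps)
    fix \<tau> n assume \<tau>: "\<tau> \<in> carrier GK" and n: "n \<in> N"
    have "\<tau> \<zero> = \<zero>"
      using \<tau> ring_hom_cring.hom_zero[OF ring_hom_cringI[OF cring_axioms cring_axioms]]
      by (auto simp: galois_iff)
    then show "?e (gconj \<tau> n) = \<tau> (?e n)"
      using \<tau> n x(2)[OF \<tau>] conj_closed conj_eq_one_iff by auto
  qed
  then have "?e \<in> f ` carrier H" using f(1) by (simp only: bij_betw_def)
  then obtain h where h: "h \<in> carrier H" "f h = ?e" by (elim imageE) simp
  have "x = (\<Oplus>n\<in>N. if n = \<one>\<^bsub>Sym\<^esub> then x else \<zero>)"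
    using x(1) finite_N subgroup.one_closed[OF subgroup_N] by (intro finsum_delta[symmetric]) auto
  also have "\<dots> = (\<Oplus>n\<in>N. ?e n)"
    using x(1) by (intro finsum_cong' refl funcsetI) auto
  also have "\<dots> = counit fga.AH ?e" by (simp add: fga.AH_simps)
  also have "\<dots> = counit H h" using f(2)[OF h(1)] h(2) by simp
  finally have "x = counit H h" .
  moreover have "cocommutative_hopf_algebra (M\<lparr>carrier := K\<rparr>) H"
    using H unfolding hopf_galois_structure_def by simp
  then have "counit H \<in> Ring.ring_hom H (M\<lparr>carrier := K\<rparr>)"
    by (intro hopf_algebra.counit_hom cocommutative_hopf_algebra.axioms(1))
  ultimately show ?thesis using ring_hom_closed h(1) by fastforce
qed

theorem structure_exists:
  assumes fixed: "\<And>x. \<lbrakk>x \<in> carrier M; \<And>\<tau>. \<tau> \<in> carrier GK \<Longrightarrow> \<tau> x = x\<rbrakk> \<Longrightarrow> x \<in> K"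
  shows "\<exists>(H :: ('a, nat \<Rightarrow> 'a) hopf) \<mu>. hopf_galois_structure (M\<lparr>carrier := L\<rparr>) K H \<mu> \<and>
    greither_pareigis_structure M K L N H \<mu>"
proof -
  interpret ga: galois_action M K "carrier GK" Q L \<Omega> coset_value G' ltrans "\<lambda>n. n" gconj
    by (rule galois_action[OF fixed])
  \<comment> \<open>Functions on the finite set N are coded as sequences along an enumeration of N
    with repetitions; this gives the Hopf algebra the required type of elements.\<close>
  define J where "J x = (\<lambda>i :: nat. x (from_nat_into N i) :: 'a)" for x
  have N: "N \<noteq> {}" "countable N"
    using subgroup.one_closed[OF subgroup_N] finite_N by (auto intro: countable_finite)
  have "inj_on J ga.D"
  proof (rule inj_onI)
    fix x y assume xy: "x \<in> ga.D" "y \<in> ga.D" "J x = J y"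
    show "x = y"
    proof (rule fga.A_eqI)
      fix n assume "n \<in> carrier Q"
      then have "n \<in> range (from_nat_into N)" using range_from_nat_into[OF N] by simp
      then obtain i where "n = from_nat_into N i" by (rule rangeE)
      then show "x n = y n" using fun_cong[OF xy(3), of i] by (simp add: J_def)
    qed (use xy ga.D_subset in auto)
  qed
  then have "bij_betw (inv_into ga.D J) (J ` ga.D) ga.D"
    by (intro bij_betw_inv_into inj_on_imp_bij_betw)
  then interpret hm: hopf_model M K "carrier GK" Q L \<Omega> coset_value G' ltrans "\<lambda>n. n" gconj
      "J ` ga.D" "inv_into ga.D J"
    by (intro hopf_model.intro hopf_model_axioms.intro ga.galois_action_axioms)
  have D: "descended_algebra M K L N = ga.D"
    by (simp add: descended_algebra_def ga.D_def fga.AH_simps)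
  have "greither_pareigis_structure M K L N hm.H hm.\<mu>"
    unfolding greither_pareigis_structure_def Let_def D
  proof (intro exI[of _ "inv_into ga.D J"] conjI ballI)
    show "bij_betw (inv_into ga.D J) (carrier hm.H) ga.D"
      using hm.f_bij by (simp add: hm.H_simps(1))
    show "hm.\<mu> h y = (\<Oplus>n\<in>N. inv_into ga.D J h n \<otimes>
        the_elem ((\<lambda>\<tau>. \<tau> y) ` (inv\<^bsub>Sym\<^esub> n) G'))" if "h \<in> carrier hm.H" "y \<in> L" for h y
    proof -
      have h: "h \<in> J ` ga.D" using that by (simp add: hm.H_simps(1))
      have inv: "inv\<^bsub>Q\<^esub> n = inv\<^bsub>Sym\<^esub> n" if "n \<in> N" for n
        using S.m_inv_consistent[OF subgroup_N that] .
      have "(\<Oplus>n\<in>N. inv_into ga.D J h n \<otimes> coset_value ((inv\<^bsub>Q\<^esub> n) G') y) =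
          (\<Oplus>n\<in>N. inv_into ga.D J h n \<otimes> the_elem ((\<lambda>\<tau>. \<tau> y) ` (inv\<^bsub>Sym\<^esub> n) G'))"
      proof (rule finsum_cong'[OF refl])
        show "(\<lambda>n. inv_into ga.D J h n \<otimes> the_elem ((\<lambda>\<tau>. \<tau> y) ` (inv\<^bsub>Sym\<^esub> n) G')) \<in> N \<rightarrow> carrier M"
        proof
          fix n assume n: "n \<in> N"
          have "(inv\<^bsub>Q\<^esub> n) G' \<in> \<Omega>" using n ga.act_closed[of "inv\<^bsub>Q\<^esub> n" G'] Q.inv_closed[of n] by simp
          then have "coset_value ((inv\<^bsub>Q\<^esub> n) G') y \<in> carrier M" using that(2) by simp
          then show "inv_into ga.D J h n \<otimes> the_elem ((\<lambda>\<tau>. \<tau> y) ` (inv\<^bsub>Sym\<^esub> n) G') \<in> carrier M"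
            using hm.f_value[OF h, of n] n inv[OF n] by (simp add: coset_value_def)
        qed
      qed (simp add: coset_value_def inv)
      then show ?thesis using that(2) by (simp add: hm.\<mu>_def)
    qed
  qed (simp_all add: hm.f_ring_hom hm.f_hom hm.H_simps(1) fga.AH_simps(6,8,9)
      hm.comult_compatible hm.H_simps(7))
  then show ?thesis using hm.hopf_galois_structure_H by blast
qed

end

section \<open>The transfer of types\<close>

lemma finite_heisenberg_group: "finite (carrier (heisenberg_group p))"
proof -
  have "carrier (heisenberg_group p) \<subseteq>
      (\<lambda>(a, b, c). mat_of_rows_list 3 [[1, a, b], [0, 1, c], [0, 0, 1]]) `
        ({0..<int p} \<times> {0..<int p} \<times> {0..<int p})"
  proof
    fix A assume "A \<in> carrier (heisenberg_group p)"
    then obtain a b c where "A = mat_of_rows_list 3 [[1, a, b], [0, 1, c], [0, 0, 1]]"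
      "a \<in> {0..<int p}" "b \<in> {0..<int p}" "c \<in> {0..<int p}"
      unfolding heisenberg_group_def by auto
    then show "A \<in> (\<lambda>(a, b, c). mat_of_rows_list 3 [[1, a, b], [0, 1, c], [0, 0, 1]]) `
        ({0..<int p} \<times> {0..<int p} \<times> {0..<int p})"
      by (intro image_eqI[of _ _ "(a, b, c)"]) simp_all
  qed
  then show ?thesis by (rule finite_subset) simp
qed

lemma finite_G_group: "finite (carrier (G_group p))"
proof -
  have "carrier (G_group p) \<subseteq>
      (\<lambda>(a, b). mat_of_rows_list 2 [[(1 + int p * b) mod int (p\<^sup>2), a], [0, 1]]) `
        ({0..<int (p\<^sup>2)} \<times> {0..<int (p\<^sup>2)})"
    by (auto simp: G_group_def simp del: of_nat_power)
  then show ?thesis by (rule finite_subset) simp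
qed

text \<open>The given structure is used twice: its N yields the abelian regular subgroup, and its
  counit yields the fixed field. The latter depends on M and K only, so it also serves the new
  subgroup.\<close>

lemma transfer_type:
  fixes M :: "('a, 'b) ring_scheme"
  assumes "field M" "subfield K M" "subfield L M" "K \<subseteq> L"
    and baer: "baer T \<Psi> \<beta> h" and fin: "finite (carrier T)"
    and \<kappa>: "range \<kappa> = carrier Z" "\<And>x y. \<kappa> (x + y) = \<kappa> x \<otimes>\<^bsub>Z\<^esub> \<kappa> y"
      "\<And>x y. \<kappa> x = \<kappa> y \<longleftrightarrow> \<Psi> x = \<Psi> y"
    and T: "has_hopf_galois_structure_of_type TYPE('h) M K L T"
  shows "has_hopf_galois_structure_of_type TYPE(nat \<Rightarrow> 'a) M K L Z"
proof -
  obtain H :: "('a, 'h) hopf" and \<mu> N where N: "hopf_galois_structure (M\<lparr>carrier := L\<rparr>) K H \<mu>"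
    "greither_pareigis_subgroup M K L N" "greither_pareigis_structure M K L N H \<mu>"
    "perm_group M K L N \<cong> T"
    using T unfolding has_hopf_galois_structure_of_type_def by auto
  interpret gs: galois_setting M K L
    using assms(1-4) by (intro galois_setting.intro galois_setting_axioms.intro)
  interpret baer T \<Psi> \<beta> h by (rule baer)
  obtain \<phi>' where "\<phi>' \<in> iso (perm_group M K L N) T" using N(4) by (auto simp: is_iso_def)
  then have fin_N: "finite N"
    using fin bij_betw_finite[of \<phi>' N "carrier T"] by (auto simp: iso_def)
  interpret gp: gp_subgroup M K L N
    by unfold_locales (rule N(2), rule fin_N)
  have "T \<cong> perm_group M K L N" using N(4) by (rule group.iso_sym[OF gp.Q.is_group])
  then obtain \<phi> where \<phi>: "\<phi> \<in> iso T (perm_group M K L N)" by (auto simp: is_iso_def)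
  interpret br: baer_regular T \<Psi> \<beta> h "galois_cosets M K L" N \<phi> "carrier (galois_group M L)"
    by (intro baer_regular.intro baer_regular_axioms.intro baer gp.subgroup_N gp.regular_N \<phi> gs.G'_coset)
  have gp': "greither_pareigis_subgroup M K L (range br.\<pi>)"
    unfolding greither_pareigis_subgroup_def
  proof (intro conjI br.subgroup_\<pi> br.regular_\<pi> ballI)
    fix \<tau> n assume "\<tau> \<in> carrier (galois_group M K)" "n \<in> range br.\<pi>"
    then show "galois_conj M K L \<tau> n \<in> range br.\<pi>"
      using gp.conj_closed[of \<tau>] unfolding galois_conj_def
      by (intro br.normalised_\<pi> gs.trans_Sym) auto
  qed
  have iso: "perm_group M K L (range br.\<pi>) \<cong> Z" by (rule br.iso_\<pi>[OF \<kappa>])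
  have "finite (range br.\<pi>)"
  proof -
    \<comment> \<open>A translation depends on its label only through \<Psi>, so the finite group T
      indexes all of them.\<close>
    have "range br.\<pi> = (\<lambda>t. br.\<pi> (SOME x. \<Psi> x = t)) ` carrier T"
    proof (intro equalityI subsetI)
      fix n assume "n \<in> range br.\<pi>"
      then obtain z where z: "n = br.\<pi> z" by auto
      have "\<Psi> (SOME x. \<Psi> x = \<Psi> z) = \<Psi> z" by (rule someI) simp
      then have "n = br.\<pi> (SOME x. \<Psi> x = \<Psi> z)" by (simp add: z br.\<pi>_eq_iff)
      then show "n \<in> (\<lambda>t. br.\<pi> (SOME x. \<Psi> x = t)) ` carrier T" by auto
    qed auto
    then show ?thesis using fin by simp
  qed
  then interpret gp': gp_subgroup M K L "range br.\<pi>"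
    by unfold_locales (rule gp')
  have "\<exists>(H :: ('a, nat \<Rightarrow> 'a) hopf) \<mu>. hopf_galois_structure (M\<lparr>carrier := L\<rparr>) K H \<mu> \<and>
      greither_pareigis_structure M K L (range br.\<pi>) H \<mu>"
    by (rule gp'.structure_exists) (rule gp.fixed_field[OF N(1,3)])
  then show ?thesis
    unfolding has_hopf_galois_structure_of_type_def using gp' iso by blast
qed

theorem theorem7:
  fixes p :: nat
    and M :: "('a, 'b) ring_scheme" and K L :: "'a set"
  assumes "Factorial_Ring.prime p" and "odd p"
    and "field M" and "subfield K M" and "subfield L M" and "K \<subseteq> L"
    and "normal_closure M K L"
    and "separable_extension M K L"
    and "ring.dimension M (p ^ 3) K L"
  shows "(has_hopf_galois_structure_of_type TYPE('h) M K L (heisenberg_group p) \<longrightarrow>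
           has_hopf_galois_structure_of_type TYPE(nat \<Rightarrow> 'a) M K L
             (integer_mod_group p \<times>\<times> integer_mod_group p \<times>\<times> integer_mod_group p))
       \<and> (has_hopf_galois_structure_of_type TYPE('h) M K L (G_group p) \<longrightarrow>
           has_hopf_galois_structure_of_type TYPE(nat \<Rightarrow> 'a) M K L
             (integer_mod_group (p ^ 2) \<times>\<times> integer_mod_group p))"
proof (intro conjI impI)
  have p: "p > 1" using assms(1) by (rule prime_gt_1_nat)
  \<comment> \<open>As p is odd, both right sides are even; the halves invert 2 modulo p and modulo
    p^2.\<close>
  have h: "2 * ((p + 1) div 2) = p + 1" "2 * ((p\<^sup>2 + 1) div 2) = p\<^sup>2 + 1"
    using assms(2) by simp_all
  show "has_hopf_galois_structure_of_type TYPE(nat \<Rightarrow> 'a) M K L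
      (integer_mod_group p \<times>\<times> integer_mod_group p \<times>\<times> integer_mod_group p)"
    if "has_hopf_galois_structure_of_type TYPE('h) M K L (heisenberg_group p)"
    by (rule transfer_type[OF assms(3-6) baer_heisenberg[OF p h(1)] finite_heisenberg_group
          heisenberg_coordinates[OF p] that])
  show "has_hopf_galois_structure_of_type TYPE(nat \<Rightarrow> 'a) M K L
      (integer_mod_group (p\<^sup>2) \<times>\<times> integer_mod_group p)"
    if "has_hopf_galois_structure_of_type TYPE('h) M K L (G_group p)"
    by (rule transfer_type[OF assms(3-6) baer_G[OF p h(2)] finite_G_group G_coordinates[OF p] that])
qed

end
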